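(* Let $n\le 10$ be a positive integer and let $X_n$ be given by: $X_1=X_2=X_3=\infty$; $X_4=X_5=X_6=10^9$; $X_7=8.9\times 10^{10}$; $X_8=2.5\times 10^9$; $X_9=2.8\times 10^{10}$; $X_{10}=2.8\times 10^{11}$. Let $K$ be a totally real number field of degree $n$ whose discriminant is a fundamental discriminant with $|\mathrm{Disc}(K)|\le X_n$. If $L$ is a tamely ramified number field such that there is an isomorphism of quadratic $\mathbb{Z}$-modules $\langle O_K^0,\mathrm{tr}_{K/\mathbb{Q}}(x^2)|_{O_K^0}\rangle\cong\langle O_L^0,\mathrm{tr}_{L/\mathbb{Q}}(x^2)|_{O_L^0}\rangle$, then $K\cong L$.
   Context: For a number field $K$ with ring of integers $O_K$, the trace zero module is $O_K^0=\{x\in O_K:\mathrm{tr}_{K/\mathbb{Q}}(x)=0\}$, a free $\mathbb{Z}$-module of rank $[K:\mathbb{Q}]-1$, equipped with the integral quadratic form $x\mapsto\mathrm{tr}_{K/\mathbb{Q}}(x^2)$ (the trace zero form). A fundamental discriminant is an integer that is $1$ or the discriminant of a quadratic field. A number field is tamely ramified if every ramified prime is tamely ramified. *)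

theory Defs
  imports Complex_Main "HOL-Computational_Algebra.Polynomial" "HOL-Library.Extended_Real"
    "Jordan_Normal_Form.Determinant"
begin

text \<open>Number fields are modelled as subfields of the complex numbers that are
finite-dimensional over the rationals (every number field embeds into C).\<close>

definition subfield :: "complex set \<Rightarrow> bool" where
  "subfield K \<longleftrightarrow> 0 \<in> K \<and> 1 \<in> K \<and>
     (\<forall>x\<in>K. \<forall>y\<in>K. x + y \<in> K \<and> x * y \<in> K) \<and>
     (\<forall>x\<in>K. - x \<in> K) \<and> (\<forall>x\<in>K. x \<noteq> 0 \<longrightarrow> inverse x \<in> K)"

definition q_basis :: "complex set \<Rightarrow> complex set \<Rightarrow> bool" where
  "q_basis K B \<longleftrightarrow> finite B \<and> B \<subseteq> K \<and>
     (\<forall>c::complex \<Rightarrow> rat. (\<Sum>b\<in>B. of_rat (c b) * b) = 0 \<longrightarrow> (\<forall>b\<in>B. c b = 0)) \<and>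
     (\<forall>x\<in>K. \<exists>c::complex \<Rightarrow> rat. x = (\<Sum>b\<in>B. of_rat (c b) * b))"

definition number_field :: "complex set \<Rightarrow> bool" where
  "number_field K \<longleftrightarrow> subfield K \<and> (\<exists>B. q_basis K B)"

definition nf_degree :: "complex set \<Rightarrow> nat" where
  "nf_degree K = (THE n. \<exists>B. q_basis K B \<and> card B = n)"

definition embeddings :: "complex set \<Rightarrow> (complex \<Rightarrow> complex) set" where
  "embeddings K = {\<sigma>. (\<forall>x\<in>K. \<forall>y\<in>K. \<sigma> (x + y) = \<sigma> x + \<sigma> y \<and> \<sigma> (x * y) = \<sigma> x * \<sigma> y)
       \<and> \<sigma> 1 = 1 \<and> (\<forall>x. x \<notin> K \<longrightarrow> \<sigma> x = 0)}"

definition totally_real :: "complex set \<Rightarrow> bool" where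
  "totally_real K \<longleftrightarrow> (\<forall>\<sigma>\<in>embeddings K. \<forall>x\<in>K. \<sigma> x \<in> \<real>)"

definition nf_trace :: "complex set \<Rightarrow> complex \<Rightarrow> complex" where
  "nf_trace K x = (\<Sum>\<sigma>\<in>embeddings K. \<sigma> x)"

definition ring_of_integers :: "complex set \<Rightarrow> complex set" where
  "ring_of_integers K = {x\<in>K. \<exists>p::int poly. lead_coeff p = 1 \<and> poly (map_poly of_int p) x = 0}"

definition trace_zero_module :: "complex set \<Rightarrow> complex set" where
  "trace_zero_module K = {x\<in>ring_of_integers K. nf_trace K x = 0}"

definition integral_basis :: "complex set \<Rightarrow> complex list \<Rightarrow> bool" where
  "integral_basis K bs \<longleftrightarrow> length bs = nf_degree K \<and> set bs \<subseteq> ring_of_integers K \<and>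
     (\<forall>c::nat \<Rightarrow> int. (\<Sum>i<length bs. of_int (c i) * bs ! i) = 0 \<longrightarrow> (\<forall>i<length bs. c i = 0)) \<and>
     (\<forall>x\<in>ring_of_integers K. \<exists>c::nat \<Rightarrow> int. x = (\<Sum>i<length bs. of_int (c i) * bs ! i))"

text \<open>Disc(K) = det (tr(b_i b_j)) for an integral basis (independent of the basis).\<close>
definition nf_disc :: "complex set \<Rightarrow> int" where
  "nf_disc K = (THE d. \<exists>bs. integral_basis K bs \<and>
      of_int d = det (mat (length bs) (length bs) (\<lambda>(i, j). nf_trace K (bs ! i * bs ! j))))"

definition fundamental_discriminant :: "int \<Rightarrow> bool" where
  "fundamental_discriminant D \<longleftrightarrow> D = 1 \<or>
     (\<exists>Q. number_field Q \<and> nf_degree Q = 2 \<and> nf_disc Q = D)"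

definition is_ideal_in :: "complex set \<Rightarrow> complex set \<Rightarrow> bool" where
  "is_ideal_in R I \<longleftrightarrow> I \<subseteq> R \<and> 0 \<in> I \<and> (\<forall>x\<in>I. \<forall>y\<in>I. x + y \<in> I) \<and>
     (\<forall>x\<in>I. - x \<in> I) \<and> (\<forall>r\<in>R. \<forall>x\<in>I. r * x \<in> I)"

definition nonzero_prime_ideal :: "complex set \<Rightarrow> complex set \<Rightarrow> bool" where
  "nonzero_prime_ideal R P \<longleftrightarrow> is_ideal_in R P \<and> P \<noteq> R \<and> P \<noteq> {0} \<and>
     (\<forall>a\<in>R. \<forall>b\<in>R. a * b \<in> P \<longrightarrow> a \<in> P \<or> b \<in> P)"

definition ideal_mult :: "complex set \<Rightarrow> complex set \<Rightarrow> complex set" where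
  "ideal_mult I J = {x. \<exists>as bs. length as = length bs \<and> set as \<subseteq> I \<and> set bs \<subseteq> J \<and>
       x = sum_list (map2 (*) as bs)}"

fun ideal_pow :: "complex set \<Rightarrow> complex set \<Rightarrow> nat \<Rightarrow> complex set" where
  "ideal_pow R P 0 = R"
| "ideal_pow R P (Suc e) = ideal_mult P (ideal_pow R P e)"

definition ram_index :: "complex set \<Rightarrow> complex set \<Rightarrow> int \<Rightarrow> nat" where
  "ram_index L P p = (GREATEST e. of_int p \<in> ideal_pow (ring_of_integers L) P e)"

definition tamely_ramified :: "complex set \<Rightarrow> bool" where
  "tamely_ramified L \<longleftrightarrow> (\<forall>p::int. \<forall>P. prime p \<and> nonzero_prime_ideal (ring_of_integers L) P
       \<and> of_int p \<in> P \<longrightarrow> \<not> p dvd int (ram_index L P p))"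

definition fields_isomorphic :: "complex set \<Rightarrow> complex set \<Rightarrow> bool" where
  "fields_isomorphic K L \<longleftrightarrow> (\<exists>f. bij_betw f K L \<and>
     (\<forall>x\<in>K. \<forall>y\<in>K. f (x + y) = f x + f y \<and> f (x * y) = f x * f y))"

definition trace_zero_forms_isometric :: "complex set \<Rightarrow> complex set \<Rightarrow> bool" where
  "trace_zero_forms_isometric K L \<longleftrightarrow> (\<exists>\<phi>. bij_betw \<phi> (trace_zero_module K) (trace_zero_module L) \<and>
     (\<forall>x\<in>trace_zero_module K. \<forall>y\<in>trace_zero_module K. \<phi> (x + y) = \<phi> x + \<phi> y) \<and>
     (\<forall>x\<in>trace_zero_module K. nf_trace L ((\<phi> x)^2) = nf_trace K (x^2)))"

definition X_bound :: "nat \<Rightarrow> ereal" where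
  "X_bound n = (if n \<le> 3 then \<infinity>
     else if n \<le> 6 then ereal (10^9)
     else if n = 7 then ereal (89 * 10^9)
     else if n = 8 then ereal (25 * 10^8)
     else if n = 9 then ereal (28 * 10^9)
     else ereal (28 * 10^10))"

end

theory Submission
  imports Defs "HOL-Computational_Algebra.Computational_Algebra" "Jordan_Normal_Form.Char_Poly"
begin

text \<open>
  An isometry of the trace zero forms extends to a \<open>\<rat>\<close>-linear isometry \<open>\<Phi> : K \<rightarrow> L\<close> of the trace forms with
  \<open>\<Phi> 1 = 1\<close>. Comparing discriminants, and using tameness of \<open>L\<close> (through Stickelberger's argument at \<open>2\<close>),
  both fields have the same odd squarefree discriminant \<open>d\<close>, so each codifferent is the ring of integers plus the
  multiples of a single element \<open>f\<close> of trace \<open>0\<close>. In terms of the embeddings \<open>\<tau>\<close> of \<open>L\<close> and \<open>\<sigma>\<close> of \<open>K\<close> the map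
  \<open>\<Phi>\<close> is a real orthogonal matrix which, after adding a rational constant to all entries, has entries
  \<open>s \<tau> f' - t \<sigma> f\<close> modulo algebraic integers. If this correction is integral, the matrix is an orthogonal
  matrix of algebraic integers, hence a signed permutation matrix. Otherwise some odd prime \<open>p\<close> divides both the degree
  and \<open>d\<close>; as only two conjugates of \<open>f\<close> have poles at \<open>p\<close>, the product of all entries is too small to be
  nonzero, and each row has exactly one zero. In both cases a distinguished entry of the row belonging to the identity of
  \<open>L\<close> singles out an embedding of \<open>K\<close> into \<open>L\<close>.
\<close>

text \<open>The matrix of the isometry mixes embeddings of two unrelated fields, yet no Galois
  closure or compositum is formed. Two devices replace it. Divisibility at \<open>p\<close> of all
  conjugates of both fields is measured by one valuation ring of the complex numbers
  (\<open>place\<close>). An embedding of \<open>L\<close> is carried through symmetric expressions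
  in the embeddings of \<open>K\<close> by writing these as determinants with rational structure
  constants (\<open>norm_poly_embedding\<close>); so a distinguished entry of the row of the
  identity can be read off from coefficients lying in \<open>L\<close>. The rational constant is (u
  - 1) / n, where the trace zero projection of \<open>b 0\<close> has the image u (y' - 1/n) + s f'
  + l. With it \<open>b 0\<close>, of trace one, is sent to u y' + s f' + l, integral except for the
  multiple of \<open>f'\<close>; the other basis vectors have trace zero, so their images are
  integral and not moved. The degree bound enters in two finite checks: the equation for u in
  \<open>near_unit_square\<close>, and the inequality \<open>exponent_bound\<close>, whose exponent
  n^2 - (n - 2)^2 counts the entries in the two rows and two columns of the poles.\<close>

section \<open>Algebraic integers form a ring\<close>

definition int_span :: "complex set => complex set" where
 "int_span V = range (%c. \<Sum>v\<in>V. of_int (c v) * v)"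

lemma int_span_0 [simp]: "0 : int_span V"
 unfolding int_span_def by (rule range_eqI[of _ _ "%_. 0"]) simp

lemma int_span_add: "x : int_span V ==> y : int_span V ==> x + y : int_span V"
proof -
 assume "x : int_span V" "y : int_span V"
 then obtain c d where "x = (\<Sum>v\<in>V. of_int (c v) * v)" "y = (\<Sum>v\<in>V. of_int (d v) * v)"
  unfolding int_span_def by auto
 then have "x + y = (\<Sum>v\<in>V. of_int (c v + d v) * v)"
  by (simp add: sum.distrib algebra_simps)
 then show ?thesis unfolding int_span_def by (intro range_eqI)
qed

lemma int_span_smult: "x : int_span V ==> of_int k * x : int_span V"
proof -
 assume "x : int_span V"
 then obtain c where "x = (\<Sum>v\<in>V. of_int (c v) * v)" unfolding int_span_def by auto
 then have "of_int k * x = (\<Sum>v\<in>V. of_int (k * c v) * v)"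
  by (simp add: sum_distrib_left mult.assoc)
 then show ?thesis unfolding int_span_def by (intro range_eqI)
qed

lemma int_span_base: "finite V ==> v : V ==> v : int_span V"
 unfolding int_span_def
 by (rule range_eqI[of _ _ "%w. if w = v then 1 else 0"])
   (simp add: if_distrib[where f = of_int] sum.delta if_distrib[where f = "%x. x * _"] cong: if_cong)

lemma int_span_sum: "(!!i. i : I ==> f i : int_span V) ==> sum f I : int_span V"
 by (induction I rule: infinite_finite_induct) (auto intro: int_span_add)

lemma int_span_mult_closed:
 assumes "!!v. v : V ==> z * v : int_span V" and "x : int_span V"
 shows "z * x : int_span V"
proof -
 obtain c where "x = (\<Sum>v\<in>V. of_int (c v) * v)" using assms(2) unfolding int_span_def by auto
 then have "z * x = (\<Sum>v\<in>V. of_int (c v) * (z * v))" by (simp add: sum_distrib_left algebra_simps)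
 also have "... : int_span V" by (intro int_span_sum int_span_smult assms(1))
 finally show ?thesis .
qed

text \<open>The vector \<open>v\<close> is an eigenvector of the integer matrix \<open>c\<close>, so
  \<open>z\<close> is a root of its characteristic polynomial, which is monic and integral.\<close>

lemma algebraic_int_eigenvalue:
 fixes v :: "nat => complex" and c :: "nat => nat => int"
 assumes eig: "!!i. i < N ==> z * v i = (\<Sum>j<N. of_int (c i j) * v j)"
  and nz: "i0 < N" "v i0 ~= 0"
 shows "algebraic_int z"
proof -
 define C where "C = mat N N (%(i, j). c i j)"
 have C: "C : carrier_mat N N" unfolding C_def by simp
 let ?C = "map_mat of_int C :: complex mat"
 have C': "?C : carrier_mat N N" using C by simp
 have "eigenvector ?C (vec N v) z"
  unfolding eigenvector_def
 proof (intro conjI)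
  show "vec N v : carrier_vec (dim_row ?C)" using C by simp
  show "vec N v ~= 0\<^sub>v (dim_row ?C)"
  proof
   assume "vec N v = 0\<^sub>v (dim_row ?C)"
   then have "vec N v $ i0 = 0\<^sub>v N $ i0" using C by simp
   then show False using nz by simp
  qed
  show "?C *\<^sub>v vec N v = z \<cdot>\<^sub>v vec N v"
   by (intro eq_vecI) (auto simp: C_def scalar_prod_def eig atLeast0LessThan)
 qed
 then have "eigenvalue ?C z" unfolding eigenvalue_def by blast
 then have "poly (char_poly ?C) z = 0" using eigenvalue_root_char_poly[OF C'] by simp
 moreover have "char_poly ?C = map_poly of_int (char_poly C)"
  by (rule of_int_hom.char_poly_hom[OF C])
 moreover have "monic (char_poly C)" using degree_monic_char_poly[OF C] by simp
 ultimately show ?thesis unfolding algebraic_int_altdef_ipoly by auto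
qed

text \<open>Multiplication by \<open>z\<close> acts on the lattice spanned by \<open>V\<close>
  through an integer matrix; the nonzero \<open>w\<close> makes the list of generators an
  eigenvector.\<close>

lemma algebraic_int_stable_span:
 assumes fin: "finite V" and nz: "w : V" "w ~= 0"
  and st: "!!v. v : V ==> z * v : int_span V"
 shows "algebraic_int z"
proof -
 obtain N and h :: "nat => complex" where h: "bij_betw h {..<N} V"
  using ex_bij_betw_nat_finite[OF fin] by (auto simp: atLeast0LessThan)
 have "\<forall>v\<in>V. \<exists>c::complex => int. z * v = (\<Sum>w\<in>V. of_int (c w) * w)"
  using st unfolding int_span_def by fastforce
 then obtain c :: "complex => complex => int"
  where c: "!!v. v : V ==> z * v = (\<Sum>w\<in>V. of_int (c v w) * w)" by metis
 obtain i0 where i0: "i0 < N" "h i0 = w" using h nz(1) unfolding bij_betw_def by auto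
 show ?thesis
 proof (rule algebraic_int_eigenvalue[of N z h "%i j. c (h i) (h j)" i0])
  fix i assume "i < N"
  then have "h i : V" using h unfolding bij_betw_def by auto
  then show "z * h i = (\<Sum>j<N. of_int (c (h i) (h j)) * h j)"
   using c[of "h i"] sum.reindex_bij_betw[OF h, of "%w. of_int (c (h i) w) * w"] by simp
 qed (use i0 nz in auto)
qed

text \<open>A monic relation of degree \<open>a\<close> expresses \<open>x ^ a\<close> by lower
  powers. The factor \<open>u\<close> and the span are left arbitrary so that the relation can be
  used inside the lattice of the products \<open>x ^ i * y ^ j\<close>.\<close>

lemma algebraic_int_power_span:
 assumes "algebraic_int (x::complex)"
 obtains a where "a > 0" "!!u b. (!!i. i < a ==> x ^ i * u : int_span b) ==> x ^ a * u : int_span b"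
proof -
 obtain q :: "int poly" where q: "poly (map_poly of_int q) x = 0" "lead_coeff q = 1"
  using assms unfolding algebraic_int_altdef_ipoly by blast
 have deg: "degree q > 0"
 proof (rule ccontr)
  assume "\<not> degree q > 0"
  then have "q = 1" using q(2) by (metis degree_0_id gr0I monic_degree_0)
  then show False using q(1) by simp
 qed
 have "(\<Sum>i\<le>degree q. of_int (coeff q i) * x ^ i) = 0"
  using q(1) by (simp add: poly_altdef degree_map_poly coeff_map_poly)
 then have eq: "x ^ degree q = - (\<Sum>i<degree q. of_int (coeff q i) * x ^ i)"
  using q(2) by (simp add: lessThan_Suc_atMost[symmetric] eq_neg_iff_add_eq_0 add.commute)
 show ?thesis
 proof (rule that[OF deg])
  fix u b assume h: "!!i. i < degree q ==> x ^ i * u : int_span b"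
  have "x ^ degree q * u = (\<Sum>i<degree q. of_int (- coeff q i) * (x ^ i * u))"
   by (simp add: eq sum_distrib_right sum_negf mult.assoc)
  also have "... : int_span b" by (intro int_span_sum int_span_smult) (use h in auto)
  finally show "x ^ degree q * u : int_span b" .
 qed
qed

text \<open>The products \<open>x ^ i * y ^ j\<close> below the two degrees span a lattice stable
  under both numbers.\<close>

lemma algebraic_int_add_mult:
 assumes "algebraic_int (x::complex)" "algebraic_int y"
 shows "algebraic_int (x + y)" "algebraic_int (x * y)"
proof -
 obtain a where a: "a > 0" "!!u b. (!!i. i < a ==> x ^ i * u : int_span b) ==> x ^ a * u : int_span b"
  using algebraic_int_power_span[OF assms(1)] by metis
 obtain b where b: "b > 0" "!!u V. (!!i. i < b ==> y ^ i * u : int_span V) ==> y ^ b * u : int_span V"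
  using algebraic_int_power_span[OF assms(2)] by metis
 define V where "V = (%(i, j). x ^ i * y ^ j) ` ({..<a} \<times> {..<b})"
 have fin: "finite V" unfolding V_def by simp
 have inV: "x ^ i * y ^ j : V" if "i < a" "j < b" for i j unfolding V_def using that by auto
 have one: "1 : V" using inV[of 0 0] a b by simp
 have bs: "x ^ i * y ^ j : int_span V" if "i < a" "j < b" for i j
  using int_span_base[OF fin inV[OF that]] .
 have X: "x * v : int_span V" if vV: "v : V" for v
 proof -
  obtain i j where ij: "v = x ^ i * y ^ j" "i < a" "j < b" using vV unfolding V_def by auto
  have "x ^ Suc i * y ^ j : int_span V"
  proof (cases "Suc i < a")
   case True then show ?thesis using bs ij by blast
  next
   case False
   then have "Suc i = a" using ij by simp
   then show ?thesis using a(2)[of "y ^ j" V] bs ij by auto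
  qed
  then show ?thesis using ij by (simp add: mult.assoc)
 qed
 have Y: "y * v : int_span V" if vV: "v : V" for v
 proof -
  obtain i j where ij: "v = x ^ i * y ^ j" "i < a" "j < b" using vV unfolding V_def by auto
  have "y ^ Suc j * x ^ i : int_span V"
  proof (cases "Suc j < b")
   case True then show ?thesis using bs[of i "Suc j"] ij by (simp add: mult.commute)
  next
   case False
   then have "Suc j = b" using ij by simp
   then show ?thesis using b(2)[of "x ^ i" V] bs ij by (simp add: mult.commute)
  qed
  then show ?thesis using ij by (simp add: ac_simps)
 qed
 show "algebraic_int (x + y)"
  by (rule algebraic_int_stable_span[OF fin one]) (auto simp: distrib_right intro: int_span_add X Y)
 show "algebraic_int (x * y)"
  by (rule algebraic_int_stable_span[OF fin one])
    (auto simp: mult.assoc intro!: int_span_mult_closed[OF X] Y)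
qed

lemma algebraic_int_diff: "algebraic_int (x::complex) ==> algebraic_int y ==> algebraic_int (x - y)"
 using algebraic_int_add_mult(1)[of x "- y"] by simp

lemma algebraic_int_of_int_complex [simp]: "algebraic_int (of_int k :: complex)"
 by (rule int_imp_algebraic_int) simp

lemma algebraic_int_of_nat_complex [simp]: "algebraic_int (of_nat k :: complex)"
 by (rule int_imp_algebraic_int) simp

lemma algebraic_int_power: "algebraic_int (x::complex) ==> algebraic_int (x ^ n)"
 by (induction n) (auto intro: algebraic_int_add_mult)

lemma algebraic_int_sum: "(!!i. i : I ==> algebraic_int (f i :: complex)) ==> algebraic_int (sum f I)"
 by (induction I rule: infinite_finite_induct) (auto intro: algebraic_int_add_mult)

lemma algebraic_int_prod: "(!!i. i : I ==> algebraic_int (f i :: complex)) ==> algebraic_int (prod f I)"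
 by (induction I rule: infinite_finite_induct) (auto intro: algebraic_int_add_mult)

lemma algebraic_int_power_imp:
 assumes "algebraic_int ((x::complex) ^ n)" "n > 0" shows "algebraic_int x"
 by (rule algebraic_int_root[of "x ^ n" "monom 1 n"])
   (use assms in \<open>auto simp: poly_monom degree_monom_eq\<close>)

text \<open>After division by a power of the variable, the constant term of an integral equation is
  nonzero and a multiple of \<open>x\<close>. This serves to show that a difference of conjugates
  divisible by every power of \<open>p\<close> vanishes.\<close>

lemma algebraic_int_dvd_int:
 assumes "algebraic_int (x::complex)" "x ~= 0"
 obtains k :: int and y where "k ~= 0" "algebraic_int y" "x * y = of_int k"
proof -
 obtain q :: "int poly" where q: "poly (map_poly of_int q) x = 0" "lead_coeff q = 1"
  using assms(1) unfolding algebraic_int_altdef_ipoly by blast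
 have "\<exists>k y. k ~= 0 & algebraic_int y & x * y = of_int k"
  using q
 proof (induction "degree q" arbitrary: q)
  case 0
  then have "q = 1" by (metis degree_0_id monic_degree_0)
  then show ?case using 0 by simp
 next
  case (Suc n)
  obtain c r where cr: "q = pCons c r" by (cases q) auto
  have r0: "r ~= 0" using Suc.hyps(2) cr by auto
  have eq: "of_int c + x * poly (map_poly of_int r) x = 0" using Suc.prems(1) cr r0 by (simp add: map_poly_pCons)
  have r: "lead_coeff r = 1" using Suc.prems(2) cr r0 by simp
  show ?case
  proof (cases "c = 0")
   case True
   then have "poly (map_poly of_int r) x = 0" using eq assms(2) by simp
   moreover have "n = degree r" using Suc.hyps(2) cr r0 by simp
   ultimately show ?thesis using Suc.hyps(1) r by blast
  next
   case False
   have "algebraic_int (poly (map_poly of_int r) x)"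
    by (auto simp: poly_altdef coeff_map_poly intro!: algebraic_int_sum algebraic_int_add_mult(2)
      algebraic_int_power assms(1))
   moreover have "x * poly (map_poly of_int r) x = of_int (- c)" using eq by (simp add: add_eq_0_iff)
   ultimately show ?thesis using False by (metis neg_equal_0_iff_equal)
  qed
 qed
 then show ?thesis using that by blast
qed

section \<open>Valuation rings of the complex numbers above a prime\<close>

text \<open>A valuation ring of the complex numbers whose maximal ideal contains \<open>p\<close>.
  It plays the role of a p-adic valuation chosen once for all conjugates of both fields; only
  membership in the ring and in its maximal ideal is used, never a value group.\<close>

locale place =
 fixes p :: nat and A :: "complex set"
 assumes p: "prime p"
  and A_0: "0 : A" and A_1: "1 : A"
  and A_add: "x : A ==> y : A ==> x + y : A"
  and A_mult: "x : A ==> y : A ==> x * y : A"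
  and A_minus: "x : A ==> - x : A"
  and A_p: "inverse (of_nat p) ~: A"
  and A_val: "x ~: A ==> inverse x : A"
begin

definition M :: "complex set" where "M = {x : A. x = 0 \<or> inverse x ~: A}"

lemma p0: "(of_nat p :: complex) ~= 0" using p by auto

lemma A_diff: "x : A ==> y : A ==> x - y : A" using A_add[of x "- y"] A_minus by simp

lemma A_power: "x : A ==> x ^ n : A" by (induction n) (auto intro: A_1 A_mult)

lemma A_sum: "(!!i. i : I ==> f i : A) ==> sum f I : A"
 by (induction I rule: infinite_finite_induct) (auto intro: A_0 A_add)

lemma A_prod: "(!!i. i : I ==> f i : A) ==> prod f I : A"
 by (induction I rule: infinite_finite_induct) (auto intro: A_1 A_mult)

text \<open>Valuation rings are integrally closed: if \<open>x\<close> were outside, its inverse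
  would lie in \<open>A\<close>, and dividing the monic equation by \<open>x ^ (d - 1)\<close>
  writes \<open>x\<close> as a polynomial in that inverse.\<close>

lemma A_algebraic_int:
 assumes "algebraic_int x" shows "x : A"
proof (rule ccontr)
 assume x: "x ~: A"
 then have x0: "x ~= 0" using A_0 by auto
 have ix: "inverse x : A" using x by (rule A_val)
 have nat: "of_nat k : A" for k by (induction k) (auto intro: A_0 A_1 A_add)
 have int: "of_int k : A" for k
  by (cases k) (auto intro: nat A_minus simp del: of_nat_Suc)
 obtain q :: "int poly" where q: "poly (map_poly of_int q) x = 0" "lead_coeff q = 1"
  using assms unfolding algebraic_int_altdef_ipoly by blast
 define d where "d = degree q"
 have "d > 0"
 proof (rule ccontr)
  assume "\<not> d > 0"
  then have "q = 1" using q(2) unfolding d_def by (metis degree_0_id gr0I monic_degree_0)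
  then show False using q(1) by simp
 qed
 have "(\<Sum>i\<le>d. of_int (coeff q i) * x ^ i) = 0"
  using q(1) by (simp add: poly_altdef degree_map_poly coeff_map_poly d_def)
 then have eq: "x ^ d = - (\<Sum>i<d. of_int (coeff q i) * x ^ i)"
  using q(2) by (simp add: lessThan_Suc_atMost[symmetric] eq_neg_iff_add_eq_0 add.commute d_def)
 have "x = x ^ d * inverse x ^ (d - 1)"
  using \<open>d > 0\<close> x0 by (cases d) (auto simp: power_inverse field_simps)
 also have "... = - (\<Sum>i<d. of_int (coeff q i) * (x ^ i * inverse x ^ (d - 1)))"
  by (simp add: eq sum_distrib_right mult.assoc)
 also have "... = - (\<Sum>i<d. of_int (coeff q i) * inverse x ^ (d - 1 - i))"
 proof -
  have "x ^ i * inverse x ^ (d - 1) = inverse x ^ (d - 1 - i)" if "i < d" for i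
  proof -
   have "inverse x ^ (d - 1) = inverse x ^ i * inverse x ^ (d - 1 - i)"
    using that by (simp flip: power_add)
   then show ?thesis using x0 by (simp add: power_inverse)
  qed
  then show ?thesis by simp
 qed
 also have "... : A" by (intro A_minus A_sum A_mult int A_power ix)
 finally show False using x by contradiction
qed

lemma A_of_int [simp]: "of_int k : A" by (rule A_algebraic_int) simp
lemma A_of_nat [simp]: "of_nat k : A" by (rule A_algebraic_int) simp
lemma A_numeral [simp]: "numeral k : A" using A_of_nat[of "numeral k"] by simp

lemma M_A: "x : M ==> x : A" unfolding M_def by simp
lemma M_0 [simp]: "0 : M" unfolding M_def using A_0 by simp
lemma M_1 [simp]: "1 ~: M" unfolding M_def using A_1 by simp

lemma unit_inverse: "x : A ==> x ~: M ==> x ~= 0 & inverse x : A" unfolding M_def by auto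

lemma unitI: "x * y = 1 ==> y : A ==> x ~: M"
proof
 assume "x * y = 1" "y : A" "x : M"
 then have "y = inverse x" "x ~= 0" by (auto simp: inverse_unique)
 then show False using \<open>x : M\<close> \<open>y : A\<close> unfolding M_def by auto
qed

lemma not_A_inverse_M: "x ~: A ==> inverse x : M"
 unfolding M_def using A_val by auto

lemma M_mult: "x : M ==> a : A ==> x * a : M"
proof (rule ccontr)
 assume h: "x : M" "a : A" "x * a ~: M"
 have "x * a : A" using h M_A A_mult by auto
 then have "x * a ~= 0" "inverse (x * a) : A" using unit_inverse[OF _ h(3)] by simp_all
 then have "a * inverse (x * a) : A" using h A_mult by auto
 moreover have "x * (a * inverse (x * a)) = 1" using \<open>x * a ~= 0\<close> by (metis mult.assoc right_inverse)
 ultimately show False using unitI h(1) by blast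
qed

lemma M_mult2: "x : M ==> a : A ==> a * x : M" using M_mult[of x a] by (simp add: mult.commute)

text \<open>Of two nonzero elements one divides the other in \<open>A\<close>, so the sum is a
  multiple of one of the two nonunits.\<close>

lemma M_add: assumes "x : M" "y : M" shows "x + y : M"
proof -
 consider "y = 0" | "y ~= 0" "x / y : A" | "y ~= 0" "x / y ~: A" by blast
 then show ?thesis
 proof cases
  case 1 then show ?thesis using assms by simp
 next
  case 2
  then have "x + y = y * (1 + x / y)" by (simp add: field_simps)
  then show ?thesis using M_mult[OF assms(2), of "1 + x / y"] 2 A_add A_1 by auto
 next
  case 3
  then have "inverse (x / y) : A" by (intro A_val)
  then have "y / x : A" by (simp add: field_simps)
  moreover have "x ~= 0" using 3 A_0 by auto
  then have "x + y = x * (1 + y / x)" by (simp add: field_simps)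
  ultimately show ?thesis using M_mult[OF assms(1), of "1 + y / x"] A_add A_1 by auto
 qed
qed

lemma M_minus: "x : M ==> - x : M" using M_mult[of x "- 1"] A_minus A_1 by simp
lemma M_diff: "x : M ==> y : M ==> x - y : M" using M_add[of x "- y"] M_minus by simp
lemma M_sum: "(!!i. i : I ==> f i : M) ==> sum f I : M"
 by (induction I rule: infinite_finite_induct) (auto intro: M_add)

lemma M_prime: assumes "x * y : M" "x : A" "y : A" shows "x : M \<or> y : M"
proof (rule ccontr)
 assume "\<not> (x : M \<or> y : M)"
 then have "x ~= 0" "y ~= 0" "inverse x : A" "inverse y : A"
  using assms unit_inverse[of x] unit_inverse[of y] by auto
 moreover have "x * y * (inverse x * inverse y) = (x * inverse x) * (y * inverse y)" by (simp only: ac_simps)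
 ultimately have "inverse x * inverse y : A" "x * y * (inverse x * inverse y) = 1"
  using A_mult[of "inverse x" "inverse y"] by auto
 then show False using unitI assms(1) by blast
qed

lemma M_power: "x ^ n : M ==> x : A ==> x : M"
proof (induction n)
 case (Suc n)
 then show ?case using M_prime[of x "x ^ n"] A_power[of x n] by auto
qed simp

lemma unit_add_M: "x : A ==> x ~: M ==> y : M ==> x + y ~: M"
 using M_diff[of "x + y" y] by auto

lemma M_p: "of_nat p : M" unfolding M_def using A_p by simp

lemma M_of_int: "of_int k : M \<longleftrightarrow> int p dvd k"
proof
 assume "int p dvd k"
 then obtain j where "k = int p * j" by auto
 then show "of_int k : M" using M_mult[OF M_p, of "of_int j"] by simp
next
 assume k: "of_int k : M"
 show "int p dvd k"
 proof (rule ccontr)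
  assume "\<not> int p dvd k"
  then have "coprime (int p) k" using p by (simp add: prime_imp_coprime)
  then obtain a b where ab: "a * int p + b * k = 1"
   by (metis bezout_int coprime_iff_gcd_eq_1)
  have "of_nat p * of_int a + of_int k * of_int b : M"
   by (intro M_add M_mult M_p k A_of_int)
  also have "(of_nat p * of_int a + of_int k * of_int b :: complex) = of_int (a * int p + b * k)" by simp
  finally show False using ab by simp
 qed
qed

lemma A_power_imp: assumes "x ^ n : A" "n > 0" shows "x : A"
proof (rule ccontr)
 assume x: "x ~: A"
 then have i: "inverse x : M" and x0: "x ~= 0" using not_A_inverse_M A_0 by auto
 have "inverse x * (x ^ n * inverse x ^ (n - 1)) : M"
  by (intro M_mult i A_mult assms A_power M_A)
 moreover have "inverse x * (x ^ n * inverse x ^ (n - 1)) = 1"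
  using assms(2) x0 by (cases n) (auto simp: power_inverse field_simps)
 ultimately show False by simp
qed

lemma A_of_int_divide:
 assumes "of_int a / of_int b : A" "int p dvd b" "b ~= 0"
 shows "int p dvd a"
proof -
 have "of_int b * (of_int a / of_int b) : M" using M_mult assms(1,2) M_of_int by blast
 then show ?thesis using assms(3) M_of_int by simp
qed

text \<open>Turns membership in \<open>A\<close> into divisibility of rational integers. Together
  with the rationality of norms this brings information at the place back to the integers.\<close>

lemma A_divide_power_int:
 assumes "of_int a / of_nat p ^ k : A" shows "int p ^ k dvd a"
 using assms
proof (induction k arbitrary: a)
 case (Suc k)
 have "of_int a / of_int (int p ^ Suc k) : A" using Suc.prems by simp
 then have "int p dvd a" by (rule A_of_int_divide) (use p in auto)
 then obtain j where j: "a = int p * j" by auto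
 then have "of_int a / of_nat p ^ Suc k = (of_int j / of_nat p ^ k :: complex)" using p0 by simp
 then show ?case using Suc j by simp
qed simp

end

text \<open>Zorn's lemma gives a subring maximal among those without the inverse of
  \<open>p\<close>. Adjoining any outside element therefore produces that inverse, and this forces
  the valuation property.\<close>

lemma subring_exists_place:
 assumes p: "prime (p::nat)"
 obtains A where "place p A"
proof -
 define R where "R = {A :: complex set. 0 : A & 1 : A & (\<forall>x\<in>A. \<forall>y\<in>A. x + y : A & x * y : A) \<and>
  (\<forall>x\<in>A. - x : A) & inverse (of_nat p) ~: A}"
 have p0: "(of_nat p :: complex) ~= 0" using p by auto
 have "\<int> : R"
 proof -
  have "inverse (of_nat p) ~: (\<int> :: complex set)"
  proof
   assume "inverse (of_nat p) : (\<int> :: complex set)"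
   then obtain k where "inverse (of_nat p) = (of_int k :: complex)" by (auto elim: Ints_cases)
   then have "(1::complex) = of_int (k * int p)" using p0 by (simp add: field_simps)
   then have "1 = k * int p" by (metis of_int_1 of_int_eq_iff)
   then have "int p dvd 1" by (metis dvd_triv_right)
   then show False using p by auto
  qed
  then show ?thesis unfolding R_def by auto
 qed
 then have ne: "R ~= {}" by auto
 have "\<exists>A\<in>R. \<forall>X\<in>R. A \<subseteq> X --> X = A"
 proof (rule subset_Zorn_nonempty[OF ne])
  fix C assume C: "C ~= {}" "subset.chain R C"
  have sub: "C \<subseteq> R" using C(2) unfolding subset.chain_def by auto
  have ch: "X \<subseteq> Y \<or> Y \<subseteq> X" if "X : C" "Y : C" for X Y
   using C(2) that unfolding subset.chain_def by auto
  have two: "\<exists>Z\<in>C. x : Z & y : Z" if xy: "x : \<Union>C" "y : \<Union>C" for x y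
  proof -
   obtain X Y where "X : C" "x : X" "Y : C" "y : Y" using xy by auto
   then show ?thesis using ch[of X Y] by auto
  qed
  have cl: "x + y : \<Union>C & x * y : \<Union>C" if xy: "x : \<Union>C" "y : \<Union>C" for x y
  proof -
   obtain Z where Z: "Z : C" "x : Z" "y : Z" using two[OF xy] by auto
   then have "x + y : Z & x * y : Z" using sub unfolding R_def by blast
   then show ?thesis using Z(1) by blast
  qed
  have mi: "- x : \<Union>C" if "x : \<Union>C" for x
   using that sub unfolding R_def by blast
  have "0 : \<Union>C" "1 : \<Union>C" "inverse (of_nat p) ~: \<Union>C"
   using C(1) sub unfolding R_def by auto
  then show "\<Union>C : R" unfolding R_def using cl mi by auto
 qed
 then obtain A where A: "A : R" and max: "!!X. X : R ==> A \<subseteq> X ==> X = A" by blast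
 have A0: "0 : A" and A1: "1 : A" and Aa: "!!x y. x : A ==> y : A ==> x + y : A"
  and Am: "!!x y. x : A ==> y : A ==> x * y : A" and An: "!!x. x : A ==> - x : A"
  and Ap: "inverse (of_nat p) ~: A" using A unfolding R_def by auto
 have nat: "of_nat k : A" for k by (induction k) (auto intro: A0 A1 Aa)
 have pw: "x ^ k : A" if "x : A" for x k by (induction k) (auto intro: A1 Am that)
 have sm: "sum f I : A" if "!!i. i : I ==> f i : A" for f :: "nat => complex" and I
  using that by (induction I rule: infinite_finite_induct) (auto intro: A0 Aa)
 define E where "E x = {poly q x | q. \<forall>i. coeff q i : A}" for x :: complex
 have sub_E: "A \<subseteq> E x" for x
 proof
  fix a assume "a : A"
  then have "\<forall>i. coeff [:a:] i : A" using A0 by (auto simp: coeff_pCons split: nat.splits)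
  then show "a : E x" unfolding E_def by (intro CollectI exI[of _ "[:a:]"]) auto
 qed
 have x_E: "x : E x" for x
 proof -
  have "\<forall>i. coeff [:0, 1:] i : A" using A0 A1 by (auto simp: coeff_pCons split: nat.splits)
  then show ?thesis unfolding E_def by (intro CollectI exI[of _ "[:0, 1:]"]) auto
 qed
 have E_R: "inverse (of_nat p) : E x" if "x ~: A" for x
 proof (rule ccontr)
  assume np: "inverse (of_nat p) ~: E x"
  have "E x : R"
  proof -
   have "u + v : E x" "u * v : E x" if uv: "u : E x" "v : E x" for u v
   proof -
    obtain q r where qr: "u = poly q x" "\<forall>i. coeff q i : A" "v = poly r x" "\<forall>i. coeff r i : A"
     using uv unfolding E_def by auto
    have "\<forall>i. coeff (q + r) i : A" using qr Aa by auto
    then show "u + v : E x" unfolding E_def using qr by (intro CollectI exI[of _ "q + r"]) auto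
    have "\<forall>i. coeff (q * r) i : A" using qr by (auto simp: coeff_mult intro!: sm Am)
    then show "u * v : E x" unfolding E_def using qr by (intro CollectI exI[of _ "q * r"]) auto
   qed
   moreover have "- u : E x" if u: "u : E x" for u
   proof -
    obtain q where q: "u = poly q x" "\<forall>i. coeff q i : A" using u unfolding E_def by auto
    then have "\<forall>i. coeff (- q) i : A" using An by auto
    then show ?thesis unfolding E_def using q by (intro CollectI exI[of _ "- q"]) auto
   qed
   ultimately show ?thesis unfolding R_def using sub_E[of x] A0 A1 np by auto
  qed
  then have "E x = A" using max sub_E by blast
  then show False using x_E[of x] that by simp
 qed
 \<comment> \<open>If \<open>?w\<close> were not invertible in \<open>A\<close>, adjoining its
   inverse would write the inverse of \<open>p\<close> as a polynomial in it. Clearing denominators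
   puts \<open>?w ^ k\<close> into \<open>p A\<close>, while \<open>?w ^ k\<close> is congruent to 1
   modulo \<open>p A\<close>.\<close>
 have unit: "inverse (1 - of_nat p * b) : A" "1 - of_nat p * b ~= 0" if b: "b : A" for b
 proof -
  let ?w = "1 - of_nat p * b"
  have wA: "?w : A" using Aa[OF A1 An[OF Am[OF nat b]]] by simp
  have pk: "\<exists>c\<in>A. ?w ^ k = 1 - of_nat p * c" for k
  proof (induction k)
   case 0 show ?case using A0 by (intro bexI[of _ 0]) auto
  next
   case (Suc k)
   then obtain c where c: "c : A" "?w ^ k = 1 - of_nat p * c" by auto
   have "?w ^ Suc k = 1 - of_nat p * (c + b * ?w ^ k)" using c(2) by (simp add: algebra_simps)
   moreover have "c + b * ?w ^ k : A" using Aa[OF c(1) Am[OF b pw[OF wA]]] .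
   ultimately show ?case by blast
  qed
  show w0: "?w ~= 0"
  proof
   assume "?w = 0"
   then have "inverse (of_nat p) = b" using p0 by (simp add: field_simps)
   then show False using b Ap by simp
  qed
  show "inverse ?w : A"
  proof (rule ccontr)
   assume "inverse ?w ~: A"
   then obtain q where q: "inverse (of_nat p) = poly q (inverse ?w)" "\<forall>i. coeff q i : A"
    using E_R unfolding E_def by blast
   define k where "k = degree q"
   have "?w ^ k = of_nat p * (poly q (inverse ?w) * ?w ^ k)" using q(1) p0 by (simp flip: q(1))
   also have "poly q (inverse ?w) * ?w ^ k = (\<Sum>i\<le>k. coeff q i * ?w ^ (k - i))"
   proof -
    have "inverse ?w ^ i * ?w ^ k = ?w ^ (k - i)" if "i <= k" for i
     using that w0 by (simp add: power_inverse power_diff field_simps)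
    then show ?thesis by (simp add: poly_altdef k_def sum_distrib_right mult.assoc)
   qed
   finally have e1: "?w ^ k = of_nat p * (\<Sum>i\<le>k. coeff q i * ?w ^ (k - i))" .
   obtain c where c: "c : A" "?w ^ k = 1 - of_nat p * c" using pk by blast
   let ?s = "c + (\<Sum>i\<le>k. coeff q i * ?w ^ (k - i))"
   have "?s : A" using c(1) q(2) by (intro Aa sm Am pw wA) auto
   moreover have "of_nat p * ?s = 1" using e1 c(2) by (simp add: algebra_simps)
   then have "?s = inverse (of_nat p)" by (metis inverse_unique)
   ultimately show False using Ap by simp
  qed
 qed
 have rel: "\<exists>q. (\<forall>i. coeff q i : A) & of_nat p * poly q x = 1" if x: "x ~: A" for x
 proof -
  obtain q where "inverse (of_nat p) = poly q x" "\<forall>i. coeff q i : A"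
   using E_R[OF x] unfolding E_def by blast
  then show ?thesis using p0 by (intro exI[of _ q]) (auto simp flip: \<open>inverse (of_nat p) = poly q x\<close>)
 qed
 text \<open>Two relations of minimal degree for \<open>x\<close> and \<open>inverse x\<close>: the one of larger degree can be
  shortened by the other.\<close>
 have red: False
  if x: "x ~= 0" and q: "\<forall>i. coeff q i : A" "of_nat p * poly q x = 1"
   and r: "\<forall>i. coeff r i : A" "of_nat p * poly r (inverse x) = 1"
   and le: "degree r <= degree q"
   and mn: "!!q'. \<forall>i. coeff q' i : A ==> of_nat p * poly q' x = 1 ==> degree q <= degree q'" for x q r
 proof -
  let ?w = "1 - of_nat p * coeff r 0"
  have wi: "inverse ?w : A" and w0: "?w ~= 0" using unit r(1) by auto
  obtain r0 r1 where rr: "r = pCons r0 r1" by (cases r) auto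
  have dq: "degree q > 0"
  proof (rule ccontr)
   assume "\<not> degree q > 0"
   then have "poly q x = coeff q 0" by (simp add: poly_altdef)
   then have "inverse (of_nat p) = coeff q 0" using q(2) by (metis inverse_unique)
   then show False using q(1) Ap by simp
  qed
  define k where "k = degree q"
  have wx: "?w = of_nat p * (inverse x * poly r1 (inverse x))"
   using r(2) by (simp add: rr algebra_simps)
  have r1: "\<forall>i. coeff r1 i : A" using r(1) by (metis coeff_pCons_Suc rr)
  have d1: "i < k" if "coeff r1 i ~= 0" for i
  proof -
   have "coeff r (Suc i) ~= 0" using that rr by simp
   then have "Suc i <= degree r" by (rule le_degree)
   then show ?thesis using le k_def by simp
  qed
  \<comment> \<open>\<open>s\<close> is \<open>r1\<close> with its coefficients reversed, of degree
    below \<open>k\<close>. The relation for the inverse of \<open>x\<close>, multiplied by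
    \<open>x ^ k\<close>, becomes \<open>?w * x ^ k = p * s(x)\<close>, and as \<open>?w\<close> is
    a unit it replaces the leading power in the relation \<open>q\<close>.\<close>
  define s where "s = (\<Sum>i<k. monom (coeff r1 i) (k - Suc i))"
  have sA: "coeff s j : A" for j
   unfolding s_def by (simp add: coeff_sum) (intro sm, use r1 A0 in auto)
  have s_deg: "degree s < k"
   unfolding s_def
   by (rule degree_sum_less) (use dq k_def in \<open>auto intro!: le_less_trans[OF degree_monom_le]\<close>)
  have "x ^ k * (inverse x * poly r1 (inverse x)) = poly s x"
  proof -
   have "poly r1 (inverse x) = (\<Sum>i<k. coeff r1 i * inverse x ^ i)"
    unfolding poly_altdef by (rule sum.mono_neutral_cong) (use d1 in \<open>auto simp: coeff_eq_0 not_le\<close>)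
   then have "x ^ k * (inverse x * poly r1 (inverse x))
     = (\<Sum>i<k. x ^ k * (inverse x * (coeff r1 i * inverse x ^ i)))"
    by (simp only: sum_distrib_left)
   also have "... = (\<Sum>i<k. coeff r1 i * x ^ (k - Suc i))"
   proof (rule sum.cong[OF refl])
    fix i assume "i : {..<k}"
    then have "k = (k - Suc i) + Suc i" by simp
    then have "x ^ k = x ^ (k - Suc i) * (x * x ^ i)" by (metis power_Suc power_add)
    then have "x ^ k * (inverse x * (coeff r1 i * inverse x ^ i))
      = coeff r1 i * x ^ (k - Suc i) * ((x * inverse x) * (x ^ i * inverse x ^ i))"
     by (simp only: ac_simps)
    moreover have "x ^ i * inverse x ^ i = 1" using x by (simp flip: power_mult_distrib)
    ultimately show "x ^ k * (inverse x * (coeff r1 i * inverse x ^ i)) = coeff r1 i * x ^ (k - Suc i)"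
     using x by simp
   qed
   also have "... = poly s x" by (simp add: s_def poly_sum poly_monom)
   finally show ?thesis .
  qed
  then have "?w * x ^ k = of_nat p * poly s x"
   by (subst wx) (simp add: ac_simps)
  then have "inverse ?w * (?w * x ^ k) = inverse ?w * (of_nat p * poly s x)" by simp
  moreover have "inverse ?w * (?w * x ^ k) = x ^ k" by (subst mult.assoc[symmetric]) (use w0 in simp)
  ultimately have xk: "x ^ k = of_nat p * inverse ?w * poly s x" by (simp only: ac_simps)
  define c where "c = coeff q k"
  define q' where "q' = q - monom c k + smult (c * (of_nat p * inverse ?w)) s"
  have "\<forall>i. coeff q' i : A"
  proof
   fix i
   have "coeff q i - coeff (monom c k) i : A" using q(1) A0 by (auto simp: c_def)
   then show "coeff q' i : A" unfolding q'_def using Aa Am nat wi sA q(1) by (auto simp: c_def)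
  qed
  moreover have "poly q' x = poly q x"
   by (simp add: q'_def poly_monom xk)
  then have "of_nat p * poly q' x = 1" using q(2) by simp
  ultimately have "degree q <= degree q'" by (rule mn)
  moreover have "degree (q - monom c k) < k"
  proof -
   have "coeff (q - monom c k) i = 0" if "i \<ge> k" for i
    using that by (cases "i = k") (auto simp: c_def k_def coeff_eq_0)
   then show ?thesis using dq k_def by (metis degree_0 leading_coeff_0_iff not_le)
  qed
  then have "degree q' < k" unfolding q'_def using s_deg
   by (intro degree_add_less) (auto intro: le_less_trans[OF degree_smult_le])
  ultimately show False using k_def by simp
 qed
 have val: "inverse x : A" if x: "x ~: A" for x
 proof (rule ccontr)
  assume ix: "inverse x ~: A"
  have x0: "x ~= 0" using x A0 by auto
  let ?P = "%z q. (\<forall>i. coeff q i : A) & of_nat p * poly q z = 1"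
  obtain q where q: "?P x q" "!!q'. ?P x q' ==> degree q <= degree q'"
   using ex_has_least_nat[of "?P x" _ degree] rel[OF x] by metis
  obtain r where r: "?P (inverse x) r" "!!r'. ?P (inverse x) r' ==> degree r <= degree r'"
   using ex_has_least_nat[of "?P (inverse x)" _ degree] rel[OF ix] by metis
  show False
  proof (cases "degree r <= degree q")
   case True then show False using red[of x q r] x0 q r by blast
  next
   case False
   then show False using red[of "inverse x" r q] x0 q r by (simp add: inverse_inverse_eq)
  qed
 qed
 have "place p A" by unfold_locales (use p A0 A1 Aa Am An Ap val in auto)
 then show ?thesis by (rule that)
qed

section \<open>Subfields of the complex numbers as rational vector spaces\<close>

interpretation rat: vector_space "%(q::rat) (x::complex). of_rat q * x"
 by unfold_locales (simp_all add: algebra_simps of_rat_add of_rat_mult)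

lemma subfieldD:
 assumes "subfield K"
 shows "0 : K" "1 : K" "x : K ==> y : K ==> x + y : K" "x : K ==> y : K ==> x * y : K"
  "x : K ==> - x : K" "x : K ==> inverse x : K"
  "x : K ==> y : K ==> x - y : K" "x : K ==> y : K ==> x / y : K"
  "x : K ==> x ^ n : K" "of_nat m : K" "of_int k : K" "of_rat q : K"
proof -
 have *: "0 : K" "1 : K" "!!x y. x : K ==> y : K ==> x + y : K"
  "!!x y. x : K ==> y : K ==> x * y : K" "!!x. x : K ==> - x : K"
  and i: "!!x. x : K ==> x ~= 0 ==> inverse x : K" using assms unfolding subfield_def by auto
 have inv: "inverse x : K" if "x : K" for x using * i[of x] that by (cases "x = 0") auto
 have nat: "of_nat m : K" for m by (induction m) (auto intro: *)
 have int: "of_int k : K" for k by (cases k) (auto intro: * nat simp del: of_nat_Suc)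
 have "of_rat q : K" for q
 proof -
  obtain a b where "q = of_int a / of_int b" by (metis quotient_of_div prod.exhaust)
  then have "of_rat q = (of_int a / of_int b :: complex)" by (simp add: of_rat_divide)
  then show ?thesis using * int inv by (simp add: divide_inverse)
 qed
 then show "of_rat q : K" .
 show "0 : K" "1 : K" "x : K ==> y : K ==> x + y : K" "x : K ==> y : K ==> x * y : K"
  "x : K ==> - x : K" "x : K ==> inverse x : K" "of_nat m : K" "of_int k : K"
  using * inv nat int by auto
 show "x : K ==> y : K ==> x - y : K" using *(3)[of x "- y"] *(5) by auto
 show "x : K ==> y : K ==> x / y : K" unfolding divide_inverse using * inv by auto
 show "x : K ==> x ^ n : K" by (induction n) (auto intro: *)
qed

lemma subfield_sum: "subfield K ==> (!!i. i : I ==> f i : K) ==> sum f I : K"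
 by (induction I rule: infinite_finite_induct) (auto intro: subfieldD)

lemma subfield_prod: "subfield K ==> (!!i. i : I ==> f i : K) ==> prod f I : K"
 by (induction I rule: infinite_finite_induct) (auto intro: subfieldD)

lemma subfield_Rats: "subfield \<rat>" unfolding subfield_def by auto

lemma Rats_subset_subfield: "subfield K ==> x : \<rat> ==> x : K"
 using subfieldD(12) by (auto elim!: Rats_cases)

lemma subfield_rat_subspace: "subfield K ==> rat.subspace K"
 unfolding rat.subspace_def using subfieldD by auto

lemma q_basis_iff:
 assumes "subfield K"
 shows "q_basis K B \<longleftrightarrow> finite B & \<not> rat.dependent B & rat.span B = K"
proof (cases "finite B")
 case fin: True
 have ind: "\<not> rat.dependent B \<longleftrightarrow>
   (\<forall>c::complex => rat. (\<Sum>b\<in>B. of_rat (c b) * b) = 0 --> (\<forall>b\<in>B. c b = 0))"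
  using rat.dependent_finite[OF fin] by auto
 have sp: "rat.span B = range (%c. \<Sum>b\<in>B. of_rat (c b) * b)" by (rule rat.span_finite[OF fin])
 show ?thesis
 proof
  assume q: "q_basis K B"
  then have "B \<subseteq> K" unfolding q_basis_def by auto
  then have "rat.span B \<subseteq> K" by (rule rat.span_minimal[OF _ subfield_rat_subspace[OF assms]])
  moreover have "K \<subseteq> rat.span B" using q unfolding q_basis_def sp by auto
  ultimately show "finite B & \<not> rat.dependent B & rat.span B = K"
   using q ind unfolding q_basis_def by auto
 next
  assume r: "finite B & \<not> rat.dependent B & rat.span B = K"
  then have "B \<subseteq> K" using rat.span_superset by auto
  then show "q_basis K B" unfolding q_basis_def using r ind sp by auto
 qed
next
 case False then show ?thesis unfolding q_basis_def by simp
qed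

lemma nf_degree_eq: assumes "subfield K" "q_basis K B" shows "nf_degree K = card B"
 unfolding nf_degree_def
proof (rule the_equality)
 show "\<exists>B'. q_basis K B' & card B' = card B" using assms by auto
next
 fix n assume "\<exists>B'. q_basis K B' & card B' = n"
 then obtain B' where B': "q_basis K B'" "card B' = n" by auto
 have *: "card X = rat.dim K" if "q_basis K X" for X
  using that rat.dim_eq_card[of X K] unfolding q_basis_iff[OF assms(1)]
  by (metis rat.span_span)
 show "n = card B" using *[OF B'(1)] *[OF assms(2)] B' by simp
qed

locale numfield =
 fixes K :: "complex set"
 assumes nf: "number_field K"
begin

lemma sf: "subfield K" using nf unfolding number_field_def by simp

lemmas K_closed = subfieldD[OF sf]
lemmas K_sum = subfield_sum[OF sf]
lemmas K_prod = subfield_prod[OF sf]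

definition n :: nat where "n = nf_degree K"

lemma basis_ex: obtains B where "finite B" "\<not> rat.dependent B" "rat.span B = K" "card B = n"
 using nf nf_degree_eq[OF sf] unfolding number_field_def n_def q_basis_iff[OF sf] by metis

lemma indep_bound: assumes "\<not> rat.dependent S" "S \<subseteq> K" shows "finite S" "card S <= n"
proof -
 obtain B where B: "finite B" "\<not> rat.dependent B" "rat.span B = K" "card B = n" by (rule basis_ex)
 show "finite S" "card S <= n"
  using rat.independent_span_bound[OF B(1) assms(1)] assms(2) B by auto
qed

lemma indep_span_K:
 assumes "\<not> rat.dependent S" "S \<subseteq> K" "card S = n" shows "rat.span S = K"
proof (rule ccontr)
 assume ne: "rat.span S ~= K"
 have "rat.span S \<subseteq> K" by (rule rat.span_minimal[OF assms(2) subfield_rat_subspace[OF sf]])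
 then obtain x where x: "x : K" "x ~: rat.span S" using ne by auto
 have "\<not> rat.dependent (insert x S)" using rat.independent_insertI[OF x(2) assms(1)] .
 then have "card (insert x S) <= n" using indep_bound(2) assms(2) x(1) by auto
 moreover have "x ~: S" using x rat.span_superset by auto
 ultimately show False using assms(3) indep_bound(1)[OF assms(1,2)] by simp
qed

lemma n_pos: "n > 0"
proof -
 have "\<not> rat.dependent {1}" by (simp add: rat.dependent_single)
 then show ?thesis using indep_bound(2)[of "{1}"] K_closed by auto
qed

end

section \<open>Minimal polynomials and primitive elements\<close>

text \<open>Subfields are sets, so a polynomial over \<open>F\<close> is a complex polynomial with a
  condition on its coefficients; divisibility below is divisibility over the complex
  numbers.\<close>

definition poly_over :: "complex set => complex poly set" where
 "poly_over F = {p. \<forall>i. coeff p i : F}"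

lemma poly_overI: "(!!i. coeff p i : F) ==> p : poly_over F" unfolding poly_over_def by simp
lemma poly_overD: "p : poly_over F ==> coeff p i : F" unfolding poly_over_def by simp

lemma poly_over_closed:
 assumes "subfield F"
 shows "p : poly_over F ==> q : poly_over F ==> p + q : poly_over F"
  "p : poly_over F ==> q : poly_over F ==> p - q : poly_over F"
  "p : poly_over F ==> q : poly_over F ==> p * q : poly_over F"
  "c : F ==> p : poly_over F ==> smult c p : poly_over F"
  "c : F ==> monom c k : poly_over F" "0 : poly_over F" "1 : poly_over F"
  "c : F ==> p : poly_over F ==> pCons c p : poly_over F"
  "p : poly_over F ==> pderiv p : poly_over F"
  "p : poly_over F ==> x : F ==> poly p x : F"
 using subfieldD[OF assms]
 by (auto simp: poly_over_def coeff_mult coeff_pCons coeff_pderiv poly_altdef coeff_1 split: nat.splits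
   intro!: subfield_sum[OF assms] subfieldD(10)[OF assms, of "Suc _", simplified])

lemma poly_over_pcompose:
 assumes "subfield F" "p : poly_over F" "q : poly_over F"
 shows "pcompose p q : poly_over F"
 using assms(2)
proof (induction p)
 case 0 then show ?case using assms by (simp add: poly_over_closed)
next
 case (pCons a p)
 have "a : F" "p : poly_over F"
  using poly_overD[OF pCons.prems, of 0] poly_overD[OF pCons.prems, of "Suc _"] by (auto simp: poly_over_def)
 then show ?case using pCons.IH assms
  by (simp add: pcompose_pCons poly_over_closed[OF assms(1)])
qed

lemma poly_over_sum: "subfield F ==> (!!i. i : I ==> f i : poly_over F) ==> sum f I : poly_over F"
 by (induction I rule: infinite_finite_induct) (auto intro: poly_over_closed)

text \<open>Division with remainder by the monic \<open>r\<close> never leaves \<open>F\<close>.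
  Hence the last conclusion: an exact quotient by \<open>r\<close> again has its coefficients in
  \<open>F\<close>.\<close>

lemma minimal_poly_over:
 assumes F: "subfield F" and ex: "p0 : poly_over F" "p0 ~= 0" "poly p0 b = 0"
 obtains r where "r : poly_over F" "lead_coeff r = 1" "poly r b = 0"
  "!!p. p : poly_over F ==> poly p b = 0 ==> r dvd p"
  "!!p. p : poly_over F ==> poly p b = 0 ==> p ~= 0 ==> degree r <= degree p"
  "!!p q. p : poly_over F ==> p = r * q ==> q : poly_over F"
proof -
 let ?P = "%p. p : poly_over F & p ~= 0 & poly p b = 0"
 obtain r0 where r0: "?P r0" "!!q. ?P q ==> degree r0 <= degree q"
  using ex_has_least_nat[of ?P p0 degree] ex by metis
 define r where "r = smult (inverse (lead_coeff r0)) r0"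
 have lc0: "lead_coeff r0 ~= 0" using r0 by simp
 have r: "r : poly_over F" "lead_coeff r = 1" "poly r b = 0" "degree r = degree r0"
  unfolding r_def using r0(1) lc0 by (auto intro!: poly_over_closed[OF F] subfieldD(6)[OF F] poly_overD)
 have min: "degree r <= degree p" if "p : poly_over F" "poly p b = 0" "p ~= 0" for p
  using r0(2)[of p] that r by simp
 have quo: "\<exists>q\<in>poly_over F. p = r * q" if "p : poly_over F" "poly p b = 0" for p
  using that
 proof (induction "degree p" arbitrary: p rule: less_induct)
  case less
  show ?case
  proof (cases "p = 0")
   case True then show ?thesis by (intro bexI[of _ 0]) (auto intro: poly_over_closed[OF F])
  next
   case False
   let ?m = "monom (lead_coeff p) (degree p - degree r)"
   define p' where "p' = p - ?m * r"
   have dle: "degree r <= degree p" using min less.prems False by simp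
   have m: "?m : poly_over F" using less.prems by (intro poly_over_closed[OF F] poly_overD)
   have p': "p' : poly_over F" "poly p' b = 0"
    unfolding p'_def using less.prems m r by (auto intro: poly_over_closed[OF F])
   show ?thesis
   proof (cases "p' = 0")
    case True
    then show ?thesis using m p'_def by (intro bexI[of _ ?m]) (auto simp: mult.commute)
   next
    case p'0: False
    have r_ne: "r ~= 0" using r(2) by auto
    have dm: "degree (?m * r) = degree p" using False r_ne dle by (simp add: degree_mult_eq degree_monom_eq)
    have "coeff (?m * r) (degree p) = lead_coeff p"
     using dm r(2) by (metis degree_mult_eq_0 lead_coeff_monom lead_coeff_mult mult.right_neutral)
    then have "coeff p' (degree p) = 0" unfolding p'_def by simp
    moreover have "degree p' <= degree p" unfolding p'_def using dm by (intro degree_diff_le) auto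
    ultimately have "degree p' < degree p" using p'0
     by (metis leading_coeff_0_iff nat_less_le)
    then obtain q where q: "q : poly_over F" "p' = r * q" using less.hyps p' by blast
    have "p = r * (q + ?m)" using q p'_def by (simp add: algebra_simps)
    then show ?thesis using q m by (intro bexI[of _ "q + ?m"]) (auto intro: poly_over_closed[OF F])
   qed
  qed
 qed
 have "q : poly_over F" if h: "p : poly_over F" "p = r * q" for p q
 proof -
  have "poly p b = 0" using h r by simp
  then obtain q' where "q' : poly_over F" "r * q = r * q'" using quo[OF h(1)] h(2) by auto
  then show ?thesis using r(2) by auto
 qed
 moreover have "r dvd p" if "p : poly_over F" "poly p b = 0" for p using quo[OF that] by auto
 ultimately show ?thesis using r min by (intro that[of r])
qed

lemma poly_over_mono: "F \<subseteq> G ==> poly_over F \<subseteq> poly_over G" unfolding poly_over_def by auto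

definition adjoin :: "complex => complex set" where
 "adjoin b = {poly p b | p. p : poly_over \<rat>}"

text \<open>By minimality the constant term \<open>c\<close> of the minimal polynomial is nonzero,
  and \<open>x\<close> times a polynomial in \<open>x\<close> equals \<open>- c\<close>.\<close>

lemma inverse_in_algebra:
 assumes R: "!!x y. x : R ==> y : R ==> x + y : R" "!!x y. x : R ==> y : R ==> x * y : R" "\<rat> \<subseteq> R"
  and alg: "p : poly_over \<rat>" "p ~= 0" "poly p x = 0" and x: "x : R" "x ~= 0"
 shows "inverse x : R"
proof -
 obtain r where r: "r : poly_over \<rat>" "lead_coeff r = 1" "poly r x = 0"
  "!!p. p : poly_over \<rat> ==> poly p x = 0 ==> p ~= 0 ==> degree r <= degree p"
  using minimal_poly_over[OF subfield_Rats alg] by metis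
 obtain c s where cs: "r = pCons c s" by (cases r) auto
 have c: "c : \<rat>" and s: "s : poly_over \<rat>"
  using poly_overD[OF r(1), of 0] poly_overD[OF r(1), of "Suc _"] cs by (auto simp: poly_over_def)
 have s0: "s ~= 0" using cs r(2,3) x by auto
 have eq: "c + x * poly s x = 0" using r(3) cs by simp
 have c0: "c ~= 0"
 proof
  assume "c = 0"
  then have "poly s x = 0" using eq x by simp
  then have "degree r <= degree s" using r(4) s s0 by blast
  then show False using cs s0 by simp
 qed
 have pw: "x ^ k : R" for k using R(2) R(3) x by (induction k) auto
 have "(\<Sum>i\<in>I. coeff s i * x ^ i) : R" if "finite I" for I
  using that
 proof induction
  case (insert i F)
  have "coeff s i : R" using s R(3) by (auto simp: poly_over_def)
  then have "coeff s i * x ^ i : R" using R(2) pw by blast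
  then show ?case using insert R(1) by simp
 qed (use R(3) in auto)
 then have "poly s x : R" by (simp add: poly_altdef)
 moreover have "- inverse c : R" using c R(3) by auto
 ultimately have "- inverse c * poly s x : R" using R(2) by blast
 moreover have "x * (- inverse c * poly s x) = 1"
  using eq c0 by (simp add: field_simps add_eq_0_iff)
 ultimately show ?thesis by (metis inverse_unique)
qed

lemma adjoin_closed:
 "x : adjoin b ==> y : adjoin b ==> x + y : adjoin b"
 "x : adjoin b ==> y : adjoin b ==> x * y : adjoin b"
 "x : adjoin b ==> - x : adjoin b" "\<rat> \<subseteq> adjoin b" "b : adjoin b"
proof -
 note c = poly_over_closed[OF subfield_Rats]
 show "x : adjoin b ==> y : adjoin b ==> x + y : adjoin b"
  unfolding adjoin_def by clarify (metis c(1) poly_add)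
 show "x : adjoin b ==> y : adjoin b ==> x * y : adjoin b"
  unfolding adjoin_def by clarify (metis c(3) poly_mult)
 show "x : adjoin b ==> - x : adjoin b"
  unfolding adjoin_def by clarify (metis c(2,6) diff_0 poly_minus)
 show "\<rat> \<subseteq> adjoin b"
 proof
  fix q :: complex assume "q : \<rat>"
  then have "[:q:] : poly_over \<rat>" by (intro c(6,8))
  then show "q : adjoin b" unfolding adjoin_def by (intro CollectI exI[of _ "[:q:]"]) auto
 qed
 have "[:0, 1:] : poly_over \<rat>" by (intro c) auto
 then show "b : adjoin b" unfolding adjoin_def by (intro CollectI exI[of _ "[:0, 1:]"]) auto
qed

context numfield
begin

lemma algebraic_over_Rats:
 assumes x: "x : K" obtains p where "p : poly_over \<rat>" "p ~= 0" "poly p x = 0"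
proof (cases "inj_on (%i. x ^ i) {..n}")
 case False
 then obtain i j where ij: "i ~= j" "x ^ i = x ^ j" unfolding inj_on_def by auto
 have "monom 1 i - monom 1 j ~= (0 :: complex poly)" using ij(1)
  by (metis coeff_monom eq_iff_diff_eq_0 one_neq_zero)
 moreover have "poly (monom 1 i - monom 1 j) x = 0" using ij(2) by (simp add: poly_monom)
 ultimately show ?thesis
  by (intro that[of "monom 1 i - monom 1 j"] poly_over_closed[OF subfield_Rats]) auto
next
 case inj: True
 let ?S = "(%i. x ^ i) ` {..n}"
 have "card ?S = Suc n" using card_image[OF inj] by simp
 moreover have "?S \<subseteq> K" using x K_closed by auto
 ultimately have "rat.dependent ?S" using indep_bound(2) by fastforce
 then obtain u where u: "(\<Sum>v\<in>?S. of_rat (u v) * v) = 0" "\<exists>v\<in>?S. u v ~= 0"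
  using rat.dependent_finite[of ?S] by auto
 define p where "p = (\<Sum>i\<le>n. monom (of_rat (u (x ^ i)) :: complex) i)"
 obtain i where i: "i <= n" "u (x ^ i) ~= 0" using u(2) by auto
 have "coeff p i = of_rat (u (x ^ i))" unfolding p_def using i by (simp add: coeff_sum sum.delta)
 then have "p ~= 0" using i(2) by auto
 moreover have "p : poly_over \<rat>" unfolding p_def
  by (intro poly_over_sum[OF subfield_Rats] poly_over_closed[OF subfield_Rats]) auto
 moreover have "poly p x = (\<Sum>i\<le>n. of_rat (u (x ^ i)) * x ^ i)" unfolding p_def by (simp add: poly_sum poly_monom)
 then have "poly p x = 0" using u(1) sum.reindex[OF inj, of "%v. of_rat (u v) * v"] by simp
 ultimately show ?thesis using that by blast
qed

lemma adjoin_subset: assumes "b : K" shows "adjoin b \<subseteq> K"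
proof
 fix x assume "x : adjoin b"
 then obtain p where "x = poly p b" "p : poly_over \<rat>" unfolding adjoin_def by auto
 then show "x : K" using poly_over_closed(10)[OF sf, of p b] poly_over_mono[of \<rat> K] assms
   Rats_subset_subfield[OF sf] by blast
qed

lemma adjoin_subfield: assumes b: "b : K" shows "subfield (adjoin b)"
proof -
 have "inverse x : adjoin b" if x: "x : adjoin b" "x ~= 0" for x
 proof -
  have "x : K" using x adjoin_subset[OF b] by auto
  then obtain p where "p : poly_over \<rat>" "p ~= 0" "poly p x = 0" by (rule algebraic_over_Rats)
  then show ?thesis using inverse_in_algebra[of "adjoin b"] adjoin_closed x by blast
 qed
 moreover have "0 : adjoin b" "1 : adjoin b" using adjoin_closed(4)[of b] by auto
 ultimately show ?thesis unfolding subfield_def using adjoin_closed by auto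
qed

text \<open>The classical primitive element \<open>c = a + m * b\<close>. The minimal polynomial
  \<open>r\<close> of \<open>b\<close> over the field of \<open>c\<close> takes the place of the
  usual gcd: it divides \<open>pb\<close> and also \<open>pa\<close> composed with
  \<open>c - m X\<close>. These have \<open>b\<close> as their only common root, and
  \<open>b\<close> is a simple root of \<open>pb\<close>, so \<open>r\<close> is linear.\<close>

lemma adjoin_two:
 assumes a: "a : K" and b: "b : K"
 obtains c where "c : K" "a : adjoin c" "b : adjoin c"
proof -
 obtain pa where pa: "pa : poly_over \<rat>" "pa ~= 0" "poly pa a = 0" using algebraic_over_Rats[OF a] .
 obtain pb0 where pb0: "pb0 : poly_over \<rat>" "pb0 ~= 0" "poly pb0 b = 0" using algebraic_over_Rats[OF b] .
 obtain pb where pb: "pb : poly_over \<rat>" "lead_coeff pb = 1" "poly pb b = 0"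
   "!!p. p : poly_over \<rat> ==> poly p b = 0 ==> p ~= 0 ==> degree pb <= degree p"
  using minimal_poly_over[OF subfield_Rats pb0] by metis
 have pbn0: "pb ~= 0" using pb(2) by auto
 have degpb: "degree pb > 0" using pb(2,3) by (metis gr0I monic_degree_0 one_neq_zero poly_1)
 have simple: "poly (pderiv pb) b ~= 0"
 proof
  assume "poly (pderiv pb) b = 0"
  moreover have "pderiv pb ~= 0" using degpb by (simp add: pderiv_eq_0_iff)
  ultimately have "degree pb <= degree (pderiv pb)"
   using pb(1,4) poly_over_closed(9)[OF subfield_Rats] by blast
  then show False using degpb by (simp add: degree_pderiv)
 qed
 \<comment> \<open>The values to avoid are those \<open>m\<close> for which \<open>c - m * v\<close>
   is a root of \<open>pa\<close> for some root \<open>v\<close> of \<open>pb\<close> other than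
   \<open>b\<close>. Pairs with \<open>v = b\<close> only add the value 0, by the convention on
   division.\<close>
 define X where "X = (%(u, v). (u - a) / (b - v)) ` ({z. poly pa z = 0} \<times> {z. poly pb z = 0})"
 have "finite X" unfolding X_def using poly_roots_finite[OF pa(2)] poly_roots_finite[OF pbn0] by auto
 then obtain m :: nat where m: "of_nat m ~: X"
 proof -
  have "infinite (range (of_nat :: nat => complex))" by (rule range_inj_infinite) (simp add: inj_of_nat)
  then have "\<not> range (of_nat :: nat => complex) \<subseteq> X" using \<open>finite X\<close> finite_subset by blast
  then show ?thesis using that by blast
 qed
 define c where "c = a + of_nat m * b"
 have cK: "c : K" unfolding c_def using a b K_closed by auto
 let ?F = "adjoin c"
 have F: "subfield ?F" by (rule adjoin_subfield[OF cK])
 have QF: "poly_over \<rat> \<subseteq> poly_over ?F" using adjoin_closed(4) by (rule poly_over_mono)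
 obtain r where r: "r : poly_over ?F" "lead_coeff r = 1" "poly r b = 0"
   "!!p. p : poly_over ?F ==> poly p b = 0 ==> r dvd p"
  using minimal_poly_over[OF F subsetD[OF QF pb(1)] pbn0 pb(3)] by metis
 have r0: "r ~= 0" using r(2) by auto
 have rpb: "r dvd pb" using r(4) pb QF by auto
 have rpa: "r dvd pcompose pa [:c, - of_nat m:]"
 proof (rule r(4))
  have "[:c, - of_nat m:] : poly_over ?F"
   by (intro poly_over_closed[OF F] subfieldD[OF F] adjoin_closed)
  then show "pcompose pa [:c, - of_nat m:] : poly_over ?F"
   using pa(1) QF by (intro poly_over_pcompose[OF F]) auto
  show "poly (pcompose pa [:c, - of_nat m:]) b = 0"
   using pa(3) by (simp add: poly_pcompose c_def)
 qed
 have root: "v = b" if v: "poly r v = 0" for v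
 proof (rule ccontr)
  assume vb: "v ~= b"
  have "poly pb v = 0" using v rpb by (auto simp: dvd_def)
  moreover have "poly pa (c - of_nat m * v) = 0" 
  proof -
   obtain k where "pcompose pa [:c, - of_nat m:] = r * k" using rpa by auto
   then have "poly (pcompose pa [:c, - of_nat m:]) v = 0" using v by simp
   then show ?thesis by (simp add: poly_pcompose mult.commute)
  qed
  moreover have "of_nat m = ((c - of_nat m * v) - a) / (b - v)"
   using vb by (simp add: c_def field_simps)
  ultimately have "of_nat m : X" unfolding X_def by (intro image_eqI[of _ _ "(c - of_nat m * v, v)"]) auto
  then show False using m by simp
 qed
 have "degree r = 1"
 proof -
  obtain s where s: "r = [:- b, 1:] * s" using r(3) by (metis dvdE poly_eq_0_iff_dvd)
  have "degree s = 0"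
  proof (rule ccontr)
   assume "degree s ~= 0"
   then obtain v where v: "poly s v = 0" using fundamental_theorem_of_algebra_alt[of s] by (metis constant_degree fundamental_theorem_of_algebra)
   then have "v = b" using root s by simp
   then obtain s' where "s = [:- b, 1:] * s'" using v by (metis dvdE poly_eq_0_iff_dvd)
   then obtain t where t: "pb = [:- b, 1:] * ([:- b, 1:] * t)" using rpb s by (metis dvdE mult.assoc)
   have "poly (pderiv pb) b = 0" unfolding t by (simp add: pderiv_mult del: mult_pCons_left mult_pCons_right)
   then show False using simple by simp
  qed
  moreover have "s ~= 0" using s r0 by auto
  ultimately show ?thesis unfolding s by (subst degree_mult_eq) auto
 qed
 have e: "r = [:coeff r 0, 1:]"
 proof (rule poly_eqI)
  fix i
  show "coeff r i = coeff [:coeff r 0, 1:] i"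
   using r(2) \<open>degree r = 1\<close> by (cases i; cases "i - 1") (auto simp: coeff_eq_0)
 qed
 define e where "e = coeff r 0"
 have e: "r = [:e, 1:]" using e unfolding e_def .
 then have "poly [:e, 1:] b = 0" using r(3) by simp
 then have "b = - e" by (simp add: eq_neg_iff_add_eq_0 add.commute)
 moreover have "e : ?F" using poly_overD[OF r(1), of 0] e by simp
 ultimately have bF: "b : ?F" using adjoin_closed(3) by simp
 have "a = c + (- of_nat m) * b" by (simp add: c_def)
 moreover have "- of_nat m : ?F" using subfieldD[OF F] by simp
 ultimately have "a : ?F" using bF adjoin_closed by metis
 then show ?thesis using that cK bF by blast
qed

lemma adjoin_trans: assumes c: "c : K" and "a : adjoin c" shows "adjoin a \<subseteq> adjoin c"
proof
 fix x assume "x : adjoin a"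
 then obtain p where p: "x = poly p a" "p : poly_over \<rat>" unfolding adjoin_def by auto
 show "x : adjoin c" unfolding p(1)
  using poly_over_closed(10)[OF adjoin_subfield[OF c]] poly_over_mono[OF adjoin_closed(4)] p(2) assms(2) by blast
qed

lemma primitive_element: obtains t where "t : K" "K = adjoin t"
proof -
 obtain B where B: "finite B" "\<not> rat.dependent B" "rat.span B = K" "card B = n" by (rule basis_ex)
 have "\<exists>t\<in>K. S \<subseteq> adjoin t" if "finite S" "S \<subseteq> K" for S
  using that
 proof (induction S)
  case empty show ?case using K_closed by auto
 next
  case (insert b S)
  then obtain t where t: "t : K" "S \<subseteq> adjoin t" by auto
  obtain c where c: "c : K" "t : adjoin c" "b : adjoin c" using adjoin_two[of t b] t insert by auto
  then show ?case using adjoin_trans[OF c(1,2)] t by auto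
 qed
 moreover have "B \<subseteq> K" using B(3) rat.span_superset by auto
 ultimately obtain t where t: "t : K" "B \<subseteq> adjoin t" using B(1) by blast
 have "K \<subseteq> adjoin t" unfolding B(3)[symmetric]
  by (rule rat.span_minimal[OF t(2) subfield_rat_subspace[OF adjoin_subfield[OF t(1)]]])
 then show ?thesis using that t adjoin_subset by blast
qed

end

section \<open>Matrices given by index functions and independent families\<close>

lemma prod_if_det: "det (mat n n f) = (\<Sum>q | q permutes {0..<n}. signof q * (\<Prod>i = 0..<n. f (i, q i)))"
 by (subst det_def'[of _ n]) (auto intro!: sum.cong prod.cong simp: permutes_in_image)

lemma square_inverse_comm:
 fixes f g :: "nat => nat => 'a :: field"
 assumes "!!i j. i < n ==> j < n ==> (\<Sum>k<n. f i k * g k j) = (if i = j then 1 else 0)"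
  and "i < n" "j < n"
 shows "(\<Sum>k<n. g i k * f k j) = (if i = j then 1 else 0)"
proof -
 let ?F = "mat n n (%(i, j). f i j)" and ?G = "mat n n (%(i, j). g i j)"
 have "?F * ?G = 1\<^sub>m n"
  by (rule eq_matI) (auto simp: scalar_prod_def assms(1) atLeast0LessThan)
 then have "?G * ?F = 1\<^sub>m n" by (rule mat_mult_left_right_inverse[rotated 2]) simp_all
 then have "(?G * ?F) $$ (i, j) = 1\<^sub>m n $$ (i, j)" by simp
 then show ?thesis using assms(2,3) by (simp add: scalar_prod_def atLeast0LessThan)
qed

lemma det_nonzero_inverse:
 fixes f :: "nat => nat => 'a :: field"
 assumes "!!v. (!!i. i < n ==> (\<Sum>j<n. f i j * v j) = 0) ==> (\<forall>j<n. v j = 0)"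
 shows "\<exists>g. (\<forall>i<n. \<forall>j<n. (\<Sum>k<n. f i k * g k j) = (if i = j then 1 else 0)) \<and>
  (\<forall>i<n. \<forall>j<n. (\<Sum>k<n. g i k * f k j) = (if i = j then 1 else 0))"
proof -
 let ?F = "mat n n (%(i, j). f i j)"
 have F: "?F : carrier_mat n n" by simp
 have "det ?F ~= 0"
 proof
  assume "det ?F = 0"
  then obtain v where v: "v : carrier_vec n" "v ~= 0\<^sub>v n" "?F *\<^sub>v v = 0\<^sub>v n"
   using det_0_iff_vec_prod_zero[OF F] by auto
  have "(\<Sum>j<n. f i j * (v $ j)) = 0" if "i < n" for i
  proof -
   have "(?F *\<^sub>v v) $ i = 0" using v(3) that by simp
   then show ?thesis using that v(1) by (simp add: scalar_prod_def atLeast0LessThan)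
  qed
  then have "\<forall>j<n. v $ j = 0" by (rule assms)
  then have "v = 0\<^sub>v n" using v(1) by (intro eq_vecI) auto
  then show False using v(2) by simp
 qed
 then have "?F : Units (ring_mat TYPE('a) n undefined)" by (rule det_non_zero_imp_unit[OF F])
 then obtain G where G: "G : carrier_mat n n" "?F * G = 1\<^sub>m n"
  unfolding Units_def by (auto simp: ring_mat_simps)
 have *: "(\<Sum>k<n. f i k * G $$ (k, j)) = (if i = j then 1 else 0)" if "i < n" "j < n" for i j
 proof -
  have "(?F * G) $$ (i, j) = 1\<^sub>m n $$ (i, j)" using G by simp
  then show ?thesis using that G(1) by (simp add: scalar_prod_def atLeast0LessThan)
 qed
 show ?thesis
  by (rule exI[of _ "%k j. G $$ (k, j)"]) (use * square_inverse_comm[OF *] in blast)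
qed

lemma independent_family:
 fixes e :: "nat => complex"
 assumes h: "!!c::nat => rat. (\<Sum>i<m. of_rat (c i) * e i) = 0 ==> \<forall>i<m. c i = 0"
 shows "inj_on e {..<m}" "\<not> rat.dependent (e ` {..<m})"
proof -
 show inj: "inj_on e {..<m}"
 proof (rule inj_onI, rule ccontr)
  fix i j assume ij: "i : {..<m}" "j : {..<m}" "e i = e j" "i ~= j"
  let ?c = "%k. if k = i then 1 else if k = j then - 1 else (0::rat)"
  have "(\<Sum>k<m. of_rat (?c k) * e k) = (\<Sum>k\<in>{i, j}. of_rat (?c k) * e k)"
   by (rule sum.mono_neutral_right) (use ij in auto)
  also have "... = 0" using ij by simp
  finally have "?c i = 0" using h[of ?c] ij(1) by blast
  then show False by simp
 qed
 show "\<not> rat.dependent (e ` {..<m})"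
 proof
  assume "rat.dependent (e ` {..<m})"
  then obtain u where u: "(\<Sum>v\<in>e ` {..<m}. of_rat (u v) * v) = 0" "\<exists>v\<in>e ` {..<m}. u v ~= 0"
   using rat.dependent_finite[of "e ` {..<m}"] by auto
  have "(\<Sum>i<m. of_rat (u (e i)) * e i) = 0"
   using u(1) sum.reindex[OF inj, of "%v. of_rat (u v) * v"] by simp
  then have "\<forall>i<m. u (e i) = 0" using h[of "%i. u (e i)"] by blast
  then show False using u(2) by auto
 qed
qed

section \<open>Embeddings, trace and dual bases\<close>

lemma embeddingsD:
 assumes "\<sigma> : embeddings K" "subfield K"
 shows "x : K ==> y : K ==> \<sigma> (x + y) = \<sigma> x + \<sigma> y" "x : K ==> y : K ==> \<sigma> (x * y) = \<sigma> x * \<sigma> y"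
  "\<sigma> 1 = 1" "\<sigma> 0 = 0" "x : K ==> \<sigma> (- x) = - \<sigma> x"
  "x : K ==> y : K ==> \<sigma> (x - y) = \<sigma> x - \<sigma> y" "x : K ==> \<sigma> (x ^ k) = \<sigma> x ^ k"
  "\<sigma> (of_nat m) = of_nat m" "\<sigma> (of_int z) = of_int z" "\<sigma> (of_rat q) = of_rat q"
  "x : K ==> \<sigma> x = 0 \<longleftrightarrow> x = 0" "x ~: K ==> \<sigma> x = 0"
proof -
 note c = subfieldD[OF assms(2)]
 have add: "\<sigma> (x + y) = \<sigma> x + \<sigma> y" and mul: "\<sigma> (x * y) = \<sigma> x * \<sigma> y" if "x : K" "y : K" for x y
  using assms(1) that unfolding embeddings_def by auto
 show one: "\<sigma> 1 = 1" and out: "x ~: K ==> \<sigma> x = 0" using assms(1) unfolding embeddings_def by auto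
 have zero: "\<sigma> 0 = 0" using add[of 0 0] c by simp
 have neg: "\<sigma> (- x) = - \<sigma> x" if "x : K" for x
  using add[of x "- x"] zero that c by (simp add: eq_neg_iff_add_eq_0 add.commute)
 have nat: "\<sigma> (of_nat m) = of_nat m" for m by (induction m) (auto simp: zero add c one)
 have int: "\<sigma> (of_int z) = of_int z" for z
  by (cases z) (auto simp: neg nat c simp del: of_nat_Suc)
 have nz: "\<sigma> x ~= 0" if "x : K" "x ~= 0" for x
  using mul[of x "inverse x"] that c one by auto
 have "\<sigma> (of_rat q) = of_rat q" for q
 proof -
  obtain a b where ab: "q = of_int a / of_int b" "b > 0" by (metis quotient_of_div quotient_of_denom_pos prod.exhaust)
  then have "of_rat q * of_int b = (of_int a :: complex)" by (simp add: of_rat_divide)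
  then have "\<sigma> (of_rat q) * of_int b = of_int a" using mul[of "of_rat q" "of_int b"] c int by metis
  then have "\<sigma> (of_rat q) * of_int b = of_rat q * of_int b"
   using \<open>of_rat q * of_int b = of_int a\<close> by simp
  then show ?thesis using ab(2) by simp
 qed
 then show "\<sigma> (of_rat q) = of_rat q" .
 have pow: "\<sigma> (x ^ k) = \<sigma> x ^ k" if "x : K" for x k using that by (induction k) (auto simp: one mul c)
 show "x : K ==> y : K ==> \<sigma> (x + y) = \<sigma> x + \<sigma> y" "x : K ==> y : K ==> \<sigma> (x * y) = \<sigma> x * \<sigma> y"
  "\<sigma> 0 = 0" "x : K ==> \<sigma> (- x) = - \<sigma> x" "x : K ==> \<sigma> (x ^ k) = \<sigma> x ^ k"
  "\<sigma> (of_nat m) = of_nat m" "\<sigma> (of_int z) = of_int z"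
  "x : K ==> \<sigma> x = 0 \<longleftrightarrow> x = 0"
  using add mul zero neg pow nat int nz[of x] by auto
 show "x : K ==> y : K ==> \<sigma> (x - y) = \<sigma> x - \<sigma> y" using add[of x "- y"] neg c by simp
qed

lemma embeddings_sum:
 "\<sigma> : embeddings K ==> subfield K ==> (!!i. i : I ==> f i : K) ==> \<sigma> (sum f I) = (\<Sum>i\<in>I. \<sigma> (f i))"
 by (induction I rule: infinite_finite_induct) (auto simp: embeddingsD subfield_sum)

lemma embeddings_inj: "\<sigma> : embeddings K ==> subfield K ==> inj_on \<sigma> K"
proof (rule inj_onI)
 fix x y assume h: "\<sigma> : embeddings K" "subfield K" "x : K" "y : K" "\<sigma> x = \<sigma> y"
 have "\<sigma> (x - y) = 0" using embeddingsD(6)[OF h(1-4)] h(5) by simp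
 then show "x = y" using embeddingsD(11)[OF h(1,2), of "x - y"] subfieldD(7)[OF h(2)] h by auto
qed

context numfield
begin

abbreviation E where "E \<equiv> embeddings K"
abbreviation tr where "tr \<equiv> nf_trace K"

lemmas E = embeddingsD[OF _ sf]
lemmas E_sum = embeddings_sum[OF _ sf]

lemma embeddings_poly:
 assumes "\<sigma> : E" "q : poly_over \<rat>" "x : K" shows "\<sigma> (poly q x) = poly q (\<sigma> x)"
proof -
 have c: "coeff q i : \<rat>" for i using assms(2) by (rule poly_overD)
 have "\<sigma> (coeff q i) = coeff q i" for i using c[of i] E(10)[OF assms(1)] by (auto elim: Rats_cases)
 then show ?thesis unfolding poly_altdef
  using c Rats_subset_subfield[OF sf] assms K_closed by (subst E_sum) (auto simp: E)
qed

text \<open>The embeddings correspond to the complex roots of the minimal polynomial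
  \<open>r\<close> of a primitive element. These are simple, so their number is the degree.\<close>

lemma embeddings_param:
 obtains t where "t : K" "K = adjoin t" "\<not> rat.dependent ((%i. t ^ i) ` {..<n})" "inj_on (%i. t ^ i) {..<n}"
  "finite E" "card E = n" "inj_on (%\<sigma>. \<sigma> t) E"
proof -
 obtain t where t: "t : K" "K = adjoin t" by (rule primitive_element)
 obtain q0 where q0: "q0 : poly_over \<rat>" "q0 ~= 0" "poly q0 t = 0" using algebraic_over_Rats[OF t(1)] .
 obtain r where r: "r : poly_over \<rat>" "lead_coeff r = 1" "poly r t = 0"
   "!!p. p : poly_over \<rat> ==> poly p t = 0 ==> r dvd p"
   "!!p. p : poly_over \<rat> ==> poly p t = 0 ==> p ~= 0 ==> degree r <= degree p"
   "!!p q. p : poly_over \<rat> ==> p = r * q ==> q : poly_over \<rat>"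
  using minimal_poly_over[OF subfield_Rats q0] by metis
 note Rc = poly_over_closed[OF subfield_Rats]
 define N where "N = degree r"
 have r0: "r ~= 0" using r(2) by auto
 have N0: "N > 0" unfolding N_def using r(2,3) by (metis gr0I monic_degree_0 one_neq_zero poly_1)
 let ?S = "(%i. t ^ i) ` {..<N}"
 have zero: "\<forall>i<N. c i = 0" if "(\<Sum>i<N. of_rat (c i) * t ^ i) = 0" for c
 proof -
  define p where "p = (\<Sum>i<N. monom (of_rat (c i) :: complex) i)"
  have co: "coeff p j = (if j < N then of_rat (c j) else 0)" for j
   unfolding p_def by (simp add: coeff_sum)
  have "poly p t = 0" using that unfolding p_def by (simp add: poly_sum poly_monom)
  moreover have "p : poly_over \<rat>" by (rule poly_overI) (simp add: co)
  moreover have "degree p < N" using N0 co by (metis degree_0 leading_coeff_0_iff not_le not_less)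
  ultimately have "p = 0" using r(5)[of p] unfolding N_def by force
  then show ?thesis using co by (metis coeff_0 of_rat_eq_0_iff)
 qed
 have inj: "inj_on (%i. t ^ i) {..<N}"
 proof (rule inj_onI, rule ccontr)
  fix i j assume ij: "i : {..<N}" "j : {..<N}" "t ^ i = t ^ j" "i ~= j"
  let ?c = "%k. if k = i then 1 else if k = j then - 1 else (0::rat)"
  have "(\<Sum>k<N. of_rat (?c k) * t ^ k) = (\<Sum>k\<in>{i, j}. of_rat (?c k) * t ^ k)"
   by (rule sum.mono_neutral_right) (use ij in auto)
  also have "... = 0" using ij by simp
  finally have "?c i = 0" using zero[of ?c] ij by auto
  then show False by simp
 qed
 have indep: "\<not> rat.dependent ?S"
 proof
  assume "rat.dependent ?S"
  then obtain u where u: "(\<Sum>v\<in>?S. of_rat (u v) * v) = 0" "\<exists>v\<in>?S. u v ~= 0"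
   using rat.dependent_finite[of ?S] by auto
  have "(\<Sum>i<N. of_rat (u (t ^ i)) * t ^ i) = 0"
   using u(1) sum.reindex[OF inj, of "%v. of_rat (u v) * v"] by simp
  then show False using zero[of "%i. u (t ^ i)"] u(2) by auto
 qed
 have pw: "t ^ k : rat.span ?S" for k
 proof (induction k rule: less_induct)
  case (less k)
  show ?case
  proof (cases "k < N")
   case True then show ?thesis by (intro rat.span_base) auto
  next
   case False
   have "(\<Sum>i\<le>N. coeff r i * t ^ i) = 0" using r(3) by (simp add: poly_altdef N_def)
   then have "t ^ N = - (\<Sum>i<N. coeff r i * t ^ i)"
    using r(2) by (simp add: N_def lessThan_Suc_atMost[symmetric] eq_neg_iff_add_eq_0 add.commute)
   then have "t ^ k = - (\<Sum>i<N. coeff r i * t ^ i) * t ^ (k - N)"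
    using False by (metis le_add_diff_inverse not_less power_add)
   also have "... = (\<Sum>i<N. (- coeff r i) * t ^ (i + (k - N)))"
    by (simp add: sum_distrib_right sum_negf power_add mult.assoc)
   also have "... : rat.span ?S"
   proof (rule rat.span_sum)
    fix i assume i: "i : {..<N}"
    have "- coeff r i : \<rat>" using poly_overD[OF r(1)] by simp
    then obtain c where c: "- coeff r i = of_rat c" by (rule Rats_cases)
    show "- coeff r i * t ^ (i + (k - N)) : rat.span ?S"
     unfolding c by (rule rat.span_scale, rule less) (use i False in auto)
   qed
   finally show ?thesis .
  qed
 qed
 have "K \<subseteq> rat.span ?S"
 proof
  fix x assume "x : K"
  then obtain p where p: "x = poly p t" "p : poly_over \<rat>" using t(2) unfolding adjoin_def by auto
  have "coeff p i * t ^ i : rat.span ?S" for i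
  proof -
   obtain c where "coeff p i = of_rat c" using poly_overD[OF p(2), of i] by (auto elim: Rats_cases)
   then show ?thesis using rat.span_scale[OF pw] by simp
  qed
  then show "x : rat.span ?S" unfolding p(1) poly_altdef by (intro rat.span_sum)
 qed
 moreover have SK: "?S \<subseteq> K" using t K_closed by auto
 then have "rat.span ?S \<subseteq> K" by (rule rat.span_minimal[OF _ subfield_rat_subspace[OF sf]])
 ultimately have "q_basis K ?S" using indep q_basis_iff[OF sf] by auto
 then have Nn: "N = n" unfolding n_def using nf_degree_eq[OF sf] card_image[OF inj] by simp
 define Z where "Z = {z. poly r z = 0}"
 have cardZ: "card Z = N"
 proof -
  \<comment> \<open>The minimal polynomial \<open>s\<close> of a multiple root \<open>z\<close> has
    at most the degree of the derivative of \<open>r\<close>. But \<open>s\<close> or its cofactor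
    in \<open>r\<close> vanishes at \<open>t\<close>, and minimality of \<open>r\<close> at
    \<open>t\<close> forces \<open>s\<close> to have the full degree of \<open>r\<close>.\<close>
  have "rsquarefree r"
   unfolding rsquarefree_roots
  proof (intro allI notI, elim conjE)
   fix z assume z: "poly r z = 0" "poly (pderiv r) z = 0"
   obtain s where s: "s : poly_over \<rat>" "lead_coeff s = 1" "poly s z = 0"
    "!!p. p : poly_over \<rat> ==> poly p z = 0 ==> s dvd p"
    "!!p. p : poly_over \<rat> ==> poly p z = 0 ==> p ~= 0 ==> degree s <= degree p"
    "!!p q. p : poly_over \<rat> ==> p = s * q ==> q : poly_over \<rat>"
    using minimal_poly_over[OF subfield_Rats r(1) r0 z(1)] by metis
   have "s dvd r" using s(4) r(1) z(1) by blast
   then obtain q where q: "r = s * q" by auto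
   have qQ: "q : poly_over \<rat>" using s(6)[OF r(1) q] .
   have q0: "q ~= 0" and s0: "s ~= 0" using q r0 by auto
   have deg: "degree r = degree s + degree q" using q q0 s0 by (simp add: degree_mult_eq)
   have ds: "degree s > 0" using s(2,3) by (metis gr0I monic_degree_0 one_neq_zero poly_1)
   have "poly s t = 0"
   proof (rule ccontr)
    assume "poly s t ~= 0"
    then have "poly q t = 0" using r(3) q by simp
    then have "degree r <= degree q" using r(5) qQ q0 by blast
    then show False using deg ds by simp
   qed
   then have "degree r <= degree s" using r(5) s(1) s0 by blast
   moreover have "pderiv r ~= 0" using N0 N_def by (simp add: pderiv_eq_0_iff)
   then have "degree s <= degree (pderiv r)" using s(5) Rc(9)[OF r(1)] z(2) by blast
   ultimately show False using N0 N_def by (simp add: degree_pderiv)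
  qed
  then show ?thesis using rsquarefree_card_degree[OF r0] by (simp add: Z_def N_def)
 qed
 \<comment> \<open>Evaluation at the root \<open>z\<close>. It does not depend on the chosen
   polynomial because \<open>r\<close> divides the difference of two choices; the value 0 outside
   \<open>K\<close> matches the convention of \<open>embeddings\<close>.\<close>
 define ps where "ps z x = (if x : K then poly (SOME p. p : poly_over \<rat> & poly p t = x) z else 0)" for z x
 have ps: "ps z (poly p t) = poly p z" if p: "p : poly_over \<rat>" and z: "z : Z" for z p
 proof -
  define p' where "p' = (SOME p'. p' : poly_over \<rat> & poly p' t = poly p t)"
  have p': "p' : poly_over \<rat> & poly p' t = poly p t" unfolding p'_def by (rule someI[of _ p]) (use p in simp)
  then have "r dvd p' - p" using r(4)[of "p' - p"] Rc(2) p by auto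
  then have "poly (p' - p) z = 0" using z unfolding Z_def by (auto simp del: poly_diff elim!: dvdE)
  moreover have "poly p t : K" using p t(2) unfolding adjoin_def by auto
  ultimately show ?thesis unfolding ps_def p'_def by simp
 qed
 have psE: "ps z : E" if z: "z : Z" for z
  unfolding embeddings_def
 proof (intro CollectI conjI ballI allI impI)
  fix x y assume xy: "x : K" "y : K"
  obtain p q where pq: "x = poly p t" "p : poly_over \<rat>" "y = poly q t" "q : poly_over \<rat>"
   using xy t(2) unfolding adjoin_def by auto
  show "ps z (x + y) = ps z x + ps z y" "ps z (x * y) = ps z x * ps z y"
   using ps[OF Rc(1)[OF pq(2,4)] z] ps[OF Rc(3)[OF pq(2,4)] z] ps[OF pq(2) z] ps[OF pq(4) z] pq by auto
 next
  show "ps z 1 = 1" using ps[OF Rc(7) z] by simp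
 qed (simp add: ps_def)
 have psid: "\<sigma> t : Z & ps (\<sigma> t) = \<sigma>" if \<sigma>: "\<sigma> : E" for \<sigma>
 proof
  have "poly r (\<sigma> t) = \<sigma> (poly r t)" using embeddings_poly[OF \<sigma> r(1) t(1)] by simp
  then show Z: "\<sigma> t : Z" using r(3) E(4)[OF \<sigma>] unfolding Z_def by simp
  show "ps (\<sigma> t) = \<sigma>"
  proof
   fix x show "ps (\<sigma> t) x = \<sigma> x"
   proof (cases "x : K")
    case True
    then obtain p where p: "x = poly p t" "p : poly_over \<rat>" using t(2) unfolding adjoin_def by auto
    then show ?thesis using ps[OF p(2) Z] embeddings_poly[OF \<sigma> p(2) t(1)] by simp
   next
    case False then show ?thesis using E(12)[OF \<sigma>] by (simp add: ps_def)
   qed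
  qed
 qed
 have pst: "ps z t = z" if "z : Z" for z
 proof -
  have "[:0, 1:] : poly_over \<rat>" by (intro Rc) auto
  then show ?thesis using ps[of "[:0, 1:]" z] that by simp
 qed
 have "bij_betw ps Z E"
  by (rule bij_betw_byWitness[where f' = "%\<sigma>. \<sigma> t"]) (use psE psid pst in auto)
 then have "card E = n" using cardZ Nn by (simp add: bij_betw_same_card)
 moreover have "finite E" using calculation n_pos by (intro card_ge_0_finite) simp
 moreover have "inj_on (%\<sigma>. \<sigma> t) E" by (rule inj_on_inverseI[of _ ps]) (use psid in auto)
 ultimately show ?thesis using that[of t] t indep inj Nn by simp
qed

lemma finite_E: "finite E" and card_E: "card E = n" using embeddings_param by metis+

text \<open>An enumeration of the embeddings, needed to form matrices and determinants of
  conjugates.\<close>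

definition em :: "nat => complex => complex" where "em = (SOME h. bij_betw h {..<n} E)"

lemma em: "bij_betw em {..<n} E"
proof -
 obtain h where "bij_betw h {..<n} E"
  using ex_bij_betw_nat_finite[OF finite_E] card_E by (auto simp: atLeast0LessThan)
 then show ?thesis unfolding em_def by (rule someI[of "%h. bij_betw h {..<n} E"])
qed

lemma em_E: "i < n ==> em i : E" using em unfolding bij_betw_def by auto
lemma em_surj: "\<sigma> : E ==> \<exists>i<n. \<sigma> = em i" using em unfolding bij_betw_def by auto
lemma em_inj: "i < n ==> j < n ==> em i = em j \<longleftrightarrow> i = j"
 using em unfolding bij_betw_def inj_on_def by auto

lemma sum_E: "(\<Sum>\<sigma>\<in>E. f \<sigma>) = (\<Sum>i<n. f (em i))" using sum.reindex_bij_betw[OF em] by metis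
lemma prod_E: "(\<Prod>\<sigma>\<in>E. f \<sigma>) = (\<Prod>i<n. f (em i))" using prod.reindex_bij_betw[OF em] by metis
lemma tr_em: "tr x = (\<Sum>i<n. em i x)" unfolding nf_trace_def by (rule sum_E)

lemma span_powers:
 assumes "\<not> rat.dependent (e ` {..<n})" "inj_on e {..<n}" "e ` {..<n} \<subseteq> K" "x : K"
 shows "\<exists>c :: nat => rat. x = (\<Sum>i<n. of_rat (c i) * e i)"
proof -
 have "rat.span (e ` {..<n}) = K" using indep_span_K[OF assms(1,3)] card_image[OF assms(2)] by simp
 then obtain u where "x = (\<Sum>v\<in>e ` {..<n}. of_rat (u v) * v)"
  using assms(4) rat.span_finite[of "e ` {..<n}"] by auto
 then have "x = (\<Sum>i<n. of_rat (u (e i)) * e i)" using sum.reindex[OF assms(2)] by simp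
 then show ?thesis by (rule exI[of _ "%i. u (e i)"])
qed

text \<open>The left regular representation: \<open>B\<close> is the matrix of multiplication by \<open>x\<close>, and \<open>S\<close>
 diagonalises all these matrices simultaneously.\<close>
lemma regular_representation:
 obtains e :: "nat => complex" and R :: "nat => nat => complex" where
  "\<forall>i<n. e i : K"
  "\<forall>i<n. \<forall>j<n. (\<Sum>k<n. em i (e k) * R k j) = (if i = j then 1 else 0)"
  "\<forall>i<n. \<forall>j<n. (\<Sum>k<n. R i k * em k (e j)) = (if i = j then 1 else 0)"
  "\<forall>x\<in>K. \<exists>c :: nat => rat. x = (\<Sum>i<n. of_rat (c i) * e i)"
  "\<forall>x\<in>K. \<exists>B :: nat => nat => rat. \<forall>j<n. x * e j = (\<Sum>i<n. of_rat (B i j) * e i)"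
proof -
 obtain t where t: "t : K" "\<not> rat.dependent ((%i. t ^ i) ` {..<n})" "inj_on (%i. t ^ i) {..<n}"
  "inj_on (%\<sigma>. \<sigma> t) E" using embeddings_param by metis
 define e where "e i = t ^ i" for i
 have eK: "e i : K" for i using t K_closed unfolding e_def by auto
 \<comment> \<open>Vandermonde: a kernel vector would be a polynomial of degree below
   \<open>n\<close> vanishing at the \<open>n\<close> distinct conjugates of
   \<open>t\<close>.\<close>
 have nd: "\<forall>j<n. v j = 0" if v: "!!i. i < n ==> (\<Sum>j<n. em i (e j) * v j) = 0" for v
 proof -
  define p where "p = (\<Sum>j<n. monom (v j) j)"
  have co: "coeff p j = (if j < n then v j else 0)" for j unfolding p_def by (simp add: coeff_sum)
  have deg: "degree p < n" if "p ~= 0" using that co by (metis leading_coeff_0_iff)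
  have root: "poly p (em i t) = 0" if "i < n" for i
   using v[OF that] E(7)[OF em_E[OF that] t(1)] unfolding p_def e_def by (simp add: poly_sum poly_monom mult.commute)
  have "p = 0"
  proof (rule ccontr)
   assume p0: "p ~= 0"
   have "(%\<sigma>. \<sigma> t) ` E \<subseteq> {z. poly p z = 0}" using root em_surj by auto
   then have "card ((%\<sigma>. \<sigma> t) ` E) <= card {z. poly p z = 0}"
    by (intro card_mono poly_roots_finite p0)
   also have "... <= degree p" by (rule poly_roots_degree[OF p0])
   finally show False using deg[OF p0] card_image[OF t(4)] card_E by simp
  qed
  then show ?thesis using co by (metis coeff_0)
 qed
 obtain R where R: "\<forall>i<n. \<forall>j<n. (\<Sum>k<n. em i (e k) * R k j) = (if i = j then 1 else 0)"
  "\<forall>i<n. \<forall>j<n. (\<Sum>k<n. R i k * em k (e j)) = (if i = j then 1 else 0)"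
  using det_nonzero_inverse[of n "%i k. em i (e k)", OF nd] by blast
 have sp: "\<exists>c :: nat => rat. x = (\<Sum>i<n. of_rat (c i) * e i)" if "x : K" for x
 proof -
  have "e = (%i. t ^ i)" by (simp add: e_def fun_eq_iff)
  then have "\<not> rat.dependent (e ` {..<n})" "inj_on e {..<n}" using t(2,3) by simp_all
  moreover have "e ` {..<n} \<subseteq> K" using eK by auto
  ultimately show ?thesis by (rule span_powers[OF _ _ _ that])
 qed
 have mult: "\<exists>B :: nat => nat => rat. \<forall>j<n. x * e j = (\<Sum>i<n. of_rat (B i j) * e i)" if x: "x : K" for x
 proof -
  have "x * e j : K" for j by (rule K_closed(4)[OF x eK])
  then have "\<forall>j. \<exists>c :: nat => rat. x * e j = (\<Sum>i<n. of_rat (c i) * e i)" using sp by simp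
  then obtain c :: "nat => nat => rat" where "\<forall>j. x * e j = (\<Sum>i<n. of_rat (c j i) * e i)"
   using choice[of "%j c. x * e j = (\<Sum>i<n. of_rat (c i) * e i)"] by auto
  then show ?thesis by (intro exI[of _ "%i j. c j i"]) auto
 qed
 show ?thesis by (rule that[OF _ R]) (use eK sp mult in auto)
qed

text \<open>Multiplication by \<open>x\<close> has a rational matrix. The matrix of conjugates of
  the basis diagonalises it with the conjugates of \<open>x\<close> on the diagonal, so the sum over
  the embeddings is the trace of a rational matrix.\<close>

lemma tr_Rats: assumes x: "x : K" shows "tr x : \<rat>"
proof -
 obtain e R where e: "\<forall>i<n. e i : K"
  and R: "\<forall>i<n. \<forall>j<n. (\<Sum>k<n. em i (e k) * R k j) = (if i = j then 1 else 0)"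
  "\<forall>i<n. \<forall>j<n. (\<Sum>k<n. R i k * em k (e j)) = (if i = j then 1 else 0)"
  and "\<forall>x\<in>K. \<exists>c :: nat => rat. x = (\<Sum>i<n. of_rat (c i) * e i)"
  and B: "\<forall>x\<in>K. \<exists>B :: nat => nat => rat. \<forall>j<n. x * e j = (\<Sum>i<n. of_rat (B i j) * e i)"
  by (rule regular_representation)
 obtain b :: "nat => nat => rat" where b: "!!j. j < n ==> x * e j = (\<Sum>i<n. of_rat (b i j) * e i)"
  using B x by blast
 have m: "em k x * em k (e j) = (\<Sum>i<n. of_rat (b i j) * em k (e i))" if "k < n" "j < n" for k j
 proof -
  have "em k x * em k (e j) = em k (x * e j)" using E(2)[OF em_E] that x e by simp
  also have "... = (\<Sum>i<n. of_rat (b i j) * em k (e i))"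
   unfolding b[OF that(2)] using em_E[OF that(1)] e K_closed by (subst E_sum) (auto simp: E)
  finally show ?thesis .
 qed
 have "tr x = (\<Sum>k<n. em k x * (\<Sum>j<n. em k (e j) * R j k))" unfolding tr_em using R(1) by simp
 also have "... = (\<Sum>k<n. \<Sum>j<n. (em k x * em k (e j)) * R j k)"
  by (simp add: sum_distrib_left mult.assoc)
 also have "... = (\<Sum>k<n. \<Sum>j<n. \<Sum>i<n. of_rat (b i j) * (R j k * em k (e i)))"
  by (simp add: m sum_distrib_left sum_distrib_right ac_simps)
 also have "... = (\<Sum>j<n. \<Sum>i<n. \<Sum>k<n. of_rat (b i j) * (R j k * em k (e i)))"
  by (subst sum.swap, rule sum.cong[OF refl], subst sum.swap, simp)
 also have "... = (\<Sum>j<n. \<Sum>i<n. of_rat (b i j) * (if j = i then 1 else 0))"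
  by (simp add: sum_distrib_left[symmetric] R(2))
 also have "... = (\<Sum>j<n. \<Sum>i<n. if j = i then of_rat (b i j) else 0)" by (intro sum.cong) auto
 also have "... = of_rat (\<Sum>j<n. b j j)"
  by (simp add: of_rat_sum)
 finally show ?thesis by simp
qed

lemma tr_add: "x : K ==> y : K ==> tr (x + y) = tr x + tr y"
 unfolding nf_trace_def by (simp add: E sum.distrib)

lemma tr_diff: "x : K ==> y : K ==> tr (x - y) = tr x - tr y"
 unfolding nf_trace_def by (simp add: E sum_subtractf)

lemma tr_0 [simp]: "tr 0 = 0" unfolding nf_trace_def by (simp add: E)

lemma tr_scale: "c : \<rat> ==> x : K ==> tr (c * x) = c * tr x"
proof -
 assume "c : \<rat>" "x : K"
 moreover from this obtain q where "c = of_rat q" by (auto elim: Rats_cases)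
 ultimately show ?thesis unfolding nf_trace_def by (simp add: E K_closed sum_distrib_left)
qed

lemma tr_sum: "(!!i. i : I ==> f i : K) ==> tr (sum f I) = (\<Sum>i\<in>I. tr (f i))"
 by (induction I rule: infinite_finite_induct) (auto simp: tr_add K_sum)

lemma tr_1: "tr 1 = of_nat n" unfolding nf_trace_def by (simp add: E card_E)

lemma tr_of_Rats: "c : \<rat> ==> tr c = c * of_nat n" using tr_scale[of c 1] tr_1 K_closed by simp

lemma tr_nondegenerate: assumes "x : K" "!!y. y : K ==> tr (x * y) = 0" shows "x = 0"
proof (rule ccontr)
 assume "x ~= 0"
 then have "tr (x * inverse x) = of_nat n" using tr_1 by simp
 then show False using assms K_closed n_pos by simp
qed

definition dual :: "(nat => complex) => (nat => complex) => bool" where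
 "dual e e' \<longleftrightarrow> (\<forall>i<n. e i : K & e' i : K) & (\<forall>i<n. \<forall>j<n. tr (e i * e' j) = (if i = j then 1 else 0))"

lemma dual_sym: "dual e e' ==> dual e' e" unfolding dual_def by (auto simp: mult.commute)

text \<open>Duality says that the matrices of conjugates of \<open>e\<close> and \<open>e'\<close>
  are inverse up to transposition. Multiplied in the other order they give a relation that separates
  embeddings, the form in which dual bases are used later.\<close>

lemma dual_sum_em:
 assumes "dual e e'" "k < n" "l < n"
 shows "(\<Sum>i<n. em k (e i) * em l (e' i)) = (if k = l then 1 else 0)"
proof -
 have "(\<Sum>k<n. em k (e i) * em k (e' j)) = (if i = j then 1 else 0)" if "i < n" "j < n" for i j
 proof -
  have "(\<Sum>k<n. em k (e i) * em k (e' j)) = tr (e i * e' j)"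
   unfolding tr_em using assms(1) that unfolding dual_def by (intro sum.cong) (auto simp: E em_E)
  then show ?thesis using assms(1) that unfolding dual_def by simp
 qed
 from square_inverse_comm[of n "%i k. em k (e i)" "%k j. em k (e' j)", OF this assms(3,2)]
 show ?thesis by (simp add: mult.commute eq_commute)
qed

lemma dual_sum:
 assumes "dual e e'" "\<sigma> : E" "\<sigma>' : E"
 shows "(\<Sum>i<n. \<sigma> (e i) * \<sigma>' (e' i)) = (if \<sigma> = \<sigma>' then 1 else 0)"
 using dual_sum_em[OF assms(1)] em_surj[OF assms(2)] em_surj[OF assms(3)] em_inj by auto

lemma id_in_E: "(%x. if x : K then x else 0) : E"
 unfolding embeddings_def using K_closed by auto

text \<open>The identity is itself an embedding, so the relation separating embeddings recovers
  \<open>x\<close> from its traces against the dual basis.\<close>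

lemma dual_expand:
 assumes d: "dual e e'" and x: "x : K"
 shows "x = (\<Sum>i<n. tr (x * e' i) * e i)"
proof -
 let ?\<sigma> = "%x. if x : K then x else 0"
 have e: "e i : K" "e' i : K" if "i < n" for i using d that unfolding dual_def by auto
 have "(\<Sum>i<n. tr (x * e' i) * e i) = (\<Sum>i<n. (\<Sum>\<tau>\<in>E. \<tau> x * \<tau> (e' i)) * ?\<sigma> (e i))"
  unfolding nf_trace_def using e x by (intro sum.cong) (auto simp: E intro!: sum.cong)
 also have "... = (\<Sum>i<n. \<Sum>\<tau>\<in>E. \<tau> x * (?\<sigma> (e i) * \<tau> (e' i)))"
  by (intro sum.cong refl) (simp only: sum_distrib_right, simp only: ac_simps)
 also have "... = (\<Sum>\<tau>\<in>E. \<tau> x * (\<Sum>i<n. ?\<sigma> (e i) * \<tau> (e' i)))"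
  by (subst sum.swap) (simp only: sum_distrib_left)
 also have "... = (\<Sum>\<tau>\<in>E. \<tau> x * (if ?\<sigma> = \<tau> then 1 else 0))"
  using dual_sum[OF d id_in_E] by (intro sum.cong refl) simp
 also have "... = (\<Sum>\<tau>\<in>E. if ?\<sigma> = \<tau> then \<tau> x else 0)" by (intro sum.cong) auto
 also have "... = ?\<sigma> x" using finite_E id_in_E by (simp add: sum.delta' eq_commute[of ?\<sigma>])
 also have "... = x" using x by simp
 finally show ?thesis by simp
qed

definition indep :: "(nat => complex) => bool" where
 "indep e \<longleftrightarrow> (\<forall>i<n. e i : K) \<and>
  (\<forall>c::nat => rat. (\<Sum>i<n. of_rat (c i) * e i) = 0 --> (\<forall>i<n. c i = 0))"

lemma indepD: "indep e ==> (\<Sum>i<n. of_rat (c i) * e i) = 0 ==> i < n ==> c i = 0"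
 unfolding indep_def by blast

lemma indep_inj: "indep e ==> inj_on e {..<n}"
 and indep_independent: "indep e ==> \<not> rat.dependent (e ` {..<n})"
 by (auto simp: indep_def intro!: independent_family)

lemma indep_span: assumes "indep e" "x : K"
 shows "\<exists>c :: nat => rat. x = (\<Sum>i<n. of_rat (c i) * e i)"
 by (rule span_powers[OF indep_independent[OF assms(1)] indep_inj[OF assms(1)] _ assms(2)])
   (use assms(1) in \<open>auto simp: indep_def\<close>)

text \<open>The Gram matrix is rational and, as the trace form is nondegenerate, invertible; its
  inverse yields the dual basis.\<close>

lemma indep_dual_ex: assumes e: "indep e" obtains e' where "dual e e'"
proof -
 have eK: "e i : K" if "i < n" for i using e that unfolding indep_def by auto
 have "\<forall>i j. \<exists>q. i < n --> j < n --> tr (e i * e j) = of_rat q"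
  using tr_Rats eK K_closed by (metis Rats_cases)
 then obtain g where g: "!!i j. i < n ==> j < n ==> tr (e i * e j) = of_rat (g i j)" by metis
 have nd: "\<forall>j<n. v j = 0" if v: "!!i. i < n ==> (\<Sum>j<n. g i j * v j) = 0" for v
 proof -
  define x where "x = (\<Sum>j<n. of_rat (v j) * e j)"
  have xK: "x : K" unfolding x_def using eK K_closed by (intro K_sum) auto
  have "tr (x * e i) = 0" if i: "i < n" for i
  proof -
   have "tr (x * e i) = (\<Sum>j<n. tr (of_rat (v j) * (e i * e j)))"
    unfolding x_def sum_distrib_right using eK i K_closed
    by (subst tr_sum) (auto simp: ac_simps)
   also have "... = (\<Sum>j<n. of_rat (v j) * of_rat (g i j))"
    using eK i K_closed g by (intro sum.cong) (auto simp: tr_scale)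
   also have "... = of_rat (\<Sum>j<n. g i j * v j)" by (simp add: of_rat_sum of_rat_mult mult.commute)
   also have "... = 0" using v[OF i] by simp
   finally show ?thesis .
  qed
  then have "tr (x * y) = 0" if yK: "y : K" for y
  proof -
   obtain c :: "nat => rat" where c: "y = (\<Sum>i<n. of_rat (c i) * e i)" using indep_span[OF e yK] by blast
   have "tr (x * y) = (\<Sum>i<n. tr (of_rat (c i) * (x * e i)))"
    unfolding c sum_distrib_left using xK eK K_closed by (subst tr_sum) (auto simp: ac_simps)
   also have "... = 0" using \<open>!!i. i < n ==> tr (x * e i) = 0\<close> xK eK K_closed
    by (intro sum.neutral) (auto simp: tr_scale)
   finally show ?thesis .
  qed
  then have "x = 0" using tr_nondegenerate xK by blast
  then show ?thesis using indepD[OF e, of v] unfolding x_def by blast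
 qed
 obtain h where h: "\<forall>i<n. \<forall>j<n. (\<Sum>k<n. g i k * h k j) = (if i = j then 1 else 0)"
  using det_nonzero_inverse[of n g, OF nd] by blast
 define e' where "e' j = (\<Sum>k<n. of_rat (h k j) * e k)" for j
 have e'K: "e' j : K" for j unfolding e'_def using eK K_closed by (intro K_sum) auto
 have "tr (e i * e' j) = (if i = j then 1 else 0)" if ij: "i < n" "j < n" for i j
 proof -
  have "tr (e i * e' j) = (\<Sum>k<n. tr (of_rat (h k j) * (e i * e k)))"
   unfolding e'_def sum_distrib_left using ij eK K_closed by (subst tr_sum) (auto simp: ac_simps)
  also have "... = (\<Sum>k<n. of_rat (h k j) * of_rat (g i k))"
   using eK ij K_closed g by (intro sum.cong) (auto simp: tr_scale)
  also have "... = of_rat (\<Sum>k<n. g i k * h k j)" by (simp add: of_rat_sum of_rat_mult mult.commute)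
  finally show ?thesis using h ij by simp
 qed
 then have "dual e e'" unfolding dual_def using eK e'K by auto
 then show ?thesis by (rule that)
qed

lemma dual_indep: assumes "dual e e'" shows "indep e"
 unfolding indep_def
proof (intro conjI allI impI)
 have e: "e i : K" "e' i : K" if "i < n" for i using assms that unfolding dual_def by auto
 show "e i : K" if "i < n" for i using e that by simp
 fix c :: "nat => rat" and i assume z: "(\<Sum>i<n. of_rat (c i) * e i) = 0" and i: "i < n"
 have "0 = tr ((\<Sum>j<n. of_rat (c j) * e j) * e' i)" using z by simp
 also have "... = (\<Sum>j<n. tr (of_rat (c j) * (e j * e' i)))"
  unfolding sum_distrib_right using e i K_closed by (subst tr_sum) (auto simp: ac_simps)
 also have "... = (\<Sum>j<n. of_rat (c j) * (if j = i then 1 else 0))"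
  using assms i e K_closed unfolding dual_def by (intro sum.cong) (auto simp: tr_scale)
 also have "... = (\<Sum>j<n. if j = i then of_rat (c j) else 0)" by (intro sum.cong) auto
 also have "... = of_rat (c i)" using i by simp
 finally show "c i = 0" by simp
qed

end

section \<open>Determinants under base change\<close>

text \<open>The determinant of the base change which replaces the \<open>k\<close>-th basis vector
  by the vector with coordinates \<open>v\<close>, an instance of Cramer's rule.\<close>

lemma det_replace_column:
 fixes v :: "nat => 'a :: comm_ring_1"
 assumes "k < n"
 shows "det (mat n n (%(i, j). if j = k then v i else if i = j then 1 else 0)) = v k"
proof -
 have "mat n n (%(i, j). if j = k then v i else if i = j then 1 else 0) =
   replace_col (1\<^sub>m n) (1\<^sub>m n *\<^sub>v vec n v) k"
  by (rule eq_matI) (auto simp: replace_col_def)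
 also have "det ... = vec n v $ k * det (1\<^sub>m n)" by (rule cramer_lemma_mat) (use assms in auto)
 finally show ?thesis using assms by simp
qed

lemma det_congruence:
 fixes c g :: "nat => nat => 'a :: comm_ring_1"
 shows "det (mat n n (%(i, j). \<Sum>k<n. \<Sum>l<n. c k i * g k l * c l j)) =
  (det (mat n n (%(i, j). c i j)))\<^sup>2 * det (mat n n (%(i, j). g i j))"
proof -
 let ?C = "mat n n (%(i, j). c i j)" and ?G = "mat n n (%(i, j). g i j)"
 have "mat n n (%(i, j). \<Sum>k<n. \<Sum>l<n. c k i * g k l * c l j) = transpose_mat ?C * (?G * ?C)"
  by (rule eq_matI)
    (auto simp: scalar_prod_def atLeast0LessThan sum_distrib_left mult.assoc)
 also have "det ... = det ?C * (det ?G * det ?C)"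
  using det_mult[of "transpose_mat ?C" n "?G * ?C"] det_mult[of ?G n ?C] det_transpose[of ?C n]
   mult_carrier_mat[of ?G n n ?C n] by simp
 finally show ?thesis by (simp add: power2_eq_square ac_simps)
qed

lemma det_mat_prod:
 fixes f g :: "nat => nat => 'a :: comm_ring_1"
 shows "det (mat n n (%(i, j). \<Sum>k<n. f i k * g k j)) =
  det (mat n n (%(i, j). f i j)) * det (mat n n (%(i, j). g i j))"
proof -
 have "mat n n (%(i, j). \<Sum>k<n. f i k * g k j) = mat n n (%(i, j). f i j) * mat n n (%(i, j). g i j)"
  by (rule eq_matI) (auto simp: scalar_prod_def atLeast0LessThan)
 then show ?thesis by (simp add: det_mult[of _ n])
qed

lemma det_hom:
 fixes h :: "'a :: comm_ring_1 => 'b :: comm_ring_1"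
 assumes "comm_ring_hom h"
 shows "det (mat n n (%(i, j). h (f i j))) = h (det (mat n n (%(i, j). f i j)))"
proof -
 interpret comm_ring_hom h by fact
 have "mat n n (%(i, j). h (f i j)) = map_mat h (mat n n (%(i, j). f i j))"
  by (rule eq_matI) auto
 then show ?thesis by (simp add: hom_det)
qed

lemma det_of_int: "det (mat n n (%(i, j). of_int (f i j) :: 'b :: comm_ring_1)) = of_int (det (mat n n (%(i, j). f i j)))"
 by (rule det_hom) unfold_locales

section \<open>Rings of integers, discriminants and integral bases\<close>

context numfield
begin

abbreviation OK where "OK \<equiv> ring_of_integers K"

lemma O_iff: "x : OK \<longleftrightarrow> x : K & algebraic_int x"
 unfolding ring_of_integers_def algebraic_int_altdef_ipoly by auto

lemma O_K: "x : OK ==> x : K" by (simp add: O_iff)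

lemma O_closed:
 "0 : OK" "1 : OK" "x : OK ==> y : OK ==> x + y : OK" "x : OK ==> y : OK ==> x * y : OK"
 "x : OK ==> - x : OK" "x : OK ==> y : OK ==> x - y : OK" "of_int k : OK" "of_nat m : OK"
 "x : OK ==> x ^ m : OK"
 by (auto simp: O_iff K_closed algebraic_int_add_mult algebraic_int_diff algebraic_int_power)

lemma O_sum: "(!!i. i : I ==> f i : OK) ==> sum f I : OK"
 by (induction I rule: infinite_finite_induct) (auto intro: O_closed)

lemma emb_algebraic_int: assumes "\<sigma> : E" "x : OK" shows "algebraic_int (\<sigma> x)"
proof -
 have x: "x : K" and "algebraic_int x" using assms by (auto simp: O_iff)
 then obtain q :: "int poly" where q: "poly (map_poly of_int q) x = 0" "lead_coeff q = 1"
  unfolding algebraic_int_altdef_ipoly by auto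
 have "map_poly of_int q : poly_over \<rat>" by (intro poly_overI) (simp add: coeff_map_poly)
 from embeddings_poly[OF assms(1) this x] have "poly (map_poly of_int q) (\<sigma> x) = 0"
  using q(1) E(4)[OF assms(1)] by simp
 then show ?thesis unfolding algebraic_int_altdef_ipoly using q(2) by auto
qed

lemma tr_Ints: assumes "x : OK" shows "tr x : \<int>"
proof (rule rational_algebraic_int_is_int)
 show "algebraic_int (tr x)" unfolding nf_trace_def by (intro algebraic_int_sum emb_algebraic_int assms)
 show "tr x : \<rat>" using tr_Rats assms by (simp add: O_iff)
qed

lemma tr_int: assumes "x : OK" obtains k where "tr x = of_int k"
 using tr_Ints[OF assms] by (auto elim: Ints_cases)

text \<open>The leading coefficient of an integral equation times \<open>x\<close> is a root of the
  monic polynomial \<open>s\<close> obtained by scaling that equation.\<close>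

lemma O_multiple: assumes x: "x : K" obtains m :: int where "m > 0" "of_int m * x : OK"
proof -
 obtain q where q: "q : poly_over \<rat>" "q ~= 0" "poly q x = 0" using algebraic_over_Rats[OF x] .
 then have "algebraic x" unfolding algebraic_altdef poly_over_def by auto
 then obtain r where r: "!!i. coeff r i : \<int>" "r ~= 0" "poly r x = 0" using algebraicE by metis
 define d where "d = degree r"
 have "\<forall>i. \<exists>k. coeff r i = of_int k" using r(1) by (auto elim: Ints_cases)
 then obtain c where c: "!!i. coeff r i = of_int (c i)" by metis
 have cd: "c d ~= 0" using r(2) c[of d] unfolding d_def by auto
 have d0: "d > 0"
 proof (rule ccontr)
  assume "\<not> d > 0"
  then have "poly r x = coeff r 0" unfolding d_def by (simp add: poly_altdef)
  then show False using r(3) c[of 0] cd \<open>\<not> d > 0\<close> by simp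
 qed
 define z where "z = of_int (c d) * x"
 define s :: "complex poly" where "s = monom 1 d + (\<Sum>i<d. monom (of_int (c i * c d ^ (d - 1 - i))) i)"
 have s_co: "coeff s i = (if i = d then 1 else if i < d then of_int (c i * c d ^ (d - 1 - i)) else 0)" for i
  unfolding s_def by (simp add: coeff_sum)
 have deg_s: "degree s = d"
  by (rule antisym[OF degree_le le_degree]) (auto simp: s_co)
 have "poly s z = z ^ d + (\<Sum>i<d. of_int (c i * c d ^ (d - 1 - i)) * z ^ i)"
  unfolding s_def by (simp add: poly_sum poly_monom)
 also have "... = of_int (c d) ^ (d - 1) * (of_int (c d) * x ^ d + (\<Sum>i<d. of_int (c i) * x ^ i))"
 proof -
  have "z ^ d = of_int (c d) ^ (d - 1) * (of_int (c d) * x ^ d)"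
   using d0 unfolding z_def by (cases d) (auto simp: power_mult_distrib)
  moreover have "of_int (c i * c d ^ (d - 1 - i)) * z ^ i = of_int (c d) ^ (d - 1) * (of_int (c i) * x ^ i)"
   if "i < d" for i
  proof -
   have "(of_int (c d) :: complex) ^ (d - 1) = of_int (c d) ^ (d - 1 - i) * of_int (c d) ^ i"
    using that by (simp flip: power_add)
   then show ?thesis unfolding z_def by (simp add: power_mult_distrib)
  qed
  ultimately show ?thesis by (simp only: distrib_left sum_distrib_left) (intro arg_cong2[of _ _ _ _ "(+)"] sum.cong, auto)
 qed
 also have "of_int (c d) * x ^ d + (\<Sum>i<d. of_int (c i) * x ^ i) = poly r x"
  by (simp add: poly_altdef c d_def lessThan_Suc_atMost[symmetric] add.commute)
 finally have "poly s z = 0" using r(3) by simp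
 moreover have "!!i. coeff s i : \<int>" by (simp add: s_co)
 moreover have "lead_coeff s = 1" using s_co deg_s by simp
 ultimately have "algebraic_int z" by (intro algebraic_int.intros[of s]) auto
 then have zO: "z : OK" unfolding O_iff z_def using x K_closed by auto
 show ?thesis
 proof (cases "c d > 0")
  case True then show ?thesis using that[of "c d"] zO unfolding z_def by simp
 next
  case False
  then show ?thesis using that[of "- c d"] O_closed(5)[OF zO] cd unfolding z_def by simp
 qed
qed

definition zbasis :: "(nat => complex) => bool" where
 "zbasis b \<longleftrightarrow> (\<forall>i<n. b i : OK) & indep b & (\<forall>x\<in>OK. \<exists>c::nat => int. x = (\<Sum>i<n. of_int (c i) * b i))"

definition disc :: "(nat => complex) => complex" where
 "disc b = det (mat n n (%(i, j). tr (b i * b j)))"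

lemma disc_transform:
 assumes b: "!!i. i < n ==> b i : K" and c: "!!i j. i < n ==> j < n ==> c i j : \<rat>"
  and b': "!!j. j < n ==> b' j = (\<Sum>i<n. c i j * b i)"
 shows "disc b' = (det (mat n n (%(i, j). c i j)))\<^sup>2 * disc b"
proof -
 have "tr (b' i * b' j) = (\<Sum>k<n. \<Sum>l<n. c k i * tr (b k * b l) * c l j)" if ij: "i < n" "j < n" for i j
 proof -
  have "tr (b' i * b' j) = tr (\<Sum>k<n. \<Sum>l<n. (c k i * c l j) * (b k * b l))"
   using ij by (simp add: b' sum_product ac_simps)
  also have "... = (\<Sum>k<n. tr (\<Sum>l<n. (c k i * c l j) * (b k * b l)))"
   using b c ij Rats_subset_subfield[OF sf] K_closed by (intro tr_sum K_sum) auto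
  also have "... = (\<Sum>k<n. \<Sum>l<n. tr ((c k i * c l j) * (b k * b l)))"
   using b c ij Rats_subset_subfield[OF sf] K_closed by (intro sum.cong refl tr_sum) auto
  also have "... = (\<Sum>k<n. \<Sum>l<n. c k i * tr (b k * b l) * c l j)"
  proof (intro sum.cong refl)
   fix k l assume "k : {..<n}" "l : {..<n}"
   then have "tr (c k i * c l j * (b k * b l)) = c k i * c l j * tr (b k * b l)"
    using b c ij K_closed by (intro tr_scale) auto
   then show "tr (c k i * c l j * (b k * b l)) = c k i * tr (b k * b l) * c l j" by (simp add: ac_simps)
  qed
  finally show ?thesis .
 qed
 then have "disc b' = det (mat n n (%(i, j). \<Sum>k<n. \<Sum>l<n. c k i * tr (b k * b l) * c l j))"
  unfolding disc_def by (intro arg_cong[of _ _ det] eq_matI) auto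
 also have "... = (det (mat n n (%(i, j). c i j)))\<^sup>2 * det (mat n n (%(i, j). tr (b i * b j)))"
  by (rule det_congruence)
 finally show ?thesis unfolding disc_def .
qed

lemma gram_int:
 assumes "!!i. i < n ==> b i : OK"
 shows "\<exists>g :: nat => nat => int. (\<forall>i<n. \<forall>j<n. tr (b i * b j) = of_int (g i j)) \<and>
  (\<forall>i j. g i j = g j i) & disc b = of_int (det (mat n n (%(i, j). g i j)))"
proof -
 have "\<forall>i j. \<exists>k. i < n --> j < n --> tr (b i * b j) = of_int k"
  using assms tr_Ints O_closed by (metis Ints_cases)
 then obtain g where g: "!!i j. i < n ==> j < n ==> tr (b i * b j) = of_int (g i j)" by metis
 \<comment> \<open>The choice of \<open>g\<close> is free outside the range, so it is symmetrised to
   obtain a matrix symmetric at all indices.\<close>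
 define g' where "g' i j = (if i <= j then g i j else g j i)" for i j
 have g': "tr (b i * b j) = of_int (g' i j)" if "i < n" "j < n" for i j
  using g[OF that] g[OF that(2,1)] unfolding g'_def by (simp add: mult.commute)
 have "disc b = of_int (det (mat n n (%(i, j). g' i j)))"
  unfolding disc_def det_of_int[symmetric] by (intro arg_cong[of _ _ det] eq_matI) (auto simp: g')
 moreover have "g' i j = g' j i" for i j unfolding g'_def by auto
 ultimately show ?thesis using g' by (intro exI[of _ g']) auto
qed

lemma disc_int: assumes "!!i. i < n ==> b i : OK" shows "\<exists>d::int. disc b = of_int d"
 using gram_int[of b] assms by auto

lemma disc_emb:
 assumes "!!i. i < n ==> b i : K"
 shows "disc b = (det (mat n n (%(k, i). em k (b i))))\<^sup>2"
proof -
 have "disc b = det (mat n n (%(i, j). \<Sum>k<n. (em k (b i)) * em k (b j)))"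
  unfolding disc_def tr_em using assms by (intro arg_cong[of _ _ det] eq_matI) (auto simp: E em_E intro!: sum.cong)
 also have "... = det (mat n n (%(i, k). em k (b i))) * det (mat n n (%(k, j). em k (b j)))"
  by (rule det_mat_prod)
 also have "mat n n (%(i, k). em k (b i)) = transpose_mat (mat n n (%(k, i). em k (b i)))"
  by (rule eq_matI) auto
 also have "det ... = det (mat n n (%(k, i). em k (b i)))" by (rule det_transpose[of _ n]) simp
 finally show ?thesis by (simp add: power2_eq_square)
qed

lemma disc_nonzero: assumes "indep b" shows "disc b ~= 0"
proof
 assume z: "disc b = 0"
 have bK: "!!i. i < n ==> b i : K" using assms unfolding indep_def by auto
 obtain b' where d: "dual b b'" using indep_dual_ex[OF assms] .
 let ?S = "mat n n (%(k, i). em k (b i))" and ?T = "mat n n (%(i, l). em l (b' i))"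
 have "?S * ?T = 1\<^sub>m n"
  by (rule eq_matI) (auto simp: scalar_prod_def atLeast0LessThan dual_sum_em[OF d])
 then have "det ?S * det ?T = 1" using det_mult[of ?S n ?T] by simp
 then show False using z disc_emb[OF bK] by auto
qed

lemma indepI_disc:
 assumes bK: "!!i. i < n ==> b i : K" and d: "disc b ~= 0" shows "indep b"
proof (rule ccontr)
 assume "\<not> indep b"
 then obtain c :: "nat => rat" and j where c: "(\<Sum>i<n. of_rat (c i) * b i) = 0" "j < n" "c j ~= 0"
  unfolding indep_def using bK by blast
 have "(\<Sum>l<n. tr (b a * b l) * of_rat (c l)) = 0" if a: "a < n" for a
 proof -
  have "(\<Sum>l<n. tr (b a * b l) * of_rat (c l)) = (\<Sum>l<n. tr (of_rat (c l) * (b a * b l)))"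
   using a bK K_closed by (intro sum.cong) (auto simp: tr_scale)
  also have "... = tr (b a * (\<Sum>l<n. of_rat (c l) * b l))"
   unfolding sum_distrib_left using a bK K_closed by (subst tr_sum) (auto simp: ac_simps)
  finally show ?thesis using c(1) by simp
 qed
 then have "mat n n (%(i, j). tr (b i * b j)) *\<^sub>v vec n (%l. of_rat (c l)) = 0\<^sub>v n"
  by (intro eq_vecI) (auto simp: scalar_prod_def atLeast0LessThan)
 moreover have "vec n (%l. of_rat (c l) :: complex) ~= 0\<^sub>v n"
 proof
  assume "vec n (%l. of_rat (c l) :: complex) = 0\<^sub>v n"
  then have "vec n (%l. of_rat (c l) :: complex) $ j = 0\<^sub>v n $ j" by simp
  then show False using c by simp
 qed
 ultimately have "disc b = 0" unfolding disc_def
  by (subst det_0_iff_vec_prod_zero[of _ n]) (auto intro!: exI[of _ "vec n (%l. of_rat (c l))"])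
 then show False using d by simp
qed

lemma int_indep_imp_indep:
 assumes bK: "!!i. i < n ==> b i : K"
  and h: "!!c::nat => int. (\<Sum>i<n. of_int (c i) * b i) = 0 ==> \<forall>i<n. c i = 0"
 shows "indep b"
 unfolding indep_def
proof (intro conjI allI impI)
 fix c :: "nat => rat" and i assume z: "(\<Sum>i<n. of_rat (c i) * b i) = 0" and i: "i < n"
 define num where "num j = fst (quotient_of (c j))" for j
 define den where "den j = snd (quotient_of (c j))" for j
 have q: "c j = of_int (num j) / of_int (den j)" "den j > 0" for j
  unfolding num_def den_def by (simp_all add: quotient_of_div quotient_of_denom_pos')
 define D where "D = (\<Prod>j<n. den j)"
 define k where "k j = num j * (\<Prod>l\<in>{..<n} - {j}. den l)" for j
 have kD: "of_int (k j) = c j * of_int D" if "j < n" for j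
 proof -
  have "D = den j * (\<Prod>l\<in>{..<n} - {j}. den l)" unfolding D_def using that by (subst prod.remove[of _ j]) auto
  then show ?thesis unfolding k_def using q[of j] by (simp add: field_simps)
 qed
 have "(\<Sum>j<n. of_int (k j) * b j) = of_rat (of_int D) * (\<Sum>j<n. of_rat (c j) * b j)"
 proof -
  have "(of_int (k j) :: complex) = of_rat (of_int D) * of_rat (c j)" if "j < n" for j
   using kD[OF that] by (metis mult.commute of_rat_mult of_rat_of_int_eq)
  then show ?thesis by (simp add: sum_distrib_left mult.assoc)
 qed
 then have "k i = 0" using h[of k] z i by simp
 moreover have "D ~= 0" unfolding D_def using q(2) by (simp add: less_imp_neq[symmetric])
 ultimately show "c i = 0" using kD[OF i] by simp
qed (use bK in auto)

lemma zbasis_iff_integral_basis: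
 "integral_basis K bs \<longleftrightarrow> length bs = n & zbasis (%i. bs ! i)"
proof
 assume h: "integral_basis K bs"
 then have l: "length bs = n" and s: "set bs \<subseteq> OK" unfolding integral_basis_def n_def by auto
 have O: "bs ! i : OK" if "i < n" for i using s l that nth_mem by auto
 moreover have "indep (%i. bs ! i)"
  by (rule int_indep_imp_indep) (use h l O O_K in \<open>auto simp: integral_basis_def\<close>)
 ultimately show "length bs = n & zbasis (%i. bs ! i)"
  using h l unfolding zbasis_def integral_basis_def by auto
next
 assume h: "length bs = n & zbasis (%i. bs ! i)"
 have "\<forall>i<n. c i = 0" if z: "(\<Sum>i<n. of_int (c i) * bs ! i) = 0" for c :: "nat => int"
 proof -
  have "(\<Sum>i<n. of_rat (of_int (c i)) * bs ! i) = 0" using z by simp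
  then have "\<forall>i<n. (of_int (c i) :: rat) = 0"
   using h indepD[of "%i. bs ! i" "%i. of_int (c i)"] unfolding zbasis_def by blast
  then show ?thesis by simp
 qed
 then show "integral_basis K bs"
  using h unfolding zbasis_def integral_basis_def by (auto simp: n_def in_set_conv_nth)
qed

lemma zbasis_cong: "(!!i. i < n ==> b i = b' i) ==> zbasis b \<longleftrightarrow> zbasis b'"
 unfolding zbasis_def indep_def by auto

text \<open>Base change in the two directions multiplies the discriminant by squares of integers
  whose product is 1.\<close>

lemma zbasis_disc_unique:
 assumes "zbasis b" "zbasis b'" shows "disc b = disc b'"
proof -
 have tr: "\<exists>C::int. disc b' = of_int (C\<^sup>2) * disc b" if "zbasis b" "zbasis b'" for b b'
 proof -
  have "\<forall>j. \<exists>c::nat => int. j < n --> b' j = (\<Sum>i<n. of_int (c i) * b i)"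
   using that unfolding zbasis_def by blast
  then obtain c :: "nat => nat => int" where c: "!!j. j < n ==> b' j = (\<Sum>i<n. of_int (c j i) * b i)"
   by metis
  have "disc b' = (det (mat n n (%(i, j). of_int (c j i))))\<^sup>2 * disc b"
   by (rule disc_transform) (use that c in \<open>auto simp: zbasis_def O_K\<close>)
  also have "... = of_int ((det (mat n n (%(i, j). c j i)))\<^sup>2) * disc b" by (simp add: det_of_int)
  finally show ?thesis by blast
 qed
 obtain C where C: "disc b' = of_int (C\<^sup>2) * disc b" using tr[OF assms] by auto
 obtain C' where C': "disc b = of_int (C'\<^sup>2) * disc b'" using tr[OF assms(2,1)] by auto
 have "disc b = of_int (C'\<^sup>2 * C\<^sup>2) * disc b" using C by (subst C') simp
 moreover have "disc b ~= 0" using disc_nonzero assms unfolding zbasis_def by auto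
 ultimately have "C'\<^sup>2 * C\<^sup>2 = 1" by (metis mult_cancel_right1 of_int_eq_1_iff)
 then have "C\<^sup>2 = 1" using zmult_eq_1_iff[of "C'\<^sup>2" "C\<^sup>2"] by (smt (verit) zero_le_power2)
 then show ?thesis using C by simp
qed

lemma nf_disc_eq: assumes "zbasis b" shows "of_int (nf_disc K) = disc b"
proof -
 have b: "!!i. i < n ==> b i : OK" using assms unfolding zbasis_def by auto
 obtain d :: int where d: "disc b = of_int d" using disc_int[of b, OF b] by auto
 have eq: "det (mat (length bs) (length bs) (%(i, j). nf_trace K (bs ! i * bs ! j))) = disc b"
  if "integral_basis K bs" for bs
  using that zbasis_disc_unique[OF _ assms, of "%i. bs ! i"]
  unfolding zbasis_iff_integral_basis disc_def by auto
 have "nf_disc K = d" unfolding nf_disc_def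
 proof (rule the_equality)
  have "integral_basis K (map b [0..<n])"
   unfolding zbasis_iff_integral_basis using assms zbasis_cong[of "%i. map b [0..<n] ! i" b] by auto
  then show "\<exists>bs. integral_basis K bs & complex_of_int d =
    det (mat (length bs) (length bs) (%(i, j). nf_trace K (bs ! i * bs ! j)))"
   using eq d by metis
 next
  fix d' assume "\<exists>bs. integral_basis K bs & complex_of_int d' =
    det (mat (length bs) (length bs) (%(i, j). nf_trace K (bs ! i * bs ! j)))"
  then have "complex_of_int d' = disc b" using eq by auto
  then show "d' = d" using d by simp
 qed
 then show ?thesis using d by simp
qed

lemma indepI_set:
 assumes "inj_on e {..<n}" "e ` {..<n} \<subseteq> K" "\<not> rat.dependent (e ` {..<n})"
 shows "indep e"
 unfolding indep_def
proof (intro conjI allI impI)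
 show "e i : K" if "i < n" for i using assms(2) that by auto
 fix c :: "nat => rat" and i assume z: "(\<Sum>i<n. of_rat (c i) * e i) = 0" and i: "i < n"
 define u where "u v = c (the_inv_into {..<n} e v)" for v
 have u: "u (e j) = c j" if "j < n" for j unfolding u_def using the_inv_into_f_f[OF assms(1)] that by simp
 have "(\<Sum>v\<in>e ` {..<n}. of_rat (u v) * v) = 0"
  using z by (simp add: sum.reindex[OF assms(1)] u)
 then have "u (e i) = 0" using assms(3) rat.dependent_finite[of "e ` {..<n}"] i by blast
 then show "c i = 0" using u[OF i] by simp
qed

text \<open>The positive generator of the ideal of traces of integers. It measures how far the field
  is from having an integer of trace one, and it links the discriminant of the field to that of its
  trace zero module.\<close>

definition tgen :: nat where
 "tgen = (LEAST g. g > 0 & (\<exists>y\<in>OK. tr y = of_nat g))"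

lemma tgen: "tgen > 0" "\<exists>y\<in>OK. tr y = of_nat tgen"
proof -
 have "n > 0 & (\<exists>y\<in>OK. tr y = of_nat n)" using n_pos tr_1 O_closed by auto
 then have "tgen > 0 & (\<exists>y\<in>OK. tr y = of_nat tgen)" unfolding tgen_def by (rule LeastI)
 then show "tgen > 0" "\<exists>y\<in>OK. tr y = of_nat tgen" by auto
qed

lemma tgen_dvd: assumes "x : OK" "tr x = of_int k" shows "int tgen dvd k"
proof (rule ccontr)
 assume nd: "\<not> int tgen dvd k"
 obtain y where y: "y : OK" "tr y = of_nat tgen" using tgen(2) by auto
 define r where "r = k mod int tgen"
 have "r ~= 0" using nd unfolding r_def by (simp add: dvd_eq_mod_eq_0)
 moreover have "0 <= r" "r < int tgen" unfolding r_def using tgen(1) by simp_all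
 ultimately have r: "0 < r" "r < int tgen" by simp_all
 let ?x = "x - of_int (k div int tgen) * y"
 have xO: "?x : OK" using assms y O_closed by auto
 have "tr ?x = of_int k - of_int (k div int tgen) * of_nat tgen"
  using assms y by (simp add: tr_diff tr_scale O_K K_closed)
 also have "... = of_int (k - (k div int tgen) * int tgen)" by simp
 also have "k - (k div int tgen) * int tgen = r" unfolding r_def by (simp add: minus_div_mult_eq_mod)
 finally have "tr ?x = of_nat (nat r)" using r(1) by simp
 then have "nat r > 0 & (\<exists>y\<in>OK. tr y = of_nat (nat r))" using xO r(1) by auto
 then have "tgen <= nat r" unfolding tgen_def by (rule Least_le)
 then show False using r by linarith
qed

text \<open>All vectors but the zeroth lie in the trace zero module, so an isometry of trace zero
  modules applies to them.\<close>

definition adapted :: "(nat => complex) => bool" where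
 "adapted b \<longleftrightarrow> (\<forall>i<n. b i : OK) & indep b & tr (b 0) = of_nat tgen & (\<forall>i<n. i > 0 --> tr (b i) = 0)"

lemma adapted_ex: "\<exists>b. adapted b"
proof -
 obtain y where y: "y : OK" "tr y = of_nat tgen" using tgen(2) by auto
 have y0: "y ~= 0" using y(2) tgen(1) by auto
 have yK: "y : K" using y O_K by auto
 have "\<not> rat.dependent {y}" using y0 by (simp add: rat.dependent_single)
 then obtain B where B: "{y} \<subseteq> B" "B \<subseteq> K" "\<not> rat.dependent B" "K \<subseteq> rat.span B"
  using rat.maximal_independent_subset_extend[of "{y}" K] yK by auto
 have "rat.span B = K"
  using B rat.span_minimal[OF B(2) subfield_rat_subspace[OF sf]] by auto
 moreover have finB: "finite B" using indep_bound(1) B by auto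
 ultimately have "q_basis K B" using B q_basis_iff[OF sf] by auto
 then have cardB: "card B = n" unfolding n_def using nf_degree_eq[OF sf] by simp
 have "card {1..<n} = card (B - {y})" using cardB B(1) finB by simp
 then obtain h0 where h0: "bij_betw h0 {1..<n} (B - {y})"
  using finite_same_card_bij[of "{1..<n}" "B - {y}"] finB by auto
 define h where "h i = (if i = 0 then y else h0 i)" for i :: nat
 have him: "h ` {..<n} = B"
 proof -
  have "{..<n} = insert 0 {1..<n}" using n_pos by auto
  moreover have "h ` {1..<n} = h0 ` {1..<n}" unfolding h_def by auto
  ultimately have "h ` {..<n} = insert y (B - {y})"
   using bij_betw_imp_surj_on[OF h0] by (simp only: image_insert) (simp add: h_def)
  then show ?thesis using B(1) by auto
 qed
 then have "inj_on h {..<n}" using cardB by (intro eq_card_imp_inj_on) auto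
 then have h: "indep h" using B him by (intro indepI_set) auto
 have hK: "h i : K" if "i < n" for i using h that unfolding indep_def by auto
 have "\<forall>i. \<exists>q. i < n --> tr (h i) = of_rat q" using tr_Rats hK by (metis Rats_cases)
 then obtain q where q: "!!i. i < n ==> tr (h i) = of_rat (q i)" by metis
 define w where "w i = of_nat tgen * h i - of_rat (q i) * y" for i
 have wK: "w i : K" if "i < n" for i unfolding w_def using hK that yK K_closed by auto
 have "\<forall>i. \<exists>m::int. i < n --> m > 0 & of_int m * w i : OK" using O_multiple wK by metis
 then obtain m :: "nat => int" where m: "!!i. i < n ==> m i > 0 & of_int (m i) * w i : OK" by metis
 define b where "b i = (if i = 0 then y else of_int (m i) * w i)" for i
 have "indep b"
  unfolding indep_def
 proof (intro conjI allI impI)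
  show "b i : K" if "i < n" for i unfolding b_def using yK m that O_K by auto
  fix c :: "nat => rat" and i assume z: "(\<Sum>i<n. of_rat (c i) * b i) = 0" and i: "i < n"
  define s where "s = (\<Sum>i\<in>{1..<n}. c i * of_int (m i) * q i)"
  define c' where "c' i = (if i = 0 then c 0 - s else c i * of_int (m i) * of_nat tgen)" for i
  have sp: "(\<Sum>i<n. f i) = f 0 + (\<Sum>i\<in>{1..<n}. f i)" for f :: "nat => complex"
  proof -
   have "{..<n} = insert 0 {1..<n}" using n_pos by auto
   then show ?thesis by simp
  qed
  have "(\<Sum>i<n. of_rat (c' i) * h i) = (of_rat (c 0) - of_rat s) * y
    + (\<Sum>i\<in>{1..<n}. of_rat (c i) * of_int (m i) * of_nat tgen * h i)"
   unfolding sp by (simp add: c'_def h_def of_rat_diff of_rat_mult)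
  also have "... = of_rat (c 0) * y + (\<Sum>i\<in>{1..<n}. of_rat (c i) * (of_int (m i) * w i))"
   unfolding s_def w_def
   by (simp add: of_rat_sum of_rat_mult sum_distrib_left algebra_simps sum_subtractf)
  also have "... = (\<Sum>i<n. of_rat (c i) * b i)" unfolding sp by (simp add: b_def)
  finally have "(\<Sum>i<n. of_rat (c' i) * h i) = 0" using z by simp
  then have c'0: "!!j. j < n ==> c' j = 0" using indepD[OF h] by blast
  have cj: "c j = 0" if "j : {1..<n}" for j
   using c'0[of j] that m[of j] tgen(1) unfolding c'_def by auto
  show "c i = 0"
  proof (cases "i = 0")
   case True
   have "s = 0" unfolding s_def using cj by simp
   then show ?thesis using c'0[OF i] True unfolding c'_def by simp
  qed (use cj i in auto)
 qed
 moreover have "tr (b i) = 0" if "i < n" "i > 0" for i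
  unfolding b_def w_def using that hK yK y q K_closed
  by (simp add: tr_scale tr_diff)
 ultimately have "adapted b" unfolding adapted_def using m y by (auto simp: b_def)
 then show ?thesis by blast
qed

text \<open>An adapted family with discriminant of least absolute value is an integral basis: a
  nonintegral coordinate could be reduced to its fractional part \<open>r\<close>, which multiplies
  the discriminant by \<open>r\<^sup>2\<close>. The zeroth coordinate is always integral because
  \<open>tgen\<close> generates the traces.\<close>

lemma adapted_zbasis: obtains b where "adapted b" "zbasis b"
proof -
 let ?P = "%b. adapted b"
 let ?m = "%b. nat \<bar>SOME d::int. disc b = of_int d\<bar>"
 obtain b where b: "adapted b" "!!b'. adapted b' ==> ?m b <= ?m b'"
  using ex_has_least_nat[of ?P _ ?m] adapted_ex by metis
 have bO: "!!i. i < n ==> b i : OK" and bi: "indep b" and b0: "tr (b 0) = of_nat tgen"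
  and bt: "!!i. i < n ==> i > 0 ==> tr (b i) = 0" using b(1) unfolding adapted_def by auto
 have bK: "!!i. i < n ==> b i : K" using bO O_K by auto
 obtain d :: int where d: "disc b = of_int d" using disc_int[of b, OF bO] by auto
 have d0: "d ~= 0" using d disc_nonzero[OF bi] by auto
 have md: "?m b' = nat \<bar>d'\<bar>" if "disc b' = of_int d'" for b' d'
 proof -
  have "(SOME d::int. disc b' = of_int d) = d'" by (rule some_equality) (use that in auto)
  then show ?thesis by simp
 qed
 have "\<exists>c::nat => int. x = (\<Sum>i<n. of_int (c i) * b i)" if x: "x : OK" for x
 proof -
  have xK: "x : K" using x O_K by auto
  obtain q :: "nat => rat" where q: "x = (\<Sum>i<n. of_rat (q i) * b i)" using indep_span[OF bi xK] by auto
  have sp: "(\<Sum>i<n. f i) = f 0 + (\<Sum>i\<in>{1..<n}. f i)" for f :: "nat => complex"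
  proof -
   have "{..<n} = insert 0 {1..<n}" using n_pos by auto
   then show ?thesis by simp
  qed
  have "tr x = (\<Sum>i<n. of_rat (q i) * tr (b i))"
   unfolding q using bK K_closed by (subst tr_sum) (auto simp: tr_scale)
  also have "... = of_rat (q 0) * of_nat tgen" unfolding sp using b0 bt by simp
  finally have trx: "tr x = of_rat (q 0) * of_nat tgen" .
  obtain k where k: "tr x = of_int k" using tr_int[OF x] .
  obtain k' where k': "k = int tgen * k'" using tgen_dvd[OF x k] by auto
  have "of_rat (q 0) * of_nat tgen = (of_int k :: complex)" using trx k by simp
  also have "... = of_rat (of_int k') * of_nat tgen" unfolding k' by simp
  finally have "of_rat (q 0) * of_nat tgen = (of_rat (of_int k') * of_nat tgen :: complex)" .
  moreover have "(of_nat tgen :: complex) ~= 0" using tgen(1) by simp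
  ultimately have "of_rat (q 0) = (of_rat (of_int k') :: complex)" by (simp only: mult_cancel_right) auto
  then have q0: "q 0 = of_int k'" by (simp only: of_rat_eq_iff)
  have qi: "q i : \<int>" if i: "i < n" for i
  proof (cases "i = 0")
   case True then show ?thesis using q0 by simp
  next
   case False
   show ?thesis
   proof (rule ccontr)
    assume ni: "q i ~: \<int>"
    define r where "r = q i - of_int \<lfloor>q i\<rfloor>"
    have r: "0 < r" "r < 1" unfolding r_def using ni
     by (smt (verit) Ints_of_int diff_gt_0_iff_gt of_int_floor_le order_le_less, linarith)
    \<comment> \<open>The zeroth coordinate is dropped so that the new vector has trace zero and the
      family stays adapted.\<close>
    define v where "v j = (if j = 0 then 0 else if j = i then r else q j)" for j
    define b' where "b' j = (if j = i then (\<Sum>l<n. of_rat (v l) * b l) else b j)" for j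
    have b'i: "b' i = x - of_int k' * b 0 - of_int \<lfloor>q i\<rfloor> * b i"
    proof -
     have "(\<Sum>l<n. of_rat (v l) * b l) =
       (\<Sum>l<n. of_rat (q l) * b l - (if l = 0 then of_int k' * b 0 else 0)
        - (if l = i then of_int \<lfloor>q i\<rfloor> * b i else 0))"
      by (intro sum.cong refl) (use False q0 in \<open>auto simp: v_def r_def of_rat_diff algebra_simps\<close>)
     also have "... = x - of_int k' * b 0 - of_int \<lfloor>q i\<rfloor> * b i"
      using n_pos i by (simp add: sum_subtractf q[symmetric])
     finally show ?thesis unfolding b'_def by simp
    qed
    have b'iO: "b' i : OK" unfolding b'i using x bO n_pos i O_closed by auto
    have trb': "tr (b' i) = 0"
     unfolding b'i using xK bK n_pos i K_closed b0 bt[OF i] False k k' by (simp add: tr_diff tr_scale)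
    define c where "c l j = (if j = i then of_rat (v l) else if l = j then 1 else (0::complex))" for l j
    have "disc b' = (det (mat n n (%(i, j). c i j)))\<^sup>2 * disc b"
    proof (rule disc_transform[OF bK])
     show "b' j = (\<Sum>l<n. c l j * b l)" if "j < n" for j
      unfolding b'_def c_def using that by (auto simp: if_distrib[of "%z. z * _"] cong: if_cong)
    qed (auto simp: c_def)
    also have "det (mat n n (%(i, j). c i j)) = of_rat r"
     unfolding c_def using det_replace_column[OF i, of "%l. of_rat (v l) :: complex"] False by (simp add: v_def)
    finally have db': "disc b' = of_rat (r\<^sup>2 * of_int d)" unfolding d by (simp add: of_rat_mult of_rat_power)
    have b'O: "!!j. j < n ==> b' j : OK" using b'iO bO unfolding b'_def by metis
    obtain d' :: int where d': "disc b' = of_int d'" using disc_int[of b', OF b'O] by auto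
    have "of_rat (of_int d') = (of_rat (r\<^sup>2 * of_int d) :: complex)" using db' d' by simp
    then have eq: "(of_int d' :: rat) = r\<^sup>2 * of_int d" by (simp only: of_rat_eq_iff)
    have "d' ~= 0" using eq r d0 by auto
    have "indep b'" by (rule indepI_disc) (use b'O O_K d' \<open>d' ~= 0\<close> in auto)
    then have "adapted b'" unfolding adapted_def using b'O trb' b0 bt False by (auto simp: b'_def)
    then have "nat \<bar>d\<bar> <= nat \<bar>d'\<bar>" using b(2) md[OF d] md[OF d'] by metis
    then have "(of_int \<bar>d\<bar> :: rat) <= of_int \<bar>d'\<bar>" by simp
    also have "... = r\<^sup>2 * of_int \<bar>d\<bar>" using eq by (simp add: abs_mult)
    also have "... < 1 * of_int \<bar>d\<bar>" using r d0 by (intro mult_strict_right_mono) (auto simp: power_less_one_iff abs_square_less_1)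
    finally show False by simp
   qed
  qed
  then have "\<forall>i. \<exists>k. i < n --> q i = of_int k" by (metis Ints_cases)
  then obtain c where "!!i. i < n ==> q i = of_int (c i)" by metis
  then have "x = (\<Sum>i<n. of_int (c i) * b i)" using q by simp
  then show ?thesis by blast
 qed
 then have "zbasis b" unfolding zbasis_def using bO bi by auto
 then show ?thesis using that b(1) by blast
qed

end

section \<open>Squares of primes dividing Gram determinants\<close>

lemma det_scale:
 fixes f :: "nat => nat => 'a :: comm_ring_1"
 shows "det (mat n n (%(i, j). r i * f i j * s j)) =
  (\<Prod>i<n. r i) * (\<Prod>j<n. s j) * det (mat n n (%(i, j). f i j))"
proof -
 have "signof q * (\<Prod>i = 0..<n. r i * f i (q i) * s (q i)) =
   (\<Prod>i<n. r i) * (\<Prod>j<n. s j) * (signof q * (\<Prod>i = 0..<n. f i (q i)))"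
  if q: "q permutes {0..<n}" for q
 proof -
  have "(\<Prod>i = 0..<n. s (q i)) = (\<Prod>i = 0..<n. s i)"
   using prod.permute[OF q, of s] by (simp add: o_def)
  then show ?thesis by (simp add: prod.distrib atLeast0LessThan ac_simps)
 qed
 then show ?thesis unfolding prod_if_det
  by (simp add: sum_distrib_left)
qed

lemma det_2:
 fixes f :: "nat \<times> nat => 'a :: comm_ring_1"
 shows "det (mat 2 2 f) = f (0, 0) * f (1, 1) - f (0, 1) * f (1, 0)"
proof -
 let ?A = "mat 2 2 f"
 have A: "?A : carrier_mat 2 2" by simp
 have "det ?A = (\<Sum>j<2. ?A $$ (0, j) * cofactor ?A 0 j)" by (rule laplace_expansion_row[OF A]) simp
 also have "... = f (0, 0) * cofactor ?A 0 0 + f (0, 1) * cofactor ?A 0 1" by (simp add: numeral_2_eq_2)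
 also have "cofactor ?A 0 0 = f (1, 1)"
  by (simp add: cofactor_def det_single mat_delete_def)
 also have "cofactor ?A 0 1 = - f (1, 0)"
  by (simp add: cofactor_def det_single mat_delete_def)
 finally show ?thesis by simp
qed

text \<open>Two null vectors of the Gram matrix modulo \<open>p\<close> which are independent modulo \<open>p\<close> can be completed
 to a basis over the \<open>p\<close>-local integers; the corresponding columns contribute a factor \<open>p\<close> each.\<close>
lemma det_two_null_aux:
 fixes g :: "nat => nat => int"
 assumes p: "prime (p::int)" and ij: "i < n" "j < n" "i ~= j"
  and x: "!!k. k < n ==> p dvd (\<Sum>l<n. g k l * x l)" and y: "!!k. k < n ==> p dvd (\<Sum>l<n. g k l * y l)"
  and m: "\<not> p dvd x i * y j - x j * y i" and xi: "\<not> p dvd x i"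
 shows "p\<^sup>2 dvd det (mat n n (%(i, j). g i j))"
proof -
 \<comment> \<open>Eliminates coordinate \<open>i\<close> from \<open>y\<close>, so that replacing
   columns \<open>i\<close> and \<open>j\<close> by \<open>x\<close> and \<open>w\<close> is a base
   change of determinant \<open>x i * w j\<close>.\<close>
 define w where "w l = x i * y l - y i * x l" for l
 have wi: "w i = 0" unfolding w_def by (simp add: mult.commute)
 have wj: "w j = x i * y j - x j * y i" unfolding w_def by (simp add: mult.commute)
 have w: "p dvd (\<Sum>l<n. g k l * w l)" if "k < n" for k
 proof -
  have "(\<Sum>l<n. g k l * w l) = x i * (\<Sum>l<n. g k l * y l) - y i * (\<Sum>l<n. g k l * x l)"
   unfolding w_def by (simp add: sum_distrib_left sum_subtractf algebra_simps)
  then show ?thesis using x[OF that] y[OF that] by (simp add: dvd_diff)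
 qed
 define c where "c k l = (if l = i then x k else if k = l then 1 else 0)" for k l
 define e where "e k l = (if l = j then w k else if k = l then 1 else 0)" for k l
 have dc: "det (mat n n (%(i, j). c i j)) = x i" and de: "det (mat n n (%(i, j). e i j)) = w j"
  unfolding c_def e_def by (rule det_replace_column, fact ij)+
 define E where "E k l = (\<Sum>a<n. c k a * e a l)" for k l
 have detE: "det (mat n n (%(i, j). E i j)) = x i * w j"
  unfolding E_def det_mat_prod dc de ..
 have El: "E k l = (if l = i then x k else if l = j then w k else if k = l then 1 else 0)"
  if kl: "k < n" "l < n" for k l
 proof (cases "l = j")
  case True
  have "E k l = (\<Sum>a<n. (if a = i then x k else if k = a then 1 else 0) * w a)"
   unfolding E_def c_def e_def True by simp
  also have "... = (\<Sum>a<n. if k = a then w k else 0)"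
   by (intro sum.cong) (auto simp: wi)
  finally show ?thesis using True ij kl by simp
 next
  case False
  have "E k l = (\<Sum>a<n. if a = l then c k l else 0)"
   unfolding E_def e_def using False by (intro sum.cong) auto
  then show ?thesis using False kl unfolding c_def by auto
 qed
 define h where "h k l = (\<Sum>a<n. g k a * E a l)" for k l
 define s where "s l = (if l = i then p else 1) * (if l = j then p else 1)" for l
 have dv: "s l dvd h k l" if kl: "k < n" "l < n" for k l
 proof -
  consider "l = i" | "l = j" | "l ~= i" "l ~= j" by auto
  then show ?thesis
  proof cases
   case 1
   then have "h k l = (\<Sum>a<n. g k a * x a)" unfolding h_def using kl by (intro sum.cong) (auto simp: El)
   then show ?thesis using 1 ij x[OF kl(1)] by (simp add: s_def)
  next
   case 2
   then have "h k l = (\<Sum>a<n. g k a * w a)" unfolding h_def using kl ij by (intro sum.cong) (auto simp: El)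
   then show ?thesis using 2 ij w[OF kl(1)] by (simp add: s_def)
  qed (simp add: s_def)
 qed
 have "det (mat n n (%(k, l). h k l)) = det (mat n n (%(k, l). 1 * (h k l div s l) * s l))"
  by (intro arg_cong[of _ _ det] eq_matI) (auto simp: dv)
 also have "... = (\<Prod>l<n. s l) * det (mat n n (%(k, l). h k l div s l))"
  by (subst det_scale) simp
 also have "(\<Prod>l<n. s l) = p\<^sup>2"
  unfolding s_def prod.distrib using ij by (simp add: power2_eq_square)
 finally have "p\<^sup>2 dvd det (mat n n (%(k, l). h k l))" by simp
 also have "det (mat n n (%(k, l). h k l)) = det (mat n n (%(i, j). g i j)) * (x i * w j)"
  unfolding h_def det_mat_prod detE ..
 finally have "p\<^sup>2 dvd det (mat n n (%(i, j). g i j)) * (x i * w j)" .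
 moreover have "\<not> p dvd x i * w j" using p xi m wj by (simp add: prime_dvd_mult_iff)
 then have "coprime p (x i * w j)" using p by (intro prime_imp_coprime)
 then have "coprime (p\<^sup>2) (x i * w j)" by simp
 ultimately show ?thesis by (simp add: coprime_dvd_mult_left_iff)
qed

lemma det_two_null:
 fixes g :: "nat => nat => int"
 assumes p: "prime (p::int)" and ij: "i < n" "j < n"
  and x: "!!k. k < n ==> p dvd (\<Sum>l<n. g k l * x l)" and y: "!!k. k < n ==> p dvd (\<Sum>l<n. g k l * y l)"
  and m: "\<not> p dvd x i * y j - x j * y i"
 shows "p\<^sup>2 dvd det (mat n n (%(i, j). g i j))"
proof -
 have ne: "i ~= j" using m by auto
 show ?thesis
 proof (cases "p dvd x i")
  case False
  show ?thesis by (rule det_two_null_aux[OF p ij ne _ _ m False]) (use x y in auto)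
 next
  case True
  have "\<not> p dvd x j"
  proof
   assume "p dvd x j"
   then have "p dvd x i * y j - x j * y i" using True by (intro dvd_diff dvd_mult2)
   then show False using m by simp
  qed
  moreover have "\<not> p dvd x j * y i - x i * y j" using m by (simp add: dvd_diff_commute)
  ultimately show ?thesis
   by (intro det_two_null_aux[OF p ij(2,1) ne[symmetric], of g x y]) (use x y in auto)
 qed
qed

text \<open>With \<open>x\<close> as the \<open>i\<close>-th basis vector, row and column
  \<open>i\<close> of the Gram matrix become divisible by \<open>p\<close> and their common entry by
  \<open>p\<^sup>2\<close>, so a factor \<open>p\<close> comes out of the row and another out of the
  column. The base change has determinant \<open>x i\<close>, prime to \<open>p\<close>.\<close>

lemma det_norm_null:
 fixes g :: "nat => nat => int"
 assumes p: "prime (p::int)" and i: "i < n" and sym: "!!k l. g k l = g l k"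
  and x: "!!k. k < n ==> p dvd (\<Sum>l<n. g k l * x l)"
  and xx: "p\<^sup>2 dvd (\<Sum>k<n. \<Sum>l<n. x k * g k l * x l)" and xi: "\<not> p dvd x i"
 shows "p\<^sup>2 dvd det (mat n n (%(i, j). g i j))"
proof -
 define c where "c k l = (if l = i then x k else if k = l then 1 else 0)" for k l
 have dc: "det (mat n n (%(i, j). c i j)) = x i"
  unfolding c_def by (rule det_replace_column, fact i)
 define h where "h a b = (\<Sum>k<n. \<Sum>l<n. c k a * g k l * c l b)" for a b
 have sumd: "(\<Sum>l<n. f l * (if l = b then 1 else 0)) = f b" if "b < n" for f :: "nat => int" and b
 proof -
  have "(\<Sum>l<n. f l * (if l = b then 1 else 0)) = (\<Sum>l<n. if l = b then f l else 0)" by (intro sum.cong) auto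
  then show ?thesis using that by simp
 qed
 have gx: "(\<Sum>l<n. g k l * c l b) = (if b = i then (\<Sum>l<n. g k l * x l) else g k b)" if "b < n" for k b
  using sumd[OF that, of "g k"] unfolding c_def by auto
 have h1: "h a b = (\<Sum>k<n. c k a * (\<Sum>l<n. g k l * c l b))" for a b
  unfolding h_def by (simp add: sum_distrib_left mult.assoc)
 have hsym: "h a b = h b a" for a b
  unfolding h_def
 proof (subst sum.swap, intro sum.cong refl)
  fix k l show "c l a * g l k * c k b = c k b * g k l * c l a" by (simp add: sym[of k l] ac_simps)
 qed
 have h_ki: "p dvd h k i" if k: "k < n" for k
  unfolding h1
 proof (rule dvd_sum)
  fix a assume "a : {..<n}"
  then have "p dvd (\<Sum>l<n. g a l * c l i)" using gx[OF i] x by simp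
  then show "p dvd c a k * (\<Sum>l<n. g a l * c l i)" by simp
 qed
 have h_ii: "p\<^sup>2 dvd h i i"
 proof -
  have "h i i = (\<Sum>k<n. \<Sum>l<n. x k * g k l * x l)" unfolding h_def c_def by simp
  then show ?thesis using xx by simp
 qed
 define r where "r l = (if l = i then p else 1)" for l
 have dv: "r k * r l dvd h k l" if "k < n" "l < n" for k l
  using h_ki[OF that(1)] h_ki[OF that(2)] h_ii hsym[of i l] by (auto simp: r_def power2_eq_square)
 have r0: "r k ~= 0" for k using p by (auto simp: r_def)
 have "det (mat n n (%(k, l). h k l)) = det (mat n n (%(k, l). r k * (h k l div (r k * r l)) * r l))"
 proof (intro arg_cong[of _ _ det] eq_matI)
  fix k l assume "k < dim_row (mat n n (%(k, l). r k * (h k l div (r k * r l)) * r l))"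
   "l < dim_col (mat n n (%(k, l). r k * (h k l div (r k * r l)) * r l))"
  then have kl: "k < n" "l < n" by auto
  have "h k l = (r k * r l) * (h k l div (r k * r l))" using dv[OF kl] by simp
  also have "... = r k * (h k l div (r k * r l)) * r l" by (simp only: ac_simps)
  finally show "mat n n (%(k, l). h k l) $$ (k, l) = mat n n (%(k, l). r k * (h k l div (r k * r l)) * r l) $$ (k, l)"
   using kl by simp
 qed auto
 also have "... = (\<Prod>l<n. r l) * (\<Prod>l<n. r l) * det (mat n n (%(k, l). h k l div (r k * r l)))"
  by (rule det_scale)
 also have "(\<Prod>l<n. r l) = p" unfolding r_def using i by simp
 finally have "p\<^sup>2 dvd det (mat n n (%(k, l). h k l))" by (simp add: power2_eq_square)
 also have "det (mat n n (%(k, l). h k l)) = (x i)\<^sup>2 * det (mat n n (%(i, j). g i j))"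
  unfolding h_def det_congruence dc ..
 finally have "p\<^sup>2 dvd (x i)\<^sup>2 * det (mat n n (%(i, j). g i j))" .
 moreover have "coprime (p\<^sup>2) ((x i)\<^sup>2)" using p xi by (simp add: prime_imp_coprime)
 ultimately show ?thesis by (simp add: coprime_dvd_mult_right_iff)
qed

section \<open>The codifferent and null vectors of the trace form modulo a prime\<close>

context numfield
begin

text \<open>The inverse different, the dual lattice of the ring of integers under the trace
  form.\<close>

definition codiff :: "complex set" where
 "codiff = {x : K. \<forall>y\<in>OK. tr (x * y) : \<int>}"

lemma codiff_K: "x : codiff ==> x : K" unfolding codiff_def by simp
lemma codiffD: "x : codiff ==> y : OK ==> tr (x * y) : \<int>" unfolding codiff_def by simp
lemma codiff_tr: "x : codiff ==> tr x : \<int>" using codiffD[of x 1] O_closed by simp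

lemma O_codiff: "x : OK ==> x : codiff" unfolding codiff_def using O_K tr_Ints O_closed by auto

lemma codiff_closed:
 "x : codiff ==> y : codiff ==> x + y : codiff" "x : codiff ==> y : codiff ==> x - y : codiff"
 "x : codiff ==> y : OK ==> x * y : codiff" "x : codiff ==> of_int k * x : codiff"
proof -
 show "x + y : codiff" if "x : codiff" "y : codiff"
  using that unfolding codiff_def by (auto simp: K_closed O_K distrib_right tr_add)
 show "x - y : codiff" if "x : codiff" "y : codiff"
  using that unfolding codiff_def by (auto simp: K_closed O_K left_diff_distrib tr_diff)
 show m: "x * y : codiff" if "x : codiff" "y : OK" for x y
  using that unfolding codiff_def by (auto simp: K_closed O_K O_closed mult.assoc)
 show "of_int k * x : codiff" if "x : codiff" using m[OF that O_closed(7)[of k]] by (simp add: mult.commute)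
qed

lemma zbasis_dual:
 assumes "zbasis b" shows "\<exists>b'. dual b b' & (\<forall>i<n. b' i : codiff)"
proof -
 have bi: "indep b" and bO: "!!i. i < n ==> b i : OK" using assms unfolding zbasis_def by auto
 obtain b' where d: "dual b b'" using indep_dual_ex[OF bi] .
 have b'K: "b' i : K" if "i < n" for i using d that unfolding dual_def by auto
 have b'c: "b' i : codiff" if i: "i < n" for i
  unfolding codiff_def
 proof (intro CollectI conjI ballI b'K[OF i])
  fix y assume y: "y : OK"
  then obtain c :: "nat => int" where c: "y = (\<Sum>j<n. of_int (c j) * b j)" using assms unfolding zbasis_def by blast
  have "tr (b' i * y) = (\<Sum>j<n. of_int (c j) * tr (b' i * b j))"
   unfolding c sum_distrib_left using b'K[OF i] bO O_K K_closed
   by (subst tr_sum) (auto simp: tr_scale mult.left_commute[of "b' i"])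
  also have "... : \<int>" using dual_sym[OF d] i unfolding dual_def by (intro Ints_sum Ints_mult) auto
  finally show "tr (b' i * y) : \<int>" .
 qed
 then show ?thesis using d by blast
qed

lemma zbasis_ex: obtains b where "zbasis b" using adapted_zbasis by blast

definition pO :: "int => complex set" where "pO m = {of_int m * x | x. x : OK}"

lemma pO_O: "x : pO m ==> x : OK" unfolding pO_def using O_closed by auto

lemma pO_iff: "m ~= 0 ==> x : pO m \<longleftrightarrow> x / of_int m : OK"
proof
 assume m: "m ~= 0"
 show "x / of_int m : OK" if "x : pO m" using that m unfolding pO_def by auto
 show "x : pO m" if "x / of_int m : OK"
  unfolding pO_def using that m by (intro CollectI exI[of _ "x / of_int m"]) auto
qed

lemma pO_closed:
 "0 : pO m" "x : pO m ==> y : pO m ==> x + y : pO m" "x : pO m ==> y : pO m ==> x - y : pO m"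
 "x : pO m ==> y : OK ==> x * y : pO m" "y : OK ==> x : pO m ==> y * x : pO m"
 "x : pO m ==> - x : pO m" "y : OK ==> of_int m * y : pO m"
proof -
 show "0 : pO m" unfolding pO_def using O_closed(1) by (intro CollectI exI[of _ 0]) auto
 show "x + y : pO m" if "x : pO m" "y : pO m"
  using that O_closed(3) unfolding pO_def by (auto simp flip: distrib_left)
 show "x - y : pO m" if "x : pO m" "y : pO m"
  using that O_closed(6) unfolding pO_def by (auto simp flip: right_diff_distrib)
 show mul: "x * y : pO m" if "x : pO m" "y : OK" for x y
  using that O_closed(4) unfolding pO_def by (auto simp: mult.assoc)
 show "y * x : pO m" if "y : OK" "x : pO m" using mul[OF that(2,1)] by (simp add: mult.commute)
 show "- x : pO m" if "x : pO m"
  using that O_closed(5) unfolding pO_def by (auto simp flip: mult_minus_right)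
 show "y : OK ==> of_int m * y : pO m" unfolding pO_def by auto
qed

lemma zbasis_pO:
 assumes b: "zbasis b" and x: "x = (\<Sum>i<n. of_int (c i) * b i)" and m: "m ~= 0"
 shows "x : pO m \<longleftrightarrow> (\<forall>i<n. m dvd c i)"
proof
 assume "x : pO m"
 then obtain z where z: "x = of_int m * z" "z : OK" unfolding pO_def by auto
 obtain k :: "nat => int" where k: "z = (\<Sum>i<n. of_int (k i) * b i)" using b z(2) unfolding zbasis_def by blast
 have "(\<Sum>i<n. of_rat (of_int (c i - m * k i)) * b i) = 0"
  using x z(1) k by (simp add: of_rat_diff of_rat_mult left_diff_distrib sum_subtractf sum_distrib_left mult.assoc)
 then have "!!i. i < n ==> (of_int (c i - m * k i) :: rat) = 0"
  using b indepD[of b "%i. of_int (c i - m * k i)"] unfolding zbasis_def by blast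
 then have "!!i. i < n ==> c i = m * k i" by (metis eq_iff_diff_eq_0 of_int_eq_0_iff)
 then show "\<forall>i<n. m dvd c i" by simp
next
 assume d: "\<forall>i<n. m dvd c i"
 have "x = of_int m * (\<Sum>i<n. of_int (c i div m) * b i)"
  unfolding x sum_distrib_left
 proof (intro sum.cong refl)
  fix i assume "i : {..<n}"
  then have "c i = m * (c i div m)" using d by simp
  then have "(of_int (c i) :: complex) = of_int m * of_int (c i div m)" by (metis of_int_mult)
  then show "of_int (c i) * b i = of_int m * (of_int (c i div m) * b i)" by simp
 qed
 moreover have "(\<Sum>i<n. of_int (c i div m) * b i) : OK"
  using b unfolding zbasis_def by (intro O_sum O_closed) auto
 ultimately show "x : pO m" unfolding pO_def by blast
qed

text \<open>The radical of the trace form modulo \<open>m\<close>; for nonzero \<open>m\<close> it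
  consists of the integers in \<open>m\<close> times the codifferent.\<close>

definition null_mod :: "int => complex set" where
 "null_mod m = {x : OK. \<forall>y\<in>OK. \<exists>k. tr (x * y) = of_int (m * k)}"

lemma gram_data:
 "\<exists>b g. zbasis b & (\<forall>i<n. \<forall>j<n. tr (b i * b j) = of_int (g i j)) & (\<forall>i j. g i j = g j i) \<and>
  nf_disc K = det (mat n n (%(i, j). g i j))"
proof -
 obtain b where b: "zbasis b" by (rule zbasis_ex)
 then have "!!i. i < n ==> b i : OK" unfolding zbasis_def by auto
 then obtain g :: "nat => nat => int" where g: "\<forall>i<n. \<forall>j<n. tr (b i * b j) = of_int (g i j)"
  "\<forall>i j. g i j = g j i" "disc b = of_int (det (mat n n (%(i, j). g i j)))"
  using gram_int[of b] by blast
 then have "of_int (nf_disc K) = (of_int (det (mat n n (%(i, j). g i j))) :: complex)"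
  using nf_disc_eq[OF b] by simp
 then have "nf_disc K = det (mat n n (%(i, j). g i j))" by (simp only: of_int_eq_iff)
 then show ?thesis using b g by blast
qed

lemma null_coords:
 assumes b: "zbasis b" and g: "!!i j. i < n ==> j < n ==> tr (b i * b j) = of_int (g i j)"
  and x: "x = (\<Sum>i<n. of_int (c i) * b i)" "x : null_mod m" and k: "k < n"
 shows "m dvd (\<Sum>l<n. g k l * c l)"
proof -
 have bO: "!!i. i < n ==> b i : OK" using b unfolding zbasis_def by auto
 have "tr (x * b k) = tr (\<Sum>l<n. of_int (c l) * (b k * b l))"
  unfolding x(1) sum_distrib_right by (intro arg_cong[of _ _ tr] sum.cong) auto
 also have "... = (\<Sum>l<n. of_int (c l) * tr (b k * b l))"
  using bO O_K k K_closed by (subst tr_sum) (auto simp: tr_scale)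
 also have "... = (\<Sum>l<n. of_int (c l) * of_int (g k l))"
  by (intro sum.cong refl) (use g k in auto)
 also have "... = of_int (\<Sum>l<n. g k l * c l)" by (simp add: mult.commute)
 finally have "tr (x * b k) = of_int (\<Sum>l<n. g k l * c l)" .
 moreover obtain j where "tr (x * b k) = of_int (m * j)" using x(2) bO[OF k] unfolding null_mod_def by blast
 ultimately have "(\<Sum>l<n. g k l * c l) = m * j" by (metis of_int_eq_iff)
 then show ?thesis by simp
qed

lemma tr_quad_coords:
 assumes b: "zbasis b" and g: "!!i j. i < n ==> j < n ==> tr (b i * b j) = of_int (g i j)"
  and x: "x = (\<Sum>i<n. of_int (c i) * b i)"
 shows "tr (x * x) = of_int (\<Sum>k<n. \<Sum>l<n. c k * g k l * c l)"
proof -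
 have bK: "!!i. i < n ==> b i : K" using b O_K unfolding zbasis_def by auto
 have "tr (x * x) = tr (\<Sum>k<n. \<Sum>l<n. (of_int (c k * c l)) * (b k * b l))"
  unfolding x by (simp add: sum_product ac_simps)
 also have "... = (\<Sum>k<n. tr (\<Sum>l<n. (of_int (c k * c l)) * (b k * b l)))"
  using bK K_closed by (intro tr_sum K_sum) auto
 also have "... = (\<Sum>k<n. \<Sum>l<n. tr ((of_int (c k * c l)) * (b k * b l)))"
  using bK K_closed by (intro sum.cong refl tr_sum) auto
 also have "... = (\<Sum>k<n. \<Sum>l<n. of_int (c k * c l) * of_int (g k l))"
  using bK K_closed g by (intro sum.cong refl) (auto simp: tr_scale simp del: of_int_mult)
 finally show ?thesis by (simp add: ac_simps)
qed

lemma coords_ex: assumes "zbasis b" "x : OK" obtains c :: "nat => int" where "x = (\<Sum>i<n. of_int (c i) * b i)"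
 using assms unfolding zbasis_def by blast

text \<open>\<open>ind\<close> says that the two radical vectors are independent modulo
  \<open>p\<close>, so some two by two minor of their coordinates is prime to
  \<open>p\<close>.\<close>

lemma two_null_disc:
 assumes p: "prime (p::int)" and x: "x : null_mod p" and y: "y : null_mod p"
  and ind: "!!a c. of_int a * x + of_int c * y : pO p ==> p dvd a & p dvd c"
 shows "p\<^sup>2 dvd nf_disc K"
proof -
 obtain b g where b: "zbasis b" and g0: "\<forall>i<n. \<forall>j<n. tr (b i * b j) = of_int (g i j)"
  and d: "nf_disc K = det (mat n n (%(i, j). g i j))" using gram_data by blast
 note g = g0[rule_format]
 have xO: "x : OK" "y : OK" using x y unfolding null_mod_def by auto
 obtain c where c: "x = (\<Sum>i<n. of_int (c i) * b i)" using coords_ex[OF b xO(1)] .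
 obtain e where e: "y = (\<Sum>i<n. of_int (e i) * b i)" using coords_ex[OF b xO(2)] .
 have p0: "p ~= 0" using p by auto
 have lin: "of_int s * x + of_int t * y = (\<Sum>i<n. of_int (s * c i + t * e i) * b i)" for s t
  unfolding c e by (simp add: sum_distrib_left sum.distrib algebra_simps)
 have "\<exists>i<n. \<exists>j<n. \<not> p dvd c i * e j - c j * e i"
 proof (rule ccontr)
  assume "\<not> ?thesis"
  then have dv: "!!i j. i < n ==> j < n ==> p dvd c i * e j - c j * e i" by blast
  have "x ~: pO p"
  proof
   assume "x : pO p"
   then have "p dvd 1" using ind[of 1 0] by simp
   then show False using p by (simp add: not_prime_unit)
  qed
  then obtain i where i: "i < n" "\<not> p dvd c i" using zbasis_pO[OF b c p0] by auto
  have "of_int (- e i) * x + of_int (c i) * y : pO p"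
   unfolding zbasis_pO[OF b lin p0] using dv[OF i(1)] by (simp add: algebra_simps)
  then show False using ind i(2) by blast
 qed
 then obtain i j where "i < n" "j < n" "\<not> p dvd c i * e j - c j * e i" by blast
 then show ?thesis unfolding d
  using det_two_null[OF p, of i n j g c e] null_coords[OF b g c x] null_coords[OF b g e y] by blast
qed

lemma norm_null_disc:
 assumes p: "prime (p::int)" and x: "x : null_mod p" "x ~: pO p"
  and xx: "tr (x * x) = of_int (p\<^sup>2 * k)"
 shows "p\<^sup>2 dvd nf_disc K"
proof -
 obtain b g where b: "zbasis b" and g0: "\<forall>i<n. \<forall>j<n. tr (b i * b j) = of_int (g i j)"
  and sym0: "\<forall>i j. g i j = g j i" and d: "nf_disc K = det (mat n n (%(i, j). g i j))"
  using gram_data by blast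
 note g = g0[rule_format] and sym = sym0[rule_format]
 have xO: "x : OK" using x unfolding null_mod_def by auto
 obtain c where c: "x = (\<Sum>i<n. of_int (c i) * b i)" using coords_ex[OF b xO] .
 have p0: "p ~= 0" using p by auto
 obtain i where i: "i < n" "\<not> p dvd c i" using zbasis_pO[OF b c p0] x(2) by auto
 have "(\<Sum>k<n. \<Sum>l<n. c k * g k l * c l) = p\<^sup>2 * k"
  using trans[OF tr_quad_coords[of b g x c, OF b g c, symmetric] xx] by (simp only: of_int_eq_iff)
 moreover have "p dvd (\<Sum>l<n. g k l * c l)" if "k < n" for k
  by (rule null_coords[OF b _ c x(1) that]) (use g in auto)
 ultimately show ?thesis unfolding d
  by (intro det_norm_null[of p i n g c, OF p i(1) _ _ _ i(2)]) (use sym in auto)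
qed

text \<open>If every dual basis vector had a multiple prime to \<open>p\<close> in the ring of
  integers, the Gram matrix would have a right inverse up to these multiples, and its determinant
  would be prime to \<open>p\<close>. So the order of some dual basis vector modulo the integers is
  divisible by \<open>p\<close>, and its multiple by that order is the vector sought.\<close>

lemma null_exists:
 assumes p: "prime (p::int)" and dv: "p dvd nf_disc K"
 obtains x where "x : null_mod p" "x ~: pO p"
proof -
 obtain b g where b: "zbasis b" and g0: "\<forall>i<n. \<forall>j<n. tr (b i * b j) = of_int (g i j)"
  and sym0: "\<forall>i j. g i j = g j i" and d: "nf_disc K = det (mat n n (%(i, j). g i j))"
  using gram_data by blast
 note g = g0[rule_format] and sym = sym0[rule_format]
 obtain b' where b': "dual b b'" and "\<forall>i<n. b' i : codiff"
  using zbasis_dual[OF b] by blast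
 then have b'_codiff: "!!i. i < n ==> b' i : codiff" by blast
 have bO: "!!i. i < n ==> b i : OK" using b unfolding zbasis_def by auto
 have b'K: "!!i. i < n ==> b' i : K" using b'_codiff codiff_K by auto
 have "\<exists>j<n. \<forall>m. of_int m * b' j : OK --> p dvd m"
 proof (rule ccontr)
  assume "\<not> ?thesis"
  then have "\<forall>j. \<exists>m. j < n --> of_int m * b' j : OK & \<not> p dvd m" by auto
  then obtain m where m: "!!j. j < n ==> of_int (m j) * b' j : OK & \<not> p dvd m j" by metis
  have "\<forall>j. \<exists>c::nat => int. j < n --> of_int (m j) * b' j = (\<Sum>i<n. of_int (c i) * b i)"
   using m b unfolding zbasis_def by blast
  then obtain c :: "nat => nat => int" where
   c: "!!j. j < n ==> of_int (m j) * b' j = (\<Sum>i<n. of_int (c j i) * b i)" by metis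
  have "(\<Sum>l<n. g k l * c j l) = (if k = j then m j else 0)" if kj: "k < n" "j < n" for k j
  proof -
   have "of_int (\<Sum>l<n. g k l * c j l) = (\<Sum>l<n. of_int (c j l) * of_int (g k l))"
    by (simp add: mult.commute)
   also have "... = (\<Sum>l<n. of_int (c j l) * tr (b k * b l))"
    by (intro sum.cong refl) (use g kj in auto)
   also have "... = tr (b k * (\<Sum>l<n. of_int (c j l) * b l))"
    unfolding sum_distrib_left using bO kj O_K K_closed
    by (subst tr_sum) (auto simp: tr_scale mult.left_commute[of "b k"])
   also have "... = tr (of_int (m j) * (b k * b' j))" using c[OF kj(2)] by (simp add: mult.left_commute)
   also have "... = of_int (m j) * tr (b k * b' j)" using bO b'K kj O_K K_closed by (intro tr_scale) auto
   also have "... = of_int (if k = j then m j else 0)" using b' kj unfolding dual_def by simp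
   finally show ?thesis by (simp only: of_int_eq_iff)
  qed
  then have "det (mat n n (%(k, j). \<Sum>l<n. g k l * c j l)) = det (mat n n (%(k, j). 1 * (if k = j then 1 else 0) * m j))"
   by (intro arg_cong[of _ _ det] eq_matI) auto
  also have "... = (\<Prod>j<n. m j) * det (mat n n (%(k, j). if k = j then 1 else 0))"
   by (subst det_scale) simp
  also have "mat n n (%(k, j). if k = j then 1 else 0) = (1\<^sub>m n :: int mat)" by (rule eq_matI) auto
  finally have "nf_disc K * det (mat n n (%(l, j). c j l)) = (\<Prod>j<n. m j)"
   unfolding d det_mat_prod by simp
  then have "p dvd (\<Prod>j<n. m j)" using dv by (metis dvd_mult2)
  then show False using p m by (auto simp: prime_dvd_prod_iff)
 qed
 then obtain j where j: "j < n" "!!m. of_int m * b' j : OK ==> p dvd m" by auto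
 obtain m0 :: int where m0: "m0 > 0" "of_int m0 * b' j : OK" using O_multiple[OF b'K[OF j(1)]] .
 define k where "k = (LEAST k. k > 0 & of_nat k * b' j : OK)"
 have "nat m0 > 0 & of_nat (nat m0) * b' j : OK" using m0 by simp
 then have k: "k > 0 & of_nat k * b' j : OK" unfolding k_def by (rule LeastI)
 have pk: "p dvd int k" using j(2)[of "int k"] k by simp
 then obtain q where q: "int k = p * q" by auto
 have p0: "p > 0" using p by (simp add: prime_gt_0_int)
 have q0: "q > 0" using q k p0 by (metis of_nat_0_less_iff zero_less_mult_pos)
 let ?x = "of_nat k * b' j"
 have kk: "?x = of_int p * (of_int q * b' j)"
  using arg_cong[OF q, of "of_int :: int => complex"] by (simp add: mult.assoc)
 have "?x : null_mod p"
  unfolding null_mod_def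
 proof (intro CollectI conjI ballI)
  show "?x : OK" using k by simp
  fix y assume y: "y : OK"
  obtain t where t: "tr (b' j * y) = of_int t" using codiffD[OF b'_codiff[OF j(1)] y] by (auto elim: Ints_cases)
  have "tr (?x * y) = of_int (p * q) * tr (b' j * y)"
   unfolding kk using b'K[OF j(1)] y O_K K_closed tr_scale[of "of_int (p * q)" "b' j * y"] by (simp add: mult.assoc)
  then show "\<exists>k. tr (?x * y) = of_int (p * k)" using t by (intro exI[of _ "q * t"]) simp
 qed
 moreover have "?x ~: pO p"
 proof
  assume "?x : pO p"
  then obtain z where "?x = of_int p * z" "z : OK" unfolding pO_def by auto
  then have "of_int q * b' j : OK" using kk p0 by simp
  then have "of_nat (nat q) * b' j : OK" using q0 by simp
  then have "k <= nat q" unfolding k_def using q0 by (intro Least_le) auto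
  moreover have "q < int k"
  proof -
   have "2 <= p" using p by (simp add: prime_ge_2_int)
   then have "2 * q <= p * q" using q0 by (intro mult_right_mono) auto
   then show ?thesis using q q0 by linarith
  qed
  ultimately show False using q0 by (simp add: le_nat_iff)
 qed
 ultimately show ?thesis by (rule that)
qed

lemma disc_dvd_of_traces:
 assumes "!!x. x : OK ==> \<exists>k. tr x = of_int (m * k)" and m: "m ~= 0"
 shows "m ^ n dvd nf_disc K"
proof -
 obtain b g where b: "zbasis b" and g0: "\<forall>i<n. \<forall>j<n. tr (b i * b j) = of_int (g i j)"
  and sym0: "\<forall>i j. g i j = g j i" and d: "nf_disc K = det (mat n n (%(i, j). g i j))"
  using gram_data by blast
 note g = g0[rule_format] and sym = sym0[rule_format]
 have bO: "!!i. i < n ==> b i : OK" using b unfolding zbasis_def by auto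
 have "m dvd g i j" if ij: "i < n" "j < n" for i j
 proof -
  obtain k where "tr (b i * b j) = of_int (m * k)"
   using assms(1)[OF O_closed(4)[OF bO[OF ij(1)] bO[OF ij(2)]]] by blast
  then have "(of_int (g i j) :: complex) = of_int (m * k)" using g[OF ij] by simp
  then have "g i j = m * k" by (simp only: of_int_eq_iff)
  then show ?thesis by simp
 qed
 then have "nf_disc K = det (mat n n (%(i, j). m * (g i j div m) * 1))"
  unfolding d by (intro arg_cong[of _ _ det] eq_matI) auto
 also have "... = m ^ n * det (mat n n (%(i, j). g i j div m))" by (subst det_scale) simp
 finally show ?thesis by simp
qed

end

section \<open>Fundamental discriminants\<close>

text \<open>For a quadratic field, \<open>2w - tr w\<close> is a square root of the discriminant; if the discriminant
 were not fundamental, a proper fraction of it would be integral.\<close>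
lemma fundamental_discriminantD:
 assumes "fundamental_discriminant d"
 shows "prime p ==> p ~= 2 ==> \<not> p\<^sup>2 dvd d" "2 dvd d ==> 4 dvd d"
  "4 dvd d ==> (d div 4) mod 4 = 2 \<or> (d div 4) mod 4 = 3"
proof -
 have *: "(\<forall>p. prime p & p ~= 2 --> \<not> p\<^sup>2 dvd d) & (2 dvd d --> 4 dvd d) \<and>
  (4 dvd d --> (d div 4) mod 4 = 2 \<or> (d div 4) mod 4 = 3)"
 proof (cases "d = 1")
  case True
  have "\<not> p\<^sup>2 dvd 1" if "prime p" for p :: int using that
   by (metis is_unit_power_iff not_prime_unit zero_neq_numeral)
  then show ?thesis using True by auto
 next
  case False
  then obtain Q where Q: "number_field Q" "nf_degree Q = 2" "nf_disc Q = d"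
   using assms unfolding fundamental_discriminant_def by auto
  interpret numfield Q by unfold_locales fact
  have n2: "n = 2" using Q(2) n_def by simp
  obtain b where b: "zbasis b" by (rule zbasis_ex)
  have bO: "b 0 : OK" "b 1 : OK" using b n2 unfolding zbasis_def by auto
  have s2: "(\<Sum>i<n. f i) = f 0 + f 1" for f :: "nat => complex" unfolding n2 by (simp add: numeral_2_eq_2)
  have s2': "(\<Sum>i<(2::nat). f i) = f 0 + f 1" for f :: "nat => complex" by (simp add: numeral_2_eq_2)
  obtain c :: "nat => int" where c: "1 = of_int (c 0) * b 0 + of_int (c 1) * b 1"
   using coords_ex[OF b O_closed(2)] unfolding s2 by metis
  have uniq: "k 0 = 0 & k 1 = 0" if "of_int (k 0) * b 0 + of_int (k 1) * b 1 = 0" for k :: "nat => int"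
  proof -
   have "(\<Sum>i<n. of_rat (of_int (k i)) * b i) = 0" unfolding s2 using that by simp
   then have "!!i. i < n ==> (of_int (k i) :: rat) = 0"
    using b indepD[of b "%i. of_int (k i)"] unfolding zbasis_def by blast
   then show ?thesis using n2 by simp
  qed
  have cop: "coprime (c 0) (c 1)"
  proof (rule coprimeI)
   fix m assume m: "m dvd c 0" "m dvd c 1"
   show "is_unit m"
   proof -
    obtain x y where xy: "c 0 = m * x" "c 1 = m * y" using m unfolding dvd_def by blast
    have "m ~= 0" using c xy by auto
    define z where "z = of_int x * b 0 + of_int y * b 1"
    have zO: "z : OK" unfolding z_def using bO O_closed by auto
    have mz: "of_int m * z = 1" using c xy unfolding z_def by (simp add: distrib_left mult.assoc)
    then have "z = 1 / of_int m" using \<open>m ~= 0\<close> by (simp add: field_simps)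
    then have "z : \<rat>" by simp
    then have "z : \<int>" using rational_algebraic_int_is_int zO O_iff by blast
    then obtain k where "z = of_int k" by (auto elim: Ints_cases)
    then have "m * k = 1" using mz by (metis of_int_eq_1_iff of_int_mult)
    then show ?thesis by (metis dvd_triv_left)
   qed
  qed
  then obtain u v where uv: "u * c 0 + v * c 1 = 1" by (metis bezout_int coprime_iff_gcd_eq_1)
  \<comment> \<open>Completes 1 to an integral basis: its coordinates are coprime, and their Bezout
    coefficients give a base change of determinant 1.\<close>
  define w where "w = of_int (- v) * b 0 + of_int u * b 1"
  have wO: "w : OK" unfolding w_def using bO O_closed by auto
  define b' where "b' i = (if i = 0 then 1 else w)" for i :: nat
  have "zbasis b'"
  proof -
   define k where "k i j = (if j = 0 then c i else if i = 0 then - v else u)" for i j :: nat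
   have "disc b' = (det (mat n n (%(i, j). of_int (k i j) :: complex)))\<^sup>2 * disc b"
    by (rule disc_transform) (use bO O_K c w_def n2 in \<open>auto simp: b'_def k_def s2' less_2_cases_iff\<close>)
   also have "det (mat n n (%(i, j). of_int (k i j) :: complex)) = of_int (det (mat n n (%(i, j). k i j)))"
    by (rule det_of_int)
   also have "det (mat n n (%(i, j). k i j)) = 1"
    unfolding n2 using uv by (subst det_2) (auto simp: k_def algebra_simps)
   finally have db: "disc b' = disc b" by simp
   have b'O: "b' i : OK" for i unfolding b'_def using wO O_closed by auto
   have "disc b ~= 0" using disc_nonzero b unfolding zbasis_def by auto
   then have "indep b'" using db b'O O_K by (intro indepI_disc) auto
   moreover have "\<exists>e::nat => int. x = (\<Sum>i<n. of_int (e i) * b' i)" if x: "x : OK" for x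
   proof -
    obtain a :: "nat => int" where a: "x = of_int (a 0) * b 0 + of_int (a 1) * b 1"
     using coords_ex[OF b x] unfolding s2 by metis
    have b0: "b 0 = of_int u * 1 - of_int (c 1) * w"
    proof -
     have "of_int u * 1 - of_int (c 1) * w = of_int (u * c 0 + v * c 1) * b 0"
      unfolding w_def by (subst c) (simp add: algebra_simps)
     then show ?thesis unfolding uv by simp
    qed
    have b1: "b 1 = of_int v * 1 + of_int (c 0) * w"
    proof -
     have "of_int v * 1 + of_int (c 0) * w = of_int (u * c 0 + v * c 1) * b 1"
      unfolding w_def by (subst c) (simp add: algebra_simps)
     then show ?thesis unfolding uv by simp
    qed
    have "x = of_int (a 0 * u + a 1 * v) * 1 + of_int (a 1 * c 0 - a 0 * c 1) * w"
     unfolding a by (subst b0, subst b1) (simp add: algebra_simps)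
    then show ?thesis unfolding s2 b'_def
     by (intro exI[of _ "%i. if i = 0 then a 0 * u + a 1 * v else a 1 * c 0 - a 0 * c 1"]) simp
   qed
   ultimately show ?thesis unfolding zbasis_def using b'O by auto
  qed
  have coord: "\<exists>k l. x = of_int k + of_int l * w" if xO: "x : OK" for x
  proof -
   obtain c :: "nat => int" where "x = (\<Sum>i<n. of_int (c i) * b' i)"
    using coords_ex[OF \<open>zbasis b'\<close> xO] .
   then have "x = of_int (c 0) + of_int (c 1) * w" unfolding s2 b'_def by simp
   then show ?thesis by blast
  qed
  have indw: "k = 0 & l = 0" if "of_int k + of_int l * w = 0" for k l
  proof -
   let ?k = "%i. if i = 0 then k else l :: int"
   have "(\<Sum>i<n. of_rat (of_int (?k i)) * b' i) = 0" unfolding s2 b'_def using that by simp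
   then have "!!i. i < n ==> (of_int (?k i) :: rat) = 0"
    using \<open>zbasis b'\<close> indepD[of b' "%i. of_int (?k i)"] unfolding zbasis_def by blast
   from this[of 0] this[of 1] show ?thesis using n2 by simp
  qed
  obtain k l where kl: "w * w = of_int k + of_int l * w" using coord[OF O_closed(4)[OF wO wO]] by blast
  obtain t where t: "tr w = of_int t" using tr_int[OF wO] .
  have trww: "tr (w * w) = of_int (2 * k + l * t)"
   unfolding kl using wO O_K K_closed t n2 by (simp add: tr_add tr_scale tr_of_Rats)
  have dd: "of_int d = disc b'" using nf_disc_eq[OF \<open>zbasis b'\<close>] Q(3) by simp
  have "of_int d = (of_int (2 * (2 * k + l * t) - t * t) :: complex)"
   unfolding dd disc_def n2 using trww t n2
   by (subst det_2) (auto simp: b'_def tr_1)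
  then have d1: "d = 2 * (2 * k + l * t) - t * t" by (simp only: of_int_eq_iff)
  have lt: "l = t"
  proof -
   text \<open>The conjugate of \<open>w\<close> is \<open>t - w\<close>.\<close>
   have cardE: "card E = 2" using card_E n2 by simp
   let ?i = "%x. if x : Q then x else 0"
   obtain a a' where a: "E = {a, a'}" "a ~= a'" using cardE by (auto simp: card_2_iff)
   define \<sigma> where "\<sigma> = (if ?i = a then a' else a)"
   have \<sigma>: "E = {?i, \<sigma>}" "?i ~= \<sigma>" using a id_in_E unfolding \<sigma>_def by auto
   have wK: "w : Q" using wO O_K by auto
   have trs: "tr x = x + \<sigma> x" if "x : Q" for x
    unfolding nf_trace_def \<sigma>(1) using \<sigma>(2) that by simp
   have \<sigma>E: "\<sigma> : E" using \<sigma> by auto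
   have sw: "\<sigma> w = of_int t - w" using trs[OF wK] t by (simp add: algebra_simps)
   have "\<sigma> w * \<sigma> w = of_int k + of_int l * \<sigma> w"
    using arg_cong[OF kl, of \<sigma>] wK K_closed by (simp add: E[OF \<sigma>E])
   then have "(of_int t - w) * (of_int t - w) = of_int k + of_int l * (of_int t - w)" using sw by simp
   then have "of_int (t * t - l * t) + of_int (2 * l - 2 * t) * w = 0"
    using kl by (simp add: algebra_simps)
   then show ?thesis using indw by fastforce
  qed
  have d2: "d = t * t + 4 * k" using d1 lt by simp
  define r where "r = 2 * w - of_int t"
  have "r * r = 4 * (w * w) - 4 * of_int t * w + of_int t * of_int t"
   unfolding r_def by (simp add: algebra_simps)
  then have rr: "r * r = of_int d" unfolding kl d2 lt by (simp add: algebra_simps)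
  have rQ: "r : Q" unfolding r_def using wO O_K K_closed K_closed(11)[of 2] by auto
  \<comment> \<open>Integers have integral coordinates at \<open>w\<close>, and
    \<open>m (a + r) / a'\<close> has the coordinate \<open>2 m / a'\<close> there.\<close>
  have frac: False if m: "of_int m * (of_int a + r) = of_int a' * x" and "x : OK" "\<not> a' dvd 2 * m" for m a a' x
  proof -
   obtain k' l' where x: "x = of_int k' + of_int l' * w" using coord[OF \<open>x : OK\<close>] by auto
   have "of_int (m * a - m * t - a' * k') + of_int (2 * m - a' * l') * w = 0"
    using m unfolding x r_def by (simp add: algebra_simps)
   then have "2 * m - a' * l' = 0" using indw by blast
   then have "a' dvd 2 * m" by (metis dvd_triv_left eq_iff_diff_eq_0)
   then show False using \<open>\<not> a' dvd 2 * m\<close> by simp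
  qed
  have odd: "\<not> p\<^sup>2 dvd d" if p: "prime p" "p ~= 2" for p
  proof
   assume "p\<^sup>2 dvd d"
   then obtain e where e: "d = p\<^sup>2 * e" by auto
   have p0: "p ~= 0" using p by auto
   let ?x = "r / of_int p"
   have "?x ^ 2 = of_int e" using rr e p0 by (simp add: power2_eq_square field_simps)
   then have "algebraic_int ?x" using algebraic_int_power_imp[of ?x 2] by simp
   then have "?x : OK" using rQ K_closed O_iff by auto
   moreover have "\<not> p dvd 2 * 1"
    using p primes_dvd_imp_eq[of p 2] by auto
   ultimately show False using frac[of 1 0 p ?x] p0 by simp
  qed
  have "4 dvd d" if "2 dvd d"
  proof -
   have "2 dvd t * t" using that d2 by (metis dvd_add_left_iff dvd_mult dvd_mult2 dvd_triv_left even_numeral)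
   then have "even t" by simp
   then show ?thesis using d2 by auto
  qed
  moreover have "(d div 4) mod 4 = 2 \<or> (d div 4) mod 4 = 3" if d4: "4 dvd d"
  proof (rule ccontr)
   assume ne: "\<not> ?thesis"
   obtain m where m: "d = 4 * m" using d4 by auto
   have "m mod 4 = 0 \<or> m mod 4 = 1" using ne m by simp presburger
   then show False
   proof
    assume "m mod 4 = 0"
    then obtain e where e: "m = 4 * e" by auto
    let ?x = "r / 4"
    have "?x ^ 2 = of_int e" using rr m e by (simp add: power2_eq_square)
    then have "algebraic_int ?x" using algebraic_int_power_imp[of ?x 2] by simp
    then have "?x : OK" using rQ K_closed(8)[OF rQ, of 4] K_closed(11)[of 4] O_iff by auto
    then show False using frac[of 1 0 4 ?x] by simp
   next
    assume m1: "m mod 4 = 1"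
    define e where "e = m div 4"
    have e: "m = 4 * e + 1" unfolding e_def using m1 by presburger
    let ?x = "(2 + r) / 4"
    have rel: "?x * ?x - ?x = of_int e" using rr m e by (simp add: field_simps)
    have "algebraic_int ?x"
    proof (rule algebraic_int.intros[of "[: - of_int e, - 1, 1 :]"])
     show "poly [:- of_int e, - 1, 1:] ?x = 0" using rel by (simp add: algebra_simps)
     show "\<forall>i. coeff [:- of_int e, - 1, 1:] i : \<int>"
      by (auto simp: coeff_pCons split: nat.splits)
    qed simp
    then have "?x : OK"
     using K_closed(8)[OF K_closed(3)[OF K_closed(11)[of 2] rQ] K_closed(11)[of 4]] O_iff by simp
    then show False using frac[of 1 2 4 ?x] by simp
   qed
  qed
  ultimately show ?thesis using odd by blast
 qed
 then show "\<not> p\<^sup>2 dvd d" if "prime p" "p ~= 2" using that by blast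
 show "4 dvd d" if "2 dvd d" using * that by blast
 show "(d div 4) mod 4 = 2 \<or> (d div 4) mod 4 = 3" if "4 dvd d" using * that by blast
qed

section \<open>Norms and their behaviour under embeddings of another field\<close>

context numfield
begin

text \<open>The rational matrices are chosen before the parameters \<open>a\<close>. Hence the
  coefficients of the product are polynomials in the \<open>a k\<close> with rational coefficients,
  although the product is written with conjugates of \<open>K\<close>. The reason is that the
  regular representations of all elements are diagonalised simultaneously.\<close>

lemma norm_poly_det:
 assumes e: "indep e" and x: "x : K"
 shows "\<exists>C Bx. \<forall>a. det (mat n n (%(i, j). [:\<Sum>k<n. a k * of_rat (C k i j), of_rat (Bx i j):])) =
  (\<Prod>\<sigma>\<in>E. [:\<Sum>k<n. a k * \<sigma> (e k), \<sigma> x:])"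
proof -
 obtain f R where fK: "\<forall>i<n. f i : K"
  and R: "\<forall>i<n. \<forall>j<n. (\<Sum>k<n. em i (f k) * R k j) = (if i = j then 1 else 0)"
  and R': "\<forall>i<n. \<forall>j<n. (\<Sum>k<n. R i k * em k (f j)) = (if i = j then 1 else 0)"
  and "\<forall>x\<in>K. \<exists>c :: nat => rat. x = (\<Sum>i<n. of_rat (c i) * f i)"
  and B: "\<forall>x\<in>K. \<exists>B :: nat => nat => rat. \<forall>j<n. x * f j = (\<Sum>i<n. of_rat (B i j) * f i)"
  by (rule regular_representation)
 have eK: "!!k. k < n ==> e k : K" using e unfolding indep_def by auto
 obtain Bx :: "nat => nat => rat" where Bx: "\<forall>j<n. x * f j = (\<Sum>i<n. of_rat (Bx i j) * f i)"
  using B x by blast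
 have "\<forall>k. \<exists>C :: nat => nat => rat. k < n --> (\<forall>j<n. e k * f j = (\<Sum>i<n. of_rat (C i j) * f i))"
  using B eK by blast
 then obtain C :: "nat => nat => nat => rat"
  where C: "\<forall>k. k < n --> (\<forall>j<n. e k * f j = (\<Sum>i<n. of_rat (C k i j) * f i))"
  using choice[of "%k C. k < n --> (\<forall>j<n. e k * f j = (\<Sum>i<n. of_rat (C i j) * f i))"] by blast
 have emB: "em l y * em l (f j) = (\<Sum>i<n. em l (f i) * of_rat (b i))"
  if "l < n" "y : K" "j < n" "y * f j = (\<Sum>i<n. of_rat (b i) * f i)" for l y j b
 proof -
  have "em l y * em l (f j) = em l (y * f j)"
   using E(2)[OF em_E[OF that(1)] that(2), of "f j"] fK that(3) by simp
  also have "... = (\<Sum>i<n. of_rat (b i) * em l (f i))"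
   unfolding that(4) using em_E[OF that(1)] fK K_closed by (subst E_sum) (auto simp: E)
  finally show ?thesis by (simp add: mult.commute)
 qed
 have "det (mat n n (%(i, j). [:\<Sum>k<n. a k * of_rat (C k i j), of_rat (Bx i j):])) =
  (\<Prod>\<sigma>\<in>E. [:\<Sum>k<n. a k * \<sigma> (e k), \<sigma> x:])" for a
 proof -
 define Z where "Z i j = (\<Sum>k<n. a k * of_rat (C k i j))" for i j
 define Q where "Q = det (mat n n (%(i, j). [:Z i j, of_rat (Bx i j):]))"
 have "poly Q c = poly (\<Prod>\<sigma>\<in>E. [:\<Sum>k<n. a k * \<sigma> (e k), \<sigma> x:]) c" for c
 proof -
  define W where "W i j = Z i j + c * of_rat (Bx i j)" for i j
  define D where "D l = (\<Sum>k<n. a k * em l (e k)) + c * em l x" for l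
  have SW: "(\<Sum>i<n. em l (f i) * W i j) = D l * em l (f j)" if lj: "l < n" "j < n" for l j
  proof -
   have "(\<Sum>i<n. em l (f i) * W i j) =
     (\<Sum>i<n. \<Sum>k<n. a k * (em l (f i) * of_rat (C k i j))) + c * (\<Sum>i<n. em l (f i) * of_rat (Bx i j))"
    unfolding W_def Z_def by (simp add: sum.distrib sum_distrib_left algebra_simps)
   also have "(\<Sum>i<n. \<Sum>k<n. a k * (em l (f i) * of_rat (C k i j))) =
     (\<Sum>k<n. a k * (\<Sum>i<n. em l (f i) * of_rat (C k i j)))"
    by (subst sum.swap) (simp add: sum_distrib_left)
   also have "... = (\<Sum>k<n. a k * (em l (e k) * em l (f j)))"
    using emB[OF lj(1) eK lj(2)] C lj by (intro sum.cong refl) auto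
   also have "(\<Sum>i<n. em l (f i) * of_rat (Bx i j)) = em l x * em l (f j)"
    using emB[OF lj(1) x lj(2)] Bx lj by simp
   finally show ?thesis unfolding D_def by (simp add: distrib_right sum_distrib_right mult.assoc)
  qed
  let ?S = "%l i. em l (f i)"
  have "det (mat n n (%(i, j). ?S i j)) * det (mat n n (%(i, j). W i j)) =
    det (mat n n (%(i, j). D i * ?S i j * 1))"
   unfolding det_mat_prod[symmetric] by (intro arg_cong[of _ _ det] eq_matI) (auto simp: SW)
  also have "... = (\<Prod>l<n. D l) * det (mat n n (%(i, j). ?S i j))" by (subst det_scale) simp
  finally have eq: "det (mat n n (%(i, j). ?S i j)) * det (mat n n (%(i, j). W i j)) =
    (\<Prod>l<n. D l) * det (mat n n (%(i, j). ?S i j))" .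
  have "det (mat n n (%(i, j). ?S i j)) * det (mat n n (%(i, j). R i j)) = 1"
  proof -
   have "mat n n (%(i, j). \<Sum>k<n. ?S i k * R k j) = 1\<^sub>m n" using R by (intro eq_matI) auto
   then show ?thesis unfolding det_mat_prod[symmetric] by simp
  qed
  then have "det (mat n n (%(i, j). ?S i j)) ~= 0" by auto
  then have dW: "det (mat n n (%(i, j). W i j)) = (\<Prod>l<n. D l)" using eq by simp
  have "poly Q c = det (mat n n (%(i, j). W i j))"
  proof -
   have "comm_ring_hom (%p. poly p c)" by unfold_locales auto
   from det_hom[OF this, of n "%i j. [:Z i j, of_rat (Bx i j):]"]
   show ?thesis unfolding Q_def W_def by simp
  qed
  also have "... = poly (\<Prod>\<sigma>\<in>E. [:\<Sum>k<n. a k * \<sigma> (e k), \<sigma> x:]) c"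
   unfolding dW poly_prod prod_E by (simp add: D_def)
  finally show ?thesis .
 qed
 then have "Q = (\<Prod>\<sigma>\<in>E. [:\<Sum>k<n. a k * \<sigma> (e k), \<sigma> x:])" by (intro poly_eq_poly_eq_iff[THEN iffD1] ext)
 then show ?thesis unfolding Q_def Z_def .
 qed
 then show ?thesis by blast
qed

text \<open>The Leibniz expansion of the determinant contains only rational constants and the
  \<open>a k\<close>. So an embedding of any field containing the \<open>a k\<close> commutes with
  forming the product and leaves the conjugates of \<open>K\<close> alone. This takes the place of
  extending \<tau> to a common Galois closure.\<close>

lemma norm_poly_embedding:
 assumes F: "subfield F" and \<tau>: "\<tau> : embeddings F" and a: "!!k. k < n ==> a k : F"
  and e: "indep e" and x: "x : K"
 shows "coeff (\<Prod>\<sigma>\<in>E. [:\<Sum>k<n. a k * \<sigma> (e k), \<sigma> x:]) m : F"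
  "\<tau> (coeff (\<Prod>\<sigma>\<in>E. [:\<Sum>k<n. a k * \<sigma> (e k), \<sigma> x:]) m) = coeff (\<Prod>\<sigma>\<in>E. [:\<Sum>k<n. \<tau> (a k) * \<sigma> (e k), \<sigma> x:]) m"
proof -
 note Fc = subfieldD[OF F] and \<tau>c = embeddingsD[OF \<tau> F]
 \<comment> \<open>\<open>q\<close> is the image of \<open>p\<close> under \<tau>, coefficient by
   coefficient. The relation survives all operations of the Leibniz expansion.\<close>
 define R where "R p q \<longleftrightarrow> (\<forall>i. coeff p i : F & coeff q i = \<tau> (coeff p i))" for p q
 have R_add: "R (p + p') (q + q')" if "R p q" "R p' q'" for p q p' q'
  using that Fc \<tau>c unfolding R_def by simp
 have R_mult: "R (p * p') (q * q')" if "R p q" "R p' q'" for p q p' q'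
  using that Fc \<tau>c unfolding R_def coeff_mult
  by (auto intro!: subfield_sum[OF F] simp: embeddings_sum[OF \<tau> F])
 have R_const: "R 0 0" "R 1 1" "R (- 1) (- 1)"
  using Fc \<tau>c unfolding R_def by (auto simp: coeff_1)
 have R_sum: "R (sum p I) (sum q I)" if "!!i. i : I ==> R (p i) (q i)" for p q and I :: "(nat => nat) set"
  using that by (induction I rule: infinite_finite_induct) (auto intro: R_const R_add)
 have R_prod: "R (prod p I) (prod q I)" if "!!i. i : I ==> R (p i) (q i)" for p q and I :: "nat set"
  using that by (induction I rule: infinite_finite_induct) (auto intro: R_const R_mult)
 obtain C Bx where C: "\<forall>a. det (mat n n (%(i, j). [:\<Sum>k<n. a k * of_rat (C k i j), of_rat (Bx i j):])) =
   (\<Prod>\<sigma>\<in>E. [:\<Sum>k<n. a k * \<sigma> (e k), \<sigma> x:])" using norm_poly_det[OF e x] by blast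
 have "R [:\<Sum>k<n. a k * of_rat (C k i j), of_rat (Bx i j):] [:\<Sum>k<n. \<tau> (a k) * of_rat (C k i j), of_rat (Bx i j):]" for i j
 proof -
  have z: "(\<Sum>k<n. a k * of_rat (C k i j)) : F" using a Fc by (intro subfield_sum[OF F]) auto
  have "\<tau> (\<Sum>k<n. a k * of_rat (C k i j)) = (\<Sum>k<n. \<tau> (a k * of_rat (C k i j)))"
   using a Fc by (intro embeddings_sum[OF \<tau> F]) auto
  also have "... = (\<Sum>k<n. \<tau> (a k) * of_rat (C k i j))" using a Fc \<tau>c by (intro sum.cong) auto
  finally show ?thesis using z Fc \<tau>c unfolding R_def by (auto simp: coeff_pCons split: nat.split)
 qed
 moreover have "R (signof q) (signof q)" for q :: "nat => nat" using R_const by (simp add: sign_def)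
 ultimately have "R (\<Prod>\<sigma>\<in>E. [:\<Sum>k<n. a k * \<sigma> (e k), \<sigma> x:]) (\<Prod>\<sigma>\<in>E. [:\<Sum>k<n. \<tau> (a k) * \<sigma> (e k), \<sigma> x:])"
  unfolding C[rule_format, symmetric] prod_if_det by (intro R_sum R_mult R_prod) auto
 then show "coeff (\<Prod>\<sigma>\<in>E. [:\<Sum>k<n. a k * \<sigma> (e k), \<sigma> x:]) m : F"
  "\<tau> (coeff (\<Prod>\<sigma>\<in>E. [:\<Sum>k<n. a k * \<sigma> (e k), \<sigma> x:]) m) = coeff (\<Prod>\<sigma>\<in>E. [:\<Sum>k<n. \<tau> (a k) * \<sigma> (e k), \<sigma> x:]) m"
  unfolding R_def by auto
qed

lemma norm_poly:
 assumes F: "subfield F" and a: "!!k. k < n ==> a k : F" and e: "indep e" and x: "x : K"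
 shows "(\<Prod>\<sigma>\<in>E. [:\<Sum>k<n. a k * \<sigma> (e k), \<sigma> x:]) : poly_over F"
proof -
 have "(%x. if x : F then x else 0) : embeddings F"
  unfolding embeddings_def using subfieldD[OF F] by auto
 from norm_poly_embedding(1)[OF F this a e x] show ?thesis by (intro poly_overI)
qed

lemma norm_poly_Rats:
 assumes w: "w : K" and x: "x : K" shows "(\<Prod>\<sigma>\<in>E. [:\<sigma> w, \<sigma> x:]) : poly_over \<rat>"
proof -
 obtain b where "zbasis b" by (rule zbasis_ex)
 then have b: "indep b" unfolding zbasis_def by auto
 obtain c :: "nat => rat" where c: "w = (\<Sum>i<n. of_rat (c i) * b i)" using indep_span[OF b w] by blast
 have bK: "!!i. i < n ==> b i : K" using b unfolding indep_def by auto
 have "(\<Sum>k<n. of_rat (c k) * \<sigma> (b k)) = \<sigma> w" if "\<sigma> : E" for \<sigma>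
  unfolding c using that bK K_closed by (subst E_sum) (auto simp: E)
 then have "(\<Prod>\<sigma>\<in>E. [:\<sigma> w, \<sigma> x:]) = (\<Prod>\<sigma>\<in>E. [:\<Sum>k<n. of_rat (c k) * \<sigma> (b k), \<sigma> x:])" by simp
 then show ?thesis using norm_poly[OF subfield_Rats _ b x, of "%k. of_rat (c k)"] by simp
qed

lemma norm_Rats: assumes "w : K" shows "(\<Prod>\<sigma>\<in>E. \<sigma> w) : \<rat>"
proof -
 have "coeff (\<Prod>\<sigma>\<in>E. [:\<sigma> w, \<sigma> 1:]) 0 = (\<Prod>\<sigma>\<in>E. \<sigma> w)"
  by (simp add: poly_0_coeff_0[symmetric] poly_prod)
 then show ?thesis using poly_overD[OF norm_poly_Rats[OF assms K_closed(2)], of 0] by simp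
qed

lemma norm_Ints: assumes "w : OK" shows "(\<Prod>\<sigma>\<in>E. \<sigma> w) : \<int>"
 by (rule rational_algebraic_int_is_int)
   (auto intro: algebraic_int_prod emb_algebraic_int norm_Rats assms O_K)

text \<open>The characteristic polynomial of \<open>b\<close> has rational coefficients whose
  denominators are powers of \<open>p\<close>; they lie in \<open>A\<close>, so they are integers. A
  single place suffices because all conjugates are tested at it.\<close>

lemma local_integral:
 assumes A: "place p A" and b: "b : K" "of_nat p * b : OK" and loc: "!!\<sigma>. \<sigma> : E ==> \<sigma> b : A"
 shows "b : OK"
proof -
 interpret place p A by fact
 let ?Q = "\<Prod>\<sigma>\<in>E. [:\<sigma> (- b), \<sigma> 1:]"
 have Q: "?Q = (\<Prod>\<sigma>\<in>E. [:- \<sigma> b, 1:])" using b by (simp add: E)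
 have deg: "degree ?Q = n" "lead_coeff ?Q = 1"
 proof -
  have "degree (\<Prod>\<sigma>\<in>E. [:- \<sigma> b, 1:]) = (\<Sum>\<sigma>\<in>E. degree [:- \<sigma> b, 1:])"
   by (rule degree_prod_eq_sum_degree) auto
  then show "degree ?Q = n" unfolding Q using card_E by simp
  show "lead_coeff ?Q = 1" unfolding Q lead_coeff_prod by simp
 qed
 have coA: "coeff (\<Prod>\<sigma>\<in>I. [:- \<sigma> b, 1:]) i : A" if "I \<subseteq> E" for I i
 proof -
  have "finite I" using that finite_E finite_subset by auto
  then show ?thesis using that
  proof (induction I arbitrary: i)
   case empty then show ?case using A_0 A_1 by (cases i) (auto simp: coeff_1)
  next
   case (insert \<sigma> I)
   have "coeff [:- \<sigma> b, 1:] j : A" for j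
    using loc[of \<sigma>] insert.prems A_minus A_0 A_1 by (auto simp: coeff_pCons split: nat.splits)
   then show ?case using insert by (auto simp: coeff_mult simp del: mult_pCons_left intro!: A_sum A_mult)
  qed
 qed
 have coint: "algebraic_int (of_nat p ^ card I * coeff (\<Prod>\<sigma>\<in>I. [:- \<sigma> b, 1:]) i)" if "I \<subseteq> E" for I i
 proof -
  have "finite I" using that finite_E finite_subset by auto
  then show ?thesis using that
  proof (induction I arbitrary: i)
   case empty then show ?case by (cases i) (auto simp: coeff_1)
  next
   case (insert \<sigma> I)
   have s: "\<sigma> : E" using insert.prems by auto
   have "of_nat p * \<sigma> b = \<sigma> (of_nat p * b)" using E[OF s] b K_closed by simp
   then have "algebraic_int (of_nat p * \<sigma> b)" using emb_algebraic_int[OF s b(2)] by simp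
   then have l: "algebraic_int (of_nat p * coeff [:- \<sigma> b, 1:] j)" for j
    by (auto simp: coeff_pCons split: nat.splits)
   have "of_nat p ^ card (insert \<sigma> I) * coeff (\<Prod>\<sigma>\<in>insert \<sigma> I. [:- \<sigma> b, 1:]) i =
     (\<Sum>j\<le>i. (of_nat p * coeff [:- \<sigma> b, 1:] j) * (of_nat p ^ card I * coeff (\<Prod>\<sigma>\<in>I. [:- \<sigma> b, 1:]) (i - j)))"
    using insert.hyps by (simp add: coeff_mult sum_distrib_left ac_simps del: mult_pCons_left mult_pCons_right)
   also have "algebraic_int ..."
    by (intro algebraic_int_sum algebraic_int_add_mult(2)[OF l]) (use insert in auto)
   finally show ?case .
  qed
 qed
 have "coeff ?Q i : \<int>" for i
 proof -
  have r: "coeff ?Q i : \<rat>" using poly_overD[OF norm_poly_Rats[of "- b" 1]] b K_closed by simp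
  have "of_nat p ^ n * coeff ?Q i : \<int>"
   by (rule rational_algebraic_int_is_int) (use coint[of E i] r card_E in \<open>auto simp: Q\<close>)
  then obtain k where k: "of_nat p ^ n * coeff ?Q i = of_int k" by (auto elim: Ints_cases)
  then have e: "coeff ?Q i = of_int k / of_nat p ^ n" using p0 by (simp add: field_simps)
  then have "int p ^ n dvd k" using coA[of E i] A_divide_power_int by (simp add: Q)
  then obtain j where "k = int p ^ n * j" by auto
  then show ?thesis using e p0 by simp
 qed
 moreover have "poly ?Q b = 0"
 proof -
  let ?i = "%x. if x : K then x else 0"
  have "poly [:- ?i b, 1:] b = 0" using b by simp
  then show ?thesis unfolding Q poly_prod using id_in_E finite_E
   by (intro prod_zero) (auto intro!: bexI[of _ ?i])
 qed
 ultimately have "algebraic_int b" using deg by (intro algebraic_int.intros[of ?Q]) auto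
 then show ?thesis using b O_iff by simp
qed

section \<open>Finite residue rings and annihilators that are prime\<close>

lemma residues_finite:
 assumes "m > 0"
 shows "\<exists>R. finite R & R \<subseteq> OK & (\<forall>y\<in>OK. \<exists>r\<in>R. y - r : pO m)"
proof -
 obtain b where b: "zbasis b" by (rule zbasis_ex)
 define R where "R = (%c. \<Sum>i<n. of_int (c i) * b i) ` ({..<n} \<rightarrow>\<^sub>E {0..<m})"
 have "finite R" unfolding R_def by (intro finite_imageI finite_PiE) auto
 moreover have "R \<subseteq> OK" unfolding R_def using b O_closed by (auto intro!: O_sum simp: zbasis_def)
 moreover have "\<exists>r\<in>R. y - r : pO m" if y: "y : OK" for y
 proof -
  obtain c where c: "y = (\<Sum>i<n. of_int (c i) * b i)" using coords_ex[OF b y] .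
  define c' where "c' = restrict (%i. c i mod m) {..<n}"
  have "(\<Sum>i<n. of_int (c' i) * b i) : R"
   unfolding R_def by (rule imageI) (use assms in \<open>auto simp: c'_def PiE_iff extensional_def\<close>)
  moreover have d: "y - (\<Sum>i<n. of_int (c' i) * b i) = (\<Sum>i<n. of_int (c i - c i mod m) * b i)"
   unfolding c c'_def by (simp add: sum_subtractf left_diff_distrib)
  have "y - (\<Sum>i<n. of_int (c' i) * b i) : pO m"
   unfolding zbasis_pO[OF b d, of m, simplified] using assms zbasis_pO[OF b d, of m] by auto
  ultimately show ?thesis by blast
 qed
 ultimately show ?thesis by (intro exI[of _ R]) auto
qed

lemma pigeonhole_residues:
 fixes f :: "nat => complex"
 assumes "m > 0" "!!i. f i : OK"
 shows "\<exists>i j. i < j & f i - f j : pO m"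
proof -
 obtain R where R: "finite R" "\<forall>y\<in>OK. \<exists>r\<in>R. y - r : pO m" using residues_finite[OF assms(1)] by blast
 have "\<forall>i. \<exists>r. r : R & f i - r : pO m" using R(2) assms(2) by blast
 then obtain r where r: "\<forall>i. r i : R & f i - r i : pO m"
  using choice[of "%i r. r : R & f i - r : pO m"] by blast
 have "\<not> inj r"
 proof
  assume "inj r"
  then have "infinite (range r)" by (rule range_inj_infinite)
  moreover have "range r \<subseteq> R" using r by auto
  ultimately show False using R(1) finite_subset by blast
 qed
 then obtain i j where ij: "i ~= j" "r i = r j" unfolding inj_def by blast
 have "f a - f b : pO m" if "r a = r b" for a b
 proof -
  have "(f a - r a) - (f b - r b) : pO m" using r pO_closed(3) by blast
  then show ?thesis using that by simp
 qed
 then show ?thesis using ij by (metis nat_neq_iff)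
qed

text \<open>Among the multiples \<open>w * x\<close> not divisible by \<open>m\<close> take one
  killed by the largest number of residues. Its annihilator modulo \<open>m\<close> cannot be
  enlarged by a further multiplication, hence it is prime.\<close>

lemma associated_prime:
 assumes m: "m > 0" and x: "x : OK" "x ~: pO m"
 obtains w where "w : OK" "w * x ~: pO m"
  "\<forall>a\<in>OK. \<forall>b\<in>OK. w * x * (a * b) : pO m --> w * x * a : pO m \<or> w * x * b : pO m"
proof -
 obtain R where R: "finite R" "R \<subseteq> OK" "\<forall>y\<in>OK. \<exists>r\<in>R. y - r : pO m" using residues_finite[OF m] by blast
 define N where "N w = card {r : R. w * x * r : pO m}" for w
 let ?Q = "%w. w : OK & w * x ~: pO m"
 have "?Q 1" using x O_closed by simp
 moreover have "\<forall>w. ?Q w --> N w <= card R" unfolding N_def using R(1) by (auto intro!: card_mono)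
 ultimately have "\<exists>w. ?Q w & (\<forall>w'. ?Q w' --> N w' <= N w)"
  by (intro ex_has_greatest_nat[of ?Q 1 N "card R + 1"]) (auto simp: less_Suc_eq_le)
 then obtain w where w: "w : OK" "w * x ~: pO m" and max: "!!w'. w' : OK ==> w' * x ~: pO m ==> N w' <= N w"
  by blast
 have "w * x * a : pO m \<or> w * x * b : pO m" if ab: "a : OK" "b : OK" "w * x * (a * b) : pO m" for a b
 proof (rule disjCI)
  assume nb: "w * x * b ~: pO m"
  have wb: "w * b : OK" using w ab O_closed by auto
  let ?U = "{r : R. w * x * r : pO m}" and ?V = "{r : R. w * b * x * r : pO m}"
  have "?U \<subseteq> ?V"
  proof
   fix r assume "r : ?U"
   then have "r : R" "w * x * r * b : pO m" using pO_closed(4) ab by auto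
   then show "r : ?V" by (simp add: ac_simps)
  qed
  moreover have "card ?V <= card ?U" using max[OF wb] nb unfolding N_def by (simp add: ac_simps)
  ultimately have eq: "?U = ?V" using R(1) by (intro card_seteq) auto
  obtain r where r: "r : R" "a - r : pO m" using R(3) ab by blast
  have "w * b * x * a : pO m" using ab(3) by (simp add: ac_simps)
  moreover have "w * b * x * (a - r) : pO m" using wb x O_closed by (intro pO_closed(5)[OF _ r(2)]) auto
  ultimately have "w * b * x * a - w * b * x * (a - r) : pO m" by (rule pO_closed(3))
  then have "r : ?V" using r by (simp add: algebra_simps)
  then have "w * x * r : pO m" using eq by auto
  moreover have "w * x * (a - r) : pO m" using w x r O_closed by (intro pO_closed(5)) auto
  ultimately have "w * x * r + w * x * (a - r) : pO m" by (rule pO_closed(2))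
  then show "w * x * a : pO m" by (simp add: algebra_simps)
 qed
 then show ?thesis using that[of w] w by blast
qed

end

section \<open>Local structure at a prime ideal and its ramification index\<close>

lemma ideal_mult_mem: "a : I ==> b : J ==> a * b : ideal_mult I J"
 unfolding ideal_mult_def by (intro CollectI exI[of _ "[a]"] exI[of _ "[b]"]) auto

lemma ideal_mult_0: "0 : ideal_mult I J"
 unfolding ideal_mult_def by (intro CollectI exI[of _ "[]"]) auto

lemma ideal_mult_add: assumes "x : ideal_mult I J" "y : ideal_mult I J" shows "x + y : ideal_mult I J"
proof -
 obtain as bs where 1: "length as = length bs" "set as \<subseteq> I" "set bs \<subseteq> J" "x = sum_list (map2 (*) as bs)"
  using assms(1) unfolding ideal_mult_def by auto
 obtain cs ds where 2: "length cs = length ds" "set cs \<subseteq> I" "set ds \<subseteq> J" "y = sum_list (map2 (*) cs ds)"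
  using assms(2) unfolding ideal_mult_def by auto
 show ?thesis unfolding ideal_mult_def
  by (intro CollectI exI[of _ "as @ cs"] exI[of _ "bs @ ds"]) (use 1 2 in auto)
qed

lemma ideal_mult_subset:
 assumes "0 : S" "!!x y. x : S ==> y : S ==> x + y : S" "!!a b. a : I ==> b : J ==> a * b : S"
 shows "ideal_mult I J \<subseteq> S"
proof
 fix x assume "x : ideal_mult I J"
 then obtain as bs where h: "length as = length bs" "set as \<subseteq> I" "set bs \<subseteq> J" "x = sum_list (map2 (*) as bs)"
  unfolding ideal_mult_def by auto
 from h(1-3) have "sum_list (map2 (*) as bs) : S"
  by (induction as bs rule: list_induct2) (use assms in auto)
 then show "x : S" using h by simp
qed

text \<open>A prime ideal \<open>P\<close> that is the annihilator of \<open>x\<close> modulo \<open>p\<close>. Since \<open>(x / p) P\<close> is integral,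
 \<open>P\<close> is locally generated by one element \<open>\<pi>\<close>.\<close>
locale local_prime = numfield +
 fixes p :: nat and x :: complex
 assumes p: "prime p" and x: "x : ring_of_integers K" and xp: "x ~: pO (int p)"
  and prime_ann: "\<forall>a\<in>ring_of_integers K. \<forall>b\<in>ring_of_integers K. x * (a * b) : pO (int p) -->
   x * a : pO (int p) \<or> x * b : pO (int p)"
begin

abbreviation pI :: "complex set" where "pI \<equiv> pO (int p)"

definition P :: "complex set" where "P = {y : OK. x * y : pI}"

lemma p_pos: "p > 0" using p by (simp add: prime_gt_0_nat)
lemma pc0: "(of_nat p :: complex) ~= 0" using p_pos by simp

lemma pI_E: assumes "y : pI" obtains z where "z : OK" "y = of_nat p * z"
 using assms unfolding pO_def by auto

lemma pI_I: "z : OK ==> of_nat p * z : pI" unfolding pO_def by auto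

lemma P_O: "y : P ==> y : OK" unfolding P_def by simp
lemma P_add: "y : P ==> z : P ==> y + z : P"
 unfolding P_def using O_closed pO_closed(2) by (auto simp: distrib_left)
lemma P_minus: "y : P ==> - y : P" unfolding P_def using O_closed pO_closed(6) by auto
lemma P_diff: "y : P ==> z : P ==> y - z : P" using P_add[of y "- z"] P_minus by simp
lemma P_mult: "y : P ==> z : OK ==> z * y : P"
 unfolding P_def using O_closed pO_closed(5)[of z "x * y"] by (auto simp: ac_simps)
lemma P_mult2: "y : P ==> z : OK ==> y * z : P" using P_mult by (simp add: mult.commute)
lemma P_1: "1 ~: P" unfolding P_def using xp by simp
lemma P_0: "0 : P" unfolding P_def using O_closed pO_closed by simp
lemma pI_P: "y : pI ==> y : P" unfolding P_def using pO_closed(5) pO_O x by auto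
lemma P_p: "of_nat p : P" using pI_P[OF pI_I[OF O_closed(2)]] by simp
lemma P_prime: "a : OK ==> b : OK ==> a * b : P ==> a : P \<or> b : P"
 unfolding P_def using prime_ann by auto
lemma P_power: "a : OK ==> a ^ k : P ==> a : P"
proof (induction k)
 case (Suc k) then show ?case using P_prime[of a "a ^ k"] O_closed(9) by auto
qed (use P_1 in simp)

text \<open>Two powers of \<open>s\<close> agree modulo \<open>p\<close>; cancelling the smaller one
  at the prime ideal leaves a positive power of \<open>s\<close> congruent to 1.\<close>

lemma P_unit:
 assumes s: "s : OK" "s ~: P" shows "\<exists>a\<in>OK. 1 - s * a : P"
proof -
 obtain i j where ij: "i < j" "s ^ i - s ^ j : pI"
  using pigeonhole_residues[of "int p" "%i. s ^ i"] p_pos s O_closed by auto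
 have "s ^ j = s ^ i * s ^ (j - i)" using ij(1) by (simp flip: power_add)
 then have "s ^ i * (1 - s ^ (j - i)) : P" using pI_P[OF ij(2)] by (simp add: right_diff_distrib)
 moreover have "s ^ i ~: P" using P_power s by blast
 moreover have "s ^ i : OK" "1 - s ^ (j - i) : OK" using s O_closed by auto
 ultimately have "1 - s ^ (j - i) : P" using P_prime[of "s ^ i" "1 - s ^ (j - i)"] by simp
 moreover have "j - i = Suc (j - i - 1)" using ij(1) by simp
 then have "s ^ (j - i) = s * s ^ (j - i - 1)" by (metis power_Suc)
 ultimately show ?thesis using s O_closed by (intro bexI[of _ "s ^ (j - i - 1)"]) auto
qed

text \<open>Multiplication by \<open>\<alpha> = x / p\<close> maps \<open>P\<close> into the
  integers. It cannot preserve \<open>P\<close>, for then \<alpha> would be integral, against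
  \<open>xp\<close>. So some \<pi> in \<open>P\<close> is sent to an element \<open>u\<close>
  outside \<open>P\<close>, and \<open>u * y = \<pi> * (\<alpha> * y)\<close> for all
  \<open>y\<close> in \<open>P\<close>.\<close>

lemma local_generator:
 obtains \<pi> u where "\<pi> : P" "u : OK" "u ~: P" "u * of_nat p = \<pi> * x" "\<forall>y\<in>P. \<exists>z\<in>OK. u * y = \<pi> * z"
proof -
 define \<alpha> where "\<alpha> = x / of_nat p"
 have \<alpha>K: "\<alpha> : K" unfolding \<alpha>_def using x O_K K_closed by auto
 have \<alpha>P: "\<alpha> * y : OK" if y: "y : P" for y
 proof -
  have "x * y : pI" using y unfolding P_def by simp
  then obtain z where "z : OK" "x * y = of_nat p * z" by (rule pI_E)
  then show ?thesis unfolding \<alpha>_def using pc0 by simp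
 qed
 have "\<exists>\<pi>\<in>P. \<alpha> * \<pi> ~: P"
 proof (rule ccontr)
  assume "\<not> ?thesis"
  then have st: "!!y. y : P ==> \<alpha> * y : P" by blast
  obtain R where R: "finite R" "R \<subseteq> OK" "\<forall>y\<in>OK. \<exists>r\<in>R. y - r : pI"
   using residues_finite[of "int p"] p_pos by (metis of_nat_0_less_iff)
  obtain b where b: "zbasis b" by (rule zbasis_ex)
  have bO: "!!i. i < n ==> b i : OK" using b unfolding zbasis_def by auto
  \<comment> \<open>The residues lying in \<open>P\<close> together with \<open>p\<close> times an
    integral basis generate \<open>P\<close> as a lattice.\<close>
  define V where "V = (R \<inter> P) \<union> (%i. of_nat p * b i) ` {..<n}"
  have fin: "finite V" unfolding V_def using R by auto
  have VP: "V \<subseteq> P" unfolding V_def using pI_P[OF pI_I] bO by auto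
  have span: "y : int_span V" if y: "y : P" for y
  proof -
   obtain r where r: "r : R" "y - r : pI" using R(3) P_O[OF y] by blast
   have "y - (y - r) : P" using P_diff[OF y pI_P[OF r(2)]] .
   then have rV: "r : V" unfolding V_def using r by auto
   obtain z where z: "z : OK" "y - r = of_nat p * z" using pI_E[OF r(2)] .
   obtain c where c: "z = (\<Sum>i<n. of_int (c i) * b i)" using coords_ex[OF b z(1)] .
   have "y - r = (\<Sum>i<n. of_int (c i) * (of_nat p * b i))"
    unfolding z(2) c by (simp add: sum_distrib_left ac_simps)
   also have "... : int_span V"
    by (intro int_span_sum int_span_smult int_span_base[OF fin]) (auto simp: V_def)
   finally have "r + (y - r) : int_span V" by (rule int_span_add[OF int_span_base[OF fin rV]])
   then show ?thesis by simp
  qed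
  have "b 0 ~= 0"
  proof
   assume "b 0 = 0"
   then have "(\<Sum>i<n. of_rat (if i = 0 then 1 else 0) * b i) = 0" by (intro sum.neutral) auto
   then have "(if (0::nat) = 0 then 1 else 0) = (0::rat)"
    using b indepD[of b "%i. if i = 0 then 1 else 0" 0] n_pos unfolding zbasis_def by blast
   then show False by simp
  qed
  then have "of_nat p * b 0 : V" "of_nat p * b 0 ~= 0" unfolding V_def using n_pos pc0 by auto
  then have "algebraic_int \<alpha>"
   using algebraic_int_stable_span[OF fin] span st VP by blast
  then have "\<alpha> : OK" using \<alpha>K O_iff by simp
  then have "of_nat p * \<alpha> : pI" by (rule pI_I)
  then show False using xp pc0 unfolding \<alpha>_def by simp
 qed
 then obtain \<pi> where \<pi>: "\<pi> : P" "\<alpha> * \<pi> ~: P" by blast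
 show ?thesis
 proof (rule that[of \<pi> "\<alpha> * \<pi>"])
  show "\<alpha> * \<pi> * of_nat p = \<pi> * x" unfolding \<alpha>_def using pc0 by simp
  show "\<forall>y\<in>P. \<exists>z\<in>OK. \<alpha> * \<pi> * y = \<pi> * z"
   using \<alpha>P by (auto intro!: bexI[of _ "\<alpha> * _"])
 qed (use \<pi> \<alpha>P in auto)
qed

lemma ideal_pow_facts:
 "0 : ideal_pow OK P m" "y : ideal_pow OK P m ==> z : ideal_pow OK P m ==> y + z : ideal_pow OK P m"
 "ideal_pow OK P m \<subseteq> OK" "y : ideal_pow OK P m ==> z : OK ==> z * y : ideal_pow OK P m"
 "y : P ==> y ^ m : ideal_pow OK P m"
proof -
 show "0 : ideal_pow OK P m" by (cases m) (auto simp: ideal_mult_0 O_closed)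
 show add: "y + z : ideal_pow OK P m" if "y : ideal_pow OK P m" "z : ideal_pow OK P m" for y z
  using that by (cases m) (auto simp: ideal_mult_add O_closed)
 show sub: "ideal_pow OK P m \<subseteq> OK"
 proof (induction m)
  case (Suc m)
  have "ideal_mult P (ideal_pow OK P m) \<subseteq> OK"
   by (rule ideal_mult_subset) (use Suc P_O O_closed in auto)
  then show ?case by simp
 qed simp
 show "z * y : ideal_pow OK P m" if "y : ideal_pow OK P m" "z : OK" for y z
 proof (cases m)
  case (Suc k)
  let ?S = "{y. z * y : ideal_mult P (ideal_pow OK P k)}"
  have "ideal_mult P (ideal_pow OK P k) \<subseteq> ?S"
  proof (rule ideal_mult_subset)
   fix a b assume "a : P" "b : ideal_pow OK P k"
   then have "(z * a) * b : ideal_mult P (ideal_pow OK P k)" using P_mult that by (intro ideal_mult_mem) auto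
   then show "a * b : ?S" by (simp add: mult.assoc)
  qed (auto simp: ideal_mult_0 ideal_mult_add distrib_left)
  then show ?thesis using that Suc by auto
 qed (use that O_closed in auto)
 show "y : P ==> y ^ m : ideal_pow OK P m"
  by (induction m) (auto intro: ideal_mult_mem O_closed)
qed

lemma ideal_pow_P: "m > 0 ==> ideal_pow OK P m \<subseteq> P"
proof (cases m)
 case (Suc k)
 have "ideal_mult P (ideal_pow OK P k) \<subseteq> P"
  by (rule ideal_mult_subset) (use P_0 P_add P_mult2 subsetD[OF ideal_pow_facts(3)] in auto)
 then show ?thesis using Suc by simp
qed simp

lemma is_prime: "nonzero_prime_ideal OK P"
proof -
 have "P ~= OK" using P_1 O_closed by auto
 moreover have "P ~= {0}" using P_p pc0 by auto
 moreover have "is_ideal_in OK P" unfolding is_ideal_in_def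
  using P_O P_0 P_add P_minus P_mult by auto
 ultimately show ?thesis unfolding nonzero_prime_ideal_def using P_prime by auto
qed

text \<open>Localised at \<open>P\<close>, where \<open>s\<close>, \<open>u\<close> and
  \<open>v\<close> are units, this says that \<open>p\<close> is a unit times
  \<open>\<pi> ^ e\<close>. The exponent is the largest one for which some multiple of
  \<open>p\<close> by an element outside \<open>P\<close> is divisible by that power of
  \<pi>.\<close>

lemma local_structure:
 obtains e \<pi> u s v where "\<pi> : P" "s : OK" "s ~: P" "v : OK" "v ~: P" "s * of_nat p = \<pi> ^ e * v"
  "u : OK" "u ~: P" "\<forall>y\<in>ideal_pow OK P e. v * u ^ e * y : pI" "e \<ge> 1" "x : P --> e \<ge> 2"
  "ram_index K P (int p) = e"
proof -
 obtain \<pi> u where \<pi>: "\<pi> : P" and u: "u : OK" "u ~: P" and ux: "u * of_nat p = \<pi> * x"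
  and uP: "\<forall>y\<in>P. \<exists>z\<in>OK. u * y = \<pi> * z" by (rule local_generator)
 have \<pi>O: "\<pi> : OK" using P_O[OF \<pi>] .
 have uk: "u ^ k : OK" "u ^ k ~: P" for k using u O_closed(9) P_power by blast+
 define Q where "Q j \<longleftrightarrow> (\<exists>s\<in>OK - P. \<exists>v\<in>OK. s * of_nat p = \<pi> ^ j * v)" for j
 have \<pi>0: "\<pi> ~= 0"
 proof
  assume "\<pi> = 0"
  then have "u = 0" using ux pc0 by simp
  then show False using u P_0 by simp
 qed
 \<comment> \<open>Two powers of \<pi> agree modulo \<open>p\<close>, so \<open>\<pi> ^ i\<close>
   times an element outside \<open>P\<close> is a multiple of \<open>p\<close>; this bounds the
   exponents.\<close>
 obtain i where bound: "!!k. Q k ==> k <= i"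
 proof -
  obtain i j where ij: "i < j" "\<pi> ^ i - \<pi> ^ j : pI"
   using pigeonhole_residues[of "int p" "%i. \<pi> ^ i"] p_pos \<pi>O O_closed by auto
  define w where "w = 1 - \<pi> ^ (j - i)"
  obtain c where c: "c : OK" "\<pi> ^ i - \<pi> ^ j = of_nat p * c" using pI_E[OF ij(2)] .
  have "\<pi> ^ j = \<pi> ^ i * \<pi> ^ (j - i)" using ij(1) by (simp flip: power_add)
  then have wc: "\<pi> ^ i * w = of_nat p * c" using c(2) unfolding w_def by (simp add: right_diff_distrib)
  have wO: "w : OK" unfolding w_def using \<pi>O O_closed by auto
  have "j - i = Suc (j - i - 1)" using ij(1) by simp
  then have "\<pi> ^ (j - i) = \<pi> * \<pi> ^ (j - i - 1)" by (metis power_Suc)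
  then have "\<pi> ^ (j - i) : P" using P_mult2[OF \<pi>] \<pi>O O_closed by simp
  then have wP: "w ~: P" unfolding w_def using P_1 P_add by (metis diff_add_cancel)
  have "k <= i" if k: "Q k" for k
  proof (rule ccontr)
   assume ki: "\<not> k <= i"
   obtain s v where sv: "s : OK" "s ~: P" "v : OK" "s * of_nat p = \<pi> ^ k * v" using k unfolding Q_def by auto
   have "\<pi> ^ i * (s * w) = s * (of_nat p * c)" using wc by (simp add: ac_simps)
   also have "... = \<pi> ^ k * v * c" using sv(4) by (simp add: mult.assoc[symmetric])
   also have "\<pi> ^ k = \<pi> ^ i * (\<pi> * \<pi> ^ (k - i - 1))" using ki by (simp flip: power_add power_Suc)
   finally have "s * w = \<pi> * (\<pi> ^ (k - i - 1) * v * c)" using \<pi>0 by (simp add: ac_simps)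
   moreover have "\<pi> * (\<pi> ^ (k - i - 1) * v * c) : P"
    by (intro P_mult2[OF \<pi>] O_closed(4) O_closed(9) \<pi>O sv c)
   ultimately show False using P_prime[OF sv(1) wO] sv(2) wP by simp
  qed
  then show ?thesis by (rule that)
 qed
 have Q1: "Q 1" unfolding Q_def using u ux x by (intro bexI[of _ u] bexI[of _ x]) auto
 define e where "e = (GREATEST k. Q k)"
 have Qe: "Q e" unfolding e_def by (rule GreatestI_nat[of Q 1 i]) (use Q1 bound in auto)
 have e_max: "k <= e" if "Q k" for k unfolding e_def by (rule Greatest_le_nat[of Q k i]) (use that bound in auto)
 obtain s v where s: "s : OK" "s ~: P" and v: "v : OK" and sv: "s * of_nat p = \<pi> ^ e * v"
  using Qe unfolding Q_def by auto
 have vP: "v ~: P"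
 proof
  assume "v : P"
  then obtain z where z: "z : OK" "u * v = \<pi> * z" using uP by blast
  have "(u * s) * of_nat p = \<pi> ^ e * (u * v)" using sv by (simp add: ac_simps)
  also have "... = \<pi> ^ Suc e * z" unfolding z(2) by simp
  finally have "(u * s) * of_nat p = \<pi> ^ Suc e * z" .
  moreover have "u * s : OK - P" using O_closed(4)[OF u(1) s(1)] P_prime[OF u(1) s(1)] u s by auto
  ultimately have "Q (Suc e)" unfolding Q_def using z(1) by blast
  then show False using e_max by fastforce
 qed
 have e2: "e \<ge> 2" if xP: "x : P"
 proof -
  obtain z where z: "z : OK" "u * x = \<pi> * z" using uP xP by blast
  have "u ^ 2 * of_nat p = u * (\<pi> * x)" using ux by (simp add: power2_eq_square)
  also have "... = \<pi> ^ 2 * z" using z(2) by (simp add: power2_eq_square mult.left_commute)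
  finally have "Q 2" unfolding Q_def using uk z(1) by blast
  then show ?thesis by (rule e_max)
 qed
 have upow: "\<exists>z\<in>OK. u ^ m * y = \<pi> ^ m * z" if "y : ideal_pow OK P m" for m y
  using that
 proof (induction m arbitrary: y)
  case (Suc m)
  let ?S = "{y. \<exists>z\<in>OK. u ^ Suc m * y = \<pi> ^ Suc m * z}"
  have "ideal_mult P (ideal_pow OK P m) \<subseteq> ?S"
  proof (rule ideal_mult_subset)
   show "0 : ?S" using O_closed by (auto intro!: bexI[of _ 0])
   fix a b assume "a : ?S" "b : ?S"
   then obtain z w where "z : OK" "u ^ Suc m * a = \<pi> ^ Suc m * z" "w : OK" "u ^ Suc m * b = \<pi> ^ Suc m * w" by auto
   then show "a + b : ?S" using O_closed(3) by (intro CollectI bexI[of _ "z + w"]) (auto simp: distrib_left)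
  next
   fix a b assume ab: "a : P" "b : ideal_pow OK P m"
   obtain z where z: "z : OK" "u * a = \<pi> * z" using uP ab by blast
   obtain w where w: "w : OK" "u ^ m * b = \<pi> ^ m * w" using Suc.IH ab by blast
   have "u ^ Suc m * (a * b) = (u * a) * (u ^ m * b)" by (simp add: ac_simps)
   also have "... = \<pi> ^ Suc m * (z * w)" unfolding z w by (simp add: ac_simps)
   finally show "a * b : ?S" using z w O_closed(4) by blast
  qed
  then show ?case using Suc.prems by auto
 qed auto
 have ram: "ram_index K P (int p) = e"
  unfolding ram_index_def
 proof (rule Greatest_equality)
  obtain a where a: "a : OK" "1 - s * a : P" using P_unit s by blast
  \<comment> \<open>\<open>w\<close> lies in the \<open>e\<close>-th power of \<open>P\<close> and
    has the form \<open>1 - s * t\<close>. Then \<open>p = s * t * p + p * w\<close>, and the first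
    summand is a multiple of \<open>\<pi> ^ e\<close>.\<close>
  define w where "w = (1 - s * a) ^ e"
  have w: "w : ideal_pow OK P e" unfolding w_def by (rule ideal_pow_facts(5)[OF a(2)])
  have "\<exists>t\<in>OK. w = 1 - s * t"
   unfolding w_def
  proof (induction e)
   case 0 show ?case using O_closed(1) by (intro bexI[of _ 0]) auto
  next
   case (Suc k)
   then obtain t where t: "t : OK" "(1 - s * a) ^ k = 1 - s * t" by auto
   have "(1 - s * a) ^ Suc k = 1 - s * (a + t - a * s * t)" unfolding power_Suc t(2) by (simp add: algebra_simps)
   moreover have "a + t - a * s * t : OK" using a t s O_closed by auto
   ultimately show ?case by blast
  qed
  then obtain t where t: "t : OK" "w = 1 - s * t" by blast
  have "\<pi> ^ e : ideal_pow OK P e" by (rule ideal_pow_facts(5)[OF \<pi>])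
  then have "(v * t) * \<pi> ^ e : ideal_pow OK P e" using v t O_closed by (intro ideal_pow_facts(4)) auto
  moreover have "of_nat p * w : ideal_pow OK P e" using w O_closed by (intro ideal_pow_facts(4)) auto
  ultimately have "(v * t) * \<pi> ^ e + of_nat p * w : ideal_pow OK P e" by (rule ideal_pow_facts(2))
  moreover have "(v * t) * \<pi> ^ e + of_nat p * w = of_nat p"
   unfolding t(2) using sv by (simp add: algebra_simps)
  ultimately show "of_int (int p) : ideal_pow (ring_of_integers K) P e" by simp
 next
  fix m assume "of_int (int p) : ideal_pow (ring_of_integers K) P m"
  then obtain z where "z : OK" "u ^ m * of_nat p = \<pi> ^ m * z" using upow by fastforce
  then have "Q m" unfolding Q_def using uk by blast
  then show "m <= e" by (rule e_max)
 qed
 have s0: "\<forall>y\<in>ideal_pow OK P e. v * u ^ e * y : pI"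
 proof
  fix y assume "y : ideal_pow OK P e"
  then obtain z where z: "z : OK" "u ^ e * y = \<pi> ^ e * z" using upow by blast
  have "v * u ^ e * y = (\<pi> ^ e * v) * z" using z(2) by (simp add: ac_simps)
  also have "... = of_nat p * (s * z)" unfolding sv[symmetric] by (simp add: ac_simps)
  also have "... : pI" using s z O_closed by (intro pI_I) auto
  finally show "v * u ^ e * y : pI" .
 qed
 show ?thesis
  by (rule that[OF \<pi> s v vP sv u s0 _ _ ram]) (use e_max[OF Q1] e2 in auto)
qed

end

section \<open>Traces and ramification\<close>

text \<open>Artin's independence of characters with vanishing replaced by membership in
  \<open>M\<close>; accordingly the characters must differ modulo \<open>M\<close>. Evaluating the
  relation at \<open>z * y\<close> and subtracting \<open>\<rho> z\<close> times the relation at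
  \<open>y\<close> removes \<rho> and multiplies the coefficient of \<tau> by a unit.\<close>

lemma (in place) artin_mod:
 fixes H :: "(complex => complex) set"
 assumes "finite H"
  and R: "1 : R" "!!y z. y : R ==> z : R ==> y * z : R"
  and H: "!!\<tau> y. \<tau> : H ==> y : R ==> \<tau> y : A" "!!\<tau>. \<tau> : H ==> \<tau> 1 = 1"
   "!!\<tau> y z. \<tau> : H ==> y : R ==> z : R ==> \<tau> (y * z) = \<tau> y * \<tau> z"
  and inc: "!!\<tau> \<tau>'. \<tau> : H ==> \<tau>' : H ==> \<tau> ~= \<tau>' ==> \<exists>y\<in>R. \<tau> y - \<tau>' y ~: M"
  and c: "!!\<tau>. \<tau> : H ==> c \<tau> : A"
  and sum: "!!y. y : R ==> (\<Sum>\<tau>\<in>H. c \<tau> * \<tau> y) : M"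
  and t: "\<tau> : H"
 shows "c \<tau> : M"
proof -
 define ok where "ok H c \<longleftrightarrow> finite H & (\<forall>\<tau>\<in>H. (\<forall>y\<in>R. \<tau> y : A) & \<tau> 1 = 1 \<and>
   (\<forall>y\<in>R. \<forall>z\<in>R. \<tau> (y * z) = \<tau> y * \<tau> z) & c \<tau> : A) \<and>
   (\<forall>\<tau>\<in>H. \<forall>\<tau>'\<in>H. \<tau> ~= \<tau>' --> (\<exists>y\<in>R. \<tau> y - \<tau>' y ~: M)) & (\<forall>y\<in>R. (\<Sum>\<tau>\<in>H. c \<tau> * \<tau> y) : M)"
  for H and c :: "(complex => complex) => complex"
 have "\<forall>\<tau>\<in>H. c \<tau> : M" if "ok H c" for H c
  using that
 proof (induction "card H" arbitrary: H c)
  case 0 then show ?case unfolding ok_def by auto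
 next
  case (Suc m)
  have fin: "finite H" and HA: "!!\<tau> y. \<tau> : H ==> y : R ==> \<tau> y : A" and H1: "!!\<tau>. \<tau> : H ==> \<tau> 1 = 1"
   and Hm: "!!\<tau> y z. \<tau> : H ==> y : R ==> z : R ==> \<tau> (y * z) = \<tau> y * \<tau> z"
   and cA: "!!\<tau>. \<tau> : H ==> c \<tau> : A"
   and inc: "!!\<tau> \<tau>'. \<tau> : H ==> \<tau>' : H ==> \<tau> ~= \<tau>' ==> \<exists>y\<in>R. \<tau> y - \<tau>' y ~: M"
   and sum: "!!y. y : R ==> (\<Sum>\<tau>\<in>H. c \<tau> * \<tau> y) : M"
   using Suc.prems unfolding ok_def by blast+
  show ?case
  proof
   fix \<tau> assume t: "\<tau> : H"
   show "c \<tau> : M"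
   proof (cases "H = {\<tau>}")
    case True
    then show ?thesis using sum[OF R(1)] H1[OF t] by simp
   next
    case False
    then obtain \<rho> where \<rho>: "\<rho> : H" "\<rho> ~= \<tau>" using t by blast
    then obtain z where z: "z : R" "\<tau> z - \<rho> z ~: M" using inc[OF t \<rho>(1)] by auto
    define c' where "c' \<sigma> = c \<sigma> * (\<sigma> z - \<rho> z)" for \<sigma>
    have c'A: "c' \<sigma> : A" if s: "\<sigma> : H" for \<sigma>
     unfolding c'_def by (rule A_mult[OF cA[OF s] A_diff[OF HA[OF s z(1)] HA[OF \<rho>(1) z(1)]]])
    have c'sum: "(\<Sum>\<sigma>\<in>H - {\<rho>}. c' \<sigma> * \<sigma> y) : M" if y: "y : R" for y
    proof -
     have "(\<Sum>\<sigma>\<in>H - {\<rho>}. c' \<sigma> * \<sigma> y) = (\<Sum>\<sigma>\<in>H. c' \<sigma> * \<sigma> y)"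
      by (rule sum.mono_neutral_left) (use fin in \<open>auto simp: c'_def\<close>)
     also have "... = (\<Sum>\<sigma>\<in>H. c \<sigma> * \<sigma> (z * y) - \<rho> z * (c \<sigma> * \<sigma> y))"
      unfolding c'_def by (intro sum.cong refl) (simp add: Hm z(1) y algebra_simps)
     also have "... = (\<Sum>\<sigma>\<in>H. c \<sigma> * \<sigma> (z * y)) - \<rho> z * (\<Sum>\<sigma>\<in>H. c \<sigma> * \<sigma> y)"
      by (simp add: sum_subtractf sum_distrib_left)
     also have "... : M"
      by (rule M_diff[OF sum[OF R(2)[OF z(1) y]] M_mult2[OF sum[OF y] HA[OF \<rho>(1) z(1)]]])
     finally show ?thesis .
    qed
    have "ok (H - {\<rho>}) c'"
     unfolding ok_def using fin HA H1 Hm c'A inc c'sum by simp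
    moreover have "m = card (H - {\<rho>})" using Suc.hyps(2) fin \<rho>(1) by simp
    ultimately have "c' \<tau> : M" using Suc.hyps(1)[of "H - {\<rho>}" c'] t \<rho>(2) by blast
    then show ?thesis
     using M_prime[of "c \<tau>" "\<tau> z - \<rho> z"] cA[OF t] z A_diff[OF HA[OF t z(1)] HA[OF \<rho>(1) z(1)]]
     unfolding c'_def by blast
   qed
  qed
 qed
 moreover have "ok H c" unfolding ok_def using assms(1) H c inc sum by simp
 ultimately show ?thesis using t by blast
qed

context numfield
begin

lemma freshman:
 assumes p: "prime (p::nat)" and uv: "u : OK" "v : OK"
 shows "(u + v) ^ p - u ^ p - v ^ p : pO (int p)"
proof -
 have pp: "p > 0" using p by (simp add: prime_gt_0_nat)
 have "(u + v) ^ p = (\<Sum>k\<le>p. of_nat (p choose k) * u ^ k * v ^ (p - k))" by (rule binomial_ring)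
 also have "{..p} = insert 0 (insert p {1..<p})" using pp by auto
 also have "(\<Sum>k\<in>.... of_nat (p choose k) * u ^ k * v ^ (p - k)) =
   v ^ p + (u ^ p + (\<Sum>k\<in>{1..<p}. of_nat (p choose k) * u ^ k * v ^ (p - k)))"
  using pp by simp
 finally have "(u + v) ^ p - u ^ p - v ^ p = (\<Sum>k\<in>{1..<p}. of_nat (p choose k) * u ^ k * v ^ (p - k))"
  by (simp add: algebra_simps)
 also have "... : pO (int p)"
 proof -
  have "of_nat (p choose k) * u ^ k * v ^ (p - k) : pO (int p)" if k: "k : {1..<p}" for k
  proof -
   have "p dvd (p choose k)" using p k by (intro dvd_choose_prime) auto
   then obtain m where "p choose k = p * m" by auto
   then have "of_nat (p choose k) * u ^ k * v ^ (p - k) = of_int (int p) * (of_nat m * u ^ k * v ^ (p - k))"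
    by simp
   also have "... : pO (int p)" using uv O_closed by (intro pO_closed(7)) auto
   finally show ?thesis .
  qed
  then have "(\<Sum>k\<in>J. of_nat (p choose k) * u ^ k * v ^ (p - k)) : pO (int p)" if "J \<subseteq> {1..<p}" for J
   using that by (induction J rule: infinite_finite_induct) (auto intro: pO_closed)
  then show ?thesis by blast
 qed
 finally show ?thesis .
qed

lemma frobenius_power:
 assumes p: "prime (p::nat)" and uv: "u : OK" "v : OK"
 shows "(u + v) ^ (p ^ i) - u ^ (p ^ i) - v ^ (p ^ i) : pO (int p)"
proof (induction i)
 case 0 show ?case using pO_closed(1) by simp
next
 case (Suc i)
 define U where "U = u ^ (p ^ i)"
 define V where "V = v ^ (p ^ i)"
 define W where "W = (u + v) ^ (p ^ i) - U - V"
 have O: "U : OK" "V : OK" "W : OK" unfolding U_def V_def W_def using uv O_closed by auto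
 have W: "W : pO (int p)" using Suc unfolding W_def U_def V_def by simp
 have pw: "a ^ (p ^ Suc i) = (a ^ (p ^ i)) ^ p" for a :: complex by (simp add: power_mult mult.commute flip: power_mult)
 have "(u + v) ^ (p ^ i) = (U + V) + W" unfolding W_def by simp
 then have 1: "(u + v) ^ (p ^ Suc i) = ((U + V) + W) ^ p" unfolding pw by simp
 have "p = Suc (p - 1)" using p by (simp add: prime_gt_0_nat)
 then have "W ^ p = W * W ^ (p - 1)" by (metis power_Suc)
 then have Wp: "W ^ p : pO (int p)" using pO_closed(4)[OF W] O O_closed by simp
 have "((U + V) + W) ^ p - (U + V) ^ p - W ^ p : pO (int p)" "(U + V) ^ p - U ^ p - V ^ p : pO (int p)"
  using freshman[OF p] O O_closed by auto
 then have "(((U + V) + W) ^ p - (U + V) ^ p - W ^ p) + ((U + V) ^ p - U ^ p - V ^ p) + W ^ p : pO (int p)"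
  by (intro pO_closed(2) Wp)
 then show ?case unfolding 1 pw[of u] pw[of v] U_def[symmetric] V_def[symmetric] by (simp add: algebra_simps)
qed

end

context local_prime
begin

text \<open>Two iterates of Frobenius agree at \<open>y\<close> modulo \<open>p\<close>. As
  Frobenius is additive modulo \<open>p\<close>, the difference \<open>z - y\<close> has a power in
  \<open>P\<close>, hence lies in \<open>P\<close>.\<close>

lemma frobenius_fixed:
 assumes y: "y : OK" shows "\<exists>r>0. y ^ (p ^ r) - y : P"
proof -
 obtain i j where ij: "i < j" "y ^ (p ^ i) - y ^ (p ^ j) : pI"
  using pigeonhole_residues[of "int p" "%i. y ^ (p ^ i)"] p_pos y O_closed by auto
 define z where "z = y ^ (p ^ (j - i))"
 have zO: "z : OK" unfolding z_def using y O_closed by auto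
 have "p ^ j = p ^ (j - i) * p ^ i" using ij(1) by (simp flip: power_add)
 then have zj: "z ^ (p ^ i) = y ^ (p ^ j)" unfolding z_def by (simp add: power_mult)
 have "((z - y) + y) ^ (p ^ i) - (z - y) ^ (p ^ i) - y ^ (p ^ i) : pI"
  by (rule frobenius_power[OF p]) (use zO y O_closed in auto)
 from pO_closed(2)[OF this ij(2)] have "- ((z - y) ^ (p ^ i)) : pI" using zj by simp
 then have "(z - y) ^ (p ^ i) : P" using pO_closed(6) pI_P by fastforce
 then have "z - y : P" by (rule P_power[rotated]) (use zO y O_closed in auto)
 then show ?thesis unfolding z_def using ij(1) by (intro exI[of _ "j - i"]) auto
qed

text \<open>Guarantees that the set \<open>H\<close> of embeddings attached to \<open>P\<close> in
  the two arguments below is not empty.\<close>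

lemma idempotent_conjugate:
 assumes "place p A" and \<epsilon>O: "\<epsilon> : OK" and \<epsilon>nP: "\<epsilon> ~: P"
  and w0: "w0 : OK" "\<epsilon> * (1 - \<epsilon>) = of_nat p * w0"
 shows "\<exists>\<tau>\<in>E. \<tau> \<epsilon> ~: place.M A"
proof (rule ccontr)
 interpret pl: place p A by fact
 assume "\<not> ?thesis"
 then have M: "\<tau> \<epsilon> : pl.M" if "\<tau> : E" for \<tau> using that by blast
 text \<open>All conjugates of the idempotent then lie in \<open>p A\<close>, so it is divisible by \<open>p\<close>.\<close>
 have "\<epsilon> / of_nat p : OK"
 proof (rule local_integral[OF \<open>place p A\<close>])
  show "\<epsilon> / of_nat p : K" using \<epsilon>O O_K K_closed by auto
  show "of_nat p * (\<epsilon> / of_nat p) : OK" using \<epsilon>O pc0 by simp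
  fix \<tau> assume \<tau>: "\<tau> : E"
  then have tM: "\<tau> \<epsilon> : pl.M" using M by blast
  have "\<tau> \<epsilon> * (1 - \<tau> \<epsilon>) = of_nat p * \<tau> w0"
   using arg_cong[OF w0(2), of \<tau>] \<epsilon>O w0(1) O_K K_closed by (simp add: E[OF \<tau>])
  moreover have u: "1 + - \<tau> \<epsilon> ~: pl.M" by (intro pl.unit_add_M pl.A_1 pl.M_1 pl.M_minus tM)
  then have "1 - \<tau> \<epsilon> ~= 0" "inverse (1 - \<tau> \<epsilon>) : A"
   using pl.unit_inverse[of "1 - \<tau> \<epsilon>"] pl.A_diff[OF pl.A_1 pl.M_A[OF tM]] by auto
  ultimately have "\<tau> \<epsilon> / of_nat p = \<tau> w0 * inverse (1 - \<tau> \<epsilon>)" using pc0 by (simp add: field_simps)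
  moreover have "\<tau> (\<epsilon> / of_nat p) = \<tau> \<epsilon> / of_nat p"
  proof -
   have "\<tau> (\<epsilon> / of_nat p * of_nat p) = \<tau> (\<epsilon> / of_nat p) * \<tau> (of_nat p)"
    using \<epsilon>O O_K K_closed by (intro E(2)[OF \<tau>]) auto
   then show ?thesis using pc0 E(8)[OF \<tau>] by (simp add: field_simps)
  qed
  ultimately show "\<tau> (\<epsilon> / of_nat p) : A"
   using pl.A_mult[OF pl.A_algebraic_int[OF emb_algebraic_int[OF \<tau> w0(1)]] \<open>inverse (1 - \<tau> \<epsilon>) : A\<close>] by simp
 qed
 then have "of_nat p * (\<epsilon> / of_nat p) : pI" by (rule pI_I)
 then have "\<epsilon> : P" using pI_P pc0 by simp
 then show False using \<epsilon>nP by simp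
qed

text \<open>If \<open>P\<close> is unramified then the trace form is nondegenerate at \<open>P\<close>: two embeddings not killing the
 idempotent of \<open>P\<close> cannot agree modulo a place above \<open>p\<close>, by the uniqueness in Hensel's lemma, so
 Artin's independence of characters applies modulo that place.\<close>
lemma unramified_trace:
 assumes xP: "x ~: P" and tr0: "\<forall>y\<in>OK. \<exists>k. tr (x * y) = of_int (int p * k)"
 shows False
proof -
 obtain A where "place p A" by (rule subring_exists_place[OF p])
 interpret pl: place p A by fact
 obtain a where a: "a : OK" "1 - x * a : P" using P_unit[OF x xP] by blast
 \<comment> \<open>Modulo \<open>p\<close> this is the idempotent of the factor at \<open>P\<close>:
   it is congruent to 1 modulo \<open>P\<close> and kills \<open>P\<close>, because \<open>x\<close>
   kills \<open>P\<close> and is invertible modulo \<open>P\<close>.\<close>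
 define \<epsilon> where "\<epsilon> = x * a"
 have \<epsilon>O: "\<epsilon> : OK" unfolding \<epsilon>_def using x a O_closed by auto
 have \<epsilon>P: "\<epsilon> * y : pI" if y: "y : P" for y
 proof -
  have "x * y : pI" using y unfolding P_def by simp
  then have "x * y * a : pI" using pO_closed(4) a(1) by blast
  then show ?thesis unfolding \<epsilon>_def by (simp add: ac_simps)
 qed
 have "1 - \<epsilon> : P" using a unfolding \<epsilon>_def by simp
 then obtain w0 where w0: "w0 : OK" "\<epsilon> * (1 - \<epsilon>) = of_nat p * w0" using \<epsilon>P pI_E by blast
 have \<epsilon>nP: "\<epsilon> ~: P" using \<open>1 - \<epsilon> : P\<close> P_add[of \<epsilon> "1 - \<epsilon>"] P_1 by auto
 have OA: "\<tau> y : A" if "\<tau> : E" "y : OK" for \<tau> y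
  using pl.A_algebraic_int emb_algebraic_int that by blast
 have tmult: "\<tau> (y * z) = \<tau> y * \<tau> z" if "\<tau> : E" "y : OK" "z : OK" for \<tau> y z
  using that E(2) O_K by blast
 define H where "H = {\<tau> : E. \<tau> \<epsilon> ~: pl.M}"
 have HE: "\<tau> : E" if "\<tau> : H" for \<tau> using that unfolding H_def by simp
 have pw: "(of_nat p * m :: complex) : pl.M" if "m : A" for m using pl.M_mult[OF pl.M_p that] .
 have \<epsilon>1: "\<tau> \<epsilon> - 1 : pl.M" if \<tau>: "\<tau> : H" for \<tau>
 proof -
  note E' = E[OF HE[OF \<tau>]]
  have "\<tau> \<epsilon> * (1 - \<tau> \<epsilon>) = of_nat p * \<tau> w0"
   using arg_cong[OF w0(2), of \<tau>] \<epsilon>O w0(1) O_K K_closed by (simp add: E')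
  then have "\<tau> \<epsilon> * (1 - \<tau> \<epsilon>) : pl.M" using pw OA HE \<tau> w0 by simp
  then have "1 - \<tau> \<epsilon> : pl.M"
   using pl.M_prime[of "\<tau> \<epsilon>" "1 - \<tau> \<epsilon>"] pl.A_diff[OF pl.A_1] OA[OF HE[OF \<tau>] \<epsilon>O] \<tau> unfolding H_def by auto
  then show ?thesis using pl.M_minus by fastforce
 qed
 have inc: "\<exists>y\<in>OK. \<tau> y - \<tau>' y ~: pl.M" if H: "\<tau> : H" "\<tau>' : H" and ne: "\<tau> ~= \<tau>'" for \<tau> \<tau>'
 proof (rule ccontr)
  assume "\<not> ?thesis"
  then have cong: "\<tau> y - \<tau>' y : pl.M" if "y : OK" for y using that by blast
  note E1 = HE[OF H(1)] and E2 = HE[OF H(2)]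
  \<comment> \<open>\<open>z\<close> lies in \<open>p ^ k M\<close>. The two embeddings are shown to
    agree to this order for every \<open>k\<close>.\<close>
  define D where "D k z \<longleftrightarrow> (\<exists>m\<in>pl.M. z = of_nat p ^ k * m)" for k :: nat and z :: complex
  have D_add: "D k (z + w)" if zw: "D k z" "D k w" for k z w
  proof -
   obtain m m' where "m : pl.M" "z = of_nat p ^ k * m" "m' : pl.M" "w = of_nat p ^ k * m'"
    using zw unfolding D_def by auto
   then show ?thesis unfolding D_def using pl.M_add by (intro bexI[of _ "m + m'"]) (auto simp: distrib_left)
  qed
  have D_mult: "D k (b * z)" if zb: "D k z" "b : A" for k z b
  proof -
   obtain m where "m : pl.M" "z = of_nat p ^ k * m" using zb unfolding D_def by auto
   then show ?thesis unfolding D_def using pl.M_mult2 zb(2) by (intro bexI[of _ "b * m"]) auto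
  qed
  have D_diff: "D k (z - w)" if "D k z" "D k w" for k z w
   using D_add[OF that(1) D_mult[OF that(2), of "- 1"]] pl.A_minus[OF pl.A_1] by simp
  have D_unit: "D k z" if "D k (b * z)" "b : A" "b ~: pl.M" for k z b
  proof -
   have b: "b ~= 0" "inverse b : A" using pl.unit_inverse that by auto
   have "D k (inverse b * (b * z))" by (rule D_mult[OF that(1) b(2)])
   moreover have "inverse b * (b * z) = z" using b(1) by simp
   ultimately show ?thesis by simp
  qed
  have D_Suc: "D (Suc k) (of_nat p * z)" if "D k z" for k z
   using that unfolding D_def by (auto simp: mult.assoc)
  have D_M: "D (Suc k) (b * z)" if "D k z" "b = of_nat p * b'" "b' : A" for k z b b'
   using D_Suc[OF D_mult[OF that(1,3)]] that(2) by (simp add: mult.assoc)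
  have all: "\<forall>y\<in>OK. D k (\<tau> y - \<tau>' y)" for k
  proof (induction k)
   case 0 show ?case unfolding D_def using cong by simp
  next
   case (Suc k)
   \<comment> \<open>Newton step for the equation
     \<open>\<epsilon> * (1 - \<epsilon>) = p * w0\<close>: the difference quotient
     \<open>1 - (\<tau> \<epsilon> + \<tau>' \<epsilon>)\<close> is congruent to -1 modulo
     \<open>M\<close>, hence a unit.\<close>
   have \<delta>\<epsilon>: "D (Suc k) (\<tau> \<epsilon> - \<tau>' \<epsilon>)"
   proof -
    have "D (Suc k) (of_nat p * (\<tau> w0 - \<tau>' w0))" using Suc w0(1) D_Suc by blast
    moreover have "of_nat p * (\<tau> w0 - \<tau>' w0) = (1 - (\<tau> \<epsilon> + \<tau>' \<epsilon>)) * (\<tau> \<epsilon> - \<tau>' \<epsilon>)"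
     using arg_cong[OF w0(2), of \<tau>] arg_cong[OF w0(2), of \<tau>'] \<epsilon>O w0(1) O_K K_closed
     by (simp add: E[OF E1] E[OF E2] algebra_simps)
    ultimately have "D (Suc k) ((1 - (\<tau> \<epsilon> + \<tau>' \<epsilon>)) * (\<tau> \<epsilon> - \<tau>' \<epsilon>))" by simp
    moreover have "1 - (\<tau> \<epsilon> + \<tau>' \<epsilon>) = - 1 + - ((\<tau> \<epsilon> - 1) + (\<tau>' \<epsilon> - 1))" by simp
    moreover have "- 1 ~: pl.M" using pl.unitI[of "- 1" "- 1"] pl.A_minus[OF pl.A_1] by simp
    then have "- 1 + - ((\<tau> \<epsilon> - 1) + (\<tau>' \<epsilon> - 1)) ~: pl.M"
     by (intro pl.unit_add_M pl.M_minus pl.M_add \<epsilon>1 H pl.A_minus pl.A_1)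
    ultimately show ?thesis
     using D_unit pl.A_diff[OF pl.A_1 pl.A_add[OF OA[OF E1 \<epsilon>O] OA[OF E2 \<epsilon>O]]] by metis
   qed
   show ?case
   proof
    fix y assume y: "y : OK"
    obtain r where r: "r > 0" "y ^ (p ^ r) - y : P" using frobenius_fixed[OF y] by blast
    define q where "q = p ^ r"
    obtain q' where q': "q = p * q'" unfolding q_def using r(1) by (cases r) auto
    have q0: "q > 0" unfolding q_def using p_pos by simp
    have yq: "y ^ q : OK" using y O_closed by auto
    obtain w where w: "w : OK" "\<epsilon> * (y ^ q - y) = of_nat p * w"
     using \<epsilon>P[OF r(2)] pI_E unfolding q_def by blast
    define \<alpha> where "\<alpha> = \<tau> y"
    define \<beta> where "\<beta> = \<tau>' y"
    define S where "S = (\<Sum>i<q. \<beta> ^ (q - Suc i) * \<alpha> ^ i)"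
    have \<alpha>A: "\<alpha> : A" "\<beta> : A" unfolding \<alpha>_def \<beta>_def using OA E1 E2 y by auto
    have pwd: "\<alpha> ^ q - \<beta> ^ q = (\<alpha> - \<beta>) * S" 
    proof -
     obtain q1 where "q = Suc q1" using q0 by (cases q) auto
     then show ?thesis unfolding S_def using diff_power_eq_sum[of \<alpha> q1 \<beta>] by (simp only: mult.commute diff_Suc_Suc)
    qed
    \<comment> \<open>The difference quotient of the \<open>q\<close>-th power is congruent to
      \<open>q * \<alpha> ^ (q - 1)\<close>, which lies in \<open>M\<close>. So
      \<open>S - 1\<close>, the quotient for \<open>Y ^ q - Y\<close>, is a unit and the precision
      rises by one.\<close>
    have S_M: "S : pl.M"
    proof -
     have "\<beta> ^ (q - Suc i) * \<alpha> ^ i - \<alpha> ^ (q - 1) : pl.M" if "i < q" for i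
     proof -
      have "\<beta> ^ m - \<alpha> ^ m : pl.M" for m
      proof (induction m)
       case (Suc m)
       have "\<beta> ^ Suc m - \<alpha> ^ Suc m = \<beta> * (\<beta> ^ m - \<alpha> ^ m) - (\<alpha> - \<beta>) * \<alpha> ^ m" by (simp add: algebra_simps)
       also have "... : pl.M"
        using pl.M_diff[OF pl.M_mult2[OF Suc \<alpha>A(2)] pl.M_mult[OF _ pl.A_power[OF \<alpha>A(1)]]] cong[OF y]
        unfolding \<alpha>_def \<beta>_def by blast
       finally show ?case .
      qed simp
      then have "(\<beta> ^ (q - Suc i) - \<alpha> ^ (q - Suc i)) * \<alpha> ^ i : pl.M" using \<alpha>A by (intro pl.M_mult pl.A_power)
      moreover have "\<alpha> ^ (q - Suc i) * \<alpha> ^ i = \<alpha> ^ (q - 1)" using that by (simp flip: power_add)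
      ultimately show ?thesis by (simp add: left_diff_distrib)
     qed
     then have "(\<Sum>i<q. \<beta> ^ (q - Suc i) * \<alpha> ^ i - \<alpha> ^ (q - 1)) : pl.M" by (intro pl.M_sum) auto
     then have "S - of_nat q * \<alpha> ^ (q - 1) : pl.M" unfolding S_def by (simp add: sum_subtractf)
     moreover have "of_nat q * \<alpha> ^ (q - 1) : pl.M"
      unfolding q' using pw[of "of_nat q' * \<alpha> ^ (p * q' - 1)"] \<alpha>A pl.A_mult pl.A_power by (simp add: mult.assoc)
     ultimately show ?thesis using pl.M_add by fastforce
    qed
    have "D (Suc k) (of_nat p * (\<tau> w - \<tau>' w))" using Suc w(1) D_Suc by blast
    moreover have "of_nat p * (\<tau> w - \<tau>' w) =
      \<tau> \<epsilon> * (S - 1) * (\<alpha> - \<beta>) + (\<beta> ^ q - \<beta>) * (\<tau> \<epsilon> - \<tau>' \<epsilon>)"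
    proof -
     have 1: "of_nat p * \<tau> w = \<tau> \<epsilon> * (\<alpha> ^ q - \<alpha>)" "of_nat p * \<tau>' w = \<tau>' \<epsilon> * (\<beta> ^ q - \<beta>)"
      using arg_cong[OF w(2), of \<tau>] arg_cong[OF w(2), of \<tau>'] \<epsilon>O w(1) y yq O_K K_closed
      by (auto simp: E[OF E1] E[OF E2] \<alpha>_def \<beta>_def)
     have "of_nat p * (\<tau> w - \<tau>' w) = \<tau> \<epsilon> * ((\<alpha> ^ q - \<beta> ^ q) - (\<alpha> - \<beta>)) + (\<beta> ^ q - \<beta>) * (\<tau> \<epsilon> - \<tau>' \<epsilon>)"
      unfolding right_diff_distrib[of "of_nat p"] 1 by (simp add: algebra_simps)
     then show ?thesis unfolding pwd by (simp add: algebra_simps)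
    qed
    moreover have "D (Suc k) ((\<beta> ^ q - \<beta>) * (\<tau> \<epsilon> - \<tau>' \<epsilon>))"
     by (rule D_mult[OF \<delta>\<epsilon>]) (intro pl.A_diff pl.A_power \<alpha>A)
    ultimately have DD: "D (Suc k) (\<tau> \<epsilon> * (S - 1) * (\<alpha> - \<beta>))"
     using D_diff[of "Suc k" "of_nat p * (\<tau> w - \<tau>' w)" "(\<beta> ^ q - \<beta>) * (\<tau> \<epsilon> - \<tau>' \<epsilon>)"]
     by (simp only: add_diff_cancel_right')
    have "- 1 ~: pl.M" using pl.unitI[of "- 1" "- 1"] pl.A_minus[OF pl.A_1] by simp
    then have "- 1 + S ~: pl.M" by (intro pl.unit_add_M S_M pl.A_minus pl.A_1)
    then have S1: "S - 1 ~: pl.M" "S - 1 : A" using pl.A_diff[OF pl.M_A[OF S_M] pl.A_1] by auto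
    have "\<tau> \<epsilon> * (S - 1) ~: pl.M"
     using pl.M_prime[of "\<tau> \<epsilon>" "S - 1"] S1 OA[OF E1 \<epsilon>O] H(1) unfolding H_def by auto
    from D_unit[OF DD pl.A_mult[OF OA[OF E1 \<epsilon>O] S1(2)] this]
    show "D (Suc k) (\<tau> y - \<tau>' y)" unfolding \<alpha>_def \<beta>_def .
   qed
  qed
  have eqO: "\<tau> y = \<tau>' y" if y: "y : OK" for y
  proof (rule ccontr)
   assume "\<tau> y ~= \<tau>' y"
   then have n0: "\<tau> y - \<tau>' y ~= 0" by simp
   have "algebraic_int (\<tau> y - \<tau>' y)" using emb_algebraic_int E1 E2 y algebraic_int_diff by blast
   \<comment> \<open>A nonzero difference would divide a nonzero integer \<open>N\<close>, which
     would then be divisible by every power of \<open>p\<close>.\<close>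
   then obtain N :: int and z where N: "N ~= 0" "algebraic_int z" "(\<tau> y - \<tau>' y) * z = of_int N"
    using n0 by (rule algebraic_int_dvd_int)
   have "int p ^ k dvd N" for k
   proof -
    obtain m where m: "m : pl.M" "\<tau> y - \<tau>' y = of_nat p ^ k * m" using all y unfolding D_def by blast
    have "of_int N / of_nat p ^ k = m * z" using N(3) m(2) pc0 by (simp add: field_simps)
    also have "... : A" using pl.A_mult pl.M_A m(1) pl.A_algebraic_int N(2) by blast
    finally show ?thesis by (rule pl.A_divide_power_int)
   qed
   from this[of "nat \<bar>N\<bar>"] have "\<bar>int p ^ nat \<bar>N\<bar>\<bar> <= \<bar>N\<bar>" using N(1) by (rule dvd_imp_le_int[rotated])
   moreover have "int (nat \<bar>N\<bar>) < int (2 ^ nat \<bar>N\<bar>)" by (simp only: of_nat_less_iff) simp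
   moreover have "(2::int) ^ nat \<bar>N\<bar> <= int p ^ nat \<bar>N\<bar>" using prime_ge_2_nat[OF p] by (intro power_mono) auto
   ultimately show False by simp
  qed
  have "\<tau> = \<tau>'"
  proof
   fix y show "\<tau> y = \<tau>' y"
   proof (cases "y : K")
    case True
    obtain m where m: "m > 0" "of_int m * y : OK" using O_multiple[OF True] .
    then have "of_int m * \<tau> y = of_int m * \<tau>' y"
     using eqO[OF m(2)] True K_closed by (simp add: E[OF E1] E[OF E2])
    then show ?thesis using m(1) by simp
   qed (use E(12)[OF E1] E(12)[OF E2] in simp)
  qed
  then show False using ne by simp
 qed
 \<comment> \<open>The trace of \<open>\<epsilon> * y\<close> is divisible by \<open>p\<close>, and
   the embeddings outside \<open>H\<close> contribute elements of \<open>M\<close>; what remains is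
   a relation among the characters in \<open>H\<close>.\<close>
 have sumM: "(\<Sum>\<tau>\<in>H. \<tau> \<epsilon> * \<tau> y) : pl.M" if y: "y : OK" for y
 proof -
  obtain k where k: "tr (x * (a * y)) = of_int (int p * k)" using tr0 O_closed(4)[OF a(1) y] by blast
  have "tr (\<epsilon> * y) : pl.M" using k pl.M_of_int[of "int p * k"] unfolding \<epsilon>_def by (simp add: mult.assoc)
  moreover have "tr (\<epsilon> * y) = (\<Sum>\<tau>\<in>E. \<tau> \<epsilon> * \<tau> y)" unfolding nf_trace_def using tmult \<epsilon>O y by simp
  moreover have "... = (\<Sum>\<tau>\<in>H. \<tau> \<epsilon> * \<tau> y) + (\<Sum>\<tau>\<in>E - H. \<tau> \<epsilon> * \<tau> y)"
   using finite_E by (subst sum.subset_diff[of H E]) (auto simp: H_def)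
  moreover have "(\<Sum>\<tau>\<in>E - H. \<tau> \<epsilon> * \<tau> y) : pl.M"
   using OA y by (intro pl.M_sum pl.M_mult) (auto simp: H_def)
  ultimately show ?thesis using pl.M_diff by fastforce
 qed
 have finH: "finite H" using finite_E unfolding H_def by simp
 have "H = {}"
 proof (rule ccontr)
  assume "H ~= {}"
  then obtain \<tau> where t: "\<tau> : H" by auto
  have "\<tau> \<epsilon> : pl.M"
  proof (rule pl.artin_mod[OF finH, of OK "%\<tau>. \<tau> \<epsilon>" \<tau>])
   show "\<exists>y\<in>OK. \<tau> y - \<tau>' y ~: pl.M" if "\<tau> : H" "\<tau>' : H" "\<tau> ~= \<tau>'" for \<tau> \<tau>' using inc that by blast
  qed (use t OA HE \<epsilon>O tmult sumM O_closed E(3) in auto)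
  then show False using t unfolding H_def by simp
 qed
 show False
  using idempotent_conjugate[OF \<open>place p A\<close> \<epsilon>O \<epsilon>nP w0] \<open>H = {}\<close> unfolding H_def by blast
qed

end

context local_prime
begin

text \<open>The conjugates of the \<open>P\<close>-part \<open>\<epsilon> \<pi> + 1 - \<epsilon>\<close> of a local generator have valuation \<open>1 / e\<close> for the
 embeddings in the local factor \<open>H\<close> of \<open>P\<close> and \<open>0\<close> otherwise; as its norm is an integer, \<open>e\<close> divides
 \<open>card H\<close>, which is congruent to the trace of the idempotent \<open>\<epsilon>\<close>.\<close>
lemma ramified_trace:
 assumes xP: "x : P" and tr0: "\<forall>y\<in>OK. \<exists>k. tr y = of_int (int p * k)"
 shows "\<exists>h. 0 < h & h <= n & p dvd h & ram_index K P (int p) dvd h & 2 <= ram_index K P (int p)"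
proof -
 obtain A where plA: "place p A" by (rule subring_exists_place[OF p])
 interpret pl: place p A by fact
 obtain e \<pi> u s v where \<pi>: "\<pi> : P" and s: "s : OK" "s ~: P" and v: "v : OK" "v ~: P"
  and sp: "s * of_nat p = \<pi> ^ e * v" and u: "u : OK" "u ~: P"
  and s0: "\<forall>y\<in>ideal_pow OK P e. v * u ^ e * y : pI" and "e \<ge> 1" and e2: "x : P --> e \<ge> 2"
  and ram: "ram_index K P (int p) = e" by (rule local_structure)
 have \<pi>O: "\<pi> : OK" using P_O[OF \<pi>] .
 have e2: "e \<ge> 2" using e2 xP by blast
 define \<sigma> where "\<sigma> = v * u ^ e"
 have \<sigma>O: "\<sigma> : OK" unfolding \<sigma>_def by (rule O_closed(4)[OF v(1) O_closed(9)[OF u(1)]])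
 have "u ^ e ~: P" using P_power[OF u(1)] u(2) by auto
 then have \<sigma>P: "\<sigma> ~: P" unfolding \<sigma>_def using P_prime[OF v(1) O_closed(9)[OF u(1)]] v(2) by auto
 obtain a where a: "a : OK" "1 - \<sigma> * a : P" using P_unit[OF \<sigma>O \<sigma>P] by blast
 have "\<exists>t\<in>OK. (1 - \<sigma> * a) ^ k = 1 - \<sigma> * t" for k
 proof (induction k)
  case 0 show ?case using O_closed(1) by (intro bexI[of _ 0]) auto
 next
  case (Suc k)
  then obtain t where t: "t : OK" "(1 - \<sigma> * a) ^ k = 1 - \<sigma> * t" by blast
  have "(1 - \<sigma> * a) ^ Suc k = 1 - \<sigma> * (a + t - a * \<sigma> * t)" unfolding power_Suc t(2) by (simp add: algebra_simps)
  moreover have "a + t - a * \<sigma> * t : OK"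
   by (rule O_closed(6)[OF O_closed(3)[OF a(1) t(1)] O_closed(4)[OF O_closed(4)[OF a(1) \<sigma>O] t(1)]])
  ultimately show ?case by blast
 qed
 then obtain t where t: "t : OK" "(1 - \<sigma> * a) ^ e = 1 - \<sigma> * t" by blast
 \<comment> \<open>In the ramified case the idempotent has to kill the whole \<open>e\<close>-th
   power of \<open>P\<close> modulo \<open>p\<close>. The element \<sigma> does, and \<epsilon> is a
   multiple of \<sigma> congruent to 1 modulo that power.\<close>
 define \<epsilon> where "\<epsilon> = \<sigma> * t"
 have \<epsilon>O: "\<epsilon> : OK" unfolding \<epsilon>_def by (rule O_closed(4)[OF \<sigma>O t(1)])
 have \<epsilon>y: "\<exists>w\<in>OK. \<epsilon> * y = of_nat p * w" if y: "y : ideal_pow OK P e" for y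
 proof -
  have "\<sigma> * y : pI" using s0 y unfolding \<sigma>_def by blast
  then have "t * (\<sigma> * y) : pI" using pO_closed(5) t(1) by blast
  then show ?thesis unfolding \<epsilon>_def using pI_E by (metis mult.assoc mult.commute)
 qed
 have i\<epsilon>: "1 - \<epsilon> : ideal_pow OK P e" using ideal_pow_facts(5)[OF a(2), of e] t(2) unfolding \<epsilon>_def by simp
 obtain w0 where w0: "w0 : OK" "\<epsilon> * (1 - \<epsilon>) = of_nat p * w0" using \<epsilon>y[OF i\<epsilon>] by blast
 have "1 - \<epsilon> : P" using i\<epsilon> ideal_pow_P[of e] e2 by auto
 then have \<epsilon>nP: "\<epsilon> ~: P" using P_add[of \<epsilon> "1 - \<epsilon>"] P_1 by auto
 have OA: "\<tau> y : A" if "\<tau> : E" "y : OK" for \<tau> y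
  using pl.A_algebraic_int emb_algebraic_int that by blast
 have tm: "\<tau> (y * z) = \<tau> y * \<tau> z" if "\<tau> : E" "y : OK" "z : OK" for \<tau> y z
  using that E(2) O_K by blast
 have pM: "(of_nat p * m :: complex) : pl.M" if "m : A" for m using pl.M_mult[OF pl.M_p that] .
 define H where "H = {\<tau> : E. \<tau> \<epsilon> ~: pl.M}"
 have HE: "\<tau> : E" if "\<tau> : H" for \<tau> using that unfolding H_def by simp
 have finH: "finite H" using finite_E unfolding H_def by simp
 have "H ~= {}" using idempotent_conjugate[OF plA \<epsilon>O \<epsilon>nP w0] unfolding H_def by blast
 then have hpos: "card H > 0" using finH by (simp add: card_gt_0_iff)
 have hn: "card H <= n" using card_mono[OF finite_E, of H] card_E unfolding H_def by auto
 have t\<epsilon>w: "\<tau> \<epsilon> * (1 - \<tau> \<epsilon>) = of_nat p * \<tau> w0" if \<tau>: "\<tau> : E" for \<tau>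
  using arg_cong[OF w0(2), of \<tau>] \<epsilon>O w0(1) O_K K_closed by (simp add: E[OF \<tau>])
 have \<epsilon>1: "1 - \<tau> \<epsilon> : pl.M" if \<tau>: "\<tau> : H" for \<tau>
 proof -
  have "\<tau> \<epsilon> * (1 - \<tau> \<epsilon>) : pl.M" unfolding t\<epsilon>w[OF HE[OF \<tau>]] using pM OA HE[OF \<tau>] w0(1) by blast
  then show ?thesis
   using pl.M_prime pl.A_diff[OF pl.A_1] OA[OF HE[OF \<tau>] \<epsilon>O] \<tau> unfolding H_def by blast
 qed
 \<comment> \<open>\<epsilon> kills \<open>y ^ e\<close> modulo \<open>p\<close> and
   \<open>\<tau> \<epsilon>\<close> is a unit, so \<open>\<tau> y ^ e\<close> lies in
   \<open>M\<close>.\<close>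
 have PM: "\<tau> y : pl.M" if \<tau>: "\<tau> : H" and y: "y : P" for \<tau> y
 proof -
  note E' = HE[OF \<tau>]
  have yO: "y : OK" using P_O y by blast
  obtain w where w: "w : OK" "\<epsilon> * y ^ e = of_nat p * w" using \<epsilon>y[OF ideal_pow_facts(5)[OF y]] by blast
  have "\<tau> \<epsilon> * \<tau> y ^ e = of_nat p * \<tau> w"
   using arg_cong[OF w(2), of \<tau>] \<epsilon>O w(1) yO O_K K_closed by (simp add: E[OF E'])
  then have "\<tau> \<epsilon> * \<tau> y ^ e : pl.M" using pM OA[OF E' w(1)] by simp
  then have "\<tau> y ^ e : pl.M"
   using pl.M_prime OA[OF E' \<epsilon>O] pl.A_power[OF OA[OF E' yO]] \<tau> unfolding H_def by blast
  then show ?thesis using pl.M_power OA[OF E' yO] by blast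
 qed
 have unitP: "\<tau> y ~: pl.M" if \<tau>: "\<tau> : H" and y: "y : OK" "y ~: P" for \<tau> y
 proof
  assume M: "\<tau> y : pl.M"
  note E' = HE[OF \<tau>]
  obtain b where b: "b : OK" "1 - y * b : P" using P_unit[OF y] by blast
  have "\<tau> (1 - y * b) = 1 - \<tau> y * \<tau> b" using y b O_K K_closed by (simp add: E[OF E'])
  then have "1 - \<tau> y * \<tau> b : pl.M" using PM[OF \<tau> b(2)] by simp
  from pl.M_add[OF this pl.M_mult[OF M OA[OF E' b(1)]]] show False by simp
 qed
 define \<alpha> where "\<alpha> = \<epsilon> * \<pi> + (1 - \<epsilon>)"
 have \<alpha>O: "\<alpha> : OK" unfolding \<alpha>_def
  by (rule O_closed(3)[OF O_closed(4)[OF \<epsilon>O \<pi>O] O_closed(6)[OF O_closed(2) \<epsilon>O]])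
 have t\<alpha>: "\<tau> \<alpha> = \<tau> \<epsilon> * \<tau> \<pi> + (1 - \<tau> \<epsilon>)" if \<tau>: "\<tau> : E" for \<tau>
  unfolding \<alpha>_def using \<epsilon>O \<pi>O O_K K_closed by (simp add: E[OF \<tau>])
 \<comment> \<open>For \<tau> in \<open>H\<close> the term \<open>1 - \<tau> \<epsilon>\<close> is
   divisible by \<open>\<tau> \<pi> ^ e\<close>, hence by \<open>\<tau> \<pi> ^ 2\<close> as
   \<open>e\<close> is at least 2. So \<open>\<tau> \<alpha>\<close> is \<open>\<tau> \<pi>\<close>
   times a unit.\<close>
 have \<alpha>H: "\<exists>g. g : A & g ~: pl.M & \<tau> \<alpha> ^ e = of_nat p * g" if \<tau>: "\<tau> : H" for \<tau>
 proof -
  note E' = HE[OF \<tau>]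
  have us: "\<tau> s : A" "\<tau> s ~: pl.M" and uv: "\<tau> v : A" "\<tau> v ~: pl.M" and ue: "\<tau> \<epsilon> : A" "\<tau> \<epsilon> ~: pl.M"
   using unitP[OF \<tau>] s v OA[OF E'] \<epsilon>O \<tau> unfolding H_def by blast+
  note i_s = pl.unit_inverse[OF us] and iv = pl.unit_inverse[OF uv] and ie = pl.unit_inverse[OF ue]
  have sp': "\<tau> s * of_nat p = \<tau> \<pi> ^ e * \<tau> v"
   using arg_cong[OF sp, of \<tau>] s v \<pi>O O_K K_closed by (simp add: E[OF E'])
  define b where "b = \<tau> v * \<tau> w0 * inverse (\<tau> s) * inverse (\<tau> \<epsilon>)"
  have bA: "b : A" unfolding b_def by (intro pl.A_mult uv OA[OF E'] w0 conjunct2[OF i_s] conjunct2[OF ie])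
  have "1 - \<tau> \<epsilon> = \<tau> \<pi> ^ e * b"
  proof -
   have "(1 - \<tau> \<epsilon>) = of_nat p * \<tau> w0 * inverse (\<tau> \<epsilon>)"
    using t\<epsilon>w[OF E'] ie by (simp add: field_simps)
   also have "of_nat p = \<tau> \<pi> ^ e * \<tau> v * inverse (\<tau> s)" using sp' i_s by (simp add: field_simps)
   finally show ?thesis unfolding b_def by (simp add: ac_simps)
  qed
  moreover have "\<tau> \<pi> ^ e = \<tau> \<pi> * (\<tau> \<pi> * \<tau> \<pi> ^ (e - 2))" using e2
   by (metis Suc_1 Suc_diff_le diff_Suc_Suc diff_zero power_Suc numeral_2_eq_2 le_add_diff_inverse add_Suc plus_nat.simps(1))
  ultimately have "\<tau> \<alpha> = \<tau> \<pi> * (\<tau> \<epsilon> + \<tau> \<pi> * (\<tau> \<pi> ^ (e - 2) * b))"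
   unfolding t\<alpha>[OF E'] by (simp add: algebra_simps)
  moreover define k where "k = \<tau> \<epsilon> + \<tau> \<pi> * (\<tau> \<pi> ^ (e - 2) * b)"
  ultimately have \<alpha>k: "\<tau> \<alpha> = \<tau> \<pi> * k" by simp
  have \<pi>M: "\<tau> \<pi> : pl.M" "\<tau> \<pi> : A" using PM[OF \<tau> \<pi>] pl.M_A by blast+
  have bb: "\<tau> \<pi> * (\<tau> \<pi> ^ (e - 2) * b) : pl.M"
   by (rule pl.M_mult[OF \<pi>M(1) pl.A_mult[OF pl.A_power[OF \<pi>M(2)] bA]])
  have k: "k ~: pl.M" "k : A" unfolding k_def
   using pl.unit_add_M[OF ue bb] pl.A_add[OF ue(1) pl.M_A[OF bb]] by blast+
  define g where "g = \<tau> s * inverse (\<tau> v) * k ^ e"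
  have gA: "g : A" unfolding g_def by (intro pl.A_mult us pl.A_power k conjunct2[OF iv])
  have "g * (inverse (\<tau> s) * \<tau> v * inverse k ^ e) = 1"
   unfolding g_def using i_s iv pl.unit_inverse[OF k(2,1)] by (simp add: field_simps)
  moreover have "inverse (\<tau> s) * \<tau> v * inverse k ^ e : A"
   by (intro pl.A_mult uv pl.A_power conjunct2[OF i_s] conjunct2[OF pl.unit_inverse[OF k(2,1)]])
  ultimately have "g ~: pl.M" by (rule pl.unitI)
  moreover have "\<tau> \<alpha> ^ e = of_nat p * g"
  proof -
   have "\<tau> \<pi> ^ e = \<tau> s * of_nat p * inverse (\<tau> v)" using sp' iv by (simp add: field_simps)
   then show ?thesis unfolding \<alpha>k g_def power_mult_distrib by (simp add: ac_simps)
  qed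
  ultimately show ?thesis using gA by blast
 qed
 have \<alpha>nH: "\<tau> \<alpha> ^ e : A & \<tau> \<alpha> ^ e ~: pl.M" if \<tau>: "\<tau> : E - H" for \<tau>
 proof -
  have E': "\<tau> : E" and M: "\<tau> \<epsilon> : pl.M" using \<tau> unfolding H_def by auto
  have "\<tau> \<alpha> = 1 + \<tau> \<epsilon> * (\<tau> \<pi> - 1)" unfolding t\<alpha>[OF E'] by (simp add: algebra_simps)
  moreover have "\<tau> \<epsilon> * (\<tau> \<pi> - 1) : pl.M" by (rule pl.M_mult[OF M pl.A_diff[OF OA[OF E' \<pi>O] pl.A_1]])
  ultimately have "\<tau> \<alpha> ~: pl.M" using pl.unit_add_M[OF pl.A_1 pl.M_1] by simp
  then show ?thesis using pl.M_power pl.A_power OA[OF E' \<alpha>O] by blast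
 qed
 obtain gH where gH: "\<forall>\<tau>\<in>H. gH \<tau> : A & gH \<tau> ~: pl.M & \<tau> \<alpha> ^ e = of_nat p * gH \<tau>" using \<alpha>H by metis
 define g where "g = (\<Prod>\<tau>\<in>H. gH \<tau>) * (\<Prod>\<tau>\<in>E - H. \<tau> \<alpha> ^ e)"
 have prodM: "(\<Prod>\<tau>\<in>I. f \<tau>) : A & (\<Prod>\<tau>\<in>I. f \<tau>) ~: pl.M" if "\<forall>\<tau>\<in>I. f \<tau> : A & f \<tau> ~: pl.M" for I and f :: "(complex => complex) => complex"
  using that
 proof (induction I rule: infinite_finite_induct)
  case (insert i I)
  then show ?case using pl.M_prime[of "f i" "\<Prod>\<tau>\<in>I. f \<tau>"] pl.A_mult by auto
 qed (auto simp: pl.A_1)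
 have gA: "g : A" "g ~: pl.M"
  using prodM[of H gH] prodM[of "E - H" "%\<tau>. \<tau> \<alpha> ^ e"] gH \<alpha>nH pl.M_prime pl.A_mult unfolding g_def by blast+
 obtain k :: int where k: "(\<Prod>\<tau>\<in>E. \<tau> \<alpha>) = of_int k" using norm_Ints[OF \<alpha>O] by (auto elim: Ints_cases)
 have kg: "of_int (k ^ e) = of_nat p ^ card H * g"
 proof -
  have "of_int (k ^ e) = (\<Prod>\<tau>\<in>E. \<tau> \<alpha> ^ e)" by (simp add: prod_power_distrib flip: k)
  also have "... = (\<Prod>\<tau>\<in>H. \<tau> \<alpha> ^ e) * (\<Prod>\<tau>\<in>E - H. \<tau> \<alpha> ^ e)"
   using finite_E by (subst prod.subset_diff[of H E]) (auto simp: H_def)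
  also have "(\<Prod>\<tau>\<in>H. \<tau> \<alpha> ^ e) = (\<Prod>\<tau>\<in>H. of_nat p * gH \<tau>)" using gH by (intro prod.cong) auto
  finally show ?thesis unfolding g_def by (simp add: prod.distrib)
 qed
 have "g ~= 0" using gA(2) by auto
 then have k0: "k ~= 0" using kg pc0 e2 by (auto simp: power_0_left)
 define m where "m = multiplicity (int p) k"
 have pp: "prime (int p)" using p by simp
 obtain k' where k': "k = int p ^ m * k'" "\<not> int p dvd k'"
  using multiplicity_decompose'[OF k0, of "int p"] pp unfolding m_def by (metis not_prime_unit)
 have k'e: "\<not> int p dvd k' ^ e" using k'(2) pp prime_dvd_power by blast
 have eq: "of_nat p ^ (m * e) * of_int (k' ^ e) = of_nat p ^ card H * g"
  unfolding kg[symmetric] k'(1) by (simp add: power_mult_distrib power_mult)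
 \<comment> \<open>Compares the exponents of \<open>p\<close> in the \<open>e\<close>-th power of
   the norm \<open>k\<close> of \<alpha>; the remaining factors on both sides are units at the
   place.\<close>
 have "m * e = card H"
 proof (rule linorder_cases[of "m * e" "card H"])
  assume l: "m * e < card H"
  then have "(of_nat p :: complex) ^ card H = of_nat p ^ (m * e) * (of_nat p * of_nat p ^ (card H - m * e - 1))"
   by (simp flip: power_add power_Suc)
  then have "of_int (k' ^ e) = of_nat p * (of_nat p ^ (card H - m * e - 1) * g)" using eq pc0 by simp
  also have "... : pl.M" by (intro pM pl.A_mult pl.A_power pl.A_of_nat gA)
  finally show ?thesis using pl.M_of_int k'e by blast
 next
  assume l: "card H < m * e"
  then have "m * e = card H + Suc (m * e - card H - 1)" by simp
  then have "(of_nat p :: complex) ^ (m * e) = of_nat p ^ card H * (of_nat p * of_nat p ^ (m * e - card H - 1))"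
   by (metis power_add power_Suc)
  then have "g = of_nat p * (of_nat p ^ (m * e - card H - 1) * of_int (k' ^ e))" using eq pc0 by simp
  also have "... : pl.M" by (intro pM pl.A_mult pl.A_power pl.A_of_nat pl.A_of_int)
  finally show ?thesis using gA by blast
 qed
 then have "e dvd card H" by (metis dvd_triv_right)
 moreover have "p dvd card H"
 proof -
  obtain k where k: "tr \<epsilon> = of_int (int p * k)" using tr0 \<epsilon>O by blast
  have "tr \<epsilon> = (\<Sum>\<tau>\<in>H. \<tau> \<epsilon>) + (\<Sum>\<tau>\<in>E - H. \<tau> \<epsilon>)" unfolding nf_trace_def
   using finite_E by (subst sum.subset_diff[of H E]) (auto simp: H_def)
  then have "of_nat (card H) = (\<Sum>\<tau>\<in>H. 1 - \<tau> \<epsilon>) + (tr \<epsilon> - (\<Sum>\<tau>\<in>E - H. \<tau> \<epsilon>))"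
   by (simp add: sum_subtractf)
  also have "... : pl.M"
  proof -
   have "tr \<epsilon> : pl.M" unfolding k pl.M_of_int by simp
   moreover have "(\<Sum>\<tau>\<in>E - H. \<tau> \<epsilon>) : pl.M" by (rule pl.M_sum) (auto simp: H_def)
   moreover have "(\<Sum>\<tau>\<in>H. 1 - \<tau> \<epsilon>) : pl.M" by (rule pl.M_sum) (rule \<epsilon>1)
   ultimately show ?thesis using pl.M_add pl.M_diff by blast
  qed
  finally have "of_int (int (card H)) : pl.M" by simp
  then show ?thesis unfolding pl.M_of_int by simp
 qed
 ultimately show ?thesis using hpos hn e2 ram by blast
qed

text \<open>Take \<open>y = \<sigma> * \<pi>\<close> and \<open>k = e - 1\<close>. The factor
  \<sigma> sends \<open>\<pi> ^ e\<close> into the multiples of \<open>p\<close>, while it does not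
  change the order at \<open>P\<close>, where the power \<open>k\<close> still falls short.\<close>

lemma tame_power:
 assumes e: "3 <= ram_index K P (int p)"
 shows "\<exists>y\<in>OK. \<exists>k\<ge>2. y ^ k ~: pI & y ^ Suc k : pI"
proof -
 obtain e \<pi> u s v where \<pi>: "\<pi> : P" and s: "s : OK" "s ~: P" and v: "v : OK" "v ~: P"
  and sp: "s * of_nat p = \<pi> ^ e * v" and u: "u : OK" "u ~: P"
  and s0: "\<forall>y\<in>ideal_pow OK P e. v * u ^ e * y : pI" and "e \<ge> 1" "x : P --> e \<ge> 2"
  and ram: "ram_index K P (int p) = e" by (rule local_structure)
 have \<pi>O: "\<pi> : OK" using P_O[OF \<pi>] .
 define \<sigma> where "\<sigma> = v * u ^ e"
 have \<sigma>O: "\<sigma> : OK" unfolding \<sigma>_def by (rule O_closed(4)[OF v(1) O_closed(9)[OF u(1)]])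
 have "u ^ e ~: P" using P_power[OF u(1)] u(2) by auto
 then have \<sigma>P: "\<sigma> ~: P" unfolding \<sigma>_def using P_prime[OF v(1) O_closed(9)[OF u(1)]] v(2) by auto
 define k where "k = e - 1"
 have k: "e = Suc k" "k \<ge> 2" using e ram unfolding k_def by auto
 have "(\<sigma> * \<pi>) ^ Suc k = \<sigma> ^ k * (\<sigma> * \<pi> ^ e)" unfolding k(1) by (simp add: power_mult_distrib ac_simps)
 also have "... : pI"
  using s0 ideal_pow_facts(5)[OF \<pi>, of e] pO_closed(5) O_closed(9)[OF \<sigma>O] unfolding \<sigma>_def by blast
 finally have 1: "(\<sigma> * \<pi>) ^ Suc k : pI" .
 have 2: "(\<sigma> * \<pi>) ^ k ~: pI"
 proof
  assume "(\<sigma> * \<pi>) ^ k : pI"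
  then obtain z where z: "z : OK" "(\<sigma> * \<pi>) ^ k = of_nat p * z" by (rule pI_E)
  have "\<pi> ~= 0" using sp pc0 s P_0 k by auto
  have "\<pi> ^ k * (s * \<sigma> ^ k) = s * (\<sigma> * \<pi>) ^ k" by (simp add: power_mult_distrib ac_simps)
  also have "... = \<pi> ^ e * v * z" unfolding z(2) by (simp add: sp mult.assoc[symmetric])
  also have "... = \<pi> ^ k * (\<pi> * (v * z))" unfolding k(1) by (simp add: ac_simps)
  finally have "s * \<sigma> ^ k = \<pi> * (v * z)" using \<open>\<pi> ~= 0\<close> by simp
  moreover have "\<pi> * (v * z) : P" using P_mult2[OF \<pi> O_closed(4)[OF v(1) z(1)]] .
  ultimately have "s * \<sigma> ^ k : P" by simp
  then show False using P_prime[OF s(1) O_closed(9)[OF \<sigma>O]] s \<sigma>P P_power[OF \<sigma>O] by blast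
 qed
 show ?thesis using 1 2 k(2) O_closed(4)[OF \<sigma>O \<pi>O] by blast
qed

end

section \<open>Tame ramification, traces and the discriminant at 2\<close>

context numfield
begin

lemma local_primeI:
 assumes p: "prime (p::nat)" and x: "x : OK" "x ~: pO (int p)"
 shows "\<exists>w\<in>OK. local_prime K p (w * x)"
proof -
 have "int p > 0" using p by (simp add: prime_gt_0_nat)
 then obtain w where "w : OK" "w * x ~: pO (int p)"
  "\<forall>a\<in>OK. \<forall>b\<in>OK. w * x * (a * b) : pO (int p) --> w * x * a : pO (int p) \<or> w * x * b : pO (int p)"
  by (rule associated_prime[OF _ x])
 then have "local_prime K p (w * x)"
  using p x O_closed(4) by (unfold_locales) auto
 then show ?thesis using \<open>w : OK\<close> by blast
qed

text \<open>If all traces are divisible by \<open>p\<close>, then by \<open>unramified_trace\<close>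
  a prime above \<open>p\<close> is ramified, and tameness makes its index prime to
  \<open>p\<close>. The conditions on \<open>h\<close> and \<open>e\<close> are contradictory in the
  small degrees where this is applied.\<close>

lemma tame_traces:
 assumes tame: "tamely_ramified K" and p: "prime (p::nat)" and tr0: "\<forall>y\<in>OK. \<exists>k. tr y = of_int (int p * k)"
 shows "\<exists>h e. 0 < h & h <= n & p dvd h & e dvd h & 2 <= e & \<not> p dvd e"
proof -
 have "1 ~: pO (int p)"
 proof
  assume "1 : pO (int p)"
  then have "1 / of_int (int p) : OK" using pO_iff[of "int p" 1] p by (auto simp: prime_gt_0_nat)
  then have "1 / of_nat p : (\<int> :: complex set)"
   by (intro rational_algebraic_int_is_int) (auto simp: O_iff)
  then obtain k where "1 / of_nat p = (of_int k :: complex)" by (auto elim: Ints_cases)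
  then have "(of_int (int p * k) :: complex) = of_int 1" using p by (simp add: field_simps prime_gt_0_nat)
  then have "int p dvd 1" by (metis dvd_triv_left of_int_eq_iff)
  then show False using p by (simp add: prime_nat_iff)
 qed
 then obtain w where "w : OK" "local_prime K p (w * 1)" using local_primeI[OF p O_closed(2)] by blast
 then interpret local_prime K p w by simp
 have "w : P" using unramified_trace tr0 O_closed(4) x by blast
 then obtain h where h: "0 < h" "h <= n" "p dvd h" "ram_index K P (int p) dvd h" "2 <= ram_index K P (int p)"
  using ramified_trace tr0 by blast
 have "of_int (int p) : P" using P_p by simp
 then have "\<not> int p dvd int (ram_index K P (int p))"
  using tame[unfolded tamely_ramified_def, rule_format, of "int p" P] is_prime p by simp
 then show ?thesis using h by auto
qed

text \<open>Ryser-type inclusion-exclusion: it avoids the Galois closure in Stickelberger's argument.\<close>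
lemma permanent_Rats:
 assumes b: "!!i. i < n ==> b i : K"
 shows "(\<Sum>q | q permutes {0..<n}. \<Prod>i = 0..<n. em i (b (q i))) : \<rat>"
proof -
 \<comment> \<open>\<open>N T\<close> collects the index maps with image exactly \<open>T\<close>.
   The norm of the partial sum over \<open>S\<close> is the sum of the \<open>N T\<close> with
   \<open>T\<close> contained in \<open>S\<close>, so induction isolates \<open>N S\<close>; for the
   full set the maps are the permutations.\<close>
 define N where "N T = (\<Sum>f\<in>{f : PiE {0..<n} (%_. T). f ` {0..<n} = T}. \<Prod>i = 0..<n. em i (b (f i)))" for T
 have NQ: "N S : \<rat>" if "S \<subseteq> {0..<n}" for S
  using finite_subset[OF that finite_atLeastLessThan] that
 proof (induction S rule: finite_psubset_induct)
  case (psubset S)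
  have finP: "finite (PiE {0..<n} (%_. S))" using psubset.hyps by (intro finite_PiE) auto
  have "(\<Prod>\<sigma>\<in>E. \<sigma> (\<Sum>c\<in>S. b c)) : \<rat>" by (rule norm_Rats) (use psubset.prems b in \<open>auto intro!: K_sum\<close>)
  also have "(\<Prod>\<sigma>\<in>E. \<sigma> (\<Sum>c\<in>S. b c)) = (\<Prod>i = 0..<n. \<Sum>c\<in>S. em i (b c))"
   unfolding prod_E atLeast0LessThan
   by (intro prod.cong refl E_sum em_E) (use psubset.prems b in auto)
  also have "... = (\<Sum>f\<in>PiE {0..<n} (%_. S). \<Prod>i = 0..<n. em i (b (f i)))"
   using psubset.hyps by (intro prod_sum_PiE) auto
  also have "... = (\<Sum>T\<in>Pow S. \<Sum>f\<in>{f : PiE {0..<n} (%_. S). f ` {0..<n} = T}. \<Prod>i = 0..<n. em i (b (f i)))"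
   using psubset.hyps finP by (intro sum.group[symmetric]) (auto simp: PiE_def)
  also have "... = (\<Sum>T\<in>Pow S. N T)"
   unfolding N_def by (intro sum.cong refl) (auto simp: PiE_def extensional_def Pi_def)
  also have "... = N S + (\<Sum>T\<in>Pow S - {S}. N T)" using psubset.hyps by (intro sum.remove) auto
  finally have "N S + (\<Sum>T\<in>Pow S - {S}. N T) : \<rat>" .
  moreover have "(\<Sum>T\<in>Pow S - {S}. N T) : \<rat>" by (rule Rats_sum) (use psubset in auto)
  ultimately have "(N S + (\<Sum>T\<in>Pow S - {S}. N T)) - (\<Sum>T\<in>Pow S - {S}. N T) : \<rat>" by (rule Rats_diff)
  then show ?case by simp
 qed
 have "(\<Sum>q | q permutes {0..<n}. \<Prod>i = 0..<n. em i (b (q i))) = N {0..<n}"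
  unfolding N_def
 proof (rule sum.reindex_bij_witness[of _ "%f i. if i : {0..<n} then f i else i" "%q. restrict q {0..<n}"])
  fix q assume q: "q : {q. q permutes {0..<n}}"
  then have "q ` {0..<n} = {0..<n}" by (simp add: permutes_image)
  then show "restrict q {0..<n} : {f : PiE {0..<n} (%_. {0..<n}). f ` {0..<n} = {0..<n}}" by auto
  show "(%i. if i : {0..<n} then restrict q {0..<n} i else i) = q"
   using q by (auto simp: permutes_def fun_eq_iff)
 next
  fix f assume f: "f : {f : PiE {0..<n} (%_. {0..<n}). f ` {0..<n} = {0..<n}}"
  then have im: "f ` {0..<n} = {0..<n}" by auto
  then have "inj_on f {0..<n}" by (intro eq_card_imp_inj_on) auto
  then have "bij_betw f {0..<n} {0..<n}" using im by (simp add: bij_betw_def)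
  then have "bij_betw (%i. if i : {0..<n} then f i else i) {0..<n} {0..<n}"
   by (subst bij_betw_cong[of _ _ f]) auto
  then show "(%i. if i : {0..<n} then f i else i) : {q. q permutes {0..<n}}"
   by (auto intro!: bij_imp_permutes)
  show "restrict (%i. if i : {0..<n} then f i else i) {0..<n} = f"
   using f by (auto simp: PiE_def extensional_def restrict_def fun_eq_iff)
 qed (auto intro!: prod.cong)
 then show ?thesis using NQ[of "{0..<n}"] by simp
qed

text \<open>The numerator raised to the power \<open>k + 1\<close> contains the factor 2 to the
  power \<open>k + j\<close>, and \<open>k + j\<close> is at least \<open>2 * k - 1\<close>, which
  reaches \<open>k + 1\<close> because \<open>k\<close> is at least 2. With \<open>k = e - 1\<close>
  this is where a ramification index of 2 has to be excluded.\<close>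

lemma half_product_integral:
 assumes y: "y : OK" and k: "k \<ge> 2" "y ^ Suc k : pO 2" and \<tau>: "\<tau> : E" "\<tau>' : E" and j: "j \<ge> k - 1"
 shows "algebraic_int (\<tau> (y ^ k) * \<tau>' (y ^ j) / 2)"
proof (rule algebraic_int_power_imp)
 obtain z where z: "z : OK" "y ^ Suc k = 2 * z" using k(2) unfolding pO_def by auto
 have yK: "y : K" "z : K" using y z O_K by auto
 have ty: "\<rho> y ^ Suc k = 2 * \<rho> z" if \<rho>: "\<rho> : E" for \<rho>
 proof -
  have "\<rho> (of_int 2 * z) = \<rho> (of_int 2) * \<rho> z" using E(2)[OF \<rho> K_closed(11) yK(2)] .
  then have "\<rho> (2 * z) = 2 * \<rho> z" unfolding E(9)[OF \<rho>] by simp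
  then show ?thesis using E(7)[OF \<rho> yK(1), of "Suc k"] z(2) by argo
 qed
 have aint: "algebraic_int (\<tau> z)" "algebraic_int (\<tau>' z)" "algebraic_int (\<tau>' y)"
  using emb_algebraic_int \<tau> z y by auto
 have "(\<tau> (y ^ k) * \<tau>' (y ^ j)) ^ Suc k = (\<tau> y ^ Suc k) ^ k * (\<tau>' y ^ Suc k) ^ j"
  unfolding E(7)[OF \<tau>(1) yK(1)] E(7)[OF \<tau>(2) yK(1)] power_mult_distrib power_mult[symmetric]
  by (simp only: mult.commute)
 also have "... = 2 ^ (k + j) * (\<tau> z ^ k * \<tau>' z ^ j)"
  unfolding ty[OF \<tau>(1)] ty[OF \<tau>(2)] power_mult_distrib power_add by (simp add: ac_simps)
 also have "k + j = Suc k + (k + j - Suc k)" using k j by auto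
 then have "(2::complex) ^ (k + j) = 2 ^ Suc k * 2 ^ (k + j - Suc k)" by (metis power_add)
 finally have "(\<tau> (y ^ k) * \<tau>' (y ^ j) / 2) ^ Suc k = of_int (2 ^ (k + j - Suc k)) * (\<tau> z ^ k * \<tau>' z ^ j)"
  by (simp add: power_divide del: power_Suc)
 also have "algebraic_int ..." using aint by (intro algebraic_int_add_mult algebraic_int_power algebraic_int_of_int_complex)
 finally show "algebraic_int ((\<tau> (y ^ k) * \<tau>' (y ^ j) / 2) ^ Suc k)" .
qed simp

lemma disc_replace:
 assumes b: "!!l. l < n ==> b l : K" and i: "i < n" and z: "z = (\<Sum>l<n. of_int (X l) * b l)"
 shows "disc (b(i := z)) = (of_int (X i))\<^sup>2 * disc b"
proof -
 have "disc (b(i := z)) = (det (mat n n (%(m, l). if l = i then of_int (X m) else if m = l then 1 else 0)))\<^sup>2 * disc b"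
 proof (rule disc_transform)
  fix l assume l: "l < n"
  show "(b(i := z)) l = (\<Sum>m<n. (if l = i then of_int (X m) else if m = l then 1 else 0) * b m)"
   using l by (cases "l = i") (auto simp: z if_distrib[of "%c. c * _"] sum.delta cong: if_cong)
 qed (use b in auto)
 also have "det (mat n n (%(m, l). if l = i then of_int (X m) else if m = l then 1 else 0)) = (of_int (X i) :: complex)"
  by (rule det_replace_column[OF i])
 finally show ?thesis .
qed

text \<open>Stickelberger's argument: the Leibniz expansion of the square root of the discriminant is \<open>P - N\<close>, and a
 basis starting with suitable powers of \<open>y\<close> makes both \<open>P\<close> and \<open>N\<close> divisible by \<open>2\<close>.\<close>
lemma stickelberger:
 assumes y: "y : OK" and k: "k \<ge> 2" "y ^ k ~: pO 2" "y ^ Suc k : pO 2" and d4: "4 dvd nf_disc K"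
 shows "(nf_disc K div 4) mod 4 = 0 \<or> (nf_disc K div 4) mod 4 = 1"
proof -
 obtain b where b: "zbasis b" by (rule zbasis_ex)
 have bO: "!!l. l < n ==> b l : OK" using b unfolding zbasis_def by blast
 have bK: "!!l. l < n ==> b l : K" using bO O_K by blast
 have yk: "y ^ m : OK" "y ^ m : K" for m using O_closed(9)[OF y] O_K by blast+
 obtain X where X: "y ^ k = (\<Sum>l<n. of_int (X l) * b l)" using coords_ex[OF b yk(1)] .
 obtain Y where Y: "y ^ (k - 1) = (\<Sum>l<n. of_int (Y l) * b l)" using coords_ex[OF b yk(1)] .
 obtain i where i: "i < n" "odd (X i)" using zbasis_pO[OF b X, of 2] k(2) by auto
 \<comment> \<open>Eliminates the \<open>i\<close>-th coordinate of \<open>y ^ (k - 1)\<close>, so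
   that \<open>y ^ k\<close> and \<open>w\<close> can replace two basis vectors by a base change of
   odd determinant.\<close>
 define W where "W l = X i * Y l - Y i * X l" for l
 define w where "w = of_int (X i) * y ^ (k - 1) - of_int (Y i) * y ^ k"
 have wO: "w : OK" unfolding w_def by (intro O_closed(6) O_closed(4) O_closed(7) yk)
 have w: "w = (\<Sum>l<n. of_int (W l) * b l)"
  unfolding w_def X Y W_def by (simp add: sum_distrib_left sum_subtractf algebra_simps)
 \<comment> \<open>Multiplication by \<open>y\<close> turns \<open>w\<close> into an odd multiple of
   \<open>y ^ k\<close> modulo 2.\<close>
 have "w ~: pO 2"
 proof
  assume "w : pO 2"
  then have "w * y + of_int (Y i) * y ^ Suc k : pO 2"
   by (intro pO_closed(2) pO_closed(4) pO_closed(5) y O_closed(7) k(3))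
  moreover have "y ^ k = y * y ^ (k - 1)" using k(1) by (metis power_Suc Suc_diff_1 gr0I not_numeral_le_zero)
  then have "w * y + of_int (Y i) * y ^ Suc k = of_int (X i) * y ^ k" unfolding w_def by (simp add: algebra_simps)
  ultimately have "of_int (X i) * y ^ k : pO 2" by simp
  then have "of_int (X i) * y ^ k - of_int 2 * (of_int (X i div 2) * y ^ k) : pO 2"
   by (intro pO_closed(3) pO_closed(7) O_closed(4) O_closed(7) yk)
  moreover have "(of_int (X i) :: complex) = of_int (2 * (X i div 2) + 1)" using i(2) by simp
  then have "of_int (X i) * y ^ k - of_int 2 * (of_int (X i div 2) * y ^ k) = y ^ k"
   by (simp add: algebra_simps)
  ultimately show False using k(2) by simp
 qed
 then obtain j where j: "j < n" "odd (W j)" using zbasis_pO[OF b w, of 2] by auto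
 have Wi: "W i = 0" unfolding W_def by simp
 then have ij: "i ~= j" using j by auto
 define b1 where "b1 = b(i := y ^ k)"
 define b2 where "b2 = b1(j := w)"
 have b1K: "b1 l : K" and b1O: "b1 l : OK" if "l < n" for l unfolding b1_def using bK bO yk that by auto
 have b2O: "b2 l : OK" if "l < n" for l unfolding b2_def using b1O wO that by auto
 have b2K: "b2 l : K" if "l < n" for l using b2O O_K that by blast
 have w1: "w = (\<Sum>l<n. of_int (W l) * b1 l)" unfolding w b1_def by (intro sum.cong refl) (use Wi in auto)
 define c where "c = X i * W j"
 have oddc: "odd c" unfolding c_def using i j by simp
 have disc: "disc b2 = of_int (c\<^sup>2 * nf_disc K)"
  using disc_replace[OF b1K j(1) w1] disc_replace[OF bK i(1) X] nf_disc_eq[OF b]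
  unfolding b2_def b1_def[symmetric] c_def by (simp add: power_mult_distrib)
 let ?S = "{q. q permutes {0..<n}}"
 have finS: "finite ?S" by (rule finite_permutations) simp
 define T where "T q = (\<Prod>r = 0..<n. em r (b2 (q r)))" for q
 \<comment> \<open>\<open>P\<close> and \<open>N\<close> are the halves of the sums over the even
   and over the odd permutations: the determinant is \<open>2 * (P - N)\<close> and the permanent
   \<open>2 * (P + N)\<close>.\<close>
 define P where "P = (\<Sum>q\<in>?S. if signof q = (1::complex) then T q / 2 else 0)"
 define N where "N = (\<Sum>q\<in>?S. if signof q = (1::complex) then 0 else T q / 2)"
 have T2: "algebraic_int (T q / 2)" if q: "q permutes {0..<n}" for q
 proof -
  obtain r1 where r1: "r1 < n" "q r1 = i" using i(1) permutes_image[OF q] by (metis atLeast0LessThan imageE lessThan_iff)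
  obtain r2 where r2: "r2 < n" "q r2 = j" using j(1) permutes_image[OF q] by (metis atLeast0LessThan imageE lessThan_iff)
  have ne: "r1 ~= r2" using r1 r2 ij by auto
  define R where "R = (\<Prod>r\<in>{0..<n} - {r1} - {r2}. em r (b2 (q r)))"
  have Tq: "T q = em r1 (b2 i) * (em r2 (b2 j) * R)"
   unfolding T_def R_def using r1 r2 ne
   by (subst prod.remove[of _ r1], simp, simp, subst prod.remove[of _ r2]) auto
  have bij: "b2 i = y ^ k" "b2 j = w" unfolding b2_def b1_def using ij by auto
  have emw: "em r2 w = of_int (X i) * em r2 (y ^ (k - 1)) - of_int (Y i) * em r2 (y ^ k)"
   unfolding w_def using yk K_closed em_E[OF r2(1)] by (simp add: E)
  have "T q / 2 = (of_int (X i) * (em r1 (y ^ k) * em r2 (y ^ (k - 1)) / 2)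
    - of_int (Y i) * (em r1 (y ^ k) * em r2 (y ^ k) / 2)) * R"
   unfolding Tq bij emw by (simp add: algebra_simps diff_divide_distrib)
  also have "algebraic_int ..."
  proof (intro algebraic_int_add_mult algebraic_int_diff algebraic_int_of_int_complex)
   show "algebraic_int (em r1 (y ^ k) * em r2 (y ^ (k - 1)) / 2)" "algebraic_int (em r1 (y ^ k) * em r2 (y ^ k) / 2)"
    using half_product_integral[OF y k(1,3) em_E[OF r1(1)] em_E[OF r2(1)]] by auto
   show "algebraic_int R" unfolding R_def
   proof (rule algebraic_int_prod)
    fix r assume "r : {0..<n} - {r1} - {r2}"
    then have "r < n" "q r < n" using permutes_in_image[OF q, of r] by auto
    then show "algebraic_int (em r (b2 (q r)))" using emb_algebraic_int[OF em_E b2O] by blast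
   qed
  qed
  finally show ?thesis .
 qed
 have PN: "algebraic_int P" "algebraic_int N"
  unfolding P_def N_def by (intro algebraic_int_sum; use T2 in auto)+
 have "2 * (P + N) = (\<Sum>q\<in>?S. T q)"
  unfolding P_def N_def sum.distrib[symmetric] sum_distrib_left by (intro sum.cong) auto
 also have "... : \<rat>" unfolding T_def by (rule permanent_Rats[OF b2K])
 finally have "2 * (P + N) : \<rat>" .
 then have "2 * (P + N) / 2 : \<rat>" by (rule Rats_divide) simp
 then have "P + N : \<rat>" by (simp only: nonzero_mult_div_cancel_left[OF zero_neq_numeral[symmetric]])
 then have "P + N : \<int>" using PN by (intro rational_algebraic_int_is_int algebraic_int_add_mult) simp_all
 then obtain \<alpha> where \<alpha>: "P + N = of_int \<alpha>" by (auto elim: Ints_cases)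
 have "det (mat n n (%(k, i). em k (b2 i))) = (\<Sum>q\<in>?S. signof q * T q)" unfolding prod_if_det T_def by simp
 also have "... = 2 * (P - N)"
  unfolding P_def N_def sum_subtractf[symmetric] sum_distrib_left
  by (intro sum.cong refl) (auto simp: sign_def)
 finally have "disc b2 = (2 * (P - N))\<^sup>2" by (simp only: disc_emb[OF b2K])
 then have "disc b2 = 4 * (P - N)\<^sup>2" by (simp only: power_mult_distrib) simp
 moreover obtain d' where d': "nf_disc K = 4 * d'" using d4 by auto
 ultimately have PmN: "(P - N)\<^sup>2 = of_int (c\<^sup>2 * d')" using disc by simp
 have "4 * (P * N) = (P + N)\<^sup>2 - (P - N)\<^sup>2" by (simp add: power2_eq_square algebra_simps)
 then have PN4: "4 * (P * N) = of_int (\<alpha>\<^sup>2 - c\<^sup>2 * d')" unfolding PmN \<alpha> by simp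
 define m where "m = \<alpha>\<^sup>2 - c\<^sup>2 * d'"
 have "P * N = of_int m / of_int 4" using PN4[folded m_def] by (metis of_int_numeral nonzero_mult_div_cancel_left zero_neq_numeral)
 then have "P * N : \<rat>" by (simp only: Rats_divide Rats_of_int)
 then have "P * N : \<int>" using PN by (intro rational_algebraic_int_is_int algebraic_int_add_mult) simp_all
 then obtain \<beta> where "P * N = of_int \<beta>" by (auto elim: Ints_cases)
 then have "(of_int (4 * \<beta>) :: complex) = of_int (\<alpha>\<^sup>2 - c\<^sup>2 * d')" using PN4 by simp
 then have eq: "\<alpha>\<^sup>2 - c\<^sup>2 * d' = 4 * \<beta>" by (simp only: of_int_eq_iff)
 \<comment> \<open>Odd squares are 1 modulo 4, so \<open>d'\<close> is congruent to the square of
   \<alpha> modulo 4.\<close>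
 obtain c0 where c0: "c = 2 * c0 + 1" using oddc by (auto elim: oddE)
 define \<gamma> where "\<gamma> = (c0\<^sup>2 + c0) * d' + \<beta>"
 have "d' = \<alpha>\<^sup>2 - 4 * \<gamma>" using eq unfolding c0 \<gamma>_def by (simp add: power2_eq_square algebra_simps)
 moreover have "\<alpha>\<^sup>2 mod 4 = 0 \<or> \<alpha>\<^sup>2 mod 4 = 1"
 proof (cases "even \<alpha>")
  case True then show ?thesis by (auto elim!: evenE simp: power2_eq_square)
 next
  case False
  then obtain m where "\<alpha> = 2 * m + 1" by (auto elim: oddE)
  then have "\<alpha>\<^sup>2 = 1 + 4 * (m\<^sup>2 + m)" by (simp add: power2_eq_square algebra_simps)
  then show ?thesis by presburger
 qed
 ultimately have "d' mod 4 = 0 \<or> d' mod 4 = 1" by presburger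
 then show ?thesis using d' by simp
qed

text \<open>A null vector modulo 2 yields a ramified prime above 2. Tameness makes its index odd,
  hence at least 3, as \<open>tame_power\<close> requires.\<close>

lemma tame_disc:
 assumes tame: "tamely_ramified K" and d4: "4 dvd nf_disc K"
 shows "(nf_disc K div 4) mod 4 = 0 \<or> (nf_disc K div 4) mod 4 = 1"
proof -
 have "2 dvd nf_disc K" using d4 by presburger
 then obtain z where z: "z : null_mod 2" "z ~: pO 2" using null_exists[of 2] by auto
 have zO: "z : OK" using z unfolding null_mod_def by simp
 have "int 2 = 2" by simp
 then obtain w where w: "w : OK" "local_prime K 2 (w * z)" using local_primeI[of 2 z] zO z(2) by auto
 interpret local_prime K 2 "w * z" by fact
 have "w * z : P"
 proof (rule ccontr)
  assume "w * z ~: P"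
  moreover have "\<exists>k. tr (w * z * y) = of_int (int 2 * k)" if y: "y : OK" for y
  proof -
   have "\<exists>k. tr (z * (w * y)) = of_int (2 * k)" using z(1) O_closed(4)[OF w(1) y] unfolding null_mod_def by blast
   then show ?thesis by (simp add: ac_simps)
  qed
  ultimately show False using unramified_trace by blast
 qed
 then have "ram_index K P (int 2) \<ge> 2" using local_structure by metis
 moreover have "of_int (int 2) : P" using P_p by simp
 then have "\<not> int 2 dvd int (ram_index K P (int 2))"
  using tame[unfolded tamely_ramified_def, rule_format, of "int 2" P] is_prime p by simp
 ultimately have "ram_index K P (int 2) \<ge> 3" by (cases "ram_index K P (int 2) = 2") auto
 then obtain y k where "y : OK" "k \<ge> 2" "y ^ k ~: pO (int 2)" "y ^ Suc k : pO (int 2)" using tame_power by blast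
 then show ?thesis using stickelberger[of y k] d4 by simp
qed

end

section \<open>A generator of the codifferent modulo the integers\<close>

lemma coprime_add_mult: "coprime a b ==> coprime (a + b * c) b" for a b c :: int
 using gcd_add_mult[of b c a] by (simp add: coprime_iff_gcd_eq_1 gcd.commute ac_simps)

context numfield
begin

text \<open>The adjugate of the Gram matrix expresses the discriminant times the dual basis through
  the basis.\<close>

lemma codiff_disc:
 assumes z: "z : codiff" shows "of_int (nf_disc K) * z : OK"
proof -
 obtain b g where b: "zbasis b" and g: "\<forall>i<n. \<forall>j<n. tr (b i * b j) = of_int (g i j)"
  and d: "nf_disc K = det (mat n n (%(i, j). g i j))" using gram_data by blast
 obtain b' where db: "dual b b'" using zbasis_dual[OF b] by blast
 have bO: "b i : OK" and bK: "b i : K" if "i < n" for i using b O_K that unfolding zbasis_def by blast+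
 let ?A = "mat n n (%(i, j). g i j)"
 define G where "G i j = adj_mat ?A $$ (i, j)" for i j
 have A: "?A : carrier_mat n n" by simp
 have adj: "(\<Sum>j<n. G i j * g j k) = (if i = k then nf_disc K else 0)" if ik: "i < n" "k < n" for i k
 proof -
  have "(adj_mat ?A * ?A) $$ (i, k) = (nf_disc K \<cdot>\<^sub>m 1\<^sub>m n) $$ (i, k)"
   unfolding adj_mat(3)[OF A] d by simp
  then show ?thesis using ik adj_mat(1)[OF A] unfolding G_def
   by (simp add: scalar_prod_def atLeast0LessThan)
 qed
 have db': "of_int (nf_disc K) * b' i : OK" if i: "i < n" for i
 proof -
  define X where "X = (\<Sum>j<n. of_int (G i j) * b j)"
  have XO: "X : OK" unfolding X_def by (rule O_sum) (use O_closed(4)[OF O_closed(7) bO] in auto)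
  have "tr (X * b k) = (if i = k then of_int (nf_disc K) else 0)" if k: "k < n" for k
  proof -
   have "tr (X * b k) = (\<Sum>j<n. tr (of_int (G i j) * (b j * b k)))"
    unfolding X_def sum_distrib_right mult.assoc
    by (rule tr_sum) (simp add: K_closed bK k)
   also have "... = (\<Sum>j<n. of_int (G i j * g j k))"
   proof (intro sum.cong refl)
    fix j assume "j : {..<n}"
    then have j: "j < n" by simp
    show "tr (of_int (G i j) * (b j * b k)) = of_int (G i j * g j k)"
     unfolding tr_scale[OF Rats_of_int K_closed(4)[OF bK[OF j] bK[OF k]]] using g j k by simp
   qed
   also have "... = of_int (if i = k then nf_disc K else 0)" unfolding adj[OF i k, symmetric] by simp
   finally show ?thesis by simp
  qed
  then have "X = (\<Sum>k<n. (if i = k then of_int (nf_disc K) else 0) * b' k)"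
   using dual_expand[OF dual_sym[OF db] O_K[OF XO]] by simp
  also have "... = of_int (nf_disc K) * b' i"
   using i by (simp add: if_distrib[of "%c. c * _"] sum.delta cong: if_cong)
  finally show ?thesis using XO by simp
 qed
 have "of_int (nf_disc K) * z = (\<Sum>k<n. tr (z * b k) * (of_int (nf_disc K) * b' k))"
  using arg_cong[OF dual_expand[OF dual_sym[OF db] codiff_K[OF z]], of "%x. of_int (nf_disc K) * x"]
  by (simp only: sum_distrib_left mult.left_commute)
 also have "... : OK"
 proof (rule O_sum)
  fix k assume "k : {..<n}"
  then have k: "k < n" by simp
  obtain m where "tr (z * b k) = of_int m" using codiffD[OF z bO[OF k]] by (auto elim: Ints_cases)
  then show "tr (z * b k) * (of_int (nf_disc K) * b' k) : OK"
   using O_closed(4)[OF O_closed(7) db'[OF k]] by simp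
 qed
 finally show ?thesis .
qed

lemma null_mod_codiff:
 assumes "x : null_mod m" "m ~= 0" shows "x / of_int m : codiff" "x : OK"
proof -
 show O: "x : OK" using assms unfolding null_mod_def by simp
 have "tr (x / of_int m * y) : \<int>" if y: "y : OK" for y
 proof -
  obtain k where k: "tr (x * y) = of_int (m * k)" using assms(1) y unfolding null_mod_def by blast
  have "tr (x / of_int m * y) = tr ((1 / of_int m) * (x * y))" by simp
  also have "... = (1 / of_int m) * tr (x * y)" using O y O_K K_closed(4) by (intro tr_scale) auto
  finally show ?thesis unfolding k using assms(2) by simp
 qed
 then show "x / of_int m : codiff" unfolding codiff_def using O O_K K_closed(8,11) by auto
qed

lemma codiff_null_mod:
 assumes z: "z : codiff" and O: "of_int m * z : OK" shows "of_int m * z : null_mod m"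
 unfolding null_mod_def
proof (intro CollectI conjI O ballI)
 fix y assume y: "y : OK"
 obtain k where k: "tr (z * y) = of_int k" using codiffD[OF z y] by (auto elim: Ints_cases)
 have "tr (of_int m * z * y) = of_int m * tr (z * y)"
  unfolding mult.assoc using codiff_K[OF z] O_K[OF y] K_closed(4) by (intro tr_scale) auto
 then show "\<exists>k. tr (of_int m * z * y) = of_int (m * k)" unfolding k by auto
qed

lemma coprime_O:
 assumes w: "of_int a * w : OK" "of_int c * w : OK" and co: "coprime a c" shows "w : OK"
proof -
 obtain i j where "i * a + j * c = 1" using bezout_int[of a c] co by (auto simp: coprime_iff_gcd_eq_1)
 then have "of_int i * (of_int a * w) + of_int j * (of_int c * w) = w"
  by (metis (no_types) distrib_right mult.assoc mult_1 of_int_1 of_int_add of_int_mult)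
 then show ?thesis using O_closed(3)[OF O_closed(4)[OF O_closed(7) w(1)] O_closed(4)[OF O_closed(7) w(2)]] by metis
qed

text \<open>Induction over the primes of the squarefree \<open>m\<close>, in the manner of the
  Chinese remainder theorem: for a further prime \<open>p\<close> add \<open>x / p\<close> with a
  null vector \<open>x\<close>. Its norm contributes \<open>r / p\<close> with \<open>r\<close>
  prime to \<open>p\<close> by \<open>norm_null_disc\<close>, and the cross term is integral since
  its multiples by the coprime numbers \<open>p\<close> and \<open>m'\<close> are.\<close>

lemma codiff_element:
 assumes "m > 0" "!!p. prime p ==> p dvd m ==> int p dvd nf_disc K & \<not> (int p)\<^sup>2 dvd nf_disc K"
  "!!p. prime p ==> \<not> p\<^sup>2 dvd m"
 shows "\<exists>f\<in>codiff. \<exists>\<rho>. of_nat m * f : OK & tr (f * f) = of_int \<rho> / of_nat m & coprime \<rho> (int m)"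
 using assms
proof (induction m rule: less_induct)
 case (less m)
 show ?case
 proof (cases "m = 1")
  case True
  have "0 : codiff" unfolding codiff_def using K_closed by simp
  then show ?thesis using True O_closed by (intro bexI[of _ 0] exI[of _ 0]) auto
 next
  case False
  then obtain p where p: "prime p" "p dvd m" using prime_factor_nat by blast
  then obtain m' where m': "m = p * m'" by auto
  have pd: "int p dvd nf_disc K" "\<not> (int p)\<^sup>2 dvd nf_disc K" using less.prems(2)[OF p] by auto
  have p1: "p > 1" "p ~= 0" using prime_gt_1_nat[OF p(1)] by auto
  have m'0: "m' > 0" using less.prems(1) m' by (cases m') auto
  have npm': "\<not> p dvd m'" using less.prems(3)[OF p(1)] m' by (auto simp: power2_eq_square)
  obtain f \<rho> where f: "f : codiff" "of_nat m' * f : OK" "tr (f * f) = of_int \<rho> / of_nat m'" "coprime \<rho> (int m')"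
  proof -
   have "m' < m" using m' p1 m'0 by simp
   moreover have "int q dvd nf_disc K & \<not> (int q)\<^sup>2 dvd nf_disc K" if "prime q" "q dvd m'" for q
    using less.prems(2)[OF that(1)] that(2) m' by simp
   moreover have "\<not> q\<^sup>2 dvd m'" if "prime q" for q using less.prems(3)[OF that] m' by auto
   ultimately have "\<exists>f\<in>codiff. \<exists>\<rho>. of_nat m' * f : OK & tr (f * f) = of_int \<rho> / of_nat m' & coprime \<rho> (int m')"
    using m'0 by (intro less.IH)
   then show ?thesis using that by blast
  qed
  have pi: "prime (int p)" using p by simp
  obtain x where x: "x : null_mod (int p)" "x ~: pO (int p)" using null_exists[OF pi pd(1)] .
  define h where "h = x / of_nat p"
  have h: "h : codiff" and xO: "x : OK" using null_mod_codiff[OF x(1)] p1 unfolding h_def by auto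
  have ph: "of_nat p * h = x" unfolding h_def using p1 by simp
  obtain r where r: "tr (x * x) = of_int (int p * r)" using x(1) xO unfolding null_mod_def by blast
  have nr: "\<not> int p dvd r"
  proof
   assume "int p dvd r"
   then obtain k where "r = int p * k" by auto
   then have "tr (x * x) = of_int ((int p)\<^sup>2 * k)" using r by (simp add: power2_eq_square ac_simps)
   then show False using norm_null_disc[OF pi x] pd by blast
  qed
  have fK: "f : K" and hK: "h : K" using f(1) h codiff_K by auto
  note Kp = K_closed(4)[OF fK hK] K_closed(4)[OF fK fK] K_closed(4)[OF hK hK]
  have hh: "of_nat p * tr (h * h) = of_int r"
  proof -
   have "of_nat p ^ 2 * tr (h * h) = tr (of_nat p ^ 2 * (h * h))" using Kp by (intro tr_scale[symmetric]) auto
   also have "of_nat p ^ 2 * (h * h) = x * x" unfolding ph[symmetric] by (simp add: power2_eq_square)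
   finally show ?thesis using r p1 by (simp add: power2_eq_square)
  qed
  have fh: "tr (f * h) : \<int>"
  proof -
   obtain a where a: "tr (h * (of_nat m' * f)) = of_int a" using codiffD[OF h f(2)] by (auto elim: Ints_cases)
   obtain c where c: "tr (f * x) = of_int c" using codiffD[OF f(1) xO] by (auto elim: Ints_cases)
   have "tr (h * (of_nat m' * f)) = of_nat m' * tr (f * h)"
    using tr_scale[of "of_nat m'" "f * h"] Kp by (simp add: ac_simps)
   then have a': "of_nat m' * tr (f * h) = of_int a" using a by simp
   have "tr (f * x) = of_nat p * tr (f * h)"
    using tr_scale[of "of_nat p" "f * h"] Kp unfolding ph[symmetric] by (simp add: ac_simps)
   then have c': "of_nat p * tr (f * h) = of_int c" using c by simp
   have "coprime (int p) (int m')" using npm' p by (simp add: prime_imp_coprime)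
   then obtain i j where ij: "i * int p + j * int m' = 1" using bezout_int[of "int p" "int m'"] by (auto simp: coprime_iff_gcd_eq_1)
   have "tr (f * h) = of_int (i * int p + j * int m') * tr (f * h)" unfolding ij by simp
   also have "... = of_int i * (of_nat p * tr (f * h)) + of_int j * (of_nat m' * tr (f * h))"
    by (simp add: algebra_simps)
   finally have "tr (f * h) = of_int (i * c + j * a)" unfolding a' c' by simp
   then show ?thesis by simp
  qed
  then obtain k where k: "tr (f * h) = of_int k" by (auto elim: Ints_cases)
  have "(f + h) * (f + h) = f * f + (h * h + (f * h + f * h))" by (simp add: algebra_simps)
  then have "tr ((f + h) * (f + h)) = tr (f * f) + (tr (h * h) + (tr (f * h) + tr (f * h)))"
   using tr_add[OF Kp(2) K_closed(3)[OF Kp(3) K_closed(3)[OF Kp(1) Kp(1)]]]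
    tr_add[OF Kp(3) K_closed(3)[OF Kp(1) Kp(1)]] tr_add[OF Kp(1) Kp(1)] by metis
  also have "tr (h * h) = of_int r / of_nat p" using hh p1 by (simp add: field_simps)
  finally have trm: "tr ((f + h) * (f + h)) = of_int (\<rho> * int p + r * int m' + 2 * k * (int p * int m')) / of_nat m"
   unfolding f(3) k m' using p1 m'0 by (simp add: field_simps)
  have "coprime (\<rho> * int p + r * int m' + 2 * k * (int p * int m')) (int p)"
  proof -
   have "coprime (r * int m') (int p)"
    using prime_imp_coprime[OF pi nr] prime_imp_coprime[OF p(1) npm'] by (simp add: coprime_commute)
   then have "coprime (r * int m' + int p * (\<rho> + 2 * k * int m')) (int p)" by (rule coprime_add_mult)
   then show ?thesis by (simp add: algebra_simps)
  qed
  moreover have "coprime (\<rho> * int p + r * int m' + 2 * k * (int p * int m')) (int m')"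
  proof -
   have "coprime (int p) (int m')" using npm' pi by (simp add: prime_imp_coprime)
   then have "coprime (\<rho> * int p) (int m')" using f(4) by simp
   then have "coprime (\<rho> * int p + int m' * (r + 2 * k * int p)) (int m')" by (rule coprime_add_mult)
   then show ?thesis by (simp add: algebra_simps)
  qed
  moreover have "of_nat m * (f + h) = of_nat p * (of_nat m' * f) + of_nat m' * x"
   unfolding m' ph[symmetric] by (simp add: algebra_simps)
  moreover have "of_nat p * (of_nat m' * f) + of_nat m' * x : OK"
   by (rule O_closed(3)[OF O_closed(4)[OF O_closed(8) f(2)] O_closed(4)[OF O_closed(8) xO]])
  ultimately show ?thesis using codiff_closed(1)[OF f(1) h] trm m'
   by (intro bexI[of _ "f + h"] exI[of _ "\<rho> * int p + r * int m' + 2 * k * (int p * int m')"]) auto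
 qed
qed

text \<open>A multiple of \<open>f\<close> is subtracted to make the pairing with \<open>f\<close>
  integral. If the remainder were not integral, some prime would carry two independent null vectors,
  one from the remainder and one from \<open>f\<close>, and its square would divide the
  discriminant.\<close>

lemma codiff_generated:
 assumes sq: "!!p. prime p ==> \<not> p\<^sup>2 dvd nf_disc K" and D: "int D = \<bar>nf_disc K\<bar>" "D > 0"
  and f: "f : codiff" "of_nat D * f : OK" "tr (f * f) = of_int \<rho> / of_nat D" "coprime \<rho> (int D)"
  and z: "z : codiff"
 shows "\<exists>w\<in>OK. \<exists>m. z = w + of_int m * f"
proof -
 have fK: "f : K" using codiff_K f by auto
 obtain k where k: "tr (z * (of_nat D * f)) = of_int k" using codiffD[OF z f(2)] by (auto elim: Ints_cases)
 obtain i j where ij: "i * \<rho> + j * int D = 1" using bezout_int[of \<rho> "int D"] f(4) by (auto simp: coprime_iff_gcd_eq_1)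
 \<comment> \<open>\<open>k\<close> is \<open>D\<close> times the pairing of \<open>z\<close> with
   \<open>f\<close>, and \<open>i\<close> inverts \<rho> modulo \<open>D\<close>; so the pairing of
   \<open>z'\<close> with \<open>f\<close> is integral.\<close>
 define z' where "z' = z - of_int (k * i) * f"
 have z': "z' : codiff" unfolding z'_def by (rule codiff_closed(2)[OF z codiff_closed(4)[OF f(1)]])
 have zK: "z : K" and z'K: "z' : K" using codiff_K z z' by auto
 have z'f: "tr (z' * f) = of_int (k * j)"
 proof -
  have "tr (z * (of_nat D * f)) = of_nat D * tr (z * f)"
   using tr_scale[of "of_nat D" "z * f"] K_closed(4)[OF zK fK] by (simp add: ac_simps)
  then have "tr (z * f) = of_int k / of_nat D" using k D by (simp add: field_simps)
  moreover have "tr (z' * f) = tr (z * f) - of_int (k * i) * tr (f * f)"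
   unfolding z'_def left_diff_distrib mult.assoc using zK fK K_closed(4) K_closed(11)
   by (subst tr_diff) (auto simp: tr_scale)
  ultimately have "tr (z' * f) = of_int (k * (1 - i * \<rho>)) / of_nat D" unfolding f(3) by (simp add: algebra_simps diff_divide_distrib)
  also have "1 - i * \<rho> = j * int D" using ij by simp
  finally show ?thesis using D(2) by simp
 qed
 have "z' : OK"
 proof (rule ccontr)
  assume nO: "z' ~: OK"
  have "of_nat D * z' : OK"
  proof -
   have "nf_disc K = int D \<or> nf_disc K = - int D" using D(1) by linarith
   then show ?thesis using codiff_disc[OF z'] O_closed(5)[of "of_int (nf_disc K) * z'"] by auto
  qed
  then have ex: "\<exists>m. m > 0 & of_nat m * z' : OK" using D by blast
  define m where "m = (LEAST m. m > 0 & of_nat m * z' : OK)"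
  have m: "m > 0" "of_nat m * z' : OK" using LeastI_ex[OF ex] unfolding m_def by auto
  have mmin: "of_nat k * z' ~: OK" if "k > 0" "k < m" for k using not_less_Least[of k] that unfolding m_def by blast
  have "m ~= 1" using m nO by auto
  then obtain p where p: "prime p" "p dvd m" using prime_factor_nat by blast
  then obtain m' where m': "m = p * m'" by auto
  have p1: "p > 1" "p ~= 0" using prime_gt_1_nat[OF p(1)] by auto
  have pi: "prime (int p)" using p by simp
  \<comment> \<open>By minimality of \<open>m\<close>, this multiple of \<open>z'\<close> has order
    exactly \<open>p\<close> modulo the integers.\<close>
  define w where "w = of_nat m' * z'"
  have "0 < m'" "m' < m" using m m' p1 by (cases m', auto)
  then have wO: "w ~: OK" using mmin unfolding w_def by blast
  have pw: "of_int (int p) * w : OK" using m(2) unfolding w_def m' by (simp add: ac_simps)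
  have wc: "w : codiff" using codiff_closed(4)[OF z', of "int m'"] unfolding w_def by simp
  have "int p dvd nf_disc K"
  proof (rule ccontr)
   assume "\<not> int p dvd nf_disc K"
   then have "coprime (int p) (nf_disc K)" using pi by (simp add: prime_imp_coprime)
   then show False using coprime_O[OF pw codiff_disc[OF wc]] wO by blast
  qed
  then have "int p dvd int D" using D by simp
  then obtain D' where D': "D = p * D'" by auto
  have nx: "of_int (int p) * w : null_mod (int p)" by (rule codiff_null_mod[OF wc pw])
  have D'f: "of_nat D' * f : codiff" using codiff_closed(4)[OF f(1), of "int D'"] by simp
  have pD'f: "of_int (int p) * (of_nat D' * f) : OK" using f(2) unfolding D' by (simp add: ac_simps)
  have ny: "of_int (int p) * (of_nat D' * f) : null_mod (int p)" by (rule codiff_null_mod[OF D'f pD'f])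
  have "(int p)\<^sup>2 dvd nf_disc K"
  proof (rule two_null_disc[OF pi nx ny])
   fix a c
   assume h: "of_int a * (of_int (int p) * w) + of_int c * (of_int (int p) * (of_nat D' * f)) : pO (int p)"
   define v where "v = of_int a * w + of_int c * (of_nat D' * f)"
   have vO: "v : OK"
   proof -
    have "of_int a * (of_int (int p) * w) + of_int c * (of_int (int p) * (of_nat D' * f)) = of_int (int p) * v"
     unfolding v_def by (simp add: algebra_simps)
    then show ?thesis using h pO_iff[of "int p"] p1 by simp
   qed
   obtain t where t: "tr (f * v) = of_int t" using codiffD[OF f(1) vO] by (auto elim: Ints_cases)
   have "f * v = of_int (a * int m') * (z' * f) + of_int (c * int D') * (f * f)"
    unfolding v_def w_def by (simp add: algebra_simps)
   then have "tr (f * v) = of_int (a * int m') * of_int (k * j) + of_int (c * int D') * (of_int \<rho> / of_nat D)"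
    using K_closed(4)[OF z'K fK] K_closed(4)[OF fK fK]
    by (simp add: tr_add tr_scale K_closed z'f f(3))
   then have "of_int (a * int m' * (k * j) * int p + c * \<rho>) = (of_int (t * int p) :: complex)"
    using t D(2) p1 unfolding D' by (simp add: field_simps)
   then have "a * int m' * (k * j) * int p + c * \<rho> = t * int p" by (simp only: of_int_eq_iff)
   then have "int p dvd c * \<rho>" by (metis dvd_add_right_iff dvd_triv_right)
   moreover have "\<not> int p dvd \<rho>"
    using f(4) \<open>int p dvd int D\<close> pi by (metis coprime_common_divisor not_prime_unit)
   ultimately have pc: "int p dvd c" using pi prime_dvd_mult_iff by blast
   then obtain c' where c': "c = int p * c'" by auto
   have "of_int a * w = v - of_int c' * (of_nat D * f)" unfolding v_def c' D' by (simp add: algebra_simps)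
   then have aw: "of_int a * w : OK" using O_closed(6)[OF vO O_closed(4)[OF O_closed(7) f(2)]] by simp
   have "int p dvd a"
   proof (rule ccontr)
    assume "\<not> int p dvd a"
    then have "coprime (int p) a" using pi by (simp add: prime_imp_coprime)
    then show False using coprime_O[OF pw aw] wO by blast
   qed
   then show "int p dvd a & int p dvd c" using pc by blast
  qed
  then show False using sq pi by blast
 qed
 then show ?thesis unfolding z'_def by (metis diff_add_cancel)
qed

text \<open>The element \<open>y\<close> of trace one allows the generator to be moved to trace zero
  within its class modulo the integers; \<rho> changes only by a multiple of \<open>D\<close> and
  stays invertible modulo \<open>D\<close>.\<close>

lemma codiff_generator:
 assumes sq: "!!p. prime p ==> \<not> p\<^sup>2 dvd nf_disc K" and D: "int D = \<bar>nf_disc K\<bar>" "D > 0" and y: "y : OK" "tr y = 1"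
 shows "\<exists>f \<rho> \<rho>' k. f : codiff & tr f = 0 & of_nat D * f : OK & tr (f * f) = of_int \<rho> / of_nat D \<and>
  \<rho> * \<rho>' = 1 + int D * k & (\<forall>z\<in>codiff. \<exists>w\<in>OK. \<exists>m. z = w + of_int m * f)"
proof -
 have pd: "int p dvd nf_disc K" if "p dvd D" for p using that D(1) by (metis dvd_abs_iff of_nat_dvd_iff)
 have pn: "\<not> p\<^sup>2 dvd D" if p: "prime p" for p
 proof
  assume "p\<^sup>2 dvd D"
  then have "int (p\<^sup>2) dvd int D" by (simp only: of_nat_dvd_iff)
  then have "(int p)\<^sup>2 dvd nf_disc K" using D(1) by simp
  then show False using sq[of "int p"] p by simp
 qed
 obtain f0 \<rho>0 where f0: "f0 : codiff" "of_nat D * f0 : OK"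
  "tr (f0 * f0) = of_int \<rho>0 / of_nat D" "coprime \<rho>0 (int D)"
 proof -
  have "int p dvd nf_disc K & \<not> (int p)\<^sup>2 dvd nf_disc K" if "prime p" "p dvd D" for p
   using pd[OF that(2)] sq[of "int p"] that(1) by simp
  from codiff_element[OF D(2) this pn] show ?thesis using that by blast
 qed
 obtain t where t: "tr f0 = of_int t" using codiff_tr[OF f0(1)] by (auto elim: Ints_cases)
 obtain a where a: "tr (f0 * y) = of_int a" using codiffD[OF f0(1) y(1)] by (auto elim: Ints_cases)
 obtain c where c: "tr (y * y) = of_int c" using tr_int[OF O_closed(4)[OF y(1) y(1)]] .
 define f where "f = f0 - of_int t * y"
 define \<rho> where "\<rho> = \<rho>0 + int D * (t * t * c - 2 * t * a)"
 have fc: "f : codiff" unfolding f_def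
  using codiff_closed(2)[OF f0(1) codiff_closed(4)[OF O_codiff[OF y(1)]]] .
 have K: "f0 : K" "y : K" using codiff_K f0 y O_K by auto
 note Kp = K_closed(4)[OF K(1) K(2)] K_closed(4)[OF K(1) K(1)] K_closed(4)[OF K(2) K(2)]
 have "tr f = 0" unfolding f_def using K K_closed(4,11) by (subst tr_diff) (auto simp: tr_scale t y)
 moreover have "of_nat D * f = of_nat D * f0 - of_nat D * (of_int t * y)" unfolding f_def by (simp add: algebra_simps)
 then have "of_nat D * f : OK"
  using O_closed(6)[OF f0(2) O_closed(4)[OF O_closed(8) O_closed(4)[OF O_closed(7) y(1)]]] by simp
 moreover have trf: "tr (f * f) = of_int \<rho> / of_nat D"
 proof -
  have "f * f = f0 * f0 + of_int (t * t) * (y * y) - of_int (2 * t) * (f0 * y)"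
   unfolding f_def by (simp add: algebra_simps)
  then have "tr (f * f) = tr (f0 * f0) + of_int (t * t) * tr (y * y) - of_int (2 * t) * tr (f0 * y)"
   using tr_diff[OF K_closed(3)[OF Kp(2) K_closed(4)[OF K_closed(11) Kp(3)]] K_closed(4)[OF K_closed(11) Kp(1)]]
    tr_add[OF Kp(2) K_closed(4)[OF K_closed(11) Kp(3)]] tr_scale[OF Rats_of_int Kp(3)] tr_scale[OF Rats_of_int Kp(1)]
   by metis
  then show ?thesis unfolding f0(3) a c \<rho>_def using D(2) by (simp add: field_simps)
 qed
 moreover have co: "coprime \<rho> (int D)" unfolding \<rho>_def by (rule coprime_add_mult[OF f0(4)])
 moreover obtain i j where ij: "i * \<rho> + j * int D = 1" using bezout_int[of \<rho> "int D"] co by (auto simp: coprime_iff_gcd_eq_1)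
 then have "\<rho> * i = 1 + int D * (- j)" by (simp add: algebra_simps)
 moreover have "\<forall>z\<in>codiff. \<exists>w\<in>OK. \<exists>m. z = w + of_int m * f"
  using codiff_generated[OF sq D fc _ trf co] calculation(2) by blast
 ultimately show ?thesis using fc by blast
qed

end

context numfield
begin

text \<open>The square of the trace differs from the trace of the square by twice the second
  elementary symmetric function of the conjugates. This parity later rules out \<open>u = 3\<close>
  and \<open>u = - 3\<close> in degree 8.\<close>

lemma tr_square_parity:
 assumes x: "x : OK" shows "\<exists>k. tr (x * x) = tr x + of_int (2 * k)"
proof -
 have xK: "x : K" using x O_K by blast
 obtain t where t: "tr x = of_int t" using tr_int[OF x] .
 obtain q where q: "tr (x * x) = of_int q" using tr_int[OF O_closed(4)[OF x x]] .
 have "\<exists>w. algebraic_int w & (\<Sum>i<m. em i x)\<^sup>2 = (\<Sum>i<m. em i x * em i x) + 2 * w" if "m <= n" for m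
  using that
 proof (induction m)
  case 0 show ?case by (intro exI[of _ 0]) auto
 next
  case (Suc m)
  then obtain w where w: "algebraic_int w" "(\<Sum>i<m. em i x)\<^sup>2 = (\<Sum>i<m. em i x * em i x) + 2 * w" by auto
  have ai: "algebraic_int (em i x)" if "i < n" for i using emb_algebraic_int[OF em_E[OF that] x] .
  have "algebraic_int (w + (\<Sum>i<m. em i x) * em m x)"
   using w(1) ai Suc.prems by (intro algebraic_int_add_mult algebraic_int_sum) auto
  moreover have "(\<Sum>i<Suc m. em i x)\<^sup>2 = (\<Sum>i<m. em i x)\<^sup>2 + em m x * em m x + 2 * ((\<Sum>i<m. em i x) * em m x)"
   by (simp add: power2_eq_square algebra_simps)
  then have "(\<Sum>i<Suc m. em i x)\<^sup>2 = (\<Sum>i<Suc m. em i x * em i x) + 2 * (w + (\<Sum>i<m. em i x) * em m x)"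
   unfolding w(2) by (simp add: algebra_simps)
  ultimately show ?case by blast
 qed
 from this[of n] obtain w where w: "algebraic_int w" "(tr x)\<^sup>2 = tr (x * x) + 2 * w"
  unfolding tr_em using E(2)[OF em_E xK xK] by auto
 have "w = of_int (t\<^sup>2 - q) / of_int 2" using w(2) unfolding t q by simp
 then have "w : \<rat>" by (simp only: Rats_divide Rats_of_int)
 then have "w : \<int>" using w(1) by (intro rational_algebraic_int_is_int)
 then obtain e where "w = of_int e" by (auto elim: Ints_cases)
 then have "(of_int (t\<^sup>2) :: complex) = of_int (q + 2 * e)" using w(2) unfolding t q by simp
 then have "t\<^sup>2 = q + 2 * e" by (simp only: of_int_eq_iff)
 moreover have "even (t\<^sup>2 - t)" by simp
 then obtain j where "t\<^sup>2 - t = 2 * j" by (elim evenE)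
 ultimately have "q = t + 2 * (j - e)" by simp
 then show ?thesis unfolding t q by (intro exI[of _ "j - e"]) simp
qed

end

section \<open>Poles of the generator of the codifferent\<close>

text \<open>Since \<rho>' inverts \<rho> modulo \<open>D\<close>, the coefficient of
  \<open>f\<close> in an element of the codifferent can be recovered modulo \<open>D\<close> from
  its pairing with \<open>f\<close>.\<close>

locale codifferent = numfield +
 fixes f y :: complex and D :: nat and \<rho> \<rho>' k0 :: int
 assumes D: "D > 0" and f: "f : codiff" and trf: "nf_trace K f = 0" and Df: "of_nat D * f : ring_of_integers K"
  and trff: "nf_trace K (f * f) = of_int \<rho> / of_nat D" and inv: "\<rho> * \<rho>' = 1 + int D * k0"
  and gen: "\<forall>z\<in>codiff. \<exists>w\<in>ring_of_integers K. \<exists>m. z = w + of_int m * f"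
  and y: "y : ring_of_integers K" "nf_trace K y = 1"
begin

lemma fK: "f : K" and yK: "y : K" using codiff_K[OF f] O_K[OF y(1)] by auto
lemma Dc: "(of_nat D :: complex) ~= 0" using D by simp

text \<open>The pairing of \<open>b' i\<close> with \<open>f\<close> determines the coefficient at
  \<open>f\<close> modulo \<open>D\<close>, and a change by a multiple of \<open>D\<close> is
  absorbed because \<open>D * f\<close> is integral. The coefficient is given by a formula linear in
  \<open>b' i\<close>, so that sums over \<open>i\<close> can be evaluated.\<close>

lemma dual_split:
 assumes b: "dual b b'" "\<forall>i<n. b' i : codiff"
 shows "\<exists>w. (\<forall>i<n. w i : OK & b' i = w i + of_int \<rho>' * of_nat D * tr (b' i * f) * f)"
proof -
 have "\<exists>w\<in>OK. b' i = w + of_int \<rho>' * of_nat D * tr (b' i * f) * f" if i: "i < n" for i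
 proof -
  obtain v m where v: "v : OK" "b' i = v + of_int m * f" using gen b(2) i by blast
  obtain t where t: "tr (f * v) = of_int t" using codiffD[OF f v(1)] by (auto elim: Ints_cases)
  have "b' i * f = f * v + of_int m * (f * f)" unfolding v(2) by (simp add: algebra_simps)
  then have "tr (b' i * f) = of_int t + of_int m * (of_int \<rho> / of_nat D)"
   using K_closed(4)[OF fK O_K[OF v(1)]] K_closed(4)[OF fK fK] K_closed(4,11)
   by (simp only: tr_add tr_scale Rats_of_int t trff)
  then have "of_nat D * tr (b' i * f) = of_int (int D * t + m * \<rho>)" using D by (simp add: field_simps)
  then have "of_int \<rho>' * of_nat D * tr (b' i * f) = of_int (\<rho>' * (int D * t + m * \<rho>))" by simp
  also have "\<rho>' * (int D * t + m * \<rho>) = m + int D * (\<rho>' * t + m * k0)"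
   using arg_cong[OF inv, of "%x. m * x"] by (simp add: algebra_simps)
  finally have c: "of_int \<rho>' * of_nat D * tr (b' i * f) = of_int m + of_int (\<rho>' * t + m * k0) * of_nat D"
   by (simp add: algebra_simps)
  have "v - of_int (\<rho>' * t + m * k0) * (of_nat D * f) : OK"
   by (rule O_closed(6)[OF v(1) O_closed(4)[OF O_closed(7) Df]])
  moreover have "(v - of_int (\<rho>' * t + m * k0) * (of_nat D * f)) + of_int \<rho>' * of_nat D * tr (b' i * f) * f = b' i"
  proof -
   have "(v - of_int (\<rho>' * t + m * k0) * (of_nat D * f)) + of_int \<rho>' * of_nat D * tr (b' i * f) * f = v + of_int m * f"
    unfolding c by (simp add: algebra_simps)
   then show ?thesis using v(2) by simp
  qed
  ultimately show ?thesis by metis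
 qed
 then show ?thesis by metis
qed

text \<open>Replacing the dual basis by its integral part changes \<open>\<Sum>\<^sub>i x\<^sub>i \<otimes> b'\<^sub>i\<close> by a tensor of rank one.\<close>
lemma dual_split_sum:
 assumes w: "\<forall>i<n. w i : OK & b' i = w i + of_int \<rho>' * of_nat D * tr (b' i * f) * f"
  and b: "\<forall>i<n. b' i : codiff" and \<sigma>: "\<sigma> : E"
 shows "(\<Sum>i<n. x i * \<sigma> (b' i)) = (\<Sum>i<n. x i * \<sigma> (w i)) + of_int \<rho>' * of_nat D * \<sigma> f * (\<Sum>i<n. x i * tr (b' i * f))"
proof -
 have "\<sigma> (b' i) = \<sigma> (w i) + of_int \<rho>' * of_nat D * tr (b' i * f) * \<sigma> f" if i: "i < n" for i
 proof -
  define c where "c = of_int \<rho>' * of_nat D * tr (b' i * f)"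
  have "tr (b' i * f) : \<rat>" using b i by (intro tr_Rats K_closed(4) codiff_K fK) auto
  then have c: "c : \<rat>" unfolding c_def by simp
  then obtain q where q: "c = of_rat q" by (auto elim: Rats_cases)
  have "\<sigma> (b' i) = \<sigma> (w i + c * f)" using w i unfolding c_def by metis
  also have "... = \<sigma> (w i) + c * \<sigma> f"
   using w i O_K fK K_closed(4)[OF K_closed(12) fK] unfolding q by (simp add: E[OF \<sigma>] K_closed)
  finally show ?thesis unfolding c_def .
 qed
 then have "(\<Sum>i<n. x i * \<sigma> (b' i)) = (\<Sum>i<n. x i * \<sigma> (w i) + of_int \<rho>' * of_nat D * \<sigma> f * (x i * tr (b' i * f)))"
  by (intro sum.cong refl) (simp add: algebra_simps)
 then show ?thesis by (simp add: sum.distrib sum_distrib_left)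
qed

text \<open>The relation separating embeddings, with the dual basis split into integral part and
  pole: the poles contribute a product of a function of \<tau> and a function of \<sigma>.\<close>

lemma pairing:
 "\<exists>b w. zbasis b & (\<forall>i<n. w i : OK) & (\<forall>\<tau>\<in>E. \<forall>\<sigma>\<in>E. (if \<tau> = \<sigma> then 1 else 0) =
  (\<Sum>i<n. \<tau> (b i) * \<sigma> (w i)) + of_int \<rho>' * of_nat D * \<sigma> f * \<tau> f)"
proof -
 obtain b where b: "zbasis b" by (rule zbasis_ex)
 then obtain b' where d: "dual b b'" "\<forall>i<n. b' i : codiff" using zbasis_dual by blast
 obtain w where w: "\<forall>i<n. w i : OK & b' i = w i + of_int \<rho>' * of_nat D * tr (b' i * f) * f"
  using dual_split[OF d] by blast
 have bK: "b i : K" "b' i : K" if "i < n" for i using d(1) that unfolding dual_def by auto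
 have "(if \<tau> = \<sigma> then 1 else 0) = (\<Sum>i<n. \<tau> (b i) * \<sigma> (w i)) + of_int \<rho>' * of_nat D * \<sigma> f * \<tau> f"
  if ts: "\<tau> : E" "\<sigma> : E" for \<tau> \<sigma>
 proof -
  have "(\<Sum>i<n. \<tau> (b i) * tr (b' i * f)) = \<tau> (\<Sum>i<n. tr (f * b' i) * b i)"
  proof -
   have "\<tau> (tr (f * b' i) * b i) = \<tau> (b i) * tr (b' i * f)" if i: "i < n" for i
   proof -
    obtain q where q: "tr (f * b' i) = of_rat q" using tr_Rats[OF K_closed(4)[OF fK bK(2)[OF i]]] by (auto elim: Rats_cases)
    then show ?thesis using bK i K_closed by (simp add: E[OF ts(1)] mult.commute)
   qed
   moreover have "tr (f * b' i) * b i : K" if i: "i < n" for i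
   proof -
    obtain q where "tr (f * b' i) = of_rat q" using tr_Rats[OF K_closed(4)[OF fK bK(2)[OF i]]] by (auto elim: Rats_cases)
    then show ?thesis using K_closed(4)[OF K_closed(12) bK(1)[OF i]] by simp
   qed
   ultimately show ?thesis by (subst E_sum[OF ts(1)]) auto
  qed
  also have "(\<Sum>i<n. tr (f * b' i) * b i) = f" using dual_expand[OF d(1) fK] by simp
  finally show ?thesis
   using dual_split_sum[OF w d(2) ts(2), of "%i. \<tau> (b i)"] dual_sum[OF d(1) ts] by simp
 qed
 then show ?thesis using b w by blast
qed

text \<open>With the identity for both embeddings, the pairing relation makes
  \<open>\<rho>' * (D * (f * f))\<close> integral. The factor \<rho>' is removed because
  \<open>D * (D * (f * f))\<close> is the square of the integer \<open>D * f\<close>. So the poles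
  of \<open>f\<close> have at most half the order of \<open>D\<close>.\<close>

lemma Dff: "of_nat D * (f * f) : OK"
proof -
 obtain b w where b: "zbasis b" and w: "\<forall>i<n. w i : OK" and eq: "\<forall>\<tau>\<in>E. \<forall>\<sigma>\<in>E. (if \<tau> = \<sigma> then 1 else 0) =
   (\<Sum>i<n. \<tau> (b i) * \<sigma> (w i)) + of_int \<rho>' * of_nat D * \<sigma> f * \<tau> f" using pairing by blast
 have bO: "b i : OK" if "i < n" for i using b that unfolding zbasis_def by blast
 have "(1::complex) = (\<Sum>i<n. b i * w i) + of_int \<rho>' * of_nat D * f * f"
  using eq[rule_format, OF id_in_E id_in_E] bO w O_K fK by simp
 then have 1: "of_int \<rho>' * (of_nat D * (f * f)) = 1 - (\<Sum>i<n. b i * w i)" by (simp add: algebra_simps)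
 have "(\<Sum>i<n. b i * w i) : OK" by (rule O_sum) (use O_closed(4)[OF bO] w in auto)
 then have 2: "of_int \<rho>' * (of_nat D * (f * f)) : OK" unfolding 1 by (rule O_closed(6)[OF O_closed(2)])
 have "of_nat D * (f * f) = of_int (\<rho> * \<rho>' - int D * k0) * (of_nat D * (f * f))" unfolding inv by simp
 also have "... = of_int \<rho> * (of_int \<rho>' * (of_nat D * (f * f))) - of_int k0 * ((of_nat D * f) * (of_nat D * f))"
  by (simp add: algebra_simps)
 also have "... : OK"
  by (rule O_closed(6)[OF O_closed(4)[OF O_closed(7) 2] O_closed(4)[OF O_closed(7) O_closed(4)[OF Df Df]]])
 finally show ?thesis .
qed

text \<open>A rational constant moves \<open>z\<close> into the codifferent, where it is an integer
  plus a multiple of \<open>f\<close>. So modulo the trace zero module its dual is generated by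
  \<open>f\<close> and the projection \<open>y - 1 / n\<close>; the coefficient \<open>u\<close>
  matters only modulo \<open>n\<close> and is taken of least absolute value.\<close>

lemma trace_zero_dual:
 assumes z: "z : K" "tr z = 0" and int: "!!l. l : OK ==> tr l = 0 ==> tr (z * l) : \<int>"
 shows "\<exists>u s l. l : OK & tr l = 0 & 2 * \<bar>u\<bar> <= int n & z = of_int u * (y - 1 / of_nat n) + of_int s * f + l"
proof -
 have nc: "(of_nat n :: complex) ~= 0" using n_pos by simp
 define c where "c = tr (z * y)"
 have c: "c : \<rat>" unfolding c_def by (rule tr_Rats[OF K_closed(4)[OF z(1) yK]])
 then have cK: "c : K" using K_closed(12) by (auto elim: Rats_cases)
 define z' where "z' = z - c"
 have z'K: "z' : K" unfolding z'_def by (rule K_closed(7)[OF z(1) cK])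
 have "tr (z' * v) : \<int>" if v: "v : OK" for v
 proof -
  obtain t where t: "tr v = of_int t" using tr_int[OF v] .
  define l where "l = v - of_int t * y"
  have l: "l : OK" unfolding l_def by (rule O_closed(6)[OF v O_closed(4)[OF O_closed(7) y(1)]])
  have lK: "l : K" using l O_K by blast
  have "tr l = 0" unfolding l_def using O_K[OF v] yK K_closed(4,11) by (simp add: tr_diff tr_scale t y)
  have "z' * v = of_int t * (z * y) + z * l - (of_int t * (c * y) + c * l)" unfolding z'_def l_def by (simp add: algebra_simps)
  moreover have "tr (of_int t * (z * y)) = of_int t * c" unfolding c_def by (intro tr_scale K_closed(4) z yK) auto
  moreover have "tr (of_int t * (c * y)) = of_int t * c"
   using tr_scale[of "of_int t" "c * y"] tr_scale[OF c yK] K_closed(4)[OF cK yK] y by simp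
  moreover have "tr (c * l) = 0" using tr_scale[OF c lK] \<open>tr l = 0\<close> by simp
  ultimately have "tr (z' * v) = tr (z * l)"
   using K_closed(4)[OF z(1) yK] K_closed(4)[OF z(1) lK] K_closed(4)[OF cK yK] K_closed(4)[OF cK lK] K_closed(3,4,11)
   by (simp add: tr_add tr_diff)
  then show ?thesis using int[OF l \<open>tr l = 0\<close>] by simp
 qed
 then have "z' : codiff" unfolding codiff_def using z'K by simp
 then obtain w s where w: "w : OK" "z' = w + of_int s * f" using gen by blast
 obtain u0 where u0: "tr w = of_int u0" using tr_int[OF w(1)] .
 have wK: "w : K" using w O_K by blast
 have "tr z' = of_int u0" unfolding w(2) using wK fK K_closed(4,11) by (simp add: tr_add tr_scale u0 trf)
 moreover have "tr z' = - c * of_nat n" unfolding z'_def using z cK tr_of_Rats[OF c] by (simp add: tr_diff)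
 ultimately have "c * of_nat n = - of_int u0" by (metis minus_minus minus_mult_left)
 then have cn: "c = - of_int u0 / of_nat n" using nc by (simp add: field_simps)
 \<comment> \<open>Rounds \<open>u0 / n\<close> to a nearest integer.\<close>
 define k where "k = (2 * u0 + int n) div (2 * int n)"
 define u where "u = u0 - k * int n"
 define l where "l = (w - of_int u0 * y) + of_int k * (of_nat n * y - 1)"
 have "l : OK" unfolding l_def
  by (rule O_closed(3)[OF O_closed(6)[OF w(1) O_closed(4)[OF O_closed(7) y(1)]]
   O_closed(4)[OF O_closed(7) O_closed(6)[OF O_closed(4)[OF O_closed(8) y(1)] O_closed(2)]]])
 moreover have "tr l = 0" unfolding l_def using wK yK K_closed
  by (simp add: tr_add tr_diff tr_scale u0 y tr_1)
 moreover have "2 * \<bar>u\<bar> <= int n"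
 proof -
  define r where "r = (2 * u0 + int n) mod (2 * int n)"
  have r: "0 <= r" "r < 2 * int n" unfolding r_def using n_pos by auto
  have "2 * u0 + int n = 2 * int n * k + r" unfolding k_def r_def by simp
  then have "2 * u = r - int n" unfolding u_def by (simp add: algebra_simps)
  then show ?thesis using r by (auto simp: abs_if)
 qed
 moreover have "z = of_int u * (y - 1 / of_nat n) + of_int s * f + l"
 proof -
  have "z = w + of_int s * f + c" using w(2) unfolding z'_def by (simp add: algebra_simps)
  then show ?thesis unfolding cn u_def l_def using nc by (simp add: field_simps)
 qed
 ultimately show ?thesis by blast
qed

text \<open>At a prime \<open>p\<close> exactly dividing the discriminant exactly two conjugates of \<open>f\<close> have poles: all poles are
 congruent modulo \<open>\<surd>p\<close>, and three of them would contradict the pairing relation.\<close>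
lemma two_poles:
 assumes plA: "place p A" and p: "prime p" "D = p * D'" "\<not> p dvd D'" "odd p"
 shows "\<exists>\<sigma>1\<in>E. \<exists>\<sigma>2\<in>E. \<sigma>1 ~= \<sigma>2 & \<sigma>1 f ~: A & \<sigma>2 f ~: A & \<sigma>1 f + \<sigma>2 f : A & (\<forall>\<sigma>\<in>E - {\<sigma>1, \<sigma>2}. \<sigma> f : A)"
proof -
 interpret pl: place p A by fact
 have OA: "\<tau> y : A" if "\<tau> : E" "y : OK" for \<tau> y using pl.A_algebraic_int emb_algebraic_int that by blast
 have uA: "of_int a : A" "of_int a ~: pl.M" "of_int a ~= (0::complex)" "inverse (of_int a) : A" if "\<not> int p dvd a" for a
  using pl.M_of_int[of a] that pl.A_of_int[of a] pl.unit_inverse[of "of_int a"] by auto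
 have D'u: "\<not> int p dvd int D'" using p(3) by simp
 have \<rho>u: "\<not> int p dvd \<rho>" "\<not> int p dvd \<rho>'"
 proof -
  have "\<not> int p dvd \<rho> * \<rho>'" unfolding inv p(2) using p(1)
   by (metis dvd_add_left_iff dvd_mult2 dvd_triv_left int_dvd_int_iff nat_dvd_1_iff_1 not_prime_1 of_nat_1 of_nat_mult)
  then show "\<not> int p dvd \<rho>" "\<not> int p dvd \<rho>'" by auto
 qed
 \<comment> \<open>A square root of \<open>p\<close>: scaled by it, the poles of \<open>f\<close>
   become units at the place.\<close>
 define r where "r = csqrt (of_nat p)"
 have r2: "r * r = of_nat p" unfolding r_def by (metis power2_csqrt power2_eq_square)
 have rA: "r : A" using pl.A_power_imp[where n = 2 and x = r] pl.A_of_nat[of p] r2 by (simp add: power2_eq_square)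
 have rM: "r : pl.M" using pl.M_prime[of r r] rA pl.M_p r2 by auto
 have r0: "r ~= 0" using r2 p(1) by auto
 define Q where "Q = {\<sigma> : E. \<sigma> f ~: A}"
 have QE: "\<sigma> : E" "\<sigma> f ~= 0" "inverse (\<sigma> f) : pl.M" if "\<sigma> : Q" for \<sigma>
  using that pl.A_0 pl.not_A_inverse_M unfolding Q_def by auto
 have tff: "\<sigma> (of_nat D * (f * f)) = of_nat D * (\<sigma> f * \<sigma> f)" if "\<sigma> : E" for \<sigma>
  using fK K_closed by (simp add: E[OF that])
 have pff: "of_nat p * (\<sigma> f * \<sigma> f) = inverse (of_int (int D')) * \<sigma> (of_nat D * (f * f))" if "\<sigma> : E" for \<sigma>
  unfolding tff[OF that] unfolding p(2) using uA(3)[OF D'u] by simp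
 have pffA: "of_nat p * (\<sigma> f * \<sigma> f) : A" if "\<sigma> : E" for \<sigma>
  unfolding pff[OF that] by (rule pl.A_mult[OF uA(4)[OF D'u] OA[OF that Dff]])
 have rfA: "r * \<sigma> f : A" if "\<sigma> : E" for \<sigma>
 proof -
  have "(r * \<sigma> f) ^ 2 = of_nat p * (\<sigma> f * \<sigma> f)" unfolding r2[symmetric] by (simp add: power2_eq_square)
  then show ?thesis using pl.A_power_imp[where n = 2 and x = "r * \<sigma> f"] pffA[OF that] by simp
 qed
 have trp: "of_nat p * tr (f * f) ~: pl.M"
 proof
  assume M: "of_nat p * tr (f * f) : pl.M"
  have "of_int (int D') * (of_nat p * tr (f * f)) = of_int \<rho>" unfolding trff using Dc unfolding p(2) by simp
  then have "of_int \<rho> : pl.M" using pl.M_mult2[OF M pl.A_of_int[of "int D'"]] by simp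
  then show False using uA(2)[OF \<rho>u(1)] by blast
 qed
 have trsum: "of_nat p * tr (f * f) = (\<Sum>\<sigma>\<in>E. of_nat p * (\<sigma> f * \<sigma> f))"
  unfolding nf_trace_def using E(2)[OF _ fK fK] by (simp add: sum_distrib_left)
 have pM: "of_nat p * (\<sigma> f * \<sigma> f) : pl.M" if "\<sigma> : E - Q" for \<sigma>
  using that pl.M_mult[OF pl.M_p pl.A_mult[of "\<sigma> f" "\<sigma> f"]] unfolding Q_def by auto
 \<comment> \<open>Multiplying \<open>f\<close> by the integer \<open>D * (f * f)\<close> shows that
   this integer has the same residue \<open>m\<close> at all poles. It is not 0, since the trace of
   \<open>f * f\<close> has \<open>p\<close> in its denominator.\<close>
 obtain w m where w: "w : OK" "f * (of_nat D * (f * f)) = w + of_int m * f"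
  using gen codiff_closed(3)[OF f Dff] by blast
 have m: "\<sigma> (of_nat D * (f * f)) - of_int m : pl.M" if \<sigma>: "\<sigma> : Q" for \<sigma>
 proof -
  have "\<sigma> f * \<sigma> (of_nat D * (f * f)) = \<sigma> w + of_int m * \<sigma> f"
   using arg_cong[OF w(2), of \<sigma>] fK O_K[OF w(1)] O_K[OF Dff] K_closed by (simp add: E[OF QE(1)[OF \<sigma>]])
  then have "\<sigma> (of_nat D * (f * f)) - of_int m = \<sigma> w * inverse (\<sigma> f)" using QE(2)[OF \<sigma>] by (simp add: field_simps)
  then show ?thesis using pl.M_mult2[OF QE(3)[OF \<sigma>] OA[OF QE(1)[OF \<sigma>] w(1)]] by simp
 qed
 have "\<not> int p dvd m"
 proof
  assume "int p dvd m"
  then have mM: "of_int m : pl.M" using pl.M_of_int by blast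
  have "of_nat p * (\<sigma> f * \<sigma> f) : pl.M" if \<sigma>: "\<sigma> : E" for \<sigma>
  proof (cases "\<sigma> : Q")
   case True
   have "\<sigma> (of_nat D * (f * f)) : pl.M" using pl.M_add[OF m[OF True] mM] by simp
   then show ?thesis unfolding pff[OF \<sigma>] by (rule pl.M_mult2[OF _ uA(4)[OF D'u]])
  qed (use pM \<sigma> in blast)
  then have "of_nat p * tr (f * f) : pl.M" unfolding trsum by (intro pl.M_sum)
  then show False using trp by blast
 qed
 have unit: "r * \<sigma> f ~: pl.M" if \<sigma>: "\<sigma> : Q" for \<sigma>
 proof
  assume M: "r * \<sigma> f : pl.M"
  have "\<sigma> (of_nat D * (f * f)) = (r * \<sigma> f) * (of_nat D' * (r * \<sigma> f))"
   unfolding tff[OF QE(1)[OF \<sigma>]] unfolding p(2) of_nat_mult r2[symmetric] by (simp add: ac_simps)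
  then have "\<sigma> (of_nat D * (f * f)) : pl.M"
   using pl.M_mult[OF M pl.A_mult[OF pl.A_of_nat rfA[OF QE(1)[OF \<sigma>]]]] by simp
  then have "of_int m : pl.M" using pl.M_diff[OF _ m[OF \<sigma>]] by fastforce
  then show False using pl.M_of_int \<open>\<not> int p dvd m\<close> by blast
 qed
 have unit': "inverse (r * \<sigma> f) : A" if "\<sigma> : Q" for \<sigma>
  using pl.unit_inverse[OF rfA[OF QE(1)[OF that]] unit[OF that]] by blast
 \<comment> \<open>\<open>f * v\<close> is again an integer plus a multiple of \<open>f\<close>, so
   at every pole the conjugate of \<open>v\<close> differs from the same rational integer
   \<open>c\<close> by a multiple of \<open>r\<close>.\<close>
 have cong: "\<exists>g\<in>A. \<tau> v - \<tau>' v = r * g" if t: "\<tau> : Q" "\<tau>' : Q" and v: "v : OK" for \<tau> \<tau>' v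
 proof -
  obtain w c where w: "w : OK" "f * v = w + of_int c * f" using gen codiff_closed(3)[OF f v] by blast
  have "\<sigma> v = of_int c + r * (\<sigma> w * inverse (r * \<sigma> f))" if \<sigma>: "\<sigma> : Q" for \<sigma>
  proof -
   have "\<sigma> f * \<sigma> v = \<sigma> w + of_int c * \<sigma> f"
    using arg_cong[OF w(2), of \<sigma>] fK O_K[OF w(1)] O_K[OF v] K_closed by (simp add: E[OF QE(1)[OF \<sigma>]])
   then show ?thesis using QE(2)[OF \<sigma>] r0 by (simp add: field_simps)
  qed
  from this[OF t(1)] this[OF t(2)] have "\<tau> v - \<tau>' v = r * (\<tau> w * inverse (r * \<tau> f) - \<tau>' w * inverse (r * \<tau>' f))"
   by (simp add: algebra_simps)
  moreover have "\<tau> w * inverse (r * \<tau> f) - \<tau>' w * inverse (r * \<tau>' f) : A"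
   by (intro pl.A_diff pl.A_mult OA unit' t QE(1) w(1))
  ultimately show ?thesis by blast
 qed
 obtain b w where b: "zbasis b" and w: "\<forall>i<n. w i : OK" and eq: "\<forall>\<tau>\<in>E. \<forall>\<sigma>\<in>E. (if \<tau> = \<sigma> then 1 else 0) =
   (\<Sum>i<n. \<tau> (b i) * \<sigma> (w i)) + of_int \<rho>' * of_nat D * \<sigma> f * \<tau> f" using pairing by blast
 have bO: "b i : OK" if "i < n" for i using b that unfolding zbasis_def by blast
 have rel: "\<exists>g\<in>A. (if \<tau> = \<sigma> then 1 else 0) - (if \<tau>' = \<sigma> then 1 else 0) -
   of_int (\<rho>' * int D') * (r * \<sigma> f) * r * (\<tau> f - \<tau>' f) = r * g"
  if t: "\<tau> : Q" "\<tau>' : Q" and \<sigma>: "\<sigma> : E" for \<tau> \<tau>' \<sigma>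
 proof -
  obtain g where g: "!!i. i < n ==> g i : A & \<tau> (b i) - \<tau>' (b i) = r * g i" using cong[OF t bO] by metis
  have e1: "of_int \<rho>' * of_nat D * \<sigma> f * c = of_int (\<rho>' * int D') * (r * \<sigma> f) * r * c" for c
   unfolding p(2) using r2 by (simp add: ac_simps)
  have "(if \<tau> = \<sigma> then 1 else 0) - (if \<tau>' = \<sigma> then 1 else 0) - of_int (\<rho>' * int D') * (r * \<sigma> f) * r * (\<tau> f - \<tau>' f)
   = (\<Sum>i<n. \<tau> (b i) * \<sigma> (w i)) - (\<Sum>i<n. \<tau>' (b i) * \<sigma> (w i))"
   unfolding eq[rule_format, OF QE(1)[OF t(1)] \<sigma>] eq[rule_format, OF QE(1)[OF t(2)] \<sigma>] e1
   by (simp only: right_diff_distrib) simp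
  also have "... = (\<Sum>i<n. (\<tau> (b i) - \<tau>' (b i)) * \<sigma> (w i))" by (simp add: left_diff_distrib sum_subtractf)
  also have "... = (\<Sum>i<n. r * (g i * \<sigma> (w i)))" using g by (intro sum.cong) auto
  also have "... = r * (\<Sum>i<n. g i * \<sigma> (w i))" by (simp add: sum_distrib_left)
  finally show ?thesis using g w OA[OF \<sigma>] by (intro bexI[of _ "\<Sum>i<n. g i * \<sigma> (w i)"] pl.A_sum pl.A_mult) auto
 qed
 \<comment> \<open>At a third pole \<sigma>, the difference of the pairing relations of \<tau> and
   \<tau>' shows that \<open>\<tau> f - \<tau>' f\<close> lies in \<open>A\<close>. The same
   difference taken at \<tau> itself then makes 1 a multiple of \<open>r\<close>.\<close>
 have no3: False if t: "\<tau> : Q" "\<tau>' : Q" "\<sigma> : Q" "\<tau> ~= \<tau>'" "\<sigma> ~= \<tau>" "\<sigma> ~= \<tau>'" for \<tau> \<tau>' \<sigma>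
 proof -
  let ?c = "of_int (\<rho>' * int D') :: complex"
  have cu: "\<not> int p dvd \<rho>' * int D'" using \<rho>u D'u p(1) by (simp add: prime_dvd_mult_iff)
  obtain g where g: "g : A" "- (?c * (r * \<sigma> f) * r * (\<tau> f - \<tau>' f)) = r * g"
   using rel[OF t(1,2) QE(1)[OF t(3)]] t by auto
  have e: "\<delta> = - g * inverse c * inverse X" if h: "- (c * X * r * \<delta>) = r * g" "c ~= 0" "X ~= 0" for \<delta> c X
  proof -
   have "r * g = r * (- (c * X * \<delta>))" using h(1) by (simp add: ac_simps)
   then have "g = - (c * X * \<delta>)" using r0 mult_left_cancel by blast
   then show ?thesis using h(2,3) by (simp add: field_simps)
  qed
  have "r * \<sigma> f ~= 0" using r0 QE(2)[OF t(3)] by simp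
  from e[OF g(2) uA(3)[OF cu] this] have "\<tau> f - \<tau>' f = - g * inverse ?c * inverse (r * \<sigma> f)" .
  then have dA: "\<tau> f - \<tau>' f : A" using pl.A_mult[OF pl.A_mult[OF pl.A_minus[OF g(1)] uA(4)[OF cu]] unit'[OF t(3)]] by simp
  obtain h where h: "h : A" "1 - ?c * (r * \<tau> f) * r * (\<tau> f - \<tau>' f) = r * h"
   using rel[OF t(1,2) QE(1)[OF t(1)]] t by auto
  have "1 = r * (h + ?c * (r * \<tau> f) * (\<tau> f - \<tau>' f))" using h(2) by (simp add: algebra_simps)
  moreover have "r * (h + ?c * (r * \<tau> f) * (\<tau> f - \<tau>' f)) : pl.M"
   by (rule pl.M_mult[OF rM pl.A_add[OF h(1) pl.A_mult[OF pl.A_mult[OF pl.A_of_int rfA[OF QE(1)[OF t(1)]]] dA]]])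
  ultimately show False by simp
 qed
 \<comment> \<open>A pole exists because the trace of \<open>f * f\<close> has \<open>p\<close> in
   its denominator, and a second one because \<open>f\<close> has trace zero.\<close>
 have "Q ~= {}"
 proof
  assume "Q = {}"
  then have "of_nat p * tr (f * f) : pl.M" unfolding trsum using pM by (intro pl.M_sum) auto
  then show False using trp by blast
 qed
 then obtain \<sigma>1 where s1: "\<sigma>1 : Q" by blast
 have tr0: "\<sigma>1 f + (\<Sum>\<sigma>\<in>E - {\<sigma>1}. \<sigma> f) = 0"
  using trf sum.remove[OF finite_E QE(1)[OF s1], of "%\<sigma>. \<sigma> f"] unfolding nf_trace_def by simp
 have "\<exists>\<sigma>2\<in>Q. \<sigma>2 ~= \<sigma>1"
 proof (rule ccontr)
  assume "\<not> ?thesis"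
  then have "(\<Sum>\<sigma>\<in>E - {\<sigma>1}. \<sigma> f) : A" unfolding Q_def by (intro pl.A_sum) auto
  moreover have "\<sigma>1 f = - (\<Sum>\<sigma>\<in>E - {\<sigma>1}. \<sigma> f)" using tr0 by (simp add: eq_neg_iff_add_eq_0)
  ultimately have "\<sigma>1 f : A" using pl.A_minus by simp
  then show False using s1 unfolding Q_def by simp
 qed
 then obtain \<sigma>2 where s2: "\<sigma>2 : Q" "\<sigma>2 ~= \<sigma>1" by blast
 have rest: "\<sigma> f : A" if "\<sigma> : E - {\<sigma>1, \<sigma>2}" for \<sigma>
 proof (rule ccontr)
  assume "\<sigma> f ~: A"
  then have "\<sigma> : Q" "\<sigma> ~= \<sigma>1" "\<sigma> ~= \<sigma>2" using that unfolding Q_def by auto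
  then show False using no3[OF s1 s2(1) _ s2(2)[symmetric]] by blast
 qed
 have "(\<Sum>\<sigma>\<in>E - {\<sigma>1}. \<sigma> f) = \<sigma>2 f + (\<Sum>\<sigma>\<in>E - {\<sigma>1} - {\<sigma>2}. \<sigma> f)"
  using sum.remove[of "E - {\<sigma>1}" \<sigma>2 "%\<sigma>. \<sigma> f"] finite_E QE(1)[OF s2(1)] s2(2) by simp
 then have "\<sigma>1 f + \<sigma>2 f = - (\<Sum>\<sigma>\<in>E - {\<sigma>1} - {\<sigma>2}. \<sigma> f)" using tr0 by (simp add: eq_neg_iff_add_eq_0 add.assoc)
 moreover have "(\<Sum>\<sigma>\<in>E - {\<sigma>1} - {\<sigma>2}. \<sigma> f) : A" using rest by (intro pl.A_sum) auto
 ultimately have "\<sigma>1 f + \<sigma>2 f : A" using pl.A_minus by simp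
 moreover have "\<forall>\<sigma>\<in>E - {\<sigma>1, \<sigma>2}. \<sigma> f : A" using rest by blast
 moreover have "\<sigma>1 : E" "\<sigma>2 : E" "\<sigma>1 f ~: A" "\<sigma>2 f ~: A" using s1 s2 unfolding Q_def by auto
 ultimately show ?thesis using s2(2) by metis
qed

end

section \<open>From isometries of lattices to rational isometries\<close>

lemma trace_zero_module_iff: "x : trace_zero_module K \<longleftrightarrow> x : ring_of_integers K & nf_trace K x = 0"
 unfolding trace_zero_module_def by simp

lemma numfield_degree_le:
 assumes "numfield K" "numfield L" and f: "!!x. x : K ==> \<phi> x : L" "!!x y. x : K ==> y : K ==> \<phi> (x + y) = \<phi> x + \<phi> y"
  "!!c x. c : \<rat> ==> x : K ==> \<phi> (c * x) = c * \<phi> x" "!!x. x : K ==> \<phi> x = 0 ==> x = 0"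
  and b: "numfield.indep K b"
 shows "!!c. (\<Sum>i<numfield.n K. of_rat (c i) * \<phi> (b i)) = 0 ==> \<forall>i<numfield.n K. c i = 0"
  "numfield.n K <= numfield.n L"
proof -
 interpret K: numfield K by fact
 interpret L: numfield L by fact
 have bK: "!!i. i < K.n ==> b i : K" using b unfolding K.indep_def by blast
 have sum: "\<phi> (\<Sum>i<m. of_rat (c i) * b i) = (\<Sum>i<m. of_rat (c i) * \<phi> (b i))" if "m <= K.n" for m c
  using that
 proof (induction m)
  case 0 show ?case using f(3)[of 0 0] K.K_closed(1) by simp
 next
  case (Suc m)
  have "(\<Sum>i<m. of_rat (c i) * b i) : K" using bK Suc.prems by (intro K.K_sum K.K_closed(4) K.K_closed(12)) auto
  moreover have "of_rat (c m) * b m : K" using bK[of m] Suc.prems by (intro K.K_closed(4) K.K_closed(12)) auto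
  ultimately show ?case using Suc f(2) f(3)[OF _ bK[of m], of "of_rat (c m)"] by simp
 qed
 show ind: "\<forall>i<K.n. c i = 0" if z: "(\<Sum>i<K.n. of_rat (c i) * \<phi> (b i)) = 0" for c
 proof -
  have "(\<Sum>i<K.n. of_rat (c i) * b i) : K" using bK by (intro K.K_sum K.K_closed(4) K.K_closed(12)) auto
  then have "(\<Sum>i<K.n. of_rat (c i) * b i) = 0" using f(4) sum[of K.n c] z by simp
  then show ?thesis using K.indepD[OF b] by blast
 qed
 have "inj_on (%i. \<phi> (b i)) {..<K.n}" "\<not> rat.dependent ((%i. \<phi> (b i)) ` {..<K.n})"
  using independent_family[where m = K.n and e = "%i. \<phi> (b i)"] ind by blast+
 then show "K.n <= L.n" using L.indep_bound(2)[of "(%i. \<phi> (b i)) ` {..<K.n}"] f(1) bK card_image by fastforce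
qed

locale trace_isometry = K: numfield K + L: numfield L for K L +
 fixes Phi :: "complex => complex"
 assumes Phi_L: "x : K ==> Phi x : L"
  and Phi_add: "x : K ==> y : K ==> Phi (x + y) = Phi x + Phi y"
  and Phi_scale: "c : \<rat> ==> x : K ==> Phi (c * x) = c * Phi x"
  and Phi_1: "Phi 1 = 1"
  and tr_Phi: "x : K ==> y : K ==> nf_trace L (Phi x * Phi y) = nf_trace K (x * y)"
  and Phi_O: "x : ring_of_integers K ==> nf_trace K x = 0 ==> Phi x : ring_of_integers L"
  and Phi_onto: "z : ring_of_integers L ==> nf_trace L z = 0 ==> \<exists>x\<in>ring_of_integers K. nf_trace K x = 0 & Phi x = z"
  and deg: "numfield.n K = numfield.n L"

locale lattice_isometry = K: numfield K + L: numfield L for K L +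
 fixes \<phi> :: "complex => complex"
 assumes bij: "bij_betw \<phi> (trace_zero_module K) (trace_zero_module L)"
  and \<phi>_add: "x : trace_zero_module K ==> y : trace_zero_module K ==> \<phi> (x + y) = \<phi> x + \<phi> y"
  and \<phi>_quad: "x : trace_zero_module K ==> nf_trace L ((\<phi> x)\<^sup>2) = nf_trace K (x\<^sup>2)"
begin

abbreviation "\<Lambda> \<equiv> trace_zero_module K"

lemma \<Lambda>_closed:
 "x : \<Lambda> ==> y : \<Lambda> ==> x + y : \<Lambda>" "0 : \<Lambda>" "x : \<Lambda> ==> of_int k * x : \<Lambda>" "x : \<Lambda> ==> x : K"
 unfolding trace_zero_module_iff
 using K.O_closed K.O_K by (auto simp: K.tr_add K.tr_scale)

lemma \<phi>_mem: "x : \<Lambda> ==> \<phi> x : ring_of_integers L" "x : \<Lambda> ==> nf_trace L (\<phi> x) = 0" "x : \<Lambda> ==> \<phi> x : L"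
proof -
 have "\<phi> x : trace_zero_module L" if "x : \<Lambda>" for x using bij that unfolding bij_betw_def by blast
 then show "x : \<Lambda> ==> \<phi> x : ring_of_integers L" "x : \<Lambda> ==> nf_trace L (\<phi> x) = 0" "x : \<Lambda> ==> \<phi> x : L"
  using L.O_K unfolding trace_zero_module_iff by blast+
qed

lemma \<phi>_0: "\<phi> 0 = 0" using \<phi>_add[OF \<Lambda>_closed(2) \<Lambda>_closed(2)] by simp

lemma \<phi>_int: assumes x: "x : \<Lambda>" shows "\<phi> (of_int k * x) = of_int k * \<phi> x"
proof -
 have nat: "\<phi> (of_int (int m) * x) = of_int (int m) * \<phi> x" for m
 proof (induction m)
  case (Suc m)
  have "\<phi> (of_int (int m) * x + x) = \<phi> (of_int (int m) * x) + \<phi> x" by (rule \<phi>_add[OF \<Lambda>_closed(3)[OF x] x])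
  then show ?case using Suc by (simp add: algebra_simps)
 qed (simp add: \<phi>_0)
 show ?thesis
 proof (cases "k \<ge> 0")
  case True then show ?thesis using nat[of "nat k"] by simp
 next
  case False
  have "\<phi> (of_int k * x + of_int (- k) * x) = \<phi> (of_int k * x) + \<phi> (of_int (- k) * x)"
   by (rule \<phi>_add[OF \<Lambda>_closed(3)[OF x] \<Lambda>_closed(3)[OF x]])
  then have "\<phi> (of_int k * x) + \<phi> (of_int (- k) * x) = 0" using \<phi>_0 by simp
  moreover have "\<phi> (of_int (- k) * x) = of_int (- k) * \<phi> x" using nat[of "nat (- k)"] False by simp
  ultimately show ?thesis by simp
 qed
qed

text \<open>Polarisation, as the given isometry only respects the quadratic form.\<close>

lemma \<phi>_bilinear: assumes x: "x : \<Lambda>" "y : \<Lambda>" shows "nf_trace L (\<phi> x * \<phi> y) = nf_trace K (x * y)"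
proof -
 note xK = \<Lambda>_closed(4)[OF x(1)] \<Lambda>_closed(4)[OF x(2)] and xL = \<phi>_mem(3)[OF x(1)] \<phi>_mem(3)[OF x(2)]
 have "nf_trace K ((x + y)\<^sup>2) = nf_trace K (x\<^sup>2 + (y\<^sup>2 + of_int 2 * (x * y)))"
  by (rule arg_cong[of _ _ "nf_trace K"]) (simp add: power2_eq_square algebra_simps)
 then have 1: "nf_trace K ((x + y)\<^sup>2) = nf_trace K (x\<^sup>2) + (nf_trace K (y\<^sup>2) + of_int 2 * nf_trace K (x * y))"
  by (simp only: K.tr_add K.tr_scale Rats_of_int K.K_closed xK)
 have "nf_trace L ((\<phi> x + \<phi> y)\<^sup>2) = nf_trace L ((\<phi> x)\<^sup>2 + ((\<phi> y)\<^sup>2 + of_int 2 * (\<phi> x * \<phi> y)))"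
  by (rule arg_cong[of _ _ "nf_trace L"]) (simp add: power2_eq_square algebra_simps)
 then have 2: "nf_trace L ((\<phi> x + \<phi> y)\<^sup>2) = nf_trace L ((\<phi> x)\<^sup>2) + (nf_trace L ((\<phi> y)\<^sup>2) + of_int 2 * nf_trace L (\<phi> x * \<phi> y))"
  by (simp only: L.tr_add L.tr_scale Rats_of_int L.K_closed xL)
 show ?thesis using 1 2 \<phi>_quad[OF x(1)] \<phi>_quad[OF x(2)] \<phi>_quad[OF \<Lambda>_closed(1)[OF x]] \<phi>_add[OF x] by simp
qed

text \<open>\<open>mult z\<close> is some denominator of \<open>z\<close>. It serves to extend
  \<phi> to all rational multiples of the trace zero module; by \<open>\<psi>_eq\<close> the choice
  does not matter.\<close>

definition mult :: "complex => int" where "mult z = (SOME m. m > 0 & of_int m * z : \<Lambda>)"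
definition \<psi> :: "complex => complex" where "\<psi> z = \<phi> (of_int (mult z) * z) / of_int (mult z)"

lemma mult: assumes "z : K" "nf_trace K z = 0" shows "mult z > 0" "of_int (mult z) * z : \<Lambda>"
proof -
 obtain m where m: "m > 0" "of_int m * z : ring_of_integers K" using K.O_multiple[OF assms(1)] .
 then have "m > 0 & of_int m * z : \<Lambda>" unfolding trace_zero_module_iff using assms by (simp add: K.tr_scale)
 then have "mult z > 0 & of_int (mult z) * z : \<Lambda>" unfolding mult_def by (rule someI)
 then show "mult z > 0" "of_int (mult z) * z : \<Lambda>" by auto
qed

lemma \<psi>_eq: assumes z: "z : K" "nf_trace K z = 0" and m: "m > 0" "of_int m * z : \<Lambda>"
 shows "\<psi> z = \<phi> (of_int m * z) / of_int m"
proof -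
 note M = mult[OF z]
 have "of_int m * \<phi> (of_int (mult z) * z) = \<phi> (of_int m * (of_int (mult z) * z))" by (rule \<phi>_int[OF M(2), symmetric])
 also have "... = \<phi> (of_int (mult z) * (of_int m * z))" by (simp add: ac_simps)
 also have "... = of_int (mult z) * \<phi> (of_int m * z)" by (rule \<phi>_int[OF m(2)])
 finally show ?thesis unfolding \<psi>_def using M(1) m(1) by (simp add: field_simps)
qed

lemma \<psi>_\<Lambda>: "z : \<Lambda> ==> \<psi> z = \<phi> z"
 using \<psi>_eq[of z 1] \<Lambda>_closed(4) by (simp add: trace_zero_module_iff)

lemma \<psi>_add:
 assumes z: "z : K" "nf_trace K z = 0" and w: "w : K" "nf_trace K w = 0"
 shows "\<psi> (z + w) = \<psi> z + \<psi> w"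
proof -
 note M = mult[OF z] mult[OF w]
 define m where "m = mult z * mult w"
 have m: "m > 0" unfolding m_def using M by simp
 have "of_int m * z = of_int (mult w) * (of_int (mult z) * z)" unfolding m_def by (simp add: ac_simps)
 then have mz: "of_int m * z : \<Lambda>" using \<Lambda>_closed(3)[OF M(2)] by metis
 have "of_int m * w = of_int (mult z) * (of_int (mult w) * w)" unfolding m_def by (simp add: ac_simps)
 then have mw: "of_int m * w : \<Lambda>" using \<Lambda>_closed(3)[OF M(4)] by metis
 have mzw: "of_int m * (z + w) : \<Lambda>" using \<Lambda>_closed(1)[OF mz mw] by (simp add: distrib_left)
 have "nf_trace K (z + w) = 0" using z w by (simp add: K.tr_add)
 from \<psi>_eq[OF K.K_closed(3)[OF z(1) w(1)] this m mzw] show ?thesis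
  unfolding \<psi>_eq[OF z m mz] \<psi>_eq[OF w m mw] distrib_left \<phi>_add[OF mz mw] add_divide_distrib .
qed

lemma \<psi>_scale:
 assumes c: "c : \<rat>" and z: "z : K" "nf_trace K z = 0" shows "\<psi> (c * z) = c * \<psi> z"
proof -
 obtain a b where ab: "c = of_int a / of_int b" "b > 0" using c by (auto elim: Rats_cases')
 note M = mult[OF z]
 have cK: "c : K" using c K.K_closed(12) by (auto elim: Rats_cases)
 have "nf_trace K (c * z) = 0" using z c by (simp add: K.tr_scale)
 moreover have e: "of_int (b * mult z) * (c * z) = of_int a * (of_int (mult z) * z)" unfolding ab using ab(2) by simp
 moreover have "b * mult z > 0" using ab M by simp
 ultimately have "\<psi> (c * z) = \<phi> (of_int a * (of_int (mult z) * z)) / of_int (b * mult z)"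
  using \<psi>_eq[OF K.K_closed(4)[OF cK z(1)]] \<Lambda>_closed(3)[OF M(2)] by metis
 then show ?thesis unfolding \<phi>_int[OF M(2)] \<psi>_def[of z] ab by simp
qed

lemma \<psi>_mem: assumes "z : K" "nf_trace K z = 0" shows "\<psi> z : L" "nf_trace L (\<psi> z) = 0"
proof -
 note p = \<phi>_mem[OF mult(2)[OF assms]]
 have e: "\<psi> z = (1 / of_int (mult z)) * \<phi> (of_int (mult z) * z)" unfolding \<psi>_def by simp
 show "\<psi> z : L" unfolding \<psi>_def using p L.K_closed(8,11) by blast
 show "nf_trace L (\<psi> z) = 0" unfolding e using p by (subst L.tr_scale) auto
qed

lemma \<psi>_bilinear:
 assumes z: "z : K" "nf_trace K z = 0" and w: "w : K" "nf_trace K w = 0"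
 shows "nf_trace L (\<psi> z * \<psi> w) = nf_trace K (z * w)"
proof -
 note M = mult[OF z] mult[OF w]
 let ?c = "1 / of_int (mult z * mult w) :: complex"
 have "\<psi> z * \<psi> w = ?c * (\<phi> (of_int (mult z) * z) * \<phi> (of_int (mult w) * w))" unfolding \<psi>_def by simp
 then have "nf_trace L (\<psi> z * \<psi> w) = ?c * nf_trace L (\<phi> (of_int (mult z) * z) * \<phi> (of_int (mult w) * w))"
  using L.tr_scale[of ?c] L.K_closed(4)[OF \<phi>_mem(3)[OF M(2)] \<phi>_mem(3)[OF M(4)]] by simp
 also have "... = ?c * nf_trace K ((of_int (mult z) * z) * (of_int (mult w) * w))" unfolding \<phi>_bilinear[OF M(2,4)] ..
 also have "(of_int (mult z) * z) * (of_int (mult w) * w) = of_int (mult z * mult w) * (z * w)" by (simp add: ac_simps)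
 also have "nf_trace K ... = of_int (mult z * mult w) * nf_trace K (z * w)"
  by (intro K.tr_scale K.K_closed(4) z w) auto
 finally show ?thesis using M by simp
qed

lemma \<psi>_inj: assumes z: "z : K" "nf_trace K z = 0" and 0: "\<psi> z = 0" shows "z = 0"
proof -
 note M = mult[OF z]
 have "\<phi> (of_int (mult z) * z) = \<phi> 0" using 0 M unfolding \<psi>_def \<phi>_0 by simp
 then have "of_int (mult z) * z = 0" using bij M(2) \<Lambda>_closed(2) unfolding bij_betw_def inj_on_def by blast
 then show ?thesis using M(1) by simp
qed

text \<open>\<open>K\<close> is the orthogonal sum of the rationals and the elements of trace zero.
  The isometry is extended by the identity on the rationals.\<close>

definition z0 :: "complex => complex" where "z0 x = x - nf_trace K x / of_nat K.n"
definition Phi :: "complex => complex" where "Phi x = nf_trace K x / of_nat K.n + \<psi> (z0 x)"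

lemma trn: "x : K ==> nf_trace K x / of_nat K.n : \<rat>" using K.tr_Rats by simp
lemma Rats_KL: "c : \<rat> ==> c : K" "c : \<rat> ==> c : L" using K.K_closed(12) L.K_closed(12) by (auto elim: Rats_cases)

lemma z0: "x : K ==> z0 x : K" "x : K ==> nf_trace K (z0 x) = 0"
 unfolding z0_def using trn Rats_KL K.K_closed K.n_pos by (auto simp: K.tr_diff K.tr_of_Rats)

lemma Phi_props:
 "x : K ==> Phi x : L" "x : K ==> y : K ==> Phi (x + y) = Phi x + Phi y"
 "c : \<rat> ==> x : K ==> Phi (c * x) = c * Phi x" "x : K ==> Phi x = 0 ==> x = 0" "z : \<Lambda> ==> Phi z = \<phi> z"
proof -
 show L: "Phi x : L" if "x : K" for x unfolding Phi_def using L.K_closed(3)[OF Rats_KL(2)[OF trn[OF that]] \<psi>_mem(1)[OF z0[OF that]]] .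
 show "Phi (x + y) = Phi x + Phi y" if xy: "x : K" "y : K" for x y
 proof -
  have "z0 (x + y) = z0 x + z0 y" unfolding z0_def using xy by (simp add: K.tr_add add_divide_distrib)
  then show ?thesis unfolding Phi_def using \<psi>_add[OF z0[OF xy(1)] z0[OF xy(2)]] xy by (simp add: K.tr_add add_divide_distrib)
 qed
 show "Phi (c * x) = c * Phi x" if cx: "c : \<rat>" "x : K" for c x
 proof -
  have "z0 (c * x) = c * z0 x" unfolding z0_def using cx by (simp add: K.tr_scale right_diff_distrib)
  then show ?thesis unfolding Phi_def using \<psi>_scale[OF cx(1) z0[OF cx(2)]] cx by (simp add: K.tr_scale distrib_left)
 qed
 show "x = 0" if x: "x : K" "Phi x = 0" for x
 proof -
  have "nf_trace L (Phi x) = nf_trace K x / of_nat K.n * of_nat L.n"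
   unfolding Phi_def using \<psi>_mem[OF z0[OF x(1)]] Rats_KL(2)[OF trn[OF x(1)]] trn[OF x(1)]
   by (simp only: L.tr_add L.tr_of_Rats) simp
  then have t: "nf_trace K x = 0" using x(2) K.n_pos L.n_pos by simp
  then show ?thesis using \<psi>_inj[OF x(1)] x(2) unfolding Phi_def z0_def by simp
 qed
 show "Phi z = \<phi> z" if z: "z : \<Lambda>" for z
  using \<psi>_\<Lambda>[OF z] z unfolding Phi_def z0_def trace_zero_module_iff by simp
qed

lemma degree_le: "K.n <= L.n"
proof -
 obtain b where "K.zbasis b" by (rule K.zbasis_ex)
 then have "K.indep b" unfolding K.zbasis_def by blast
 then show ?thesis
  using numfield_degree_le(2)[OF K.numfield_axioms L.numfield_axioms, of Phi b] Phi_props by blast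
qed

text \<open>Makes the comparison of degrees symmetric, so that the degrees agree.\<close>

lemma inverse_isometry: "lattice_isometry L K (inv_into \<Lambda> \<phi>)"
proof
 let ?i = "inv_into \<Lambda> \<phi>"
 show b: "bij_betw ?i (trace_zero_module L) \<Lambda>" by (rule bij_betw_inv_into[OF bij])
 have i: "?i x : \<Lambda>" "\<phi> (?i x) = x" if "x : trace_zero_module L" for x
  using b bij bij_betw_inv_into_right[OF bij that] that unfolding bij_betw_def by auto
 show "?i (x + y) = ?i x + ?i y" if "x : trace_zero_module L" "y : trace_zero_module L" for x y
 proof -
  have "\<phi> (?i x + ?i y) = x + y" using \<phi>_add i that by simp
  then show ?thesis using bij_betw_inv_into_left[OF bij \<Lambda>_closed(1)[OF i(1)[OF that(1)] i(1)[OF that(2)]]] by simp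
 qed
 show "nf_trace K ((?i x)\<^sup>2) = nf_trace L (x\<^sup>2)" if "x : trace_zero_module L" for x
  using \<phi>_quad[OF i(1)[OF that]] i(2)[OF that] by simp
qed

lemma trace_isometry: "trace_isometry K L Phi"
proof -
 interpret i: lattice_isometry L K "inv_into \<Lambda> \<phi>" by (rule inverse_isometry)
 have deg: "K.n = L.n" using degree_le i.degree_le by simp
 show ?thesis
 proof
  show "Phi 1 = 1" unfolding Phi_def z0_def K.tr_1 using K.n_pos \<psi>_\<Lambda>[OF \<Lambda>_closed(2)] \<phi>_0 by simp
  show "nf_trace L (Phi x * Phi y) = nf_trace K (x * y)" if xy: "x : K" "y : K" for x y
  proof -
   define a where "a = nf_trace K x / of_nat K.n"
   define c where "c = nf_trace K y / of_nat K.n"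
   note r = trn[OF xy(1), folded a_def] trn[OF xy(2), folded c_def]
   have x: "x = a + z0 x" and y: "y = c + z0 y" unfolding a_def c_def z0_def by auto
   note zx = z0[OF xy(1)] and zy = z0[OF xy(2)]
   note px = \<psi>_mem[OF zx] and py = \<psi>_mem[OF zy]
   note KK = Rats_KL(1)[OF r(1)] Rats_KL(1)[OF r(2)] and LL = Rats_KL(2)[OF r(1)] Rats_KL(2)[OF r(2)]
   have "nf_trace K ((a + z0 x) * (c + z0 y)) = nf_trace K (a * c + (a * z0 y + (c * z0 x + z0 x * z0 y)))"
    by (simp add: algebra_simps)
   also have "... = a * c * of_nat K.n + nf_trace K (z0 x * z0 y)"
    using KK zx zy r by (simp add: K.tr_add K.tr_scale K.K_closed K.tr_of_Rats)
   finally have 1: "nf_trace K (x * y) = a * c * of_nat K.n + nf_trace K (z0 x * z0 y)" using x y by simp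
   have "nf_trace L (Phi x * Phi y) = nf_trace L (a * c + (a * \<psi> (z0 y) + (c * \<psi> (z0 x) + \<psi> (z0 x) * \<psi> (z0 y))))"
    unfolding Phi_def a_def[symmetric] c_def[symmetric] by (simp add: algebra_simps)
   also have "... = a * c * of_nat L.n + nf_trace L (\<psi> (z0 x) * \<psi> (z0 y))"
    using LL px py r by (simp add: L.tr_add L.tr_scale L.K_closed L.tr_of_Rats)
   finally show ?thesis using 1 \<psi>_bilinear[OF zx zy] deg by simp
  qed
  show "Phi x : ring_of_integers L" if "x : ring_of_integers K" "nf_trace K x = 0" for x
   using Phi_props(5)[of x] \<phi>_mem(1)[of x] that by (simp add: trace_zero_module_iff)
  show "\<exists>x\<in>ring_of_integers K. nf_trace K x = 0 & Phi x = z" if "z : ring_of_integers L" "nf_trace L z = 0" for z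
  proof -
   have "z : \<phi> ` \<Lambda>" using bij that unfolding bij_betw_def by (simp add: trace_zero_module_iff)
   then obtain x where "x : \<Lambda>" "z = \<phi> x" by blast
   then show ?thesis using Phi_props(5)[of x] by (intro bexI[of _ x]) (auto simp: trace_zero_module_iff)
  qed
 qed (use Phi_props deg in auto)
qed

end

lemma trace_isometry_ex:
 assumes "number_field K" "number_field L" "trace_zero_forms_isometric K L"
 shows "\<exists>Phi. trace_isometry K L Phi"
proof -
 obtain \<phi> where "lattice_isometry K L \<phi>"
  using assms unfolding trace_zero_forms_isometric_def lattice_isometry_def lattice_isometry_axioms_def numfield_def by blast
 then show ?thesis using lattice_isometry.trace_isometry by blast
qed

section \<open>The mean inequality and lowest coefficients\<close>

text \<open>The inequality \<open>t <= exp (t - 1)\<close> for the ratios of the \<open>x i\<close>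
  to their mean; the exponents add up to 0.\<close>

lemma prod_le_mean_power:
 fixes x :: "'a => real" and \<mu> :: real
 assumes I: "finite I" and x: "!!i. i : I ==> x i \<ge> 0" and \<mu>: "\<mu> > 0" "(\<Sum>i\<in>I. x i) = \<mu> * card I"
 shows "(\<Prod>i\<in>I. x i) <= \<mu> ^ card I"
proof -
 have "(\<Prod>i\<in>I. x i / \<mu>) <= (\<Prod>i\<in>I. exp (x i / \<mu> - 1))"
 proof (rule prod_mono)
  fix i assume "i : I"
  then show "0 <= x i / \<mu> & x i / \<mu> <= exp (x i / \<mu> - 1)"
   using x \<mu>(1) exp_ge_add_one_self[of "x i / \<mu> - 1"] by simp
 qed
 also have "... = exp ((\<Sum>i\<in>I. x i) / \<mu> - card I)"
  using I by (simp add: exp_sum[symmetric] sum_subtractf sum_divide_distrib)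
 also have "... = 1" using \<mu> by simp
 finally show ?thesis using \<mu>(1) by (simp add: prod_dividef divide_le_eq)
qed

text \<open>One polynomial encodes the number of vanishing entries and the product of the others, so
  that both can be followed under an embedding.\<close>

lemma lowest_coeff:
 fixes v :: "'a => complex"
 assumes I: "finite I"
 shows "coeff (\<Prod>i\<in>I. [:v i, 1:]) (card {i : I. v i = 0}) = (\<Prod>i\<in>{i : I. v i ~= 0}. v i)"
  "j < card {i : I. v i = 0} ==> coeff (\<Prod>i\<in>I. [:v i, 1:]) j = 0"
proof -
 let ?Z = "{i : I. v i = 0}" and ?Y = "{i : I. v i ~= 0}"
 have "(\<Prod>i\<in>I. [:v i, 1:]) = (\<Prod>i\<in>?Z. [:v i, 1:]) * (\<Prod>i\<in>?Y. [:v i, 1:])"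
  using I by (subst prod.union_disjoint[symmetric]) (auto intro!: prod.cong)
 also have "(\<Prod>i\<in>?Z. [:v i, 1:]) = (\<Prod>i\<in>?Z. monom 1 1)" by (intro prod.cong) (auto simp: monom_altdef)
 also have "... = monom 1 (card ?Z)" by (simp add: monom_power)
 finally have e: "(\<Prod>i\<in>I. [:v i, 1:]) = monom 1 (card ?Z) * (\<Prod>i\<in>?Y. [:v i, 1:])" .
 show "coeff (\<Prod>i\<in>I. [:v i, 1:]) (card ?Z) = (\<Prod>i\<in>?Y. v i)"
  unfolding e by (simp add: coeff_monom_mult poly_0_coeff_0[symmetric] poly_prod)
 show "j < card ?Z ==> coeff (\<Prod>i\<in>I. [:v i, 1:]) j = 0" unfolding e by (simp add: coeff_monom_mult)
qed

context numfield
begin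

lemma E_rat_sum:
 assumes \<sigma>: "\<sigma> : E" and c: "!!i. i : I ==> c i : \<rat>" and z: "!!i. i : I ==> z i : K"
 shows "\<sigma> (\<Sum>i\<in>I. c i * z i) = (\<Sum>i\<in>I. c i * \<sigma> (z i))" "(\<Sum>i\<in>I. c i * z i) : K"
proof -
 have cz: "c i * z i : K & \<sigma> (c i * z i) = c i * \<sigma> (z i)" if i: "i : I" for i
 proof -
  obtain q where q: "c i = of_rat q" using c[OF i] by (auto elim: Rats_cases)
  show ?thesis unfolding q using K_closed(4)[OF K_closed(12) z[OF i]] E(2)[OF \<sigma> K_closed(12) z[OF i]] E(10)[OF \<sigma>] by simp
 qed
 then show "(\<Sum>i\<in>I. c i * z i) : K" by (intro K_sum) blast
 have "\<sigma> (\<Sum>i\<in>I. c i * z i) = (\<Sum>i\<in>I. \<sigma> (c i * z i))" using cz by (intro E_sum \<sigma>) blast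
 then show "\<sigma> (\<Sum>i\<in>I. c i * z i) = (\<Sum>i\<in>I. c i * \<sigma> (z i))" using cz by simp
qed

abbreviation idE :: "complex => complex" where "idE \<equiv> (%x. if x : K then x else 0)"

end

section \<open>Isomorphism criterion, small degrees and comparison of discriminants\<close>

context trace_isometry
begin

lemma fields_isomorphicI:
 assumes \<sigma>: "\<sigma> : K.E" and L: "!!x. x : K ==> \<sigma> x : L"
 shows "fields_isomorphic K L"
proof -
 obtain b where b: "K.zbasis b" by (rule K.zbasis_ex)
 then have ib: "K.indep b" unfolding K.zbasis_def by blast
 then have bK: "b i : K" if "i < K.n" for i using that unfolding K.indep_def by blast
 have "\<sigma> (c * x) = c * \<sigma> x" if "c : \<rat>" "x : K" for c x
  using K.E_rat_sum(1)[OF \<sigma>, of "{0::nat}" "%_. c" "%_. x"] that by simp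
 then have "\<forall>i<K.n. c i = 0" if "(\<Sum>i<K.n. of_rat (c i) * \<sigma> (b i)) = 0" for c
  using numfield_degree_le(1)[OF K.numfield_axioms L.numfield_axioms L K.E(1)[OF \<sigma>] _ _ ib] that K.E(11)[OF \<sigma>] by blast
 then have ind: "L.indep (%i. \<sigma> (b i))" unfolding L.indep_def using L bK deg by auto
 have "\<sigma> ` K = L"
 proof
  show "\<sigma> ` K \<subseteq> L" using L by blast
  show "L \<subseteq> \<sigma> ` K"
  proof
   fix z assume "z : L"
   then obtain c :: "nat => rat" where c: "z = (\<Sum>i<L.n. of_rat (c i) * \<sigma> (b i))" using L.indep_span[OF ind] by blast
   have "z = \<sigma> (\<Sum>i<K.n. of_rat (c i) * b i)" "(\<Sum>i<K.n. of_rat (c i) * b i) : K"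
    using K.E_rat_sum[OF \<sigma>, of "{..<K.n}" "%i. of_rat (c i)" b] bK c deg by auto
   then show "z : \<sigma> ` K" by blast
  qed
 qed
 then have "bij_betw \<sigma> K L" using embeddings_inj[OF \<sigma> K.sf] unfolding bij_betw_def by blast
 then show ?thesis unfolding fields_isomorphic_def using K.E(1,2)[OF \<sigma>] by blast
qed

lemma tr_Phi_0: "x : K ==> nf_trace L (Phi x) = nf_trace K x"
 using tr_Phi[of x 1] Phi_1 K.K_closed(2) by simp

lemma Phi_sum:
 fixes m :: nat
 assumes "\<forall>i<m. c i : \<rat>" "\<forall>i<m. z i : K"
 shows "Phi (\<Sum>i<m. c i * z i) = (\<Sum>i<m. c i * Phi (z i))"
 using assms
proof (induction m)
 case 0 show ?case using Phi_scale[of 0 0] K.K_closed(1) by simp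
next
 case (Suc m)
 have 1: "(\<Sum>i<m. c i * z i) : K" using K.E_rat_sum(2)[OF K.id_in_E, of "{..<m}" c z] Suc.prems by simp
 have 2: "c m * z m : K" using K.E_rat_sum(2)[OF K.id_in_E, of "{m}" c z] Suc.prems by simp
 show ?case using Phi_add[OF 1 2] Suc Phi_scale[of "c m" "z m"] by simp
qed

text \<open>In degree two a trace zero element \<open>z\<close> has norm \<open>2 * (z * z)\<close>
  for the trace form, so \<open>Phi z\<close> is \<open>z\<close> or \<open>- z\<close> and
  \<open>K\<close> is contained in \<open>L\<close> as a set of complex numbers.\<close>

lemma low_degree:
 assumes "K.n <= 2" shows "fields_isomorphic K L"
proof (rule fields_isomorphicI[OF K.id_in_E])
 fix x assume x: "x : K"
 have E1: "card (K.E - {K.idE}) = K.n - 1" using K.id_in_E K.card_E K.finite_E by simp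
 show "K.idE x : L"
 proof (cases "K.n = 1")
  case True
  then have "K.E - {K.idE} = {}" using E1 K.finite_E card_0_eq[of "K.E - {K.idE}"] by simp
  then have "K.E = {K.idE}" using K.id_in_E by blast
  then have "nf_trace K x = x" unfolding nf_trace_def using x by simp
  then have "x : \<rat>" using K.tr_Rats[OF x] by simp
  then show ?thesis using x L.K_closed(12) by (auto elim: Rats_cases)
 next
  case False
  then have n2: "K.n = 2" using assms K.n_pos by simp
  have sq: "nf_trace F (z * z) = 2 * (z * z)" if F: "numfield F" "numfield.n F = 2" and z: "z : F" "nf_trace F z = 0" for F z
  proof -
   interpret F: numfield F by fact
   have "card (F.E - {F.idE}) = 1" using F.id_in_E F.card_E F.finite_E F(2) by simp
   then obtain \<sigma> where s: "F.E - {F.idE} = {\<sigma>}" by (rule card_1_singletonE)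
   then have \<sigma>: "\<sigma> : F.E" by blast
   have t: "nf_trace F w = w + \<sigma> w" if "w : F" for w
    unfolding nf_trace_def using sum.remove[OF F.finite_E F.id_in_E, of "%\<sigma>. \<sigma> w"] s that by simp
   have "\<sigma> z = - z" using t[OF z(1)] z(2) by (simp add: eq_neg_iff_add_eq_0 add.commute)
   then show ?thesis using t[OF F.K_closed(4)[OF z(1) z(1)]] F.E(2)[OF \<sigma> z(1) z(1)] by simp
  qed
  define c where "c = nf_trace K x / of_nat K.n"
  have c: "c : \<rat>" unfolding c_def using K.tr_Rats[OF x] by simp
  then have cKL: "c : K" "c : L" using K.K_closed(12) L.K_closed(12) by (auto elim: Rats_cases)
  define z where "z = x - c"
  have z: "z : K" "nf_trace K z = 0"
   unfolding z_def using x cKL K.K_closed(7) c K.n_pos by (auto simp: K.tr_diff K.tr_of_Rats c_def)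
  have "2 * (Phi z * Phi z) = 2 * (z * z)"
   using sq[OF L.numfield_axioms _ Phi_L[OF z(1)]] sq[OF K.numfield_axioms n2 z] tr_Phi_0[OF z(1)] tr_Phi[OF z(1) z(1)] z n2 deg by simp
  then have "Phi z = z \<or> Phi z = - z" by (simp add: square_eq_iff)
  then have "z : L" using Phi_L[OF z(1)] L.K_closed(5) by (metis minus_minus)
  then have "x : L" using L.K_closed(3)[OF _ cKL(2), of z] unfolding z_def by simp
  then show ?thesis using x by simp
 qed
qed

text \<open>Replace the zeroth vector of an adapted integral basis by 1 in both fields. The two
  families correspond under \<open>Phi\<close> and so have the same discriminant, which is the field
  discriminant times the square of \<open>n / tgen\<close>.\<close>

lemma disc_relation: "nf_disc K * (int L.tgen)\<^sup>2 = nf_disc L * (int K.tgen)\<^sup>2"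
proof -
 obtain b where ab: "K.adapted b" and b: "K.zbasis b" by (rule K.adapted_zbasis)
 have bO: "b i : K.OK" and bK: "b i : K" if "i < K.n" for i using b K.O_K that unfolding K.zbasis_def by blast+
 have b0: "nf_trace K (b 0) = of_nat K.tgen" and bi: "nf_trace K (b i) = 0" if "i < K.n" "i > 0" for i
  using ab that unfolding K.adapted_def by blast+
 have b0': "nf_trace K (b 0) = of_nat K.tgen" using ab unfolding K.adapted_def by blast
 obtain c0 where c0: "c0 : L.OK" "nf_trace L c0 = of_nat L.tgen" using L.tgen(2) by blast
 \<comment> \<open>The images of the trace zero vectors together with an integer whose trace
   generates all traces form an integral basis of \<open>L\<close>.\<close>
 define c where "c = (%i. Phi (b i))(0 := c0)"
 have cO: "c i : L.OK" if "i < L.n" for i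
  unfolding c_def using c0 Phi_O[OF bO bi] that deg by auto
 have cK: "c i : L" if "i < L.n" for i using cO L.O_K that by blast
 have npos: "0 < L.n" "0 < K.n" using L.n_pos K.n_pos by auto
 have ctr: "nf_trace L (c i) = (if i = 0 then of_nat L.tgen else 0)" if "i < L.n" for i
  unfolding c_def using c0 tr_Phi_0[OF bK] bi that deg by auto
 have split: "(\<Sum>i<m. h i) = h 0 + (\<Sum>i\<in>{1..<m}. h i)" if "m > 0" for h :: "nat => complex" and m
 proof -
  have "{..<m} = insert 0 {1..<m}" using that by auto
  then show ?thesis by simp
 qed
 have czb: "L.zbasis c"
  unfolding L.zbasis_def L.indep_def
 proof (intro conjI allI impI ballI)
  fix z assume z: "z : L.OK"
  obtain t where t: "nf_trace L z = of_int t" using L.tr_int[OF z] .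
  obtain k where k: "t = int L.tgen * k" using L.tgen_dvd[OF z t] by auto
  define w where "w = z - of_int k * c0"
  have w: "w : L.OK" unfolding w_def by (rule L.O_closed(6)[OF z L.O_closed(4)[OF L.O_closed(7) c0(1)]])
  have "nf_trace L w = 0" unfolding w_def using L.O_K[OF z] L.O_K[OF c0(1)] L.K_closed(4,11)
   by (simp add: L.tr_diff L.tr_scale t k c0)
  then obtain x where x: "x : K.OK" "nf_trace K x = 0" "Phi x = w" using Phi_onto[OF w] by blast
  obtain a where a: "x = (\<Sum>i<K.n. of_int (a i) * b i)" using K.coords_ex[OF b x(1)] .
  have "nf_trace K x = (\<Sum>i<K.n. of_int (a i) * nf_trace K (b i))"
   unfolding a using bK K.K_closed(4,11) by (subst K.tr_sum) (auto simp: K.tr_scale)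
  also have "... = of_int (a 0) * of_nat K.tgen" using bi b0' by (subst split[OF npos(2)]) simp
  finally have "a 0 = 0" using x(2) K.tgen(1) by simp
  have "w = (\<Sum>i<K.n. of_int (a i) * Phi (b i))" unfolding x(3)[symmetric] a using bK by (intro Phi_sum) auto
  also have "... = (\<Sum>i\<in>{1..<K.n}. of_int (a i) * Phi (b i))" using \<open>a 0 = 0\<close> by (subst split[OF npos(2)]) simp
  finally have "z = (\<Sum>i<L.n. of_int ((a(0 := k)) i) * c i)"
   unfolding w_def using npos deg by (subst split) (auto simp: c_def algebra_simps intro!: sum.cong)
  then show "\<exists>c'. z = (\<Sum>i<L.n. of_int (c' i) * c i)" by blast
 next
  fix q :: "nat => rat" and i assume z: "(\<Sum>i<L.n. of_rat (q i) * c i) = 0" and i: "i < L.n"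
  have "nf_trace L (\<Sum>i<L.n. of_rat (q i) * c i) = (\<Sum>i<L.n. of_rat (q i) * nf_trace L (c i))"
   using cK L.K_closed(4,12) by (subst L.tr_sum) (auto simp: L.tr_scale)
  also have "... = of_rat (q 0) * of_nat L.tgen" using ctr npos by (subst split[OF npos(1)]) simp
  finally have q0: "q 0 = 0" using z L.tgen(1) by simp
  have "0 = (\<Sum>i\<in>{1..<L.n}. of_rat (q i) * Phi (b i))" using z q0 unfolding split[OF npos(1)] c_def by simp
  also have "... = (\<Sum>i<K.n. of_rat (q i) * Phi (b i))" using q0 deg by (subst split[OF npos(2)]) simp
  also have "... = Phi (\<Sum>i<K.n. of_rat (q i) * b i)" using bK by (intro Phi_sum[symmetric]) auto
  finally have p0: "Phi (\<Sum>i<K.n. of_rat (q i) * b i) = 0" by simp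
  have sK: "(\<Sum>i<K.n. of_rat (q i) * b i) : K" using bK K.K_closed(4,12) by (intro K.K_sum) auto
  have "(\<Sum>i<K.n. of_rat (q i) * b i) = 0"
   by (rule K.tr_nondegenerate[OF sK]) (use tr_Phi[OF sK] p0 in simp)
  then show "q i = 0" using K.indepD[of b q i] b i deg unfolding K.zbasis_def by simp
 qed (use cO cK in auto)
 have disc1: "\<exists>m. numfield.disc F (e(0 := 1)) = of_int (m\<^sup>2 * nf_disc F) & of_nat (numfield.n F) = (of_int (m * int g) :: complex)"
  if F: "numfield F" and e: "numfield.zbasis F e" and g: "!!i. i < numfield.n F ==> nf_trace F (e i) = (if i = 0 then of_nat g else 0)"
  for F e g
 proof -
  interpret F: numfield F by fact
  have eK: "e i : F" if "i < F.n" for i using e F.O_K that unfolding F.zbasis_def by blast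
  obtain X where X: "1 = (\<Sum>i<F.n. of_int (X i) * e i)" using F.coords_ex[OF e F.O_closed(2)] .
  have "of_nat F.n = nf_trace F 1" by (rule F.tr_1[symmetric])
  also have "... = (\<Sum>i<F.n. of_int (X i) * nf_trace F (e i))"
   by (subst X) (use eK F.K_closed(4,11) in \<open>subst F.tr_sum, auto simp: F.tr_scale\<close>)
  also have "... = of_int (X 0 * int g)" using g F.n_pos by (subst split) auto
  finally show ?thesis
   using F.disc_replace[OF eK F.n_pos X] F.nf_disc_eq[OF e] by (intro exI[of _ "X 0"]) simp
 qed
 obtain m where m: "K.disc (b(0 := 1)) = of_int (m\<^sup>2 * nf_disc K)" "of_nat K.n = (of_int (m * int K.tgen) :: complex)"
  using disc1[OF K.numfield_axioms b, of K.tgen] bi b0' by fastforce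
 obtain k where k: "L.disc (c(0 := 1)) = of_int (k\<^sup>2 * nf_disc L)" "of_nat L.n = (of_int (k * int L.tgen) :: complex)"
  using disc1[OF L.numfield_axioms czb, of L.tgen] ctr by fastforce
 have "K.disc (b(0 := 1)) = L.disc (c(0 := 1))"
  unfolding K.disc_def L.disc_def deg[symmetric]
 proof (intro arg_cong[of _ _ det] eq_matI)
  fix i j assume "i < dim_row (mat K.n K.n (%(i, j). nf_trace L ((c(0 := 1)) i * (c(0 := 1)) j)))"
   "j < dim_col (mat K.n K.n (%(i, j). nf_trace L ((c(0 := 1)) i * (c(0 := 1)) j)))"
  then have ij: "i < K.n" "j < K.n" by auto
  have "(c(0 := 1)) l = Phi ((b(0 := 1)) l)" "(b(0 := 1)) l : K" if "l < K.n" for l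
   unfolding c_def using Phi_1 bK K.K_closed(2) that by auto
  then show "mat K.n K.n (%(i, j). nf_trace K ((b(0 := 1)) i * (b(0 := 1)) j)) $$ (i, j) =
    mat K.n K.n (%(i, j). nf_trace L ((c(0 := 1)) i * (c(0 := 1)) j)) $$ (i, j)"
   using ij tr_Phi by simp
 qed auto
 then have "m\<^sup>2 * nf_disc K = k\<^sup>2 * nf_disc L" unfolding m k by (simp only: of_int_eq_iff)
 moreover have "int K.n = m * int K.tgen" "int L.n = k * int L.tgen"
  using m(2) k(2) by (metis of_int_eq_iff of_int_of_nat_eq)+
 then have mk: "m * int K.tgen = k * int L.tgen" and m0: "m ~= 0" using deg npos by auto
 ultimately have "m\<^sup>2 * (nf_disc K * (int L.tgen)\<^sup>2) = m\<^sup>2 * (nf_disc L * (int K.tgen)\<^sup>2)"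
  by (metis (no_types, opaque_lifting) mult.assoc mult.commute power_mult_distrib)
 then show ?thesis using m0 by simp
qed

end

section \<open>The matrix of the isometry in terms of embeddings\<close>

locale codifferent_isometry = trace_isometry K L Phi + CK: codifferent K f y D \<rho> \<rho>' k0 + CL: codifferent L f' y' D \<mu> \<mu>' k1
 for K L Phi f y D \<rho> \<rho>' k0 f' y' \<mu> \<mu>' k1 +
 fixes b b' :: "nat => complex"
 assumes zb: "numfield.zbasis K b" and trb: "!!i. i < numfield.n K ==> nf_trace K (b i) = (if i = 0 then 1 else 0)"
  and db: "numfield.dual K b b'" and b'c: "\<forall>i<numfield.n K. b' i : numfield.codiff K"
  and real: "totally_real K"
begin

lemma bO: "i < K.n ==> b i : K.OK" and bK: "i < K.n ==> b i : K" and b'K: "i < K.n ==> b' i : K"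
 using zb db unfolding K.zbasis_def K.dual_def by blast+

lemma tr_b'_Rats: "x : K ==> i < K.n ==> nf_trace K (x * b' i) : \<rat>"
 by (intro K.tr_Rats K.K_closed(4) b'K)

lemma indep_b': "K.indep b'" by (rule K.dual_indep[OF K.dual_sym[OF db]])

text \<open>The matrix of \<open>Phi\<close> on conjugates: it sends the vector of the
  \<open>\<sigma> x\<close> to the vector of the \<open>\<tau> (Phi x)\<close>.\<close>

definition U :: "(complex => complex) => (complex => complex) => complex" where
 "U \<tau> \<sigma> = (\<Sum>i<K.n. \<tau> (Phi (b i)) * \<sigma> (b' i))"

lemma Phi_expand: assumes \<tau>: "\<tau> : L.E" and x: "x : K"
 shows "\<tau> (Phi x) = (\<Sum>i<K.n. nf_trace K (x * b' i) * \<tau> (Phi (b i)))"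
proof -
 have "Phi x = Phi (\<Sum>i<K.n. nf_trace K (x * b' i) * b i)" using K.dual_expand[OF db x] by simp
 also have "... = (\<Sum>i<K.n. nf_trace K (x * b' i) * Phi (b i))" using tr_b'_Rats[OF x] bK by (intro Phi_sum) auto
 finally show ?thesis using L.E_rat_sum(1)[OF \<tau>, of "{..<K.n}" "%i. nf_trace K (x * b' i)" "%i. Phi (b i)"]
  tr_b'_Rats[OF x] Phi_L[OF bK] by simp
qed

lemma U_apply: assumes \<tau>: "\<tau> : L.E" and x: "x : K" shows "(\<Sum>\<sigma>\<in>K.E. U \<tau> \<sigma> * \<sigma> x) = \<tau> (Phi x)"
proof -
 have "(\<Sum>\<sigma>\<in>K.E. U \<tau> \<sigma> * \<sigma> x) = (\<Sum>\<sigma>\<in>K.E. \<Sum>i<K.n. \<tau> (Phi (b i)) * \<sigma> (x * b' i))"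
  unfolding U_def sum_distrib_right using K.E(2)[OF _ x b'K] by (intro sum.cong refl) (simp add: ac_simps)
 also have "... = (\<Sum>i<K.n. \<tau> (Phi (b i)) * nf_trace K (x * b' i))"
  by (subst sum.swap) (simp add: nf_trace_def sum_distrib_left)
 finally show ?thesis unfolding Phi_expand[OF \<tau> x] by (simp add: mult.commute)
qed

lemma U_row: assumes "\<tau> : L.E" shows "(\<Sum>\<sigma>\<in>K.E. U \<tau> \<sigma>) = 1"
proof -
 have "(\<Sum>\<sigma>\<in>K.E. U \<tau> \<sigma>) = (\<Sum>\<sigma>\<in>K.E. U \<tau> \<sigma> * \<sigma> 1)" by (intro sum.cong refl) (use K.E(3) in simp)
 then show ?thesis using U_apply[OF assms K.K_closed(2)] L.E(3)[OF assms] Phi_1 by simp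
qed

lemma U_orth: assumes \<tau>: "\<tau> : L.E" "\<tau>' : L.E"
 shows "(\<Sum>\<sigma>\<in>K.E. U \<tau> \<sigma> * U \<tau>' \<sigma>) = (if \<tau> = \<tau>' then 1 else 0)"
proof -
 have "(\<Sum>\<sigma>\<in>K.E. U \<tau> \<sigma> * U \<tau>' \<sigma>) = (\<Sum>\<sigma>\<in>K.E. \<Sum>i<K.n. \<tau>' (Phi (b i)) * (U \<tau> \<sigma> * \<sigma> (b' i)))"
  unfolding U_def[of \<tau>'] sum_distrib_left by (intro sum.cong refl) (simp add: ac_simps)
 also have "... = (\<Sum>i<K.n. \<tau>' (Phi (b i)) * \<tau> (Phi (b' i)))"
  by (subst sum.swap) (simp add: sum_distrib_left[symmetric] U_apply[OF \<tau>(1) b'K])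
 also have "... = (if \<tau>' = \<tau> then 1 else 0)"
 proof -
  have "L.dual (%i. Phi (b i)) (%i. Phi (b' i))"
   using db Phi_L bK b'K tr_Phi deg unfolding L.dual_def K.dual_def by auto
  from L.dual_sum[OF this \<tau>(2,1)] show ?thesis using deg by simp
 qed
 finally show ?thesis by auto
qed

text \<open>As \<open>K\<close> is totally real, conjugating \<tau> conjugates its row. Were \<tau>
  different from its conjugate, orthogonality of the two rows would make the sum of the squared
  absolute values of the row 0, although the row sums to 1.\<close>

lemma U_real: assumes \<tau>: "\<tau> : L.E" "\<sigma> : K.E" shows "U \<tau> \<sigma> : \<real>"
proof -
 define \<tau>' where "\<tau>' = cnj \<circ> \<tau>"
 have \<tau>': "\<tau>' : L.E" using \<tau>(1) unfolding \<tau>'_def embeddings_def by auto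
 have c: "U \<tau>' \<sigma> = cnj (U \<tau> \<sigma>)" if s: "\<sigma> : K.E" for \<sigma>
 proof -
  have "cnj (\<sigma> (b' i)) = \<sigma> (b' i)" if "i < K.n" for i
   using real s b'K[OF that] unfolding totally_real_def by (simp add: Reals_cnj_iff)
  then show ?thesis unfolding U_def \<tau>'_def by simp
 qed
 have "\<tau> = \<tau>'"
 proof (rule ccontr)
  assume "\<tau> ~= \<tau>'"
  then have "(\<Sum>\<sigma>\<in>K.E. U \<tau> \<sigma> * cnj (U \<tau> \<sigma>)) = 0" using U_orth[OF \<tau>(1) \<tau>'] c by simp
  then have "(\<Sum>\<sigma>\<in>K.E. (cmod (U \<tau> \<sigma>))\<^sup>2) = 0" by (simp only: complex_norm_square[symmetric] of_real_sum[symmetric] of_real_eq_0_iff)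
  then have "U \<tau> \<sigma> = 0" if "\<sigma> : K.E" for \<sigma> using that K.finite_E by (simp add: sum_nonneg_eq_0_iff)
  then show False using U_row[OF \<tau>(1)] by simp
 qed
 then show ?thesis using c[OF \<tau>(2)] by (simp add: Reals_cnj_iff)
qed

text \<open>The matrix on conjugates of the map \<open>x \<mapsto> Phi x + c * tr x\<close>: the
  trace has coefficient 1 at every embedding, so all entries are shifted by
  \<open>c\<close>.\<close>

definition V :: "rat => (complex => complex) => (complex => complex) => complex" where
 "V c \<tau> \<sigma> = U \<tau> \<sigma> + of_rat c"

lemma V_form: assumes \<tau>: "\<tau> : L.E" "\<sigma> : K.E"
 shows "V c \<tau> \<sigma> = (\<Sum>i<K.n. \<tau> (Phi (b i) + of_rat c * nf_trace K (b i)) * \<sigma> (b' i))"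
proof -
 have one: "1 = (\<Sum>i<K.n. nf_trace K (b i) * b' i)" using K.dual_expand[OF K.dual_sym[OF db] K.K_closed(2)] by simp
 have r: "nf_trace K (b i) : \<rat>" if "i < K.n" for i using K.tr_Rats[OF bK[OF that]] .
 have "\<sigma> 1 = (\<Sum>i<K.n. nf_trace K (b i) * \<sigma> (b' i))"
  by (subst one) (rule K.E_rat_sum(1)[OF \<tau>(2)], use r b'K in auto)
 then have s1: "1 = (\<Sum>i<K.n. nf_trace K (b i) * \<sigma> (b' i))" using K.E(3)[OF \<tau>(2)] by simp
 have "\<tau> (Phi (b i) + of_rat c * nf_trace K (b i)) = \<tau> (Phi (b i)) + of_rat c * nf_trace K (b i)" if i: "i < K.n" for i
 proof -
  obtain q where q: "of_rat c * nf_trace K (b i) = of_rat q" using r[OF i] by (metis Rats_cases of_rat_mult)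
  show ?thesis unfolding q using L.E(1)[OF \<tau>(1) Phi_L[OF bK[OF i]] L.K_closed(12)] L.E(10)[OF \<tau>(1)] by simp
 qed
 then have "(\<Sum>i<K.n. \<tau> (Phi (b i) + of_rat c * nf_trace K (b i)) * \<sigma> (b' i)) =
   (\<Sum>i<K.n. \<tau> (Phi (b i)) * \<sigma> (b' i) + of_rat c * (nf_trace K (b i) * \<sigma> (b' i)))"
  by (intro sum.cong refl) (simp add: algebra_simps)
 then show ?thesis unfolding V_def U_def using s1 by (simp add: sum.distrib sum_distrib_left[symmetric])
qed

text \<open>The entries of row \<tau> combine \<tau> of elements of \<open>L\<close> with conjugates
  of the basis \<open>b'\<close>, so \<open>norm_poly_embedding\<close> applies with
  \<open>F\<close> equal to \<open>L\<close>. The coefficient \<open>\<sigma> x\<close> of the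
  variable allows the value of a single \<sigma> to be read off.\<close>

lemma V_coeff:
 assumes x: "x : K" and \<tau>: "\<tau> : L.E"
 shows "coeff (\<Prod>\<sigma>\<in>K.E. [:V c L.idE \<sigma>, \<sigma> x:]) m : L"
  "\<tau> (coeff (\<Prod>\<sigma>\<in>K.E. [:V c L.idE \<sigma>, \<sigma> x:]) m) = coeff (\<Prod>\<sigma>\<in>K.E. [:V c \<tau> \<sigma>, \<sigma> x:]) m"
proof -
 define a where "a i = Phi (b i) + of_rat c * nf_trace K (b i)" for i
 have a: "a i : L" if i: "i < K.n" for i
 proof -
  obtain q where q: "of_rat c * nf_trace K (b i) = of_rat q" using K.tr_Rats[OF bK[OF i]] by (metis Rats_cases of_rat_mult)
  show ?thesis unfolding a_def q by (rule L.K_closed(3)[OF Phi_L[OF bK[OF i]] L.K_closed(12)])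
 qed
 have e: "(\<Prod>\<sigma>\<in>K.E. [:V c \<tau> \<sigma>, \<sigma> x:]) = (\<Prod>\<sigma>\<in>K.E. [:\<Sum>i<K.n. \<tau> (a i) * \<sigma> (b' i), \<sigma> x:])" if "\<tau> : L.E" for \<tau>
  using V_form[OF that] unfolding a_def by (intro prod.cong) auto
 have i: "(\<Prod>\<sigma>\<in>K.E. [:V c L.idE \<sigma>, \<sigma> x:]) = (\<Prod>\<sigma>\<in>K.E. [:\<Sum>i<K.n. a i * \<sigma> (b' i), \<sigma> x:])"
  unfolding e[OF L.id_in_E] using a by (intro prod.cong) auto
 show "coeff (\<Prod>\<sigma>\<in>K.E. [:V c L.idE \<sigma>, \<sigma> x:]) m : L"
  "\<tau> (coeff (\<Prod>\<sigma>\<in>K.E. [:V c L.idE \<sigma>, \<sigma> x:]) m) = coeff (\<Prod>\<sigma>\<in>K.E. [:V c \<tau> \<sigma>, \<sigma> x:]) m"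
  unfolding i e[OF \<tau>] using K.norm_poly_embedding[where a = a, OF L.sf \<tau> a indep_b' x] by blast+
qed

abbreviation zeros where "zeros c \<tau> \<equiv> {\<sigma> : K.E. V c \<tau> \<sigma> = 0}"

text \<open>The number of zeros in a row and the product of the nonzero entries of a row are conjugation equivariant,
 being the order of vanishing and the lowest coefficient of a polynomial over \<open>L\<close>.\<close>
lemma row_zeros:
 "\<exists>\<kappa>\<in>L. \<kappa> ~= 0 & (\<forall>\<tau>\<in>L.E. card (zeros c \<tau>) = card (zeros c L.idE) \<and>
  \<tau> \<kappa> = (\<Prod>\<sigma>\<in>{\<sigma> : K.E. V c \<tau> \<sigma> ~= 0}. V c \<tau> \<sigma>))"
proof -
 define P where "P \<tau> = (\<Prod>\<sigma>\<in>K.E. [:V c \<tau> \<sigma>, 1:])" for \<tau>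
 have P: "P \<tau> = (\<Prod>\<sigma>\<in>K.E. [:V c \<tau> \<sigma>, \<sigma> 1:])" for \<tau> unfolding P_def using K.E(3) by (intro prod.cong) auto
 have PL: "coeff (P L.idE) m : L" for m unfolding P by (rule V_coeff(1)[OF K.K_closed(2) L.id_in_E])
 have P\<tau>: "\<tau> (coeff (P L.idE) m) = coeff (P \<tau>) m" if "\<tau> : L.E" for \<tau> m
  unfolding P by (rule V_coeff(2)[OF K.K_closed(2) that])
 have low: "coeff (P \<tau>) (card (zeros c \<tau>)) = (\<Prod>\<sigma>\<in>{\<sigma> : K.E. V c \<tau> \<sigma> ~= 0}. V c \<tau> \<sigma>)"
  "coeff (P \<tau>) (card (zeros c \<tau>)) ~= 0" "j < card (zeros c \<tau>) ==> coeff (P \<tau>) j = 0" for \<tau> j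
  unfolding P_def lowest_coeff(1)[OF K.finite_E] using lowest_coeff(2)[OF K.finite_E] K.finite_E by auto
 have card: "card (zeros c \<tau>) = card (zeros c L.idE)" if \<tau>: "\<tau> : L.E" for \<tau>
 proof (rule linorder_cases[of "card (zeros c \<tau>)" "card (zeros c L.idE)"])
  assume "card (zeros c \<tau>) < card (zeros c L.idE)"
  then have "coeff (P L.idE) (card (zeros c \<tau>)) = 0" by (rule low(3))
  then have "coeff (P \<tau>) (card (zeros c \<tau>)) = 0" using P\<tau>[OF \<tau>, of "card (zeros c \<tau>)"] L.E(4)[OF \<tau>] by simp
  then show ?thesis using low(2) by blast
 next
  assume "card (zeros c L.idE) < card (zeros c \<tau>)"
  then have "coeff (P \<tau>) (card (zeros c L.idE)) = 0" by (rule low(3))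
  then have "\<tau> (coeff (P L.idE) (card (zeros c L.idE))) = 0" using P\<tau>[OF \<tau>, of "card (zeros c L.idE)"] by simp
  then have "coeff (P L.idE) (card (zeros c L.idE)) = 0" using L.E(11)[OF \<tau> PL] by blast
  then show ?thesis using low(2) by blast
 qed
 show ?thesis
 proof (intro bexI[of _ "coeff (P L.idE) (card (zeros c L.idE))"] conjI ballI)
  fix \<tau> assume \<tau>: "\<tau> : L.E"
  show "card (zeros c \<tau>) = card (zeros c L.idE)" by (rule card[OF \<tau>])
  show "\<tau> (coeff (P L.idE) (card (zeros c L.idE))) = (\<Prod>\<sigma>\<in>{\<sigma> : K.E. V c \<tau> \<sigma> ~= 0}. V c \<tau> \<sigma>)"
   unfolding P\<tau>[OF \<tau>] card[OF \<tau>, symmetric] by (rule low(1))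
 qed (rule low(2), rule PL)
qed

lemma row_squares: assumes \<tau>: "\<tau> : L.E"
 shows "(\<Sum>\<sigma>\<in>K.E. (V c \<tau> \<sigma>)\<^sup>2) = 1 + 2 * of_rat c + of_nat K.n * (of_rat c)\<^sup>2"
proof -
 have "(\<Sum>\<sigma>\<in>K.E. (V c \<tau> \<sigma>)\<^sup>2) = (\<Sum>\<sigma>\<in>K.E. U \<tau> \<sigma> * U \<tau> \<sigma> + 2 * of_rat c * U \<tau> \<sigma> + (of_rat c)\<^sup>2)"
  unfolding V_def by (intro sum.cong) (auto simp: power2_eq_square algebra_simps)
 also have "... = 1 + 2 * of_rat c + of_nat K.n * (of_rat c)\<^sup>2"
  using U_orth[OF \<tau> \<tau>] U_row[OF \<tau>] by (simp add: sum.distrib sum_distrib_left[symmetric] K.card_E)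
 finally show ?thesis .
qed

lemma V_real: assumes "\<tau> : L.E" "\<sigma> : K.E" shows "V c \<tau> \<sigma> = of_real (Re (V c \<tau> \<sigma>))"
proof -
 have r: "of_rat c : (\<rat> :: complex set)" by simp
 have "of_rat c : (\<real> :: complex set)" by (rule Rats_cases'[OF r]) simp
 from Reals_add[OF U_real[OF assms] this] show ?thesis unfolding V_def by (rule of_real_Re[symmetric])
qed

text \<open>The linear coefficient of the row polynomial is \<open>\<sigma>0 x\<close> times the
  product \<kappa> of the nonzero entries, and for \<open>x = 1\<close> it is \<kappa> itself. Both
  lie in \<open>L\<close>, hence so does \<open>\<sigma>0 x\<close>.\<close>

lemma single_zero_isomorphic:
 assumes "card (zeros c L.idE) = 1" shows "fields_isomorphic K L"
proof -
 obtain \<sigma>0 where z: "zeros c L.idE = {\<sigma>0}" using assms by (rule card_1_singletonE)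
 then have \<sigma>0: "\<sigma>0 : K.E" "V c L.idE \<sigma>0 = 0" by blast+
 define \<kappa> where "\<kappa> = (\<Prod>\<sigma>\<in>K.E - {\<sigma>0}. V c L.idE \<sigma>)"
 have \<kappa>0: "\<kappa> ~= 0" unfolding \<kappa>_def using z K.finite_E by auto
 have co: "coeff (\<Prod>\<sigma>\<in>K.E. [:V c L.idE \<sigma>, \<sigma> x:]) 1 = \<sigma>0 x * \<kappa>" for x
 proof -
  let ?Q = "\<Prod>\<sigma>\<in>K.E - {\<sigma>0}. [:V c L.idE \<sigma>, \<sigma> x:]"
  have "(\<Prod>\<sigma>\<in>K.E. [:V c L.idE \<sigma>, \<sigma> x:]) = [:0, \<sigma>0 x:] * ?Q"
   using prod.remove[OF K.finite_E \<sigma>0(1), of "%\<sigma>. [:V c L.idE \<sigma>, \<sigma> x:]"] \<sigma>0(2) by (simp del: mult_pCons_left)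
  then have "coeff (\<Prod>\<sigma>\<in>K.E. [:V c L.idE \<sigma>, \<sigma> x:]) 1 = \<sigma>0 x * coeff ?Q 0" by simp
  moreover have "coeff ?Q 0 = \<kappa>" unfolding \<kappa>_def by (simp add: poly_0_coeff_0[symmetric] poly_prod)
  ultimately show ?thesis by simp
 qed
 have \<kappa>L: "\<kappa> : L" using V_coeff(1)[OF K.K_closed(2) L.id_in_E, of c 1] unfolding co using K.E(3)[OF \<sigma>0(1)] by simp
 show ?thesis
 proof (rule fields_isomorphicI[OF \<sigma>0(1)])
  fix x assume x: "x : K"
  have "\<sigma>0 x * \<kappa> / \<kappa> : L" using V_coeff(1)[OF x L.id_in_E, of c 1] \<kappa>L L.K_closed(8) unfolding co by blast
  then show "\<sigma>0 x : L" using \<kappa>0 by simp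
 qed
qed

text \<open>The product of all nonzero entries is a nonzero rational integer, while no entry exceeds
  1 in absolute value. So the nonzero entries of the identity row are 1 or -1, and the sum of
  squares leaves only one; up to sign it gives \<open>\<sigma>0 x\<close> as
  \<open>Phi x + c * tr x\<close>.\<close>

lemma integral_orthogonal_isomorphic:
 assumes ai: "!!\<tau> \<sigma>. \<tau> : L.E ==> \<sigma> : K.E ==> algebraic_int (V c \<tau> \<sigma>)"
  and sq: "!!\<tau>. \<tau> : L.E ==> (\<Sum>\<sigma>\<in>K.E. (V c \<tau> \<sigma>)\<^sup>2) = 1"
 shows "fields_isomorphic K L"
proof -
 define R where "R \<tau> \<sigma> = Re (V c \<tau> \<sigma>)" for \<tau> \<sigma>
 have VR: "V c \<tau> \<sigma> = of_real (R \<tau> \<sigma>)" if "\<tau> : L.E" "\<sigma> : K.E" for \<tau> \<sigma> unfolding R_def using V_real that by blast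
 have sqR: "(\<Sum>\<sigma>\<in>K.E. (R \<tau> \<sigma>)\<^sup>2) = 1" if \<tau>: "\<tau> : L.E" for \<tau>
 proof -
  have "complex_of_real (\<Sum>\<sigma>\<in>K.E. (R \<tau> \<sigma>)\<^sup>2) = of_real 1" using sq[OF \<tau>] VR[OF \<tau>] by simp
  then show ?thesis by (simp only: of_real_eq_iff)
 qed
 have R1: "(R \<tau> \<sigma>)\<^sup>2 <= 1" if "\<tau> : L.E" "\<sigma> : K.E" for \<tau> \<sigma>
  using member_le_sum[of \<sigma> K.E "%\<sigma>. (R \<tau> \<sigma>)\<^sup>2"] sqR[OF that(1)] that K.finite_E by simp
 obtain \<kappa> where \<kappa>1: "\<kappa> : L" "\<kappa> ~= 0" "\<forall>\<tau>\<in>L.E. card (zeros c \<tau>) = card (zeros c L.idE) \<and>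
  \<tau> \<kappa> = (\<Prod>\<sigma>\<in>{\<sigma> : K.E. V c \<tau> \<sigma> ~= 0}. V c \<tau> \<sigma>)" using row_zeros[of c] by blast
 then have \<kappa>: "\<kappa> : L" "!!\<tau>. \<tau> : L.E ==> \<tau> \<kappa> = (\<Prod>\<sigma>\<in>{\<sigma> : K.E. V c \<tau> \<sigma> ~= 0}. V c \<tau> \<sigma>)" "\<kappa> ~= 0"
  by simp_all
 define q where "q \<tau> = (\<Prod>\<sigma>\<in>{\<sigma> : K.E. V c \<tau> \<sigma> ~= 0}. (R \<tau> \<sigma>)\<^sup>2)" for \<tau>
 have q\<kappa>: "(\<tau> \<kappa>)\<^sup>2 = of_real (q \<tau>)" if "\<tau> : L.E" for \<tau>
 proof -
  have "\<tau> \<kappa> = of_real (\<Prod>\<sigma>\<in>{\<sigma> : K.E. V c \<tau> \<sigma> ~= 0}. R \<tau> \<sigma>)"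
   unfolding \<kappa>(2)[OF that] of_real_prod using VR[OF that] by (intro prod.cong) auto
  then show ?thesis unfolding q_def by (simp add: prod_power_distrib)
 qed
 have q01: "0 <= q \<tau>" "q \<tau> <= 1" if "\<tau> : L.E" for \<tau>
  unfolding q_def using R1[OF that] by (auto intro!: prod_nonneg prod_le_1)
 have "(\<Prod>\<tau>\<in>L.E. \<tau> \<kappa>) : \<int>"
 proof (rule rational_algebraic_int_is_int)
  show "algebraic_int (\<Prod>\<tau>\<in>L.E. \<tau> \<kappa>)"
  proof (rule algebraic_int_prod)
   fix \<tau> assume \<tau>: "\<tau> : L.E"
   show "algebraic_int (\<tau> \<kappa>)" unfolding \<kappa>(2)[OF \<tau>] by (rule algebraic_int_prod) (use ai[OF \<tau>] in auto)
  qed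
 qed (rule L.norm_Rats[OF \<kappa>(1)])
 then obtain m where m: "(\<Prod>\<tau>\<in>L.E. \<tau> \<kappa>) = of_int m" by (auto elim: Ints_cases)
 have "(\<Prod>\<tau>\<in>L.E. \<tau> \<kappa>) ~= 0" using L.E(11)[OF _ \<kappa>(1)] \<kappa>(3) L.finite_E by auto
 then have m0: "m ~= 0" using m by auto
 have "complex_of_real (\<Prod>\<tau>\<in>L.E. q \<tau>) = (\<Prod>\<tau>\<in>L.E. \<tau> \<kappa>)\<^sup>2"
  unfolding of_real_prod prod_power_distrib by (intro prod.cong refl) (use q\<kappa> in simp)
 also have "... = of_real (of_int (m\<^sup>2))" unfolding m by simp
 finally have qm: "(\<Prod>\<tau>\<in>L.E. q \<tau>) = of_int (m\<^sup>2)" by (simp only: of_real_eq_iff)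
 have "m\<^sup>2 \<ge> 1" using m0 by (metis int_one_le_iff_zero_less zero_less_power2)
 then have "(\<Prod>\<tau>\<in>L.E. q \<tau>) \<ge> 1" unfolding qm by (metis of_int_1 of_int_le_iff)
 moreover have "(\<Prod>\<tau>\<in>L.E. q \<tau>) = q L.idE * (\<Prod>\<tau>\<in>L.E - {L.idE}. q \<tau>)" by (rule prod.remove[OF L.finite_E L.id_in_E])
 moreover have "(\<Prod>\<tau>\<in>L.E - {L.idE}. q \<tau>) <= 1" "0 <= (\<Prod>\<tau>\<in>L.E - {L.idE}. q \<tau>)"
  using q01 by (auto intro!: prod_le_1 prod_nonneg)
 ultimately have qid: "q L.idE \<ge> 1"
  using mult_left_le[of "\<Prod>\<tau>\<in>L.E - {L.idE}. q \<tau>" "q L.idE"] q01[OF L.id_in_E] by linarith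
 have unit: "(R L.idE \<sigma>)\<^sup>2 = 1" if \<sigma>: "\<sigma> : K.E" "V c L.idE \<sigma> ~= 0" for \<sigma>
 proof -
  let ?Y = "{\<sigma> : K.E. V c L.idE \<sigma> ~= 0}"
  have "q L.idE = (R L.idE \<sigma>)\<^sup>2 * (\<Prod>\<sigma>\<in>?Y - {\<sigma>}. (R L.idE \<sigma>)\<^sup>2)"
   unfolding q_def using \<sigma> K.finite_E by (intro prod.remove) auto
  moreover have "(\<Prod>\<sigma>\<in>?Y - {\<sigma>}. (R L.idE \<sigma>)\<^sup>2) <= 1" using R1[OF L.id_in_E] by (intro prod_le_1) auto
  ultimately have "q L.idE <= (R L.idE \<sigma>)\<^sup>2" using mult_left_le[of "\<Prod>\<sigma>\<in>?Y - {\<sigma>}. (R L.idE \<sigma>)\<^sup>2" "(R L.idE \<sigma>)\<^sup>2"] by simp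
  then show ?thesis using qid R1[OF L.id_in_E \<sigma>(1)] by linarith
 qed
 let ?Y = "{\<sigma> : K.E. V c L.idE \<sigma> ~= 0}"
 have "(\<Sum>\<sigma>\<in>K.E. (R L.idE \<sigma>)\<^sup>2) = (\<Sum>\<sigma>\<in>?Y. (R L.idE \<sigma>)\<^sup>2)"
  using VR[OF L.id_in_E] K.finite_E by (intro sum.mono_neutral_right) auto
 also have "... = of_nat (card ?Y)" using unit by simp
 finally have "card ?Y = 1" using sqR[OF L.id_in_E] by simp
 then obtain \<sigma>0 where Y: "?Y = {\<sigma>0}" by (rule card_1_singletonE)
 then have \<sigma>0: "\<sigma>0 : K.E" "V c L.idE \<sigma>0 ~= 0" by blast+
 have pm: "V c L.idE \<sigma>0 = 1 \<or> V c L.idE \<sigma>0 = - 1"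
  using unit[OF \<sigma>0] VR[OF L.id_in_E \<sigma>0(1)] by (auto simp: power2_eq_1_iff)
 show ?thesis
 proof (rule fields_isomorphicI[OF \<sigma>0(1)])
  fix x assume x: "x : K"
  have "(\<Sum>\<sigma>\<in>K.E. V c L.idE \<sigma> * \<sigma> x) = (\<Sum>\<sigma>\<in>K.E. U L.idE \<sigma> * \<sigma> x) + of_rat c * nf_trace K x"
   unfolding V_def nf_trace_def by (simp add: distrib_right sum.distrib sum_distrib_left)
  also have "... = Phi x + of_rat c * nf_trace K x" unfolding U_apply[OF L.id_in_E x] using Phi_L[OF x] by simp
  finally have "(\<Sum>\<sigma>\<in>K.E. V c L.idE \<sigma> * \<sigma> x) = Phi x + of_rat c * nf_trace K x" .
  moreover have "(\<Sum>\<sigma>\<in>K.E. V c L.idE \<sigma> * \<sigma> x) = (\<Sum>\<sigma>\<in>{\<sigma>0}. V c L.idE \<sigma> * \<sigma> x)"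
   using Y K.finite_E by (intro sum.mono_neutral_right) auto
  ultimately have e: "V c L.idE \<sigma>0 * \<sigma>0 x = Phi x + of_rat c * nf_trace K x" by simp
  obtain t where "of_rat c * nf_trace K x = of_rat t" using K.tr_Rats[OF x] by (metis Rats_cases of_rat_mult)
  then have "V c L.idE \<sigma>0 * \<sigma>0 x : L" unfolding e using L.K_closed(3)[OF Phi_L[OF x] L.K_closed(12)] by simp
  then show "\<sigma>0 x : L" using pm L.K_closed(5)[of "- \<sigma>0 x"] by auto
 qed
qed

end

section \<open>The formula for the matrix and the integral case\<close>

text \<open>A finite check. That \<open>u\<^sup>2\<close> is 1 modulo \<open>n\<close> leaves,
  besides 1 and -1, only \<open>u = 3\<close> and \<open>u = - 3\<close> in degree 8; there the
  parity of the cofactor decides.\<close>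

lemma near_unit_square:
 fixes u j :: int and n :: nat
 assumes n: "3 <= n" "n <= 10" and u: "2 * \<bar>u\<bar> <= int n" and eq: "u\<^sup>2 - 1 = int n * (u - 1 + 2 * j)"
 shows "u = 1 \<or> u = - 1"
proof -
 have "n : {3, 4, 5, 6, 7, 8, 9, 10}" using n by auto
 moreover have "- 5 <= u" "u <= 5" using u n by auto
 then have "u : {- 5, - 4, - 3, - 2, - 1, 0, 1, 2, 3, 4, 5}" by (auto simp: int_eq_iff) presburger+
 ultimately show ?thesis using u eq by (elim insertE emptyE; simp; presburger)
qed

context numfield
begin

text \<open>\<open>X - u / n\<close> is the orthogonal projection of \<open>X\<close> to the
  elements of trace zero.\<close>

lemma tr_shift:
 assumes X: "X : K" "tr X = u" "X' : K" "tr X' = v"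
 shows "tr ((X - u / of_nat n) * (X' - v / of_nat n)) = tr (X * X') - u * v / of_nat n"
proof -
 have uv: "u : \<rat>" "v : \<rat>" using tr_Rats X by auto
 then have r: "u / of_nat n : \<rat>" "v / of_nat n : \<rat>" "u / of_nat n * (v / of_nat n) : \<rat>" by auto
 then have rK: "u / of_nat n : K" "v / of_nat n : K" "u / of_nat n * (v / of_nat n) : K"
  using K_closed(12) by (metis Rats_cases)+
 have "(X - u / of_nat n) * (X' - v / of_nat n) =
   (X * X' - v / of_nat n * X) - (u / of_nat n * X' - u / of_nat n * (v / of_nat n))"
  by (simp add: algebra_simps)
 then have "tr ((X - u / of_nat n) * (X' - v / of_nat n)) =
   (tr (X * X') - v / of_nat n * u) - (u / of_nat n * v - u / of_nat n * (v / of_nat n) * of_nat n)"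
  using tr_diff[OF K_closed(7)[OF K_closed(4)[OF X(1,3)] K_closed(4)[OF rK(2) X(1)]] K_closed(7)[OF K_closed(4)[OF rK(1) X(3)] rK(3)]]
   tr_diff[OF K_closed(4)[OF X(1,3)] K_closed(4)[OF rK(2) X(1)]] tr_diff[OF K_closed(4)[OF rK(1) X(3)] rK(3)]
   tr_scale[OF r(2) X(1)] tr_scale[OF r(1) X(3)] tr_of_Rats[OF r(3)] X by metis
 then show ?thesis using n_pos by (simp add: field_simps)
qed

end

context codifferent_isometry
begin

lemma nc: "(of_nat K.n :: complex) ~= 0" using K.n_pos by simp

abbreviation "\<eta> \<equiv> b 0 - 1 / of_nat K.n"

lemma \<eta>: "\<eta> : K" "nf_trace K \<eta> = 0" "Phi (b 0) = Phi \<eta> + 1 / of_nat K.n"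
proof -
 have 1: "1 / of_nat K.n : K" using K.K_closed(8)[OF K.K_closed(2) K.K_closed(10)] .
 note b0 = bK[OF K.n_pos]
 show \<eta>: "\<eta> : K" using K.K_closed(7)[OF b0 1] .
 show "nf_trace K \<eta> = 0" using K.tr_diff[OF b0 1] trb[OF K.n_pos] K.tr_of_Rats[of "1 / of_nat K.n"] nc by simp
 have "Phi (1 / of_nat K.n * 1) = 1 / of_nat K.n * Phi 1" by (rule Phi_scale) (use K.K_closed(2) in auto)
 then show "Phi (b 0) = Phi \<eta> + 1 / of_nat K.n" using Phi_add[OF \<eta> 1] Phi_1 by simp
qed

text \<open>Both \<eta> and \<open>f\<close> pair integrally with the trace zero module, hence so do
  their images. Their multiples by \<open>n\<close> and by \<open>D\<close> are integers of trace
  zero, and integrality of the images of these gives the two divisibility relations.\<close>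

lemma Phi_\<eta>_f:
 "\<exists>u s l. l : L.OK & nf_trace L l = 0 & 2 * \<bar>u\<bar> <= int K.n & Phi \<eta> = of_int u * (y' - 1 / of_nat K.n) + of_int s * f' + l \<and>
  int D dvd int K.n * s"
 "\<exists>v a l \<beta>. l : L.OK & nf_trace L l = 0 & Phi f = of_int v * (y' - 1 / of_nat K.n) + of_int a * f' + l \<and>
  int D * v = int K.n * \<beta>"
proof -
 have tr_int: "nf_trace L (Phi z * w) : \<int>"
  if z: "z : K" "!!x. x : K.OK ==> nf_trace K x = 0 ==> nf_trace K (z * x) : \<int>" and w: "w : L.OK" "nf_trace L w = 0" for z w
 proof -
  obtain x where x: "x : K.OK" "nf_trace K x = 0" "Phi x = w" using Phi_onto[OF w] by blast
  then show ?thesis using tr_Phi[OF z(1) K.O_K[OF x(1)]] z(2)[OF x(1,2)] by simp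
 qed
 have \<eta>x: "nf_trace K (\<eta> * x) : \<int>" if x: "x : K.OK" "nf_trace K x = 0" for x
 proof -
  have "\<eta> * x = b 0 * x - 1 / of_nat K.n * x" by (simp add: algebra_simps)
  then have "nf_trace K (\<eta> * x) = nf_trace K (b 0 * x) - 1 / of_nat K.n * nf_trace K x"
   using K.tr_diff[OF K.K_closed(4)[OF bK[OF K.n_pos] K.O_K[OF x(1)]]
     K.K_closed(4)[OF K.K_closed(8)[OF K.K_closed(2) K.K_closed(10)] K.O_K[OF x(1)]]]
    K.tr_scale[of "1 / of_nat K.n" x] K.O_K[OF x(1)] by simp
  then show ?thesis using x(2) K.tr_Ints[OF K.O_closed(4)[OF bO[OF K.n_pos] x(1)]] by simp
 qed
 have "nf_trace L (Phi \<eta>) = 0" using tr_Phi_0[OF \<eta>(1)] \<eta>(2) by simp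
 then obtain u s l where l: "l : L.OK" "nf_trace L l = 0" and u: "2 * \<bar>u\<bar> <= int K.n"
  and P: "Phi \<eta> = of_int u * (y' - 1 / of_nat K.n) + of_int s * f' + l"
  using CL.trace_zero_dual[OF Phi_L[OF \<eta>(1)]] tr_int[OF \<eta>(1) \<eta>x] deg by metis
 have "int D dvd int K.n * s"
 proof -
  define z where "z = of_nat K.n * b 0 - 1"
  have z: "z : K.OK" unfolding z_def
   by (rule K.O_closed(6)[OF K.O_closed(4)[OF K.O_closed(8) bO[OF K.n_pos]] K.O_closed(2)])
  have z\<eta>: "z = of_nat K.n * \<eta>" unfolding z_def using nc by (simp add: right_diff_distrib)
  then have "nf_trace K z = 0" "Phi z = of_nat K.n * Phi \<eta>"
   using K.tr_scale[OF _ \<eta>(1)] Phi_scale[OF _ \<eta>(1)] \<eta>(2) by auto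
  then have O: "of_nat K.n * Phi \<eta> : L.OK" using Phi_O[OF z] by simp
  \<comment> \<open>Isolates an integral multiple of \<open>f'\<close>. Its pairing with
    \<open>f'\<close> is an integer, and \<mu> is prime to \<open>D\<close>, so \<open>D\<close>
    divides the multiplier.\<close>
  have "of_int (int K.n * s) * f' = of_nat K.n * Phi \<eta> - (of_int u * (of_nat K.n * y' - 1) + of_nat K.n * l)"
   unfolding P using nc by (simp add: algebra_simps)
  also have "... : L.OK"
   by (rule L.O_closed(6)[OF O L.O_closed(3)[OF L.O_closed(4)[OF L.O_closed(7)
    L.O_closed(6)[OF L.O_closed(4)[OF L.O_closed(8) CL.y(1)] L.O_closed(2)]] L.O_closed(4)[OF L.O_closed(8) l(1)]]])
  finally have "of_int (int K.n * s) * f' : L.OK" .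
  then have "nf_trace L (f' * (of_int (int K.n * s) * f')) : \<int>" by (rule L.codiffD[OF CL.f])
  moreover have "nf_trace L (f' * (of_int (int K.n * s) * f')) = of_int (int K.n * s) * nf_trace L (f' * f')"
   using L.tr_scale[of "of_int (int K.n * s)" "f' * f'"] L.K_closed(4)[OF CL.fK CL.fK] by (simp add: ac_simps)
  ultimately obtain t where "of_int (int K.n * s) * (of_int \<mu> / of_nat D) = (of_int t :: complex)"
   unfolding CL.trff by (auto elim: Ints_cases)
  then have "of_int (int K.n * s * \<mu>) = (of_int (int D * t) :: complex)" using CL.Dc by (simp add: field_simps)
  then have e: "int K.n * s * \<mu> = int D * t" by (simp only: of_int_eq_iff)
  have "int K.n * s = int K.n * s * (\<mu> * \<mu>') - int K.n * s * (int D * k1)" unfolding CL.inv by (simp add: algebra_simps)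
  also have "... = int D * (t * \<mu>' - int K.n * s * k1)" using arg_cong[OF e, of "%x. x * \<mu>'"] by (simp add: algebra_simps)
  finally show ?thesis by (metis dvd_triv_left)
 qed
 then show "\<exists>u s l. l : L.OK & nf_trace L l = 0 & 2 * \<bar>u\<bar> <= int K.n \<and>
   Phi \<eta> = of_int u * (y' - 1 / of_nat K.n) + of_int s * f' + l & int D dvd int K.n * s" using l u P by blast
 have fx: "nf_trace K (f * x) : \<int>" if "x : K.OK" "nf_trace K x = 0" for x using K.codiffD[OF CK.f that(1)] .
 have "nf_trace L (Phi f) = 0" using tr_Phi_0[OF CK.fK] CK.trf by simp
 then obtain v a l where l: "l : L.OK" "nf_trace L l = 0" and P: "Phi f = of_int v * (y' - 1 / of_nat K.n) + of_int a * f' + l"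
  using CL.trace_zero_dual[OF Phi_L[OF CK.fK]] tr_int[OF CK.fK fx] deg by metis
 have "nf_trace K (of_nat D * f) = 0" "Phi (of_nat D * f) = of_nat D * Phi f"
  using K.tr_scale[OF _ CK.fK] Phi_scale[OF _ CK.fK] CK.trf by auto
 then have O: "of_nat D * Phi f : L.OK" using Phi_O[OF CK.Df] by simp
 have "of_int (int D * v) / of_int (int K.n) = (of_int (int D * v) * y' + of_int a * (of_nat D * f') + of_nat D * l) - of_nat D * Phi f"
  unfolding P using nc by (simp add: field_simps)
 also have "... : L.OK"
  by (rule L.O_closed(6)[OF L.O_closed(3)[OF L.O_closed(3)[OF L.O_closed(4)[OF L.O_closed(7) CL.y(1)]
   L.O_closed(4)[OF L.O_closed(7) CL.Df]] L.O_closed(4)[OF L.O_closed(8) l(1)]] O])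
 finally have "of_int (int D * v) / of_int (int K.n) : L.OK" .
 then have "of_int (int D * v) / of_int (int K.n) : (\<int> :: complex set)"
  using L.O_iff by (intro rational_algebraic_int_is_int) auto
 then obtain \<beta> where "of_int (int D * v) / of_int (int K.n) = (of_int \<beta> :: complex)" by (elim Ints_cases)
 then have "of_int (int D * v) = (of_int (int K.n * \<beta>) :: complex)" using nc by (simp add: field_simps)
 then have "int D * v = int K.n * \<beta>" by (simp only: of_int_eq_iff)
 then show "\<exists>v a l \<beta>. l : L.OK & nf_trace L l = 0 & Phi f = of_int v * (y' - 1 / of_nat K.n) + of_int a * f' + l \<and>
  int D * v = int K.n * \<beta>" using l P by blast
qed

lemma f_emb: assumes "\<sigma> : K.E" "\<tau> : L.E"
 shows "of_nat D * (\<sigma> f * \<sigma> f) = \<sigma> (of_nat D * (f * f))" "of_nat D * (\<tau> f' * \<tau> f') = \<tau> (of_nat D * (f' * f'))"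
  "of_nat D * \<sigma> f = \<sigma> (of_nat D * f)" "of_nat D * \<tau> f' = \<tau> (of_nat D * f')"
 using K.E(2)[OF assms(1) K.K_closed(10) K.K_closed(4)[OF CK.fK CK.fK]] K.E(2)[OF assms(1) CK.fK CK.fK]
  L.E(2)[OF assms(2) L.K_closed(10) L.K_closed(4)[OF CL.fK CL.fK]] L.E(2)[OF assms(2) CL.fK CL.fK]
  K.E(2)[OF assms(1) K.K_closed(10) CK.fK] L.E(2)[OF assms(2) L.K_closed(10) CL.fK] K.E(8)[OF assms(1)] L.E(8)[OF assms(2)]
 by metis+

text \<open>Up to algebraic integers, the shifted matrix of the isometry is a sum of a function of the row and a
 function of the column.\<close>
lemma V_formula:
 assumes l: "l : L.OK" and P: "Phi \<eta> = of_int u * (y' - 1 / of_nat K.n) + of_int s * f' + l"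
  and l': "l' : L.OK" and P': "Phi f = of_int v * (y' - 1 / of_nat K.n) + of_int a * f' + l'"
  and \<beta>: "int D * v = int K.n * \<beta>" and \<tau>: "\<tau> : L.E" and \<sigma>: "\<sigma> : K.E"
 shows "algebraic_int (V (of_int (u - 1) / of_nat K.n) \<tau> \<sigma> - (of_int s * \<tau> f' - of_int (\<rho>' * \<beta>) * \<sigma> f))"
proof -
 let ?N = "of_nat K.n :: complex"
 have aL: "algebraic_int (\<tau> z)" if "z : L.OK" for z using L.emb_algebraic_int[OF \<tau> that] .
 have aK: "algebraic_int (\<sigma> z)" if "z : K.OK" for z using K.emb_algebraic_int[OF \<sigma> that] .
 obtain w where w: "\<forall>i<K.n. w i : K.OK & b' i = w i + of_int \<rho>' * of_nat D * nf_trace K (b' i * f) * f"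
  using CK.dual_split[OF db b'c] by blast
 have N0: "0 < K.n" by (rule K.n_pos)
 \<comment> \<open>The traces of \<open>b\<close> are 1, 0, ..., 0, so \<open>b'\<close> starts with
   1 and so does its integral part. Hence the image of \<open>b 0\<close>, the only one that need
   not be integral, enters with coefficient exactly 1.\<close>
 have b'0: "b' 0 = 1"
 proof -
  have "1 = (\<Sum>i<K.n. nf_trace K (b i) * b' i)" using K.dual_expand[OF K.dual_sym[OF db] K.K_closed(2)] by simp
  also have "... = (\<Sum>i<K.n. if i = 0 then b' 0 else 0)" using trb by (intro sum.cong) auto
  finally show ?thesis using N0 by simp
 qed
 then have w0: "w 0 = 1" using w[rule_format, OF N0] CK.trf by simp
 have Pf: "(\<Sum>i<K.n. \<tau> (Phi (b i)) * nf_trace K (b' i * f)) = \<tau> (Phi f)"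
  unfolding Phi_expand[OF \<tau> CK.fK] by (intro sum.cong refl) (simp add: mult.commute)
 define S where "S = (\<Sum>i\<in>{1..<K.n}. \<tau> (Phi (b i)) * \<sigma> (w i))"
 have "(\<Sum>i<K.n. \<tau> (Phi (b i)) * \<sigma> (w i)) = \<tau> (Phi (b 0)) + S"
 proof -
  have "{..<K.n} = insert 0 {1..<K.n}" using N0 by auto
  then show ?thesis unfolding S_def using w0 K.E(3)[OF \<sigma>] by simp
 qed
 then have U: "U \<tau> \<sigma> = \<tau> (Phi (b 0)) + S + of_int \<rho>' * of_nat D * \<sigma> f * \<tau> (Phi f)"
  unfolding U_def CK.dual_split_sum[OF w b'c \<sigma>] Pf by simp
 have lc: "\<tau> (of_int i * (y' - 1 / ?N) + of_int j * f' + z + of_rat r) = of_int i * (\<tau> y' - 1 / ?N) + of_int j * \<tau> f' + \<tau> z + of_rat r"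
  if z: "z : L" for i j z r
 proof -
  have "1 / ?N = of_rat (1 / of_nat K.n)" by (simp add: of_rat_divide)
  then show ?thesis using CL.yK CL.fK z by (simp add: L.E[OF \<tau>] L.K_closed)
 qed
 have "1 / ?N = of_rat (1 / of_nat K.n)" by (simp add: of_rat_divide)
 then have e1: "\<tau> (Phi (b 0)) = of_int u * (\<tau> y' - 1 / ?N) + of_int s * \<tau> f' + \<tau> l + 1 / ?N"
  unfolding \<eta>(3) P using lc[OF L.O_K[OF l], of u s "1 / of_nat K.n"] by simp
 have e2: "\<tau> (Phi f) = of_int v * (\<tau> y' - 1 / ?N) + of_int a * \<tau> f' + \<tau> l'"
  unfolding P' using lc[OF L.O_K[OF l'], of v a 0] by simp
 have "(of_int (int D * v) :: complex) = of_int (int K.n * \<beta>)" using \<beta> by simp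
 then have \<beta>': "of_nat D * of_int v / ?N = of_int \<beta>" using nc by simp
 \<comment> \<open>The factor \<open>D\<close> absorbs the two poles of half order; integrality is
   seen on the square.\<close>
 define W where "W = of_nat D * \<sigma> f * \<tau> f'"
 have W: "algebraic_int W"
 proof (rule algebraic_int_power_imp)
  have "W ^ 2 = (of_nat D * (\<sigma> f * \<sigma> f)) * (of_nat D * (\<tau> f' * \<tau> f'))" unfolding W_def by (simp add: power2_eq_square)
  also have "algebraic_int ..."
   unfolding f_emb(1,2)[OF \<sigma> \<tau>] by (rule algebraic_int_add_mult(2)[OF aK[OF CK.Dff] aL[OF CL.Dff]])
  finally show "algebraic_int (W ^ 2)" .
 qed simp
 have "algebraic_int S" unfolding S_def
 proof (rule algebraic_int_sum)
  fix i assume "i : {1..<K.n}"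
  then have i: "i < K.n" "i ~= 0" by auto
  have "Phi (b i) : L.OK" using Phi_O[OF bO[OF i(1)]] trb[OF i(1)] i(2) by simp
  then show "algebraic_int (\<tau> (Phi (b i)) * \<sigma> (w i))" using w i(1) by (intro algebraic_int_add_mult(2) aL aK) auto
 qed
 then have "algebraic_int (S + of_int u * \<tau> y' + \<tau> l + of_int \<rho>' * (\<sigma> (of_nat D * f) * (of_int v * \<tau> y' + \<tau> l') + of_int a * W))"
  using aL[OF CL.y(1)] aL[OF l] aL[OF l'] aK[OF CK.Df] W
  by (intro algebraic_int_add_mult algebraic_int_of_int_complex)
 also have "S + of_int u * \<tau> y' + \<tau> l + of_int \<rho>' * (\<sigma> (of_nat D * f) * (of_int v * \<tau> y' + \<tau> l') + of_int a * W) =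
   V (of_int (u - 1) / of_nat K.n) \<tau> \<sigma> - (of_int s * \<tau> f' - of_int (\<rho>' * \<beta>) * \<sigma> f)"
  unfolding V_def U e1 e2 f_emb(3)[OF \<sigma> \<tau>, symmetric] W_def of_int_mult \<beta>'[symmetric]
  by (simp add: of_rat_divide of_rat_diff algebra_simps diff_divide_distrib)
 finally show ?thesis .
qed

lemma row_squares': assumes "\<tau> : L.E"
 shows "of_nat K.n * (\<Sum>\<sigma>\<in>K.E. (V (of_int (u - 1) / of_nat K.n) \<tau> \<sigma>)\<^sup>2) = of_nat K.n - 1 + (of_int u)\<^sup>2"
 unfolding row_squares[OF assms] using nc
 by (simp add: of_rat_divide of_rat_diff power2_eq_square field_simps)

text \<open>As \<open>D\<close> divides \<open>s\<close>, the image of \<eta> is the projection of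
  an integer \<open>X\<close> of trace \<open>u\<close>. Comparing norms gives the equation of
  \<open>near_unit_square\<close>, so \<open>u\<close> is 1 or -1. The pairing of
  \<open>Phi \<eta>\<close> with \<open>Phi f\<close> then shows that \<open>n\<close> divides
  \<open>v\<close>; so \<open>D\<close> divides \<beta>, the correction is integral, and the squares
  in each row sum to 1.\<close>

lemma unmixed_case:
 assumes n: "3 <= K.n" "K.n <= 10" and l: "l : L.OK" "nf_trace L l = 0" and u: "2 * \<bar>u\<bar> <= int K.n"
  and P: "Phi \<eta> = of_int u * (y' - 1 / of_nat K.n) + of_int s * f' + l" and s: "int D dvd s"
  and l': "l' : L.OK" "nf_trace L l' = 0" and P': "Phi f = of_int v * (y' - 1 / of_nat K.n) + of_int a * f' + l'"
  and \<beta>: "int D * v = int K.n * \<beta>"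
 shows "fields_isomorphic K L"
proof -
 let ?N = "of_nat K.n :: complex"
 obtain s1 where s1: "s = int D * s1" using s by auto
 define X where "X = of_int u * y' + (of_int s1 * (of_nat D * f') + l)"
 define X' where "X' = of_int v * y' + l'"
 have l1: "of_int s1 * (of_nat D * f') + l : L.OK" by (rule L.O_closed(3)[OF L.O_closed(4)[OF L.O_closed(7) CL.Df] l(1)])
 have X: "X : L.OK" unfolding X_def by (rule L.O_closed(3)[OF L.O_closed(4)[OF L.O_closed(7) CL.y(1)] l1])
 have X': "X' : L.OK" unfolding X'_def by (rule L.O_closed(3)[OF L.O_closed(4)[OF L.O_closed(7) CL.y(1)] l'(1)])
 note XL = L.O_K[OF X] L.O_K[OF X']
 have trX: "nf_trace L X = of_int u"
  unfolding X_def using CL.yK CL.fK L.O_K[OF l(1)] L.K_closed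
  by (simp add: L.tr_add L.tr_scale CL.y l CL.trf)
 have trX': "nf_trace L X' = of_int v"
  unfolding X'_def using CL.yK L.O_K[OF l'(1)] L.K_closed by (simp add: L.tr_add L.tr_scale CL.y l')
 have PX: "Phi \<eta> = X - of_int u / of_nat L.n" unfolding P X_def s1 deg[symmetric] by (simp add: algebra_simps)
 have PX': "Phi f = (X' - of_int v / of_nat L.n) + of_int a * f'" unfolding P' X'_def deg[symmetric] by (simp add: algebra_simps)
 have b0: "b 0 : K.OK" "b 0 : K" "nf_trace K (b 0) = 1" using bO bK trb K.n_pos by auto
 have sq: "nf_trace L (X * X) - of_int u * of_int u / ?N = nf_trace K (b 0 * b 0) - 1 * 1 / ?N"
  using tr_Phi[OF \<eta>(1) \<eta>(1), unfolded PX] L.tr_shift[OF XL(1) trX XL(1) trX] K.tr_shift[OF b0(2,3) b0(2,3)]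
  by (simp add: deg)
 obtain j1 where j1: "nf_trace L (X * X) = nf_trace L X + of_int (2 * j1)" using L.tr_square_parity[OF X] by blast
 obtain j2 where j2: "nf_trace K (b 0 * b 0) = nf_trace K (b 0) + of_int (2 * j2)" using K.tr_square_parity[OF b0(1)] by blast
 have "of_int (u\<^sup>2 - 1) = (of_int (int K.n * (u - 1 + 2 * (j1 - j2))) :: complex)"
  using sq nc unfolding j1 j2 trX b0(3) by (simp add: power2_eq_square field_simps)
 then have "u\<^sup>2 - 1 = int K.n * (u - 1 + 2 * (j1 - j2))" by (simp only: of_int_eq_iff)
 then have u1: "u = 1 \<or> u = - 1" by (rule near_unit_square[OF n u])
 have "int K.n dvd v"
 proof -
  have Pf: "Phi \<eta> * Phi f = Phi \<eta> * (X' - of_int v / of_nat L.n) + of_int a * (X * f' - of_int u / of_nat L.n * f')"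
   unfolding PX PX' by (simp add: algebra_simps add_divide_distrib)
  have vL: "X' - of_int v / of_nat L.n : L" using XL L.K_closed by simp
  have Xf: "X * f' : L" "of_int u / of_nat L.n * f' : L" using XL CL.fK L.K_closed by simp_all
  have "nf_trace L (Phi \<eta> * Phi f) = nf_trace L (Phi \<eta> * (X' - of_int v / of_nat L.n)) +
    of_int a * (nf_trace L (X * f') - of_int u / of_nat L.n * nf_trace L f')"
   unfolding Pf using L.tr_add[OF L.K_closed(4)[OF Phi_L[OF \<eta>(1)] vL] L.K_closed(4)[OF L.K_closed(11) L.K_closed(7)[OF Xf]]]
    L.tr_scale[OF Rats_of_int L.K_closed(7)[OF Xf]] L.tr_diff[OF Xf] L.tr_scale[of "of_int u / of_nat L.n" f'] CL.fK by simp
  also have "nf_trace L (Phi \<eta> * (X' - of_int v / of_nat L.n)) = nf_trace L (X * X') - of_int u * of_int v / of_nat L.n"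
   unfolding PX by (rule L.tr_shift[OF XL(1) trX XL(2) trX'])
  finally have 1: "nf_trace L (Phi \<eta> * Phi f) = nf_trace L (X * X') - of_int u * of_int v / ?N + of_int a * nf_trace L (X * f')"
   unfolding CL.trf deg by simp
  have fb: "\<eta> * f = f * b 0 - 1 / ?N * f" by (simp add: algebra_simps)
  have "nf_trace K (\<eta> * f) = nf_trace K (f * b 0) - 1 / ?N * nf_trace K f"
   unfolding fb using K.tr_diff[OF K.K_closed(4)[OF CK.fK b0(2)] K.K_closed(4)[OF K.K_closed(8)[OF K.K_closed(2) K.K_closed(10)] CK.fK]]
    K.tr_scale[of "1 / ?N" f] CK.fK by simp
  then have 2: "nf_trace L (Phi \<eta> * Phi f) = nf_trace K (f * b 0)" using tr_Phi[OF \<eta>(1) CK.fK] CK.trf by simp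
  obtain i1 where i1: "nf_trace L (X * X') = of_int i1" using L.tr_int[OF L.O_closed(4)[OF X X']] .
  obtain i2 where i2: "nf_trace L (X * f') = of_int i2" using L.codiffD[OF CL.f X] by (auto simp: mult.commute elim: Ints_cases)
  obtain i3 where i3: "nf_trace K (f * b 0) = of_int i3" using K.codiffD[OF CK.f b0(1)] by (auto elim: Ints_cases)
  have "of_int (u * v) = (of_int (int K.n * (i1 + a * i2 - i3)) :: complex)"
   using 1 2 nc unfolding i1 i2 i3 by (simp add: field_simps)
  then have "u * v = int K.n * (i1 + a * i2 - i3)" by (simp only: of_int_eq_iff)
  then show ?thesis using u1 by (metis dvd_minus_iff dvd_triv_left mult_1 mult_minus1)
 qed
 then obtain v1 where v1: "v = int K.n * v1" by auto
 then have \<beta>1: "\<beta> = int D * v1" using \<beta> K.n_pos by simp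
 show ?thesis
 proof (rule integral_orthogonal_isomorphic)
  fix \<tau> \<sigma> assume \<tau>: "\<tau> : L.E" and \<sigma>: "\<sigma> : K.E"
  have "algebraic_int (V (of_int (u - 1) / of_nat K.n) \<tau> \<sigma> - (of_int s * \<tau> f' - of_int (\<rho>' * \<beta>) * \<sigma> f) +
    (of_int s1 * \<tau> (of_nat D * f') - of_int (\<rho>' * v1) * \<sigma> (of_nat D * f)))"
   by (rule algebraic_int_add_mult(1)[OF V_formula[OF l(1) P l'(1) P' \<beta> \<tau> \<sigma>] algebraic_int_diff[OF
    algebraic_int_add_mult(2)[OF algebraic_int_of_int_complex L.emb_algebraic_int[OF \<tau> CL.Df]]
    algebraic_int_add_mult(2)[OF algebraic_int_of_int_complex K.emb_algebraic_int[OF \<sigma> CK.Df]]]])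
  also have "V (of_int (u - 1) / of_nat K.n) \<tau> \<sigma> - (of_int s * \<tau> f' - of_int (\<rho>' * \<beta>) * \<sigma> f) +
    (of_int s1 * \<tau> (of_nat D * f') - of_int (\<rho>' * v1) * \<sigma> (of_nat D * f)) = V (of_int (u - 1) / of_nat K.n) \<tau> \<sigma>"
   unfolding f_emb(3,4)[OF \<sigma> \<tau>, symmetric] s1 \<beta>1 by (simp add: algebra_simps)
  finally show "algebraic_int (V (of_int (u - 1) / of_nat K.n) \<tau> \<sigma>)" .
 next
  fix \<tau> assume \<tau>: "\<tau> : L.E"
  have "(of_int u)\<^sup>2 = (1 :: complex)" using u1 by auto
  then show "(\<Sum>\<sigma>\<in>K.E. (V (of_int (u - 1) / of_nat K.n) \<tau> \<sigma>)\<^sup>2) = 1" using row_squares'[OF \<tau>, of u] nc by simp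
 qed
qed

end

section \<open>The case of a prime dividing degree and discriminant\<close>

text \<open>At most \<open>n\<^sup>2 - (n - 2)\<^sup>2\<close> squared entries have \<open>p\<close>
  in their denominator, and \<open>(n - 1 + u\<^sup>2) / n\<^sup>2\<close> is the mean of all
  squared entries; the inequality pushes their product times its denominator below 1. The left side
  grows with \<open>u\<close>, so only the value \<open>n div 2\<close> is computed.\<close>

lemma exponent_bound:
 fixes n p u :: nat
 assumes "(n, p) : {(3, 3), (5, 5), (6, 3), (7, 7), (9, 3), (10, 5)}" and u: "2 * u <= n"
 shows "p ^ (n\<^sup>2 - (n - 2)\<^sup>2) * (n - 1 + u\<^sup>2) ^ n\<^sup>2 < (n\<^sup>2) ^ n\<^sup>2"
proof -
 define k where "k = n div 2"
 have "u <= k" unfolding k_def using u by simp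
 then have "u\<^sup>2 <= k\<^sup>2" by (rule power_mono) simp
 then have "p ^ (n\<^sup>2 - (n - 2)\<^sup>2) * (n - 1 + u\<^sup>2) ^ n\<^sup>2 <= p ^ (n\<^sup>2 - (n - 2)\<^sup>2) * (n - 1 + k\<^sup>2) ^ n\<^sup>2"
  by (intro mult_left_mono power_mono) auto
 also have "... < (n\<^sup>2) ^ n\<^sup>2" using assms(1) unfolding k_def by (auto simp: power2_eq_square)
 finally show ?thesis .
qed

text \<open>The second conclusion serves to show that a number prime to \<open>2 * p\<close> is
  prime to \<open>n\<close>.\<close>

lemma degree_prime_cases:
 fixes n p :: nat
 assumes "3 <= n" "n <= 10" "prime p" "odd p" "p dvd n"
 shows "(n, p) : {(3, 3), (5, 5), (6, 3), (7, 7), (9, 3), (10, 5)}" "n dvd (2 * p)\<^sup>2"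
proof -
 have "p <= 10" using assms by (auto dest: dvd_imp_le)
 moreover have "p > 1" using assms(3) by (rule prime_gt_1_nat)
 ultimately have "p : {2, 3, 4, 5, 6, 7, 8, 9, 10}" by auto
 moreover have "p ~= 9"
 proof
  assume "p = 9"
  then have "(3::nat) dvd p" by simp
  then have "(3::nat) = 1 \<or> 3 = p" using assms(3) unfolding prime_nat_iff by blast
  then show False using \<open>p = 9\<close> by simp
 qed
 ultimately have p: "p : {3, 5, 7}" using assms(4) by auto
 have "n : {3, 4, 5, 6, 7, 8, 9, 10}" using assms by auto
 then show "(n, p) : {(3, 3), (5, 5), (6, 3), (7, 7), (9, 3), (10, 5)}" using p assms(5) by auto
 then show "n dvd (2 * p)\<^sup>2" by auto
qed

context codifferent_isometry
begin

text \<open>Squaring reduces this to the integrality of \<open>D * (f * f)\<close>: the poles at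
  \<open>p\<close> have order one half.\<close>

lemma sqrt_multiple_integral:
 assumes r: "r * r = of_nat p" and D': "D = p * D'" and \<tau>: "\<tau> : L.E" and \<sigma>: "\<sigma> : K.E"
 shows "algebraic_int (r * (of_nat D' * \<sigma> f))" "algebraic_int (r * (of_nat D' * \<tau> f'))"
proof -
 have e: "(r * (of_nat D' * z)) ^ 2 = of_nat D' * (of_nat D * (z * z))" for z
  unfolding D' of_nat_mult r[symmetric] by (simp add: power2_eq_square ac_simps)
 have 1: "algebraic_int (of_nat D' * \<sigma> (of_nat D * (f * f)))" "algebraic_int (of_nat D' * \<tau> (of_nat D * (f' * f')))"
  by (intro algebraic_int_add_mult algebraic_int_of_nat K.emb_algebraic_int[OF \<sigma> CK.Dff] L.emb_algebraic_int[OF \<tau> CL.Dff])+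
 show "algebraic_int (r * (of_nat D' * \<sigma> f))"
  by (rule algebraic_int_power_imp[of _ 2]) (use 1 in \<open>simp_all only: e f_emb(1,2)[OF \<sigma> \<tau>] zero_less_numeral\<close>)
 show "algebraic_int (r * (of_nat D' * \<tau> f'))"
  by (rule algebraic_int_power_imp[of _ 2]) (use 1 in \<open>simp_all only: e f_emb(1,2)[OF \<sigma> \<tau>] zero_less_numeral\<close>)
qed

text \<open>If no entry vanished, the product of all entries would have a \<open>p\<close>-adic denominator too small for the
 bound which the arithmetic-geometric mean inequality imposes on its size. So every row has a zero, and the rows
 belonging to the poles of \<open>f'\<close> show that it is unique.\<close>
lemma mixed_case:
 assumes n: "3 <= K.n" "K.n <= 10" and oddD: "odd D" and sqD: "!!q. prime q ==> \<not> q\<^sup>2 dvd D"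
  and l: "l : L.OK" and u: "2 * \<bar>u\<bar> <= int K.n"
  and P: "Phi \<eta> = of_int u * (y' - 1 / of_nat K.n) + of_int s * f' + l"
  and Dns: "int D dvd int K.n * s" and s: "\<not> int D dvd s"
  and l': "l' : L.OK" and P': "Phi f = of_int v * (y' - 1 / of_nat K.n) + of_int a * f' + l'"
  and \<beta>: "int D * v = int K.n * \<beta>"
 shows "fields_isomorphic K L"
proof -
 obtain p where p: "prime p" "p dvd D" "\<not> int p dvd s" "p dvd K.n"
 proof -
  \<comment> \<open>A prime of \<open>D / g\<close> does not divide \<open>s\<close>: it is prime to
    \<open>s / g\<close>, and to \<open>g\<close> because \<open>D\<close> is squarefree. Since
    \<open>D\<close> divides \<open>n * s\<close>, it divides the degree.\<close>
  define g where "g = gcd (int D) s"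
  obtain D1 where D1: "int D = g * D1" unfolding g_def by (meson dvd_def gcd_dvd1)
  obtain s1 where s1: "s = g * s1" unfolding g_def by (meson dvd_def gcd_dvd2)
  have g0: "g > 0" unfolding g_def using CK.D by simp
  have cop: "coprime D1 s1"
   using gcd_mult_distrib_int[of g D1 s1] D1 s1 g0 unfolding g_def
   by (metis abs_of_pos coprime_iff_gcd_eq_1 less_irrefl mult_cancel_left2)
  have D1p: "D1 > 0" using D1 g0 CK.D by (metis of_nat_0_less_iff zero_less_mult_pos)
  have "D1 ~= 1" using s D1 s1 by auto
  then have "nat D1 ~= 1" using D1p by linarith
  then obtain p where p: "prime p" "p dvd nat D1" using prime_factor_nat by blast
  have "int p dvd int (nat D1)" using p(2) by (simp only: int_dvd_int_iff)
  then have pD1: "int p dvd D1" using D1p by simp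
  have pD: "p dvd D" using pD1 D1 by (metis dvd_mult int_dvd_int_iff)
  have "\<not> int p dvd g"
  proof
   assume "int p dvd g"
   then have "int p * int p dvd int D" using pD1 D1 by (metis mult_dvd_mono)
   then have "p\<^sup>2 dvd D" by (metis int_dvd_int_iff of_nat_mult power2_eq_square)
   then show False using sqD p(1) by blast
  qed
  moreover have "\<not> int p dvd s1"
   using cop pD1 p(1) by (metis coprime_common_divisor not_prime_unit prime_nat_int_transfer)
  moreover have pp: "prime (int p)" using p(1) by simp
  ultimately have ns: "\<not> int p dvd s" unfolding s1 by (simp add: prime_dvd_mult_iff)
  have "int p dvd int K.n * s" using Dns pD by (meson dvd_trans int_dvd_int_iff)
  then have "p dvd K.n" using ns pp by (simp add: prime_dvd_mult_iff)
  then show ?thesis using that p(1) pD ns by blast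
 qed
 obtain D' where D': "D = p * D'" using p(2) by auto
 have podd: "odd p" using oddD D' by auto
 have pD': "\<not> p dvd D'" using sqD[OF p(1)] unfolding D' by (auto simp: power2_eq_square)
 note np = degree_prime_cases[OF n p(1) podd p(4)]
 have "coprime D' p" using prime_imp_coprime[OF p(1) pD'] by (simp add: coprime_commute)
 then have "coprime D' (2 * p)" using oddD D' by simp
 then have "coprime D' ((2 * p)\<^sup>2)" unfolding power2_eq_square by (simp only: coprime_mult_right_iff)
 then have "coprime D' K.n" using np(2) by (metis coprime_divisors dvd_refl)
 then have cop: "coprime (int D') (int K.n)" by simp
 \<comment> \<open>As \<open>D'\<close> is prime to \<open>n\<close>, it divides \<open>s\<close>
   and \<beta>; so away from \<open>p\<close> the correction is integral.\<close>
 have "int D' dvd int K.n * s" using Dns unfolding D' by (metis dvd_mult_right of_nat_mult)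
 then obtain s1 where s1: "s = int D' * s1" using cop coprime_dvd_mult_right_iff by (metis dvd_def)
 have "int D' dvd int K.n * \<beta>" unfolding \<beta>[symmetric] D' by simp
 then obtain \<beta>1 where \<beta>1: "\<beta> = int D' * \<beta>1" using cop coprime_dvd_mult_right_iff by (metis dvd_def)
 define c where "c = (of_int (u - 1) / of_nat K.n :: rat)"
 note F = V_formula[OF l P l' P' \<beta>, folded c_def]
 obtain A where plA: "place p A" by (rule subring_exists_place[OF p(1)])
 interpret pl: place p A by fact
 obtain \<sigma>1 \<sigma>2 where \<sigma>: "\<sigma>1 : K.E" "\<sigma>2 : K.E" "\<sigma>1 ~= \<sigma>2" "\<sigma>1 f + \<sigma>2 f : A" "\<forall>\<sigma>\<in>K.E - {\<sigma>1, \<sigma>2}. \<sigma> f : A"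
  using CK.two_poles[OF plA p(1) D' pD' podd] by blast
 obtain \<tau>1 \<tau>2 where \<tau>: "\<tau>1 : L.E" "\<tau>2 : L.E" "\<tau>1 ~= \<tau>2" "\<tau>1 f' ~: A" "\<forall>\<tau>\<in>L.E - {\<tau>1, \<tau>2}. \<tau> f' : A"
  using CL.two_poles[OF plA p(1) D' pD' podd] by blast
 have unit: "z : A" if "of_int i * z : A" "\<not> int p dvd i" for i z
 proof -
  have i: "of_int i ~= (0::complex)" "inverse (of_int i) : A"
   using pl.unit_inverse[of "of_int i"] pl.A_of_int[of i] pl.M_of_int[of i] that(2) by auto
  have "inverse (of_int i) * (of_int i * z) : A" by (rule pl.A_mult[OF i(2) that(1)])
  then show ?thesis using i(1) by (simp add: mult.assoc[symmetric])
 qed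
 have good: "V c \<tau> \<sigma> - (of_int s * \<tau> f' - of_int (\<rho>' * \<beta>) * \<sigma> f) : A" if "\<tau> : L.E" "\<sigma> : K.E" for \<tau> \<sigma>
  by (rule pl.A_algebraic_int[OF F[OF that]])
 obtain \<kappa> where \<kappa>1: "\<kappa> : L" "\<kappa> ~= 0" "\<forall>\<tau>\<in>L.E. card (zeros c \<tau>) = card (zeros c L.idE) \<and>
  \<tau> \<kappa> = (\<Prod>\<sigma>\<in>{\<sigma> : K.E. V c \<tau> \<sigma> ~= 0}. V c \<tau> \<sigma>)" using row_zeros[of c] by blast
 then have \<kappa>: "\<kappa> : L" "!!\<tau>. \<tau> : L.E ==> card (zeros c \<tau>) = card (zeros c L.idE)"
  "!!\<tau>. \<tau> : L.E ==> \<tau> \<kappa> = (\<Prod>\<sigma>\<in>{\<sigma> : K.E. V c \<tau> \<sigma> ~= 0}. V c \<tau> \<sigma>)"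
  by simp_all
 define z where "z = card (zeros c L.idE)"
 note \<kappa>2 = \<kappa>(2)[folded z_def]
 \<comment> \<open>A zero in the row of the pole \<tau>1 requires a pole of \<open>f\<close> at
   \<sigma> to cancel the pole of \<open>f'\<close>.\<close>
 have V0: "of_int s * \<tau>1 f' - of_int (\<rho>' * \<beta>) * \<sigma> f : A" if "\<sigma> : zeros c \<tau>1" for \<sigma>
  using good[OF \<tau>(1), of \<sigma>] that pl.A_minus by fastforce
 have zA: "\<sigma> : {\<sigma>1, \<sigma>2}" if z: "\<sigma> : zeros c \<tau>1" for \<sigma>
 proof (rule ccontr)
  assume "\<sigma> ~: {\<sigma>1, \<sigma>2}"
  then have "\<sigma> f : A" using \<sigma>(5) z by blast
  from pl.A_add[OF V0[OF z] pl.A_mult[OF pl.A_of_int[of "\<rho>' * \<beta>"] this]]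
  have "of_int s * \<tau>1 f' : A" by (simp only: diff_add_cancel)
  then show False using unit p(3) \<tau>(4) by blast
 qed
 \<comment> \<open>Not both entries vanish: in their sum the poles of \<open>f\<close> at \<sigma>1
   and \<sigma>2 cancel, whereas the pole of \<open>f'\<close> is multiplied by
   \<open>2 * s\<close>, which is prime to \<open>p\<close>.\<close>
 have "\<not> (\<sigma>1 : zeros c \<tau>1 & \<sigma>2 : zeros c \<tau>1)"
 proof
  assume z: "\<sigma>1 : zeros c \<tau>1 & \<sigma>2 : zeros c \<tau>1"
  have "(of_int s * \<tau>1 f' - of_int (\<rho>' * \<beta>) * \<sigma>1 f) + (of_int s * \<tau>1 f' - of_int (\<rho>' * \<beta>) * \<sigma>2 f) +
    of_int (\<rho>' * \<beta>) * (\<sigma>1 f + \<sigma>2 f) : A"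
   using z by (intro pl.A_add pl.A_mult[OF pl.A_of_int \<sigma>(4)] V0) auto
  then have "of_int (2 * s) * \<tau>1 f' : A" by (simp add: algebra_simps)
  moreover have "\<not> int p dvd 2 * s"
  proof
   assume "int p dvd 2 * s"
   then have "int p dvd int 2" using p(1,3) by (simp add: prime_dvd_mult_iff)
   then have "p dvd 2" by (simp only: int_dvd_int_iff)
   from primes_dvd_imp_eq[OF p(1) two_is_prime_nat this] show False using podd by simp
  qed
  ultimately show False using unit \<tau>(4) by blast
 qed
 then have "zeros c \<tau>1 \<subseteq> {\<sigma>1} \<or> zeros c \<tau>1 \<subseteq> {\<sigma>2}" using zA by blast
 then have "card (zeros c \<tau>1) <= 1"
 proof
  assume "zeros c \<tau>1 \<subseteq> {\<sigma>1}"
  then have "card (zeros c \<tau>1) <= card {\<sigma>1}" by (intro card_mono) auto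
  then show ?thesis by simp
 next
  assume "zeros c \<tau>1 \<subseteq> {\<sigma>2}"
  then have "card (zeros c \<tau>1) <= card {\<sigma>2}" by (intro card_mono) auto
  then show ?thesis by simp
 qed
 then have z1: "z <= 1" using \<kappa>2[OF \<tau>(1)] by simp
 show ?thesis
 proof (cases "z = 1")
  case True
  then show ?thesis using single_zero_isomorphic[of c] unfolding z_def by blast
 next
  case False
  then have "z = 0" using z1 by simp
  then have "zeros c \<tau> = {}" if "\<tau> : L.E" for \<tau> using \<kappa>2[OF that] K.finite_E by simp
  then have nz: "V c \<tau> \<sigma> ~= 0" if "\<tau> : L.E" "\<sigma> : K.E" for \<tau> \<sigma> using that by blast
  define I where "I = L.E \<times> K.E"
  have finI: "finite I" "card I = K.n\<^sup>2"
   unfolding I_def using K.finite_E L.finite_E K.card_E L.card_E deg by (auto simp: power2_eq_square)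
  define N where "N = (\<Prod>(\<tau>, \<sigma>)\<in>I. V c \<tau> \<sigma>)"
  have N\<kappa>: "N = (\<Prod>\<tau>\<in>L.E. \<tau> \<kappa>)"
  proof -
   have "\<tau> \<kappa> = (\<Prod>\<sigma>\<in>K.E. V c \<tau> \<sigma>)" if t: "\<tau> : L.E" for \<tau>
   proof -
    have "{\<sigma> : K.E. V c \<tau> \<sigma> ~= 0} = K.E" using nz[OF t] by blast
    then show ?thesis using \<kappa>(3)[OF t] by simp
   qed
   then show ?thesis unfolding N_def I_def prod.cartesian_product[symmetric] by (intro prod.cong refl) simp
  qed
  then have NQ: "N : \<rat>" using L.norm_Rats[OF \<kappa>(1)] by simp
  define r where "r = csqrt (of_nat p)"
  have r2: "r * r = of_nat p" unfolding r_def by (metis power2_csqrt power2_eq_square)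
  have rV: "algebraic_int (r * V c \<tau> \<sigma>)" if ts: "\<tau> : L.E" "\<sigma> : K.E" for \<tau> \<sigma>
  proof -
   have "r ^ 2 = of_nat p" using r2 by (simp add: power2_eq_square)
   then have "algebraic_int (r ^ 2)" by simp
   then have r: "algebraic_int r" by (rule algebraic_int_power_imp) simp
   have "r * V c \<tau> \<sigma> = r * (V c \<tau> \<sigma> - (of_int s * \<tau> f' - of_int (\<rho>' * \<beta>) * \<sigma> f)) +
     (of_int s1 * (r * (of_nat D' * \<tau> f')) - of_int (\<rho>' * \<beta>1) * (r * (of_nat D' * \<sigma> f)))"
    unfolding s1 \<beta>1 by (simp add: algebra_simps)
   also have "algebraic_int ..."
    by (rule algebraic_int_add_mult(1)[OF algebraic_int_add_mult(2)[OF r F[OF ts]] algebraic_int_diff[OF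
     algebraic_int_add_mult(2)[OF algebraic_int_of_int_complex sqrt_multiple_integral(2)[OF r2 D' ts]]
     algebraic_int_add_mult(2)[OF algebraic_int_of_int_complex sqrt_multiple_integral(1)[OF r2 D' ts]]]])
   finally show ?thesis .
  qed
  have pV: "of_nat p * (V c \<tau> \<sigma>)\<^sup>2 = (r * V c \<tau> \<sigma>) ^ 2" for \<tau> \<sigma> unfolding r2[symmetric] by (simp add: power2_eq_square)
  have N2: "of_nat p ^ K.n\<^sup>2 * N\<^sup>2 = (\<Prod>(\<tau>, \<sigma>)\<in>I. of_nat p * (V c \<tau> \<sigma>)\<^sup>2)"
   unfolding N_def finI(2)[symmetric] by (simp add: prod_power_distrib prod.distrib case_prod_unfold)
  have "of_nat p ^ K.n\<^sup>2 * N\<^sup>2 : \<int>"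
  proof (rule rational_algebraic_int_is_int)
   show "algebraic_int (of_nat p ^ K.n\<^sup>2 * N\<^sup>2)"
    unfolding N2 case_prod_unfold pV using rV by (intro algebraic_int_prod algebraic_int_power) (auto simp: I_def)
  qed (use NQ in auto)
  then obtain k where k: "of_nat p ^ K.n\<^sup>2 * N\<^sup>2 = of_int k" by (auto elim: Ints_cases)
  \<comment> \<open>At these pairs both terms of the correction lie in \<open>A\<close>, so only the
    entries outside \<open>G\<close> can contribute to the denominator of \<open>N\<^sup>2\<close>,
    each at most one factor \<open>p\<close>.\<close>
  define G where "G = (L.E - {\<tau>1, \<tau>2}) \<times> (K.E - {\<sigma>1, \<sigma>2})"
  have "card (L.E - {\<tau>1, \<tau>2}) = K.n - 2" "card (K.E - {\<sigma>1, \<sigma>2}) = K.n - 2"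
   using \<tau>(1-3) \<sigma>(1-3) K.finite_E L.finite_E K.card_E L.card_E deg by (simp_all add: card_Diff_subset)
  then have cG: "card G = (K.n - 2)\<^sup>2" unfolding G_def by (simp add: power2_eq_square card_cartesian_product)
  have GI: "G \<subseteq> I" unfolding G_def I_def by auto
  have cB: "card (I - G) = K.n\<^sup>2 - (K.n - 2)\<^sup>2" using GI finI cG by (simp add: card_Diff_subset finite_subset)
  define B where "B = K.n\<^sup>2 - (K.n - 2)\<^sup>2"
  have BA: "of_nat p ^ B * N\<^sup>2 : A"
  proof -
   have "of_nat p ^ B * N\<^sup>2 = (\<Prod>(\<tau>, \<sigma>)\<in>I - G. of_nat p * (V c \<tau> \<sigma>)\<^sup>2) * (\<Prod>(\<tau>, \<sigma>)\<in>G. (V c \<tau> \<sigma>)\<^sup>2)"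
   proof -
    have "N = (\<Prod>(\<tau>, \<sigma>)\<in>I - G. V c \<tau> \<sigma>) * (\<Prod>(\<tau>, \<sigma>)\<in>G. V c \<tau> \<sigma>)"
     unfolding N_def by (rule prod.subset_diff[OF GI finI(1)])
    then show ?thesis unfolding B_def cB[symmetric]
     by (simp add: prod_power_distrib prod.distrib case_prod_unfold power_mult_distrib)
   qed
   also have "... : A"
   proof (intro pl.A_mult pl.A_prod)
    fix x assume "x : I - G"
    then show "(case x of (\<tau>, \<sigma>) => of_nat p * (V c \<tau> \<sigma>)\<^sup>2) : A"
     unfolding case_prod_unfold pV using rV by (intro pl.A_power pl.A_algebraic_int) (auto simp: I_def)
   next
    fix x assume "x : G"
    then obtain \<tau> \<sigma> where x: "x = (\<tau>, \<sigma>)" "\<tau> : L.E" "\<sigma> : K.E" "\<tau> f' : A" "\<sigma> f : A"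
     unfolding G_def using \<tau>(5) \<sigma>(5) by blast
    have "(V c \<tau> \<sigma> - (of_int s * \<tau> f' - of_int (\<rho>' * \<beta>) * \<sigma> f)) + (of_int s * \<tau> f' - of_int (\<rho>' * \<beta>) * \<sigma> f) : A"
     by (rule pl.A_add[OF good[OF x(2,3)] pl.A_diff[OF pl.A_mult[OF pl.A_of_int x(4)] pl.A_mult[OF pl.A_of_int x(5)]]])
    then show "(case x of (\<tau>, \<sigma>) => (V c \<tau> \<sigma>)\<^sup>2) : A" unfolding x(1) using pl.A_power by simp
   qed
   finally show ?thesis .
  qed
  have "(K.n - 2)\<^sup>2 <= K.n\<^sup>2" by (rule power_mono) auto
  then have split: "K.n\<^sup>2 = B + (K.n - 2)\<^sup>2" unfolding B_def by simp
  have "of_nat p ^ B * N\<^sup>2 = of_int k / of_nat p ^ (K.n - 2)\<^sup>2"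
   unfolding k[symmetric] split power_add using pl.p0 by simp
  then have "int p ^ (K.n - 2)\<^sup>2 dvd k" using BA pl.A_divide_power_int by simp
  then obtain k' where k': "k = int p ^ (K.n - 2)\<^sup>2 * k'" by auto
  have Nk': "of_nat p ^ B * N\<^sup>2 = of_int k'"
   using k pl.p0 unfolding k' split power_add by simp
  define R where "R x = (Re (V c (fst x) (snd x)))\<^sup>2" for x
  have VR: "(V c \<tau> \<sigma>)\<^sup>2 = of_real (R (\<tau>, \<sigma>))" if "\<tau> : L.E" "\<sigma> : K.E" for \<tau> \<sigma>
   using arg_cong[OF V_real[OF that, of c], of "%x. x\<^sup>2"] unfolding R_def by simp
  have NR: "N\<^sup>2 = of_real (\<Prod>x\<in>I. R x)"
   unfolding N_def prod_power_distrib of_real_prod using VR by (intro prod.cong) (auto simp: I_def)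
  define U2 where "U2 = K.n - 1 + (nat \<bar>u\<bar>)\<^sup>2"
  have U2: "real U2 = real K.n - 1 + (of_int u)\<^sup>2" "U2 > 0" unfolding U2_def using n by (auto simp: of_nat_diff)
  have "complex_of_real (\<Sum>x\<in>I. R x) = (\<Sum>\<tau>\<in>L.E. \<Sum>\<sigma>\<in>K.E. (V c \<tau> \<sigma>)\<^sup>2)"
   unfolding I_def sum.cartesian_product of_real_sum using VR by (intro sum.cong) auto
  also have "... = (\<Sum>\<tau>\<in>L.E. (of_nat K.n - 1 + (of_int u)\<^sup>2) / of_nat K.n)"
  proof (rule sum.cong[OF refl])
   fix \<tau> assume "\<tau> : L.E"
   from row_squares'[OF this, of u, folded c_def] nc
   show "(\<Sum>\<sigma>\<in>K.E. (V c \<tau> \<sigma>)\<^sup>2) = (of_nat K.n - 1 + (of_int u)\<^sup>2) / of_nat K.n"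
    by (metis nonzero_mult_div_cancel_left)
  qed
  also have "... = of_nat K.n - 1 + (of_int u)\<^sup>2" using nc L.card_E deg by simp
  finally have "complex_of_real (\<Sum>x\<in>I. R x) = of_real (real U2)" unfolding U2(1) by simp
  then have sR: "(\<Sum>x\<in>I. R x) = real U2" by (simp only: of_real_eq_iff)
  have n2: "real (K.n\<^sup>2) > 0" using n by simp
  define \<nu> where "\<nu> = real U2 / real (K.n\<^sup>2)"
  have \<nu>: "\<nu> > 0" unfolding \<nu>_def using U2(2) n2 by (intro divide_pos_pos) simp_all
  have "(\<Sum>x\<in>I. R x) = \<nu> * real (card I)" unfolding sR finI(2) \<nu>_def using n2 by simp
  from prod_le_mean_power[OF finI(1) _ \<nu> this] have "(\<Prod>x\<in>I. R x) <= \<nu> ^ card I" by (simp add: R_def)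
  then have up: "(\<Prod>x\<in>I. R x) <= real U2 ^ K.n\<^sup>2 / real (K.n\<^sup>2) ^ K.n\<^sup>2" unfolding finI(2) \<nu>_def by (simp add: power_divide)
  have "complex_of_real (real p ^ B * (\<Prod>x\<in>I. R x)) = of_real (of_int k')" using Nk' unfolding NR by simp
  then have kR: "real p ^ B * (\<Prod>x\<in>I. R x) = of_int k'" by (simp only: of_real_eq_iff)
  have "(\<Prod>x\<in>I. R x) ~= 0"
  proof
   assume "(\<Prod>x\<in>I. R x) = 0"
   then have "N = 0" using NR by simp
   then show False unfolding N_def using nz finI(1) by (auto simp: I_def)
  qed
  moreover have "(\<Prod>x\<in>I. R x) \<ge> 0" by (intro prod_nonneg) (simp add: R_def)
  ultimately have "real p ^ B * (\<Prod>x\<in>I. R x) > 0" using p(1) by (simp add: prime_gt_0_nat)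
  then have "1 <= real p ^ B * (\<Prod>x\<in>I. R x)" unfolding kR by simp
  also have "... <= real p ^ B * (real U2 ^ K.n\<^sup>2 / real (K.n\<^sup>2) ^ K.n\<^sup>2)" by (intro mult_left_mono up) simp
  finally have "real (K.n\<^sup>2) ^ K.n\<^sup>2 <= real p ^ B * real U2 ^ K.n\<^sup>2" using n2 by (simp add: field_simps)
  then have "real ((K.n\<^sup>2) ^ K.n\<^sup>2) <= real (p ^ B * U2 ^ K.n\<^sup>2)" by simp
  then have "(K.n\<^sup>2) ^ K.n\<^sup>2 <= p ^ B * U2 ^ K.n\<^sup>2" by (simp only: of_nat_le_iff)
  moreover have "2 * nat \<bar>u\<bar> <= K.n" using u by linarith
  ultimately show ?thesis using exponent_bound[OF np(1)] unfolding B_def U2_def by (meson not_le)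
 qed
qed

lemma isomorphic:
 assumes n: "3 <= K.n" "K.n <= 10" and oddD: "odd D" and sqD: "!!q. prime q ==> \<not> q\<^sup>2 dvd D"
 shows "fields_isomorphic K L"
proof -
 obtain u s l where l: "l : L.OK" "nf_trace L l = 0" "2 * \<bar>u\<bar> <= int K.n"
  "Phi \<eta> = of_int u * (y' - 1 / of_nat K.n) + of_int s * f' + l" and D: "int D dvd int K.n * s" using Phi_\<eta>_f(1) by blast
 obtain v a l' \<beta> where l': "l' : L.OK" "nf_trace L l' = 0" "Phi f = of_int v * (y' - 1 / of_nat K.n) + of_int a * f' + l'"
  "int D * v = int K.n * \<beta>" using Phi_\<eta>_f(2) by blast
 show ?thesis
 proof (cases "int D dvd s")
  case True then show ?thesis using unmixed_case[OF n l(1-4) True l'] by blast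
 next
  case False then show ?thesis using mixed_case[OF n oddD sqD l(1) l(3,4) D False l'(1,3,4)] by blast
 qed
qed

end

section \<open>Reduction to equal odd squarefree discriminants and conclusion\<close>

context numfield
begin

lemma tgen_n: "tgen dvd n"
 using tgen_dvd[OF O_closed(2), of "int n"] tr_1 by simp

lemma tgen_power_dvd: "int tgen ^ n dvd nf_disc K"
proof (rule disc_dvd_of_traces)
 fix x assume x: "x : OK"
 obtain t where t: "tr x = of_int t" using tr_int[OF x] .
 then obtain k where "t = int tgen * k" using tgen_dvd[OF x t] by auto
 then show "\<exists>k. tr x = of_int (int tgen * k)" using t by blast
qed (use tgen(1) in simp)

text \<open>Odd primes occur only to the first power. The third power of 2 is possible, as for the
  discriminant 8, but a factor 16 would make a quarter of the discriminant divisible by 4.\<close>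

lemma fundamental_power:
 assumes fd: "fundamental_discriminant (nf_disc K)" and p: "prime (p::nat)" "int p ^ m dvd nf_disc K"
 shows "m < 2 \<or> p = 2 & m < 4"
proof (rule ccontr)
 assume "\<not> ?thesis"
 then have m: "m \<ge> 2" "p ~= 2 \<or> m \<ge> 4" by auto
 show False
 proof (cases "p = 2")
  case False
  have "(int p)\<^sup>2 dvd nf_disc K" using p(2) m(1) by (meson dvd_trans le_imp_power_dvd)
  then show False using fundamental_discriminantD(1)[OF fd, of "int p"] p(1) False by auto
 next
  case True
  then have "(2::int) ^ 4 dvd nf_disc K" using p(2) m by (metis dvd_trans le_imp_power_dvd of_nat_numeral)
  then obtain k where k: "nf_disc K = 16 * k" by auto
  then have "4 dvd nf_disc K" "(nf_disc K div 4) mod 4 = 0" by auto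
  then show False using fundamental_discriminantD(3)[OF fd] by auto
 qed
qed

end

lemma (in trace_isometry) high_degree:
 assumes n: "3 <= K.n" "K.n <= 10" and real: "totally_real K" and fd: "fundamental_discriminant (nf_disc K)"
  and tame: "tamely_ramified L"
 shows "fields_isomorphic K L"
proof -
 \<comment> \<open>Here \<open>tgen ^ n\<close> divides the discriminant. As the degree is at least
   3, only \<open>p = 2\<close> in degree 3 survives, but \<open>p\<close> also divides the
   degree.\<close>
 have gK: "K.tgen = 1"
 proof (rule ccontr)
  assume "K.tgen ~= 1"
  then obtain p where p: "prime p" "p dvd K.tgen" using prime_factor_nat by blast
  then have "int p ^ K.n dvd int K.tgen ^ K.n" by (intro dvd_power_same) simp
  then have "int p ^ K.n dvd nf_disc K" using K.tgen_power_dvd by (rule dvd_trans)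
  from K.fundamental_power[OF fd p(1) this] have pn: "p = 2" "K.n = 3" using n by auto
  have "p dvd K.n" using p(2) K.tgen_n by (rule dvd_trans)
  then have "(2::nat) dvd 3" unfolding pn .
  then show False by simp
 qed
 have rel: "nf_disc K * (int L.tgen)\<^sup>2 = nf_disc L" using disc_relation gK by simp
 \<comment> \<open>For \<open>L\<close> only \<open>tgen ^ (n - 2)\<close> can be transferred to the
   discriminant of \<open>K\<close>, which leaves \<open>p = 3\<close> in degree 3 and
   \<open>p = 2\<close> in degree 4. Tameness excludes these: no multiple of \<open>p\<close> up to
   the degree has a divisor of size at least 2 that is prime to \<open>p\<close>.\<close>
 have gL: "L.tgen = 1"
 proof (rule ccontr)
  assume "L.tgen ~= 1"
  then obtain p where p: "prime p" "p dvd L.tgen" using prime_factor_nat by blast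
  have "K.n - 2 + 2 = L.n" using n deg by simp
  then have "int L.tgen ^ (K.n - 2 + 2) dvd nf_disc K * (int L.tgen)\<^sup>2" unfolding rel using L.tgen_power_dvd by metis
  then have "int L.tgen ^ (K.n - 2) dvd nf_disc K" unfolding power_add using L.tgen(1) by simp
  moreover have "int p ^ (K.n - 2) dvd int L.tgen ^ (K.n - 2)" using p(2) by (intro dvd_power_same) simp
  ultimately have "K.n - 2 < 2 \<or> p = 2 & K.n - 2 < 4" using K.fundamental_power[OF fd p(1)] dvd_trans by blast
  moreover have pn: "p dvd K.n" using p(2) L.tgen_n deg by (metis dvd_trans)
  ultimately have np: "K.n = 3 & p = 3 \<or> K.n = 4 & p = 2"
  proof -
   assume a: "K.n - 2 < 2 \<or> p = 2 & K.n - 2 < 4"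
   have "K.n = 3 \<or> K.n = 4 \<or> K.n = 5" using a n by auto
   moreover have "p = 3" if "K.n = 3" using pn that primes_dvd_imp_eq[OF p(1), of 3] by simp
   moreover have "p = 2" if "K.n = 4"
    using pn that p(1) prime_dvd_power[of p 2 2] primes_dvd_imp_eq[OF p(1), of 2] by simp
   moreover have "p = 5" if "K.n = 5" using pn that primes_dvd_imp_eq[OF p(1), of 5] by simp
   ultimately show ?thesis using a by auto
  qed
  have "\<exists>k. nf_trace L x = of_int (int p * k)" if x: "x : L.OK" for x
  proof -
   obtain t where t: "nf_trace L x = of_int t" using L.tr_int[OF x] .
   have "int p dvd t" using L.tgen_dvd[OF x t] p(2) by (meson dvd_trans int_dvd_int_iff)
   then show ?thesis using t by auto
  qed
  then obtain h e where h: "0 < h" "h <= L.n" "p dvd h" "e dvd h" "2 <= e" "\<not> p dvd e" using L.tame_traces[OF tame p(1)] by blast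
  have "e <= h" using h by (auto dest: dvd_imp_le)
  then have "h <= 4" "e <= 4" using np h(2) deg by auto
  then have "h : {1, 2, 3, 4}" "e : {2, 3, 4}" using h by auto
  then show False using np h deg by (elim disjE conjE) auto
 qed
 have dd: "nf_disc L = nf_disc K" using rel gL by simp
 \<comment> \<open>An even fundamental discriminant is 4 times a number congruent to 2 or 3 modulo
   4, whereas tameness of \<open>L\<close> makes that number congruent to 0 or 1.\<close>
 have odd: "odd (nf_disc K)"
 proof
  assume "even (nf_disc K)"
  then have 4: "4 dvd nf_disc K" using fundamental_discriminantD(2)[OF fd] by simp
  then show False using fundamental_discriminantD(3)[OF fd 4] L.tame_disc[OF tame] dd by auto
 qed
 have sq: "\<not> q\<^sup>2 dvd nf_disc K" if "prime q" for q
 proof (cases "q = 2")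
  case True then show ?thesis using odd by (auto simp: power2_eq_square dest: dvd_mult_left)
 next
  case False then show ?thesis using fundamental_discriminantD(1)[OF fd that] by blast
 qed
 define D where "D = nat \<bar>nf_disc K\<bar>"
 have D: "int D = \<bar>nf_disc K\<bar>" "D > 0" unfolding D_def using odd by auto
 have sqD: "\<not> q\<^sup>2 dvd D" if q: "prime q" for q
 proof
  assume "q\<^sup>2 dvd D"
  then have "int (q\<^sup>2) dvd int D" by (simp only: int_dvd_int_iff)
  then have "(int q)\<^sup>2 dvd nf_disc K" unfolding D by simp
  then show False using sq[of "int q"] q by simp
 qed
 have oddD: "odd D"
 proof
  assume "even D"
  then have "int 2 dvd int D" by (simp only: int_dvd_int_iff)
  then show False unfolding D using odd by simp
 qed
 obtain y where y: "y : K.OK" "nf_trace K y = 1" using K.tgen(2) gK by auto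
 obtain y' where y': "y' : L.OK" "nf_trace L y' = 1" using L.tgen(2) gL by auto
 obtain f \<rho> \<rho>' k where f: "f : K.codiff" "nf_trace K f = 0" "of_nat D * f : K.OK" "nf_trace K (f * f) = of_int \<rho> / of_nat D"
  "\<rho> * \<rho>' = 1 + int D * k" "\<forall>z\<in>K.codiff. \<exists>w\<in>K.OK. \<exists>m. z = w + of_int m * f"
  using K.codiff_generator[OF sq D y] by blast
 obtain f' \<mu> \<mu>' k' where f': "f' : L.codiff" "nf_trace L f' = 0" "of_nat D * f' : L.OK" "nf_trace L (f' * f') = of_int \<mu> / of_nat D"
  "\<mu> * \<mu>' = 1 + int D * k'" "\<forall>z\<in>L.codiff. \<exists>w\<in>L.OK. \<exists>m. z = w + of_int m * f'"
  using L.codiff_generator[OF sq[folded dd] D[folded dd] y'] by blast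
 obtain b where b: "K.adapted b" "K.zbasis b" by (rule K.adapted_zbasis)
 obtain b' where b': "K.dual b b'" "\<forall>i<K.n. b' i : K.codiff" using K.zbasis_dual[OF b(2)] by blast
 interpret codifferent_isometry K L Phi f y D \<rho> \<rho>' k f' y' \<mu> \<mu>' k' b b'
  using f f' y y' D(2) b(2) b' real
 proof unfold_locales
  show "nf_trace K (b i) = (if i = 0 then 1 else 0)" if "i < numfield.n K" for i
   using b(1) gK that unfolding K.adapted_def by simp
 qed auto
 show ?thesis by (rule isomorphic[OF n oddD sqD])
qed

theorem theorem2:
  fixes K L :: "complex set" and n :: nat
  assumes "1 \<le> n" and "n \<le> 10"
    and "number_field K" and "nf_degree K = n" and "totally_real K"
    and "fundamental_discriminant (nf_disc K)"
    and "ereal (real_of_int \<bar>nf_disc K\<bar>) \<le> X_bound n"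
    and "number_field L" and "tamely_ramified L"
    and "trace_zero_forms_isometric K L"
  shows "fields_isomorphic K L"
proof -
  obtain Phi where "trace_isometry K L Phi" using trace_isometry_ex assms by blast
  then interpret trace_isometry K L Phi .
  have "K.n = n" using assms K.n_def by simp
  then show ?thesis using low_degree high_degree assms by (cases "n \<le> 2") auto
qed

end
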